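(* Let $R$ be a $\mathbb Z[q]_{(p,q-1)}$-algebra and let $A$ be a complete $R$-algebra with a fixed topologically étale coordinate $x$. Let $M$ be an $A$-module. A $q$-Taylor structure (of level zero) $\{\theta_n\}_{n\in\mathbb N}$ on $M$ is equivalent to a $D_{A/R,q}$-module structure on $M$ (extending its $A$-module structure) through the formula $$\forall s\in M,\quad\theta_n(s)=\sum_{k=0}^n\partial_{M,q}^k(s)\otimes\xi^{[k]},$$ where $\partial_{M,q}$ denotes the action of $\partial_q$ on $M$.
   Context: Fix a prime $p$; $\mathbb Z[q]_{(p,q-1)}$ is the localization of $\mathbb Z[q]$ at $(p,q-1)$. All modules carry the $(p,q-1)$-adic topology; completion and completeness refer to it. $(n)_q=\frac{q^n-1}{q-1}$; $(n)_q!$, $\binom nk_q$ are the usual $q$-analogs. A topologically étale coordinate $x$ on $A$ is an element such that $R[X]\to A$, $X\mapsto x$, is formally étale and topologically finitely presented. There is a unique $R$-algebra endomorphism $\sigma$ of $A$ with $\sigma(x)=qx$, $\sigma\equiv\mathrm{Id}\bmod q-1$, and a unique $R$-linear map $\partial_{A,q}:A\to A$ with $\partial_{A,q}(fg)=\partial_{A,q}(f)g+\sigma(f)\partial_{A,q}(g)$ and $\partial_{A,q}(x)=1$. $D_{A/R,q}$ is the non-commutative polynomial ring in one generator $\partial_q$ over $A$ with commutation rule $\partial_q\circ f=\sigma(f)\partial_q+\partial_{A,q}(f)$. Twisted divided polynomials: $A\langle\xi\rangle_q$ is the commutative $A$-algebra, free as an $A$-module on $\xi^{[n]}$, $n\in\mathbb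 N$ ($\xi^{[0]}=1$, $\xi=\xi^{[1]}$), with $$\xi^{[n]}\xi^{[m]}=\sum_{0\le i\le n,m}q^{\frac{i(i-1)}2}\binom{n+m-i}{n}_q\binom ni_q(q-1)^ix^i\xi^{[n+m-i]}.$$ $I^{[n+1]}$ is the ideal generated by the $\xi^{[k]}$, $k\ge n+1$. With $\xi^{(n)}=\xi(\xi+x-qx)\cdots(\xi+x-q^{n-1}x)\in A[\xi]$, there is a canonical $A$-algebra morphism $A[\xi]\to A\langle\xi\rangle_q$, $\xi^{(n)}\mapsto(n)_q!\,\xi^{[n]}$. $q$-Taylor map: let $P=A\otimes_RA$, viewed as an $A$-algebra via $f\mapsto f\otimes1$, $I$ the kernel of multiplication $P\to A$, extend $\sigma$ to $P$ as $\sigma\otimes\mathrm{Id}_A$, let $I^{(n+1)}=I\sigma(I)\cdots\sigma^n(I)$ and $\overline{I^{(n+1)}}^{\mathrm{cl}}$ the closure of its image in $\widehat P$. The $A$-algebra maps $A[\xi]/(\xi^{(n+1)})\to\widehat P/\overline{I^{(n+1)}}^{\mathrm{cl}}$, $\xi\mapsto1\otimes x-x\otimes1$, are isomorphisms. Put $A[[\xi]]_q=\varprojlim A[\xi]/(\xi^{(n+1)})$; the map $A[\xi]\to\widehat{A\langle\xi\rangle}_q$ factors through $A[[\xi]]_q$. Let $\theta$ be the composite $A\to P\to\varprojlim\widehat P/\overline{I^{(n+1)}}^{\mathrm{cl}}\simeq A[[\xi]]_q\to\widehat{A\langle\xi\rangle}_q$, the first map being $f\mapsto1\otimes f$ (so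 $\theta(x)=x+\xi$). The $q$-Taylor map of order $n$ is the composite $\theta_n:A\to\widehat{A\langle\xi\rangle}_q\to A\langle\xi\rangle_q/I^{[n+1]}$, a morphism of $R$-algebras. The notation $\otimes'_A$ means that the left factor ($A\langle\xi\rangle_q/I^{[n+1]}$) is an $A$-module via $\theta_n$. There are $A$-algebra morphisms $$\Delta_{n,m}:A\langle\xi\rangle_q/I^{[n+m+1]}\to A\langle\xi\rangle_q/I^{[n+1]}\otimes'_AA\langle\xi\rangle_q/I^{[m+1]},\quad\xi^{[k]}\mapsto\sum_{i+j=k}\xi^{[i]}\otimes\xi^{[j]}.$$ A $q$-Taylor structure (of level zero) on an $A$-module $M$ is a family, compatible with the projections for varying $n$, of additive maps $\theta_n:M\to M\otimes_AA\langle\xi\rangle_q/I^{[n+1]}$ that are semilinear ($\theta_n(fs)=\theta_n(f)\theta_n(s)$ for $f\in A$, $s\in M$), such that $\theta_0(s)=s\otimes1$ for all $s\in M$ and, for all $m,n\ge0$, $$(\theta_n\otimes\mathrm{Id}_{A\langle\xi\rangle_q/I^{[m+1]}})\circ\theta_m=(\mathrm{Id}_M\otimes\Delta_{n,m})\circ\theta_{m+n}$$ as maps $M\to M\otimes_AA\langle\xi\rangle_q/I^{[n+1]}\otimes'_AA\langle\xi\rangle_q/I^{[m+1]}$. *)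

theory Defs
  imports
    "HOL-Computational_Algebra.Polynomial"
    "HOL-Computational_Algebra.Fraction_Field"
    "HOL-Algebra.Algebra"
begin

hide_const (open) Divisibility.prime

section \<open>The base ring and $q$-analogs\<close>

text \<open>The localization of $\mathbb{Z}[q]$ at $(p, q-1)$, inside its field of fractions; $q$ is the
  indeterminate \<open>[:0, 1:]\<close>, and \<open>zq_image R A\<close> is the structure map $\mathbb{Z}[q] \to A$.\<close>

definition loc_Zq :: "nat \<Rightarrow> int poly fract ring" where
  "loc_Zq p = \<lparr>carrier = {Fract f g | f g. g \<notin> {[:int p:] * u + [:-1, 1:] * v | u v. True}},
     monoid.mult = (*), one = 1, ring.zero = 0, add = (+)\<rparr>"

definition zq_image ::
  "(int poly fract, 'r, 'c) module_scheme \<Rightarrow> ('r, 'a, 'd) module_scheme \<Rightarrow> int poly \<Rightarrow> 'a" where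
  "zq_image R A f = (Fract f 1 \<odot>\<^bsub>R\<^esub> \<one>\<^bsub>R\<^esub>) \<odot>\<^bsub>A\<^esub> \<one>\<^bsub>A\<^esub>"

abbreviation q_in ::
  "(int poly fract, 'r, 'c) module_scheme \<Rightarrow> ('r, 'a, 'd) module_scheme \<Rightarrow> 'a" where
  "q_in R A \<equiv> zq_image R A [:0, 1:]"

definition q_int :: "nat \<Rightarrow> int poly" where
  "q_int n = ([:0, 1:] ^ n - 1) div ([:0, 1:] - 1)"

definition q_fact :: "nat \<Rightarrow> int poly" where
  "q_fact n = (\<Prod>i = 1..n. q_int i)"

definition q_binom :: "nat \<Rightarrow> nat \<Rightarrow> int poly" where
  "q_binom n k = (if k \<le> n then q_fact n div (q_fact k * q_fact (n - k)) else 0)"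


section \<open>Adic topologies, completions and quotients\<close>

text \<open>The ideal $(p, q-1)B$, where \<open>c\<close> is the image of $q$ in \<open>B\<close>.\<close>

definition pq_ideal :: "nat \<Rightarrow> ('b, 'c) ring_scheme \<Rightarrow> 'b \<Rightarrow> 'b set" where
  "pq_ideal p B c = genideal B {[p] \<cdot>\<^bsub>B\<^esub> \<one>\<^bsub>B\<^esub>, c \<ominus>\<^bsub>B\<^esub> \<one>\<^bsub>B\<^esub>}"

abbreviation ideal_power :: "('b, 'c) ring_scheme \<Rightarrow> 'b set \<Rightarrow> nat \<Rightarrow> 'b set" where
  "ideal_power B I k \<equiv> I [^]\<^bsub>ideals_set B\<^esub> k"

text \<open>The limit of the rings $B/J_n$ for a decreasing sequence of ideals; the projection
  $B/J_{n+1} \to B/J_n$ sends a coset to the coset containing it.\<close>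

definition quot_limit :: "('b, 'c) ring_scheme \<Rightarrow> (nat \<Rightarrow> 'b set) \<Rightarrow> (nat \<Rightarrow> 'b set) ring" where
  "quot_limit B J = \<lparr>
     carrier = {s. \<forall>n. s n \<in> carrier (B Quot J n) \<and> s (Suc n) \<subseteq> s n},
     monoid.mult = (\<lambda>s t n. s n \<otimes>\<^bsub>B Quot J n\<^esub> t n),
     one = (\<lambda>n. \<one>\<^bsub>B Quot J n\<^esub>),
     ring.zero = (\<lambda>n. \<zero>\<^bsub>B Quot J n\<^esub>),
     add = (\<lambda>s t n. s n \<oplus>\<^bsub>B Quot J n\<^esub> t n)\<rparr>"

definition adic_completion :: "('b, 'c) ring_scheme \<Rightarrow> 'b set \<Rightarrow> (nat \<Rightarrow> 'b set) ring" where
  "adic_completion B I = quot_limit B (ideal_power B I)"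

definition to_completion :: "('b, 'c) ring_scheme \<Rightarrow> 'b set \<Rightarrow> 'b \<Rightarrow> nat \<Rightarrow> 'b set" where
  "to_completion B I b = (\<lambda>k. ideal_power B I k +>\<^bsub>B\<^esub> b)"

definition adically_complete :: "('b, 'c) ring_scheme \<Rightarrow> 'b set \<Rightarrow> bool" where
  "adically_complete B I \<longleftrightarrow>
     bij_betw (to_completion B I) (carrier B) (carrier (adic_completion B I))"

definition adic_closure :: "('b, 'c) ring_scheme \<Rightarrow> 'b set \<Rightarrow> 'b set \<Rightarrow> 'b set" where
  "adic_closure B I S = {b \<in> carrier B. \<forall>k. \<exists>s\<in>S. b \<ominus>\<^bsub>B\<^esub> s \<in> ideal_power B I k}"

definition quot_algebra ::
  "('a, 'b, 'c) module_scheme \<Rightarrow> 'b set \<Rightarrow> ('a, 'b set) module" where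
  "quot_algebra B J = \<lparr>carrier = carrier (B Quot J), monoid.mult = monoid.mult (B Quot J),
     one = one (B Quot J), ring.zero = ring.zero (B Quot J), add = add (B Quot J),
     smult = (\<lambda>a Z. \<Union>b\<in>Z. J +>\<^bsub>B\<^esub> (a \<odot>\<^bsub>B\<^esub> b))\<rparr>"


section \<open>Topologically \'etale coordinates\<close>

text \<open>
  A ring homomorphism \<open>\<phi>: S \<rightarrow> A\<close> is formally \'etale for the \<open>\<aa>\<close>-adic topologies if it has the
  unique lifting property against square-zero ideals in discrete topological \<open>S\<close>-algebras
  \<open>C\<close>, i.e. in \<open>S\<close>-algebras in which a power of \<open>\<aa>\<close> vanishes; continuity of
  the maps \<open>u\<close> and \<open>v\<close> out of \<open>A\<close> is then automatic. The elements of the test algebras are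
  taken from the type \<open>('s + 'a) list\<close>. This is no loss of generality: existence and
  uniqueness of lifts only involve \<open>S\<close>-subalgebras of \<open>C\<close> generated by the images of at most
  two maps from \<open>A\<close>, and every such subalgebra is isomorphic to one on this type.\<close>

definition formally_etale ::
  "('s, 'c) ring_scheme \<Rightarrow> 's set \<Rightarrow> ('a, 'd) ring_scheme \<Rightarrow> ('s \<Rightarrow> 'a) \<Rightarrow> bool" where
  "formally_etale S \<aa> A \<phi> \<longleftrightarrow>
     (\<forall>(C :: ('s + 'a) list ring) J \<psi> u n.
        cring C \<and> ideal J C \<and> ideal_prod C J J = {\<zero>\<^bsub>C\<^esub>} \<and>
        \<psi> \<in> ring_hom S C \<and> ideal_power C (genideal C (\<psi> ` \<aa>)) n = {\<zero>\<^bsub>C\<^esub>} \<and>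
        u \<in> ring_hom A (C Quot J) \<and> (\<forall>s\<in>carrier S. u (\<phi> s) = J +>\<^bsub>C\<^esub> \<psi> s) \<longrightarrow>
        (\<exists>!v. v \<in> extensional (carrier A) \<and> v \<in> ring_hom A C \<and>
           (\<forall>s\<in>carrier S. v (\<phi> s) = \<psi> s) \<and> (\<forall>a\<in>carrier A. J +>\<^bsub>C\<^esub> v a = u a)))"

definition mpoly_ring :: "('s, 'c) ring_scheme \<Rightarrow> 'i set \<Rightarrow> ('i multiset \<Rightarrow> 's) ring" where
  "mpoly_ring S I = \<lparr>carrier = ring.indexed_pset S I (carrier S),
     monoid.mult = (\<lambda>F G \<mu>. \<Oplus>\<^bsub>S\<^esub>\<nu>\<in>{\<nu>. \<nu> \<subseteq># \<mu>}. F \<nu> \<otimes>\<^bsub>S\<^esub> G (\<mu> - \<nu>)),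
     one = ring.indexed_const S \<one>\<^bsub>S\<^esub>, ring.zero = ring.indexed_const S \<zero>\<^bsub>S\<^esub>,
     add = ring.indexed_padd S\<rparr>"

text \<open>
  A presentation of \<open>A\<close> as the quotient of the completion of some \<open>S[T\<^sub>0, \<dots>, T\<^sub>m\<^sub>-\<^sub>1]\<close> by the
  closure of a finitely generated ideal. If \<open>A\<close> is separated and the kernel of the presentation
  is itself finitely generated, then that kernel is closed, so the definition covers both usual
  conventions.\<close>

definition top_finitely_presented ::
  "('s, 'c) ring_scheme \<Rightarrow> 's set \<Rightarrow> ('a, 'd) ring_scheme \<Rightarrow> ('s \<Rightarrow> 'a) \<Rightarrow> bool" where
  "top_finitely_presented S \<aa> A \<phi> \<longleftrightarrow>
     (\<exists>m :: nat.
        let T = mpoly_ring S {..<m};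
            const = (ring.indexed_const S :: 's \<Rightarrow> nat multiset \<Rightarrow> 's);
            \<aa>T = genideal T (const ` \<aa>);
            That = adic_completion T \<aa>T;
            to_That = (\<lambda>s. to_completion T \<aa>T (const s))
        in \<exists>B \<pi>. finite B \<and> B \<subseteq> carrier That \<and>
             \<pi> \<in> ring_hom That A \<and> \<pi> ` carrier That = carrier A \<and>
             (\<forall>s\<in>carrier S. \<pi> (to_That s) = \<phi> s) \<and>
             a_kernel That A \<pi> = adic_closure That (genideal That (to_That ` \<aa>)) (genideal That B))"

definition top_etale_coordinate ::
  "nat \<Rightarrow> (int poly fract, 'r) module \<Rightarrow> ('r, 'a) module \<Rightarrow> 'a \<Rightarrow> bool" where
  "top_etale_coordinate p R A x \<longleftrightarrow> x \<in> carrier A \<and>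
     (let \<phi> = eval R A (\<lambda>r. r \<odot>\<^bsub>A\<^esub> \<one>\<^bsub>A\<^esub>) x;
          \<aa> = pq_ideal p (UP R) (q_in R (UP R))
      in formally_etale (UP R) \<aa> A \<phi> \<and> top_finitely_presented (UP R) \<aa> A \<phi>)"


section \<open>Twisted derivation and twisted differential operators\<close>

text \<open>When \<open>A\<close> is complete and \<open>x\<close> is a topologically \'etale coordinate, there is exactly one
  such endomorphism and exactly one such derivation (as functions on \<open>carrier A\<close>).\<close>

definition is_q_endomorphism ::
  "(int poly fract, 'r) module \<Rightarrow> ('r, 'a) module \<Rightarrow> 'a \<Rightarrow> ('a \<Rightarrow> 'a) \<Rightarrow> bool" where
  "is_q_endomorphism R A x \<sigma> \<longleftrightarrow> \<sigma> \<in> ring_hom A A \<and>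
     (\<forall>r\<in>carrier R. \<forall>f\<in>carrier A. \<sigma> (r \<odot>\<^bsub>A\<^esub> f) = r \<odot>\<^bsub>A\<^esub> \<sigma> f) \<and>
     \<sigma> x = q_in R A \<otimes>\<^bsub>A\<^esub> x \<and>
     (\<forall>f\<in>carrier A. \<sigma> f \<ominus>\<^bsub>A\<^esub> f \<in> genideal A {q_in R A \<ominus>\<^bsub>A\<^esub> \<one>\<^bsub>A\<^esub>})"

definition is_q_derivation ::
  "(int poly fract, 'r) module \<Rightarrow> ('r, 'a) module \<Rightarrow> 'a \<Rightarrow> ('a \<Rightarrow> 'a) \<Rightarrow> ('a \<Rightarrow> 'a) \<Rightarrow> bool" where
  "is_q_derivation R A x \<sigma> \<delta> \<longleftrightarrow> \<delta> \<in> carrier A \<rightarrow> carrier A \<and>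
     (\<forall>f\<in>carrier A. \<forall>g\<in>carrier A. \<delta> (f \<oplus>\<^bsub>A\<^esub> g) = \<delta> f \<oplus>\<^bsub>A\<^esub> \<delta> g) \<and>
     (\<forall>r\<in>carrier R. \<forall>f\<in>carrier A. \<delta> (r \<odot>\<^bsub>A\<^esub> f) = r \<odot>\<^bsub>A\<^esub> \<delta> f) \<and>
     (\<forall>f\<in>carrier A. \<forall>g\<in>carrier A.
        \<delta> (f \<otimes>\<^bsub>A\<^esub> g) = \<delta> f \<otimes>\<^bsub>A\<^esub> g \<oplus>\<^bsub>A\<^esub> \<sigma> f \<otimes>\<^bsub>A\<^esub> \<delta> g) \<and>
     \<delta> x = \<one>\<^bsub>A\<^esub>"

text \<open>
  An element $\sum_k F_k \partial_q^k$ of $D_{A/R,q}$ is represented by its coefficient sequence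
  \<open>F\<close>. Left multiplication by $\partial_q$ is given by
  $\partial_q \circ b\,\partial_q^j = \sigma(b)\,\partial_q^{j+1} + \partial_{A,q}(b)\,\partial_q^j$.\<close>

definition diff_op_shift ::
  "('r, 'a) module \<Rightarrow> ('a \<Rightarrow> 'a) \<Rightarrow> ('a \<Rightarrow> 'a) \<Rightarrow> (nat \<Rightarrow> 'a) \<Rightarrow> nat \<Rightarrow> 'a" where
  "diff_op_shift A \<sigma> \<delta> G = (\<lambda>k. (case k of 0 \<Rightarrow> \<zero>\<^bsub>A\<^esub> | Suc j \<Rightarrow> \<sigma> (G j)) \<oplus>\<^bsub>A\<^esub> \<delta> (G k))"

definition diff_ops ::
  "('r, 'a) module \<Rightarrow> ('a \<Rightarrow> 'a) \<Rightarrow> ('a \<Rightarrow> 'a) \<Rightarrow> (nat \<Rightarrow> 'a) ring" where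
  "diff_ops A \<sigma> \<delta> = \<lparr>carrier = up A,
     monoid.mult = (\<lambda>F G l. \<Oplus>\<^bsub>A\<^esub>i\<in>{i. F i \<noteq> \<zero>\<^bsub>A\<^esub>}. F i \<otimes>\<^bsub>A\<^esub> (diff_op_shift A \<sigma> \<delta> ^^ i) G l),
     one = (\<lambda>k. if k = 0 then \<one>\<^bsub>A\<^esub> else \<zero>\<^bsub>A\<^esub>), ring.zero = (\<lambda>k. \<zero>\<^bsub>A\<^esub>),
     add = (\<lambda>F G k. F k \<oplus>\<^bsub>A\<^esub> G k)\<rparr>"

definition diff_op_const :: "('r, 'a) module \<Rightarrow> 'a \<Rightarrow> nat \<Rightarrow> 'a" where
  "diff_op_const A f = (\<lambda>k. if k = 0 then f else \<zero>\<^bsub>A\<^esub>)"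

definition diff_op_gen :: "('r, 'a) module \<Rightarrow> nat \<Rightarrow> 'a" where
  "diff_op_gen A = (\<lambda>k. if k = 1 then \<one>\<^bsub>A\<^esub> else \<zero>\<^bsub>A\<^esub>)"

text \<open>Left modules over a possibly non-commutative ring \<open>D\<close>. Actions are extensional, so that
  they are determined by their values on the carriers.\<close>

definition is_left_action ::
  "('d, 'c) ring_scheme \<Rightarrow> ('m, 'e) ring_scheme \<Rightarrow> ('d \<Rightarrow> 'm \<Rightarrow> 'm) \<Rightarrow> bool" where
  "is_left_action D M act \<longleftrightarrow> abelian_group M \<and>
     act \<in> carrier D \<rightarrow>\<^sub>E (carrier M \<rightarrow>\<^sub>E carrier M) \<and>
     (\<forall>d\<in>carrier D. \<forall>s\<in>carrier M. \<forall>t\<in>carrier M. act d (s \<oplus>\<^bsub>M\<^esub> t) = act d s \<oplus>\<^bsub>M\<^esub> act d t) \<and>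
     (\<forall>d\<in>carrier D. \<forall>e\<in>carrier D. \<forall>s\<in>carrier M. act (d \<oplus>\<^bsub>D\<^esub> e) s = act d s \<oplus>\<^bsub>M\<^esub> act e s) \<and>
     (\<forall>d\<in>carrier D. \<forall>e\<in>carrier D. \<forall>s\<in>carrier M. act (d \<otimes>\<^bsub>D\<^esub> e) s = act d (act e s)) \<and>
     (\<forall>s\<in>carrier M. act \<one>\<^bsub>D\<^esub> s = s)"

definition D_module_structures ::
  "('r, 'a) module \<Rightarrow> ('a \<Rightarrow> 'a) \<Rightarrow> ('a \<Rightarrow> 'a) \<Rightarrow> ('a, 'm) module \<Rightarrow>
    ((nat \<Rightarrow> 'a) \<Rightarrow> 'm \<Rightarrow> 'm) set" where
  "D_module_structures A \<sigma> \<delta> M = {act. is_left_action (diff_ops A \<sigma> \<delta>) M act \<and>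
     (\<forall>f\<in>carrier A. \<forall>s\<in>carrier M. act (diff_op_const A f) s = f \<odot>\<^bsub>M\<^esub> s)}"


section \<open>Tensor products\<close>

text \<open>
  The tensor product is the quotient of the free abelian group on pairs by the usual relations,
  with scalars acting through the left factor. The fields \<open>mult\<close> and \<open>one\<close> are only
  meaningful when both factors are algebras.\<close>

definition tensor_rels ::
  "('a, 'c) ring_scheme \<Rightarrow> ('a, 'm, 'd) module_scheme \<Rightarrow> ('a, 'n, 'e) module_scheme \<Rightarrow>
    ('m \<times> 'n \<Rightarrow>\<^sub>0 int) set" where
  "tensor_rels A M N = generate (free_Abelian_group (carrier M \<times> carrier N))
     ({frag_of (s \<oplus>\<^bsub>M\<^esub> s', t) - frag_of (s, t) - frag_of (s', t) | s s' t.
         s \<in> carrier M \<and> s' \<in> carrier M \<and> t \<in> carrier N} \<union>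
      {frag_of (s, t \<oplus>\<^bsub>N\<^esub> t') - frag_of (s, t) - frag_of (s, t') | s t t'.
         s \<in> carrier M \<and> t \<in> carrier N \<and> t' \<in> carrier N} \<union>
      {frag_of (a \<odot>\<^bsub>M\<^esub> s, t) - frag_of (s, a \<odot>\<^bsub>N\<^esub> t) | a s t.
         a \<in> carrier A \<and> s \<in> carrier M \<and> t \<in> carrier N})"

definition tensor_class ::
  "('a, 'c) ring_scheme \<Rightarrow> ('a, 'm, 'd) module_scheme \<Rightarrow> ('a, 'n, 'e) module_scheme \<Rightarrow>
    ('m \<times> 'n \<Rightarrow>\<^sub>0 int) \<Rightarrow> ('m \<times> 'n \<Rightarrow>\<^sub>0 int) set" where
  "tensor_class A M N c =
     tensor_rels A M N #>\<^bsub>free_Abelian_group (carrier M \<times> carrier N)\<^esub> c"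

definition tensor ::
  "('a, 'c) ring_scheme \<Rightarrow> ('a, 'm, 'd) module_scheme \<Rightarrow> ('a, 'n, 'e) module_scheme \<Rightarrow>
    ('a, ('m \<times> 'n \<Rightarrow>\<^sub>0 int) set) module" where
  "tensor A M N =
     (let G = free_Abelian_group (carrier M \<times> carrier N) Mod tensor_rels A M N
      in \<lparr>carrier = carrier G,
          monoid.mult = (\<lambda>Z W. \<Union>c\<in>Z. \<Union>d\<in>W. tensor_class A M N
            (frag_extend (\<lambda>(s, t). frag_extend (\<lambda>(s', t').
               frag_of (s \<otimes>\<^bsub>M\<^esub> s', t \<otimes>\<^bsub>N\<^esub> t')) d) c)),
          one = tensor_class A M N (frag_of (\<one>\<^bsub>M\<^esub>, \<one>\<^bsub>N\<^esub>)),
          ring.zero = one G,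
          add = monoid.mult G,
          smult = (\<lambda>a Z. \<Union>c\<in>Z. tensor_class A M N
            (frag_extend (\<lambda>(s, t). frag_of (a \<odot>\<^bsub>M\<^esub> s, t)) c))\<rparr>)"

definition tens ::
  "('a, 'c) ring_scheme \<Rightarrow> ('a, 'm, 'd) module_scheme \<Rightarrow> ('a, 'n, 'e) module_scheme \<Rightarrow>
    'm \<Rightarrow> 'n \<Rightarrow> ('m \<times> 'n \<Rightarrow>\<^sub>0 int) set" where
  "tens A M N s t = tensor_class A M N (frag_of (s, t))"

text \<open>The additive map out of a tensor product induced by a balanced biadditive map \<open>g\<close>.\<close>

definition tensor_lift ::
  "('t, 'c) ring_scheme \<Rightarrow> ('m \<Rightarrow> 'n \<Rightarrow> 't) \<Rightarrow> ('m \<times> 'n \<Rightarrow>\<^sub>0 int) set \<Rightarrow> 't" where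
  "tensor_lift T g Z = the_elem
     ((\<lambda>c. \<Oplus>\<^bsub>T\<^esub>z\<in>Poly_Mapping.keys c. [Poly_Mapping.lookup c z] \<cdot>\<^bsub>T\<^esub> g (fst z) (snd z)) ` Z)"


section \<open>Twisted divided polynomials\<close>

text \<open>
  The element $\sum_n F_n \xi^{[n]}$ is represented by its coefficient sequence \<open>F\<close>. In the
  multiplication, \<open>qdp_coeff R A x n m i\<close> is the coefficient of $\xi^{[n+m-i]}$ in
  $\xi^{[n]}\xi^{[m]}$; the indices contributing to $\xi^{[l]}$ are those with
  $i = n+m-l$ and $0 \le i \le n, m$, that is $n \le l$ and $l - n \le m \le l$.\<close>

definition qdp_coeff ::
  "(int poly fract, 'r) module \<Rightarrow> ('r, 'a) module \<Rightarrow> 'a \<Rightarrow> nat \<Rightarrow> nat \<Rightarrow> nat \<Rightarrow> 'a" where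
  "qdp_coeff R A x n m i =
     zq_image R A ([:0, 1:] ^ (i * (i - 1) div 2) * q_binom (n + m - i) n * q_binom n i
                     * ([:0, 1:] - 1) ^ i) \<otimes>\<^bsub>A\<^esub> x [^]\<^bsub>A\<^esub> i"

definition qdp :: "(int poly fract, 'r) module \<Rightarrow> ('r, 'a) module \<Rightarrow> 'a \<Rightarrow> ('a, nat \<Rightarrow> 'a) module"
  where
  "qdp R A x = \<lparr>carrier = up A,
     monoid.mult = (\<lambda>F G l. \<Oplus>\<^bsub>A\<^esub>n\<in>{..l}. \<Oplus>\<^bsub>A\<^esub>m\<in>{l - n..l}.
        F n \<otimes>\<^bsub>A\<^esub> G m \<otimes>\<^bsub>A\<^esub> qdp_coeff R A x n m (n + m - l)),
     one = (\<lambda>k. if k = 0 then \<one>\<^bsub>A\<^esub> else \<zero>\<^bsub>A\<^esub>), ring.zero = (\<lambda>k. \<zero>\<^bsub>A\<^esub>),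
     add = (\<lambda>F G k. F k \<oplus>\<^bsub>A\<^esub> G k),
     smult = (\<lambda>a F k. a \<otimes>\<^bsub>A\<^esub> F k)\<rparr>"

definition xi_div :: "('r, 'a) module \<Rightarrow> nat \<Rightarrow> nat \<Rightarrow> 'a" where
  "xi_div A n = (\<lambda>k. if k = n then \<one>\<^bsub>A\<^esub> else \<zero>\<^bsub>A\<^esub>)"

text \<open>\<open>qdp_ideal R A x n\<close> is $I^{[n+1]}$, and \<open>qdp_trunc R A x n\<close> is
  $A\langle\xi\rangle_q/I^{[n+1]}$.\<close>

definition qdp_ideal ::
  "(int poly fract, 'r) module \<Rightarrow> ('r, 'a) module \<Rightarrow> 'a \<Rightarrow> nat \<Rightarrow> (nat \<Rightarrow> 'a) set" where
  "qdp_ideal R A x n = genideal (qdp R A x) {xi_div A k | k. n + 1 \<le> k}"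

definition qdp_trunc ::
  "(int poly fract, 'r) module \<Rightarrow> ('r, 'a) module \<Rightarrow> 'a \<Rightarrow> nat \<Rightarrow> ('a, (nat \<Rightarrow> 'a) set) module"
  where
  "qdp_trunc R A x n = quot_algebra (qdp R A x) (qdp_ideal R A x n)"

definition qdp_class ::
  "(int poly fract, 'r) module \<Rightarrow> ('r, 'a) module \<Rightarrow> 'a \<Rightarrow> nat \<Rightarrow> (nat \<Rightarrow> 'a) \<Rightarrow> (nat \<Rightarrow> 'a) set"
  where
  "qdp_class R A x n F = qdp_ideal R A x n +>\<^bsub>qdp R A x\<^esub> F"

abbreviation xi_bar ::
  "(int poly fract, 'r) module \<Rightarrow> ('r, 'a) module \<Rightarrow> 'a \<Rightarrow> nat \<Rightarrow> nat \<Rightarrow> (nat \<Rightarrow> 'a) set" where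
  "xi_bar R A x n k \<equiv> qdp_class R A x n (xi_div A k)"

text \<open>The projection from order \<open>n\<close> to order \<open>m \<le> n\<close>.\<close>

definition qdp_proj ::
  "(int poly fract, 'r) module \<Rightarrow> ('r, 'a) module \<Rightarrow> 'a \<Rightarrow> nat \<Rightarrow> (nat \<Rightarrow> 'a) set \<Rightarrow> (nat \<Rightarrow> 'a) set"
  where
  "qdp_proj R A x m Z = the_elem (qdp_class R A x m ` Z)"


section \<open>The $q$-Taylor map\<close>

text \<open>The polynomial $\xi^{(n)}$ in $A[\xi]$, realised as \<open>UP A\<close>.\<close>

definition xi_pow :: "(int poly fract, 'r) module \<Rightarrow> ('r, 'a) module \<Rightarrow> 'a \<Rightarrow> nat \<Rightarrow> nat \<Rightarrow> 'a" where
  "xi_pow R A x n = (\<Otimes>\<^bsub>UP A\<^esub>i\<in>{..<n}. up_ring.monom (UP A) \<one>\<^bsub>A\<^esub> 1 \<oplus>\<^bsub>UP A\<^esub>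
     up_ring.monom (UP A) (x \<ominus>\<^bsub>A\<^esub> (q_in R A [^]\<^bsub>A\<^esub> i) \<otimes>\<^bsub>A\<^esub> x) 0)"

definition xi_ideal ::
  "(int poly fract, 'r) module \<Rightarrow> ('r, 'a) module \<Rightarrow> 'a \<Rightarrow> nat \<Rightarrow> (nat \<Rightarrow> 'a) set" where
  "xi_ideal R A x n = genideal (UP A) {xi_pow R A x (n + 1)}"

definition poly_to_qdp ::
  "(int poly fract, 'r) module \<Rightarrow> ('r, 'a) module \<Rightarrow> 'a \<Rightarrow> (nat \<Rightarrow> 'a) \<Rightarrow> nat \<Rightarrow> 'a" where
  "poly_to_qdp R A x =
     eval A (qdp R A x) (\<lambda>a. a \<odot>\<^bsub>qdp R A x\<^esub> \<one>\<^bsub>qdp R A x\<^esub>) (xi_div A 1)"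

type_synonym 'a tens2 = "('a \<times> 'a \<Rightarrow>\<^sub>0 int) set"

definition diag_ideal :: "('r, 'c) ring_scheme \<Rightarrow> ('r, 'a) module \<Rightarrow> 'a tens2 set" where
  "diag_ideal R A = a_kernel (tensor R A A) A (tensor_lift A (\<lambda>f g. f \<otimes>\<^bsub>A\<^esub> g))"

definition sigma_P ::
  "('r, 'c) ring_scheme \<Rightarrow> ('r, 'a) module \<Rightarrow> ('a \<Rightarrow> 'a) \<Rightarrow> 'a tens2 \<Rightarrow> 'a tens2" where
  "sigma_P R A \<sigma> = tensor_lift (tensor R A A) (\<lambda>f g. tens R A A (\<sigma> f) g)"

text \<open>$I^{(n)} = I \sigma(I) \cdots \sigma^{n-1}(I)$, where as usual $\sigma^i(I)$ stands for the
  ideal generated by the image.\<close>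

primrec diag_twisted_power ::
  "('r, 'c) ring_scheme \<Rightarrow> ('r, 'a) module \<Rightarrow> ('a \<Rightarrow> 'a) \<Rightarrow> nat \<Rightarrow> 'a tens2 set" where
  "diag_twisted_power R A \<sigma> 0 = carrier (tensor R A A)"
| "diag_twisted_power R A \<sigma> (Suc n) = ideal_prod (tensor R A A) (diag_twisted_power R A \<sigma> n)
     (genideal (tensor R A A) ((sigma_P R A \<sigma> ^^ n) ` diag_ideal R A))"

definition P_adic ::
  "nat \<Rightarrow> (int poly fract, 'r) module \<Rightarrow> ('r, 'a) module \<Rightarrow> 'a tens2 set" where
  "P_adic p R A = pq_ideal p (tensor R A A) (q_in R (tensor R A A))"

definition P_hat ::
  "nat \<Rightarrow> (int poly fract, 'r) module \<Rightarrow> ('r, 'a) module \<Rightarrow> (nat \<Rightarrow> 'a tens2 set) ring" where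
  "P_hat p R A = adic_completion (tensor R A A) (P_adic p R A)"

definition to_P_hat ::
  "nat \<Rightarrow> (int poly fract, 'r) module \<Rightarrow> ('r, 'a) module \<Rightarrow> 'a tens2 \<Rightarrow> nat \<Rightarrow> 'a tens2 set" where
  "to_P_hat p R A = to_completion (tensor R A A) (P_adic p R A)"

text \<open>The closure of the image of $I^{(n+1)}$ in the completion of \<open>P\<close>.\<close>

definition P_closure ::
  "nat \<Rightarrow> (int poly fract, 'r) module \<Rightarrow> ('r, 'a) module \<Rightarrow> ('a \<Rightarrow> 'a) \<Rightarrow> nat \<Rightarrow>
    (nat \<Rightarrow> 'a tens2 set) set" where
  "P_closure p R A \<sigma> n = adic_closure (P_hat p R A)
     (pq_ideal p (P_hat p R A) (to_P_hat p R A (q_in R (tensor R A A))))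
     (to_P_hat p R A ` diag_twisted_power R A \<sigma> (n + 1))"

definition P_class ::
  "nat \<Rightarrow> (int poly fract, 'r) module \<Rightarrow> ('r, 'a) module \<Rightarrow> ('a \<Rightarrow> 'a) \<Rightarrow> nat \<Rightarrow> 'a \<Rightarrow> 'a \<Rightarrow>
    (nat \<Rightarrow> 'a tens2 set) set" where
  "P_class p R A \<sigma> n f g =
     P_closure p R A \<sigma> n +>\<^bsub>P_hat p R A\<^esub> to_P_hat p R A (tens R A A f g)"

text \<open>The map from $A[\xi]/(\xi^{(n+1)})$ to the quotient of the completion of \<open>P\<close> by the closure
  of $I^{(n+1)}$.\<close>

definition xi_to_P ::
  "nat \<Rightarrow> (int poly fract, 'r) module \<Rightarrow> ('r, 'a) module \<Rightarrow> 'a \<Rightarrow> ('a \<Rightarrow> 'a) \<Rightarrow> nat \<Rightarrow>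
    (nat \<Rightarrow> 'a) set \<Rightarrow> (nat \<Rightarrow> 'a tens2 set) set" where
  "xi_to_P p R A x \<sigma> n Z =
     (let S = P_hat p R A Quot P_closure p R A \<sigma> n
      in the_elem (eval A S (\<lambda>a. P_class p R A \<sigma> n a \<one>\<^bsub>A\<^esub>)
           (P_class p R A \<sigma> n \<one>\<^bsub>A\<^esub> x \<ominus>\<^bsub>S\<^esub> P_class p R A \<sigma> n x \<one>\<^bsub>A\<^esub>) ` Z))"

text \<open>The composite of $f \mapsto 1 \otimes f$ with the inverse of the previous isomorphisms,
  an element of $A[[\xi]]_q$, i.e. of \<open>quot_limit (UP A) (xi_ideal R A x)\<close>.\<close>

definition taylor_series ::
  "nat \<Rightarrow> (int poly fract, 'r) module \<Rightarrow> ('r, 'a) module \<Rightarrow> 'a \<Rightarrow> ('a \<Rightarrow> 'a) \<Rightarrow> 'a \<Rightarrow>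
    nat \<Rightarrow> (nat \<Rightarrow> 'a) set" where
  "taylor_series p R A x \<sigma> f = (\<lambda>n. inv_into (carrier (UP A Quot xi_ideal R A x n))
     (xi_to_P p R A x \<sigma> n) (P_class p R A \<sigma> n \<one>\<^bsub>A\<^esub> f))"

definition qdp_adic ::
  "nat \<Rightarrow> (int poly fract, 'r) module \<Rightarrow> ('r, 'a) module \<Rightarrow> 'a \<Rightarrow> (nat \<Rightarrow> 'a) set" where
  "qdp_adic p R A x = pq_ideal p (qdp R A x) (q_in R A \<odot>\<^bsub>qdp R A x\<^esub> \<one>\<^bsub>qdp R A x\<^esub>)"

text \<open>The continuous map from $A[[\xi]]_q$ to the completion of $A\langle\xi\rangle_q$: modulo
  $(p,q-1)^k$, the images of the truncations of a series are eventually constant, because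
  $\xi^{(n)} \mapsto (n)_q!\,\xi^{[n]}$ and $(n)_q! \to 0$.\<close>

definition series_to_qdp ::
  "nat \<Rightarrow> (int poly fract, 'r) module \<Rightarrow> ('r, 'a) module \<Rightarrow> 'a \<Rightarrow>
    (nat \<Rightarrow> (nat \<Rightarrow> 'a) set) \<Rightarrow> nat \<Rightarrow> (nat \<Rightarrow> 'a) set" where
  "series_to_qdp p R A x s = (\<lambda>k. THE W. \<exists>N. \<forall>n\<ge>N. \<forall>g\<in>s n.
     to_completion (qdp R A x) (qdp_adic p R A x) (poly_to_qdp R A x g) k = W)"

text \<open>The map from the completion of $A\langle\xi\rangle_q$ to $A\langle\xi\rangle_q/I^{[n+1]}$
  obtained by completing the projection; the target is complete, being finite free over \<open>A\<close>.\<close>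

definition completed_qdp_proj ::
  "nat \<Rightarrow> (int poly fract, 'r) module \<Rightarrow> ('r, 'a) module \<Rightarrow> 'a \<Rightarrow> nat \<Rightarrow>
    (nat \<Rightarrow> (nat \<Rightarrow> 'a) set) \<Rightarrow> (nat \<Rightarrow> 'a) set" where
  "completed_qdp_proj p R A x n y =
     (let Q = qdp_trunc R A x n
      in THE u. u \<in> carrier Q \<and> (\<forall>k. \<forall>F\<in>y k. u \<ominus>\<^bsub>Q\<^esub> qdp_class R A x n F \<in>
           ideal_power Q (pq_ideal p Q (q_in R A \<odot>\<^bsub>Q\<^esub> \<one>\<^bsub>Q\<^esub>)) k))"

definition taylor_map ::
  "nat \<Rightarrow> (int poly fract, 'r) module \<Rightarrow> ('r, 'a) module \<Rightarrow> 'a \<Rightarrow> ('a \<Rightarrow> 'a) \<Rightarrow> nat \<Rightarrow>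
    'a \<Rightarrow> (nat \<Rightarrow> 'a) set" where
  "taylor_map p R A x \<sigma> n f =
     completed_qdp_proj p R A x n (series_to_qdp p R A x (taylor_series p R A x \<sigma> f))"


section \<open>$q$-Taylor structures\<close>

text \<open>$M \otimes_A A\langle\xi\rangle_q/I^{[n+1]}$, first as an \<open>A\<close>-module, then with its action
  of $A\langle\xi\rangle_q/I^{[n+1]}$, then as an \<open>A\<close>-module through $\theta_n$.\<close>

type_synonym ('a, 'm) taylor_target = "('m \<times> (nat \<Rightarrow> 'a) set \<Rightarrow>\<^sub>0 int) set"

definition ten_Q ::
  "(int poly fract, 'r) module \<Rightarrow> ('r, 'a) module \<Rightarrow> 'a \<Rightarrow> ('a, 'm) module \<Rightarrow> nat \<Rightarrow>
    ('a, ('a, 'm) taylor_target) module" where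
  "ten_Q R A x M n = tensor A M (qdp_trunc R A x n)"

definition ten_Q_act ::
  "(int poly fract, 'r) module \<Rightarrow> ('r, 'a) module \<Rightarrow> 'a \<Rightarrow> ('a, 'm) module \<Rightarrow> nat \<Rightarrow>
    (nat \<Rightarrow> 'a) set \<Rightarrow> ('a, 'm) taylor_target \<Rightarrow> ('a, 'm) taylor_target" where
  "ten_Q_act R A x M n u = tensor_lift (ten_Q R A x M n)
     (\<lambda>s v. tens A M (qdp_trunc R A x n) s (u \<otimes>\<^bsub>qdp_trunc R A x n\<^esub> v))"

definition ten_Q' ::
  "nat \<Rightarrow> (int poly fract, 'r) module \<Rightarrow> ('r, 'a) module \<Rightarrow> 'a \<Rightarrow> ('a \<Rightarrow> 'a) \<Rightarrow> ('a, 'm) module \<Rightarrow>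
    nat \<Rightarrow> ('a, ('a, 'm) taylor_target) module" where
  "ten_Q' p R A x \<sigma> M n = (ten_Q R A x M n)
     \<lparr>smult := (\<lambda>f. ten_Q_act R A x M n (taylor_map p R A x \<sigma> n f))\<rparr>"

text \<open>$A\langle\xi\rangle_q/I^{[n+1]}$ as an \<open>A\<close>-module through $\theta_n$.\<close>

definition qdp_trunc' ::
  "nat \<Rightarrow> (int poly fract, 'r) module \<Rightarrow> ('r, 'a) module \<Rightarrow> 'a \<Rightarrow> ('a \<Rightarrow> 'a) \<Rightarrow> nat \<Rightarrow>
    ('a, (nat \<Rightarrow> 'a) set) module" where
  "qdp_trunc' p R A x \<sigma> n = (qdp_trunc R A x n)
     \<lparr>smult := (\<lambda>f u. taylor_map p R A x \<sigma> n f \<otimes>\<^bsub>qdp_trunc R A x n\<^esub> u)\<rparr>"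

text \<open>$A\langle\xi\rangle_q/I^{[n+1]} \otimes'_A A\langle\xi\rangle_q/I^{[m+1]}$. It is an
  \<open>A\<close>-module through the original structure of the left factor, not the one used to form the
  tensor product.\<close>

definition Q_ten'_Q ::
  "nat \<Rightarrow> (int poly fract, 'r) module \<Rightarrow> ('r, 'a) module \<Rightarrow> 'a \<Rightarrow> ('a \<Rightarrow> 'a) \<Rightarrow> nat \<Rightarrow> nat \<Rightarrow>
    ('a, ((nat \<Rightarrow> 'a) set \<times> (nat \<Rightarrow> 'a) set \<Rightarrow>\<^sub>0 int) set) module" where
  "Q_ten'_Q p R A x \<sigma> n m =
     (let T = tensor A (qdp_trunc' p R A x \<sigma> n) (qdp_trunc R A x m)
      in T\<lparr>smult := (\<lambda>a. tensor_lift T (\<lambda>u v. tens A (qdp_trunc' p R A x \<sigma> n)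
             (qdp_trunc R A x m) (a \<odot>\<^bsub>qdp_trunc R A x n\<^esub> u) v))\<rparr>)"

definition Delta ::
  "nat \<Rightarrow> (int poly fract, 'r) module \<Rightarrow> ('r, 'a) module \<Rightarrow> 'a \<Rightarrow> ('a \<Rightarrow> 'a) \<Rightarrow> nat \<Rightarrow> nat \<Rightarrow>
    (nat \<Rightarrow> 'a) set \<Rightarrow> ((nat \<Rightarrow> 'a) set \<times> (nat \<Rightarrow> 'a) set \<Rightarrow>\<^sub>0 int) set" where
  "Delta p R A x \<sigma> n m Z =
     (let T = Q_ten'_Q p R A x \<sigma> n m
      in the_elem ((\<lambda>F. \<Oplus>\<^bsub>T\<^esub>k\<in>{k. F k \<noteq> \<zero>\<^bsub>A\<^esub>}. F k \<odot>\<^bsub>T\<^esub>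
           (\<Oplus>\<^bsub>T\<^esub>i\<in>{..k}. tens A (qdp_trunc' p R A x \<sigma> n) (qdp_trunc R A x m)
              (xi_bar R A x n i) (xi_bar R A x m (k - i)))) ` Z))"

text \<open>$M \otimes_A A\langle\xi\rangle_q/I^{[n+1]} \otimes'_A A\langle\xi\rangle_q/I^{[m+1]}$,
  associated to the left, and the canonical map to it from the product associated to the right.\<close>

type_synonym ('a, 'm) taylor_target2 =
  "(('a, 'm) taylor_target \<times> (nat \<Rightarrow> 'a) set \<Rightarrow>\<^sub>0 int) set"

definition ten_Q_ten'_Q ::
  "nat \<Rightarrow> (int poly fract, 'r) module \<Rightarrow> ('r, 'a) module \<Rightarrow> 'a \<Rightarrow> ('a \<Rightarrow> 'a) \<Rightarrow> ('a, 'm) module \<Rightarrow>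
    nat \<Rightarrow> nat \<Rightarrow> ('a, ('a, 'm) taylor_target2) module" where
  "ten_Q_ten'_Q p R A x \<sigma> M n m = tensor A (ten_Q' p R A x \<sigma> M n) (qdp_trunc R A x m)"

definition assoc_left ::
  "nat \<Rightarrow> (int poly fract, 'r) module \<Rightarrow> ('r, 'a) module \<Rightarrow> 'a \<Rightarrow> ('a \<Rightarrow> 'a) \<Rightarrow> ('a, 'm) module \<Rightarrow>
    nat \<Rightarrow> nat \<Rightarrow> ('m \<times> ((nat \<Rightarrow> 'a) set \<times> (nat \<Rightarrow> 'a) set \<Rightarrow>\<^sub>0 int) set \<Rightarrow>\<^sub>0 int) set \<Rightarrow>
    ('a, 'm) taylor_target2" where
  "assoc_left p R A x \<sigma> M n m =
     (let T = ten_Q_ten'_Q p R A x \<sigma> M n m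
      in tensor_lift T (\<lambda>s. tensor_lift T (\<lambda>u v.
           tens A (ten_Q' p R A x \<sigma> M n) (qdp_trunc R A x m)
             (tens A M (qdp_trunc R A x n) s u) v)))"

text \<open>The two sides of the cocycle condition:
  $\theta_n \otimes \mathrm{Id}$ and $\mathrm{Id}_M \otimes \Delta_{n,m}$.\<close>

definition theta_ten_Id ::
  "nat \<Rightarrow> (int poly fract, 'r) module \<Rightarrow> ('r, 'a) module \<Rightarrow> 'a \<Rightarrow> ('a \<Rightarrow> 'a) \<Rightarrow> ('a, 'm) module \<Rightarrow>
    nat \<Rightarrow> nat \<Rightarrow> ('m \<Rightarrow> ('a, 'm) taylor_target) \<Rightarrow> ('a, 'm) taylor_target \<Rightarrow>
    ('a, 'm) taylor_target2" where
  "theta_ten_Id p R A x \<sigma> M n m \<theta>n = tensor_lift (ten_Q_ten'_Q p R A x \<sigma> M n m)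
     (\<lambda>s v. tens A (ten_Q' p R A x \<sigma> M n) (qdp_trunc R A x m) (\<theta>n s) v)"

definition Id_ten_Delta ::
  "nat \<Rightarrow> (int poly fract, 'r) module \<Rightarrow> ('r, 'a) module \<Rightarrow> 'a \<Rightarrow> ('a \<Rightarrow> 'a) \<Rightarrow> ('a, 'm) module \<Rightarrow>
    nat \<Rightarrow> nat \<Rightarrow> ('a, 'm) taylor_target \<Rightarrow>
    ('m \<times> ((nat \<Rightarrow> 'a) set \<times> (nat \<Rightarrow> 'a) set \<Rightarrow>\<^sub>0 int) set \<Rightarrow>\<^sub>0 int) set" where
  "Id_ten_Delta p R A x \<sigma> M n m =
     (let T = Q_ten'_Q p R A x \<sigma> n m
      in tensor_lift (tensor A M T) (\<lambda>s u. tens A M T s (Delta p R A x \<sigma> n m u)))"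

definition q_taylor_structures ::
  "nat \<Rightarrow> (int poly fract, 'r) module \<Rightarrow> ('r, 'a) module \<Rightarrow> 'a \<Rightarrow> ('a \<Rightarrow> 'a) \<Rightarrow> ('a, 'm) module \<Rightarrow>
    (nat \<Rightarrow> 'm \<Rightarrow> ('a, 'm) taylor_target) set" where
  "q_taylor_structures p R A x \<sigma> M = {\<Theta>.
     (\<forall>n. \<Theta> n \<in> carrier M \<rightarrow>\<^sub>E carrier (ten_Q R A x M n)) \<and>
     (\<forall>n. \<forall>s\<in>carrier M. \<forall>t\<in>carrier M.
        \<Theta> n (s \<oplus>\<^bsub>M\<^esub> t) = \<Theta> n s \<oplus>\<^bsub>ten_Q R A x M n\<^esub> \<Theta> n t) \<and>
     (\<forall>m n. m \<le> n \<longrightarrow> (\<forall>s\<in>carrier M.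
        tensor_lift (ten_Q R A x M m)
          (\<lambda>t u. tens A M (qdp_trunc R A x m) t (qdp_proj R A x m u)) (\<Theta> n s) = \<Theta> m s)) \<and>
     (\<forall>n. \<forall>f\<in>carrier A. \<forall>s\<in>carrier M.
        \<Theta> n (f \<odot>\<^bsub>M\<^esub> s) = ten_Q_act R A x M n (taylor_map p R A x \<sigma> n f) (\<Theta> n s)) \<and>
     (\<forall>s\<in>carrier M. \<Theta> 0 s = tens A M (qdp_trunc R A x 0) s \<one>\<^bsub>qdp_trunc R A x 0\<^esub>) \<and>
     (\<forall>m n. \<forall>s\<in>carrier M.
        theta_ten_Id p R A x \<sigma> M n m (\<Theta> n) (\<Theta> m s) =
        assoc_left p R A x \<sigma> M n m (Id_ten_Delta p R A x \<sigma> M n m (\<Theta> (m + n) s)))}"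

end

theory Submission
  imports Defs
begin

text \<open>Writing $\theta_n(s) = \sum_k D_k(s) \otimes \xi^{[k]}$, the cocycle condition says
 $D_i D_j = D_{i+j}$, so $D_k = \partial^k$ with $\partial = D_1$, and semilinearity of $\theta_1$ is the
 commutation rule of $D_{A/R,q}$. Conversely the iterated twisted Leibniz rule gives semilinearity,
 once $\theta_n(f) = \sum_k \partial_{A,q}^k(f)\, \xi^{[k]}$ is known on $A$. For this, lift the inclusion
 of $A$ along $A[[\xi]]_q \to A$ to $f \mapsto \sum_k \tau_k(f)\, \xi^{(k)}$, with $x \mapsto x + \xi$. Its value
 at $\xi = (q^i - 1)x$ is $\sigma^i$ by uniqueness of lifts, and comparing the Newton expansions at these
 points gives $(k)_q!\, \tau_k = \partial_{A,q}^k$.\<close>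

text \<open>The Taylor map is defined through quotients of the completion of P = A \<otimes> A, so
  its value on f has to be located there. The candidate is the truncation of the series of
  \<open>\<tau>\<close>. A congruence modulo I^(n+1) + (p,q-1)^k for every k shows that it has the
  right image, and the extension \<open>Th\<close> of \<open>\<tau>\<close> to P shows that it is
  the only preimage: evaluation at (q^m - 1)x kills \<sigma>^m(I), which forces \<open>Th\<close> to
  carry I^(m) into series of order at least m. Factorials cannot be divided out in A, which may have
  torsion. Hence \<open>\<tau>\<close> comes from the lifting property, and its link with the
  derivation from uniqueness of lifts into the ring of divided series. Formal etaleness lifts only
  along square-zero ideals in discrete algebras, so a series ring is reached as a limit. The
  filtration by total weight in \<xi>, p and q - 1 is multiplicative because a structure constant
  that lowers the degree by i is divisible by (q-1)^i, and each lift doubles the step: from 2^i to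
  2^(i+1).\<close>

abbreviation (input) car where "car \<equiv> carrier"
abbreviation (input) mult_in ("(_ *[_]/ _)" [70, 0, 71] 70) where "a *[G] b \<equiv> a \<otimes>\<^bsub>G\<^esub> b"
abbreviation (input) add_in ("(_ +[_]/ _)" [65, 0, 66] 65) where "a +[G] b \<equiv> a \<oplus>\<^bsub>G\<^esub> b"
abbreviation (input) minus_in ("(_ -[_]/ _)" [65, 0, 66] 65) where "a -[G] b \<equiv> a \<ominus>\<^bsub>G\<^esub> b"
abbreviation (input) inv_in ("(-[_] _)" [0, 81] 80) where "-[G] a \<equiv> \<ominus>\<^bsub>G\<^esub> a"
abbreviation (input) smult_in ("(_ \<odot>[_]/ _)" [71, 0, 70] 70) where "a \<odot>[G] b \<equiv> a \<odot>\<^bsub>G\<^esub> b"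
abbreviation (input) one_in ("\<one>[_]") where "\<one>[G] \<equiv> \<one>\<^bsub>G\<^esub>"
abbreviation (input) zero_in ("\<zero>[_]") where "\<zero>[G] \<equiv> \<zero>\<^bsub>G\<^esub>"
abbreviation (input) rcos_in ("(_ +>[_]/ _)" [60, 0, 61] 60) where "I +>[G] a \<equiv> I +>\<^bsub>G\<^esub> a"
syntax "_finsum_in" :: "'g \<Rightarrow> pttrn \<Rightarrow> 'i set \<Rightarrow> 'a \<Rightarrow> 'a" ("(3\<Oplus>[_]_\<in>_./ _)" [0, 0, 51, 10] 10)
translations "\<Oplus>[G]i\<in>I. b" \<rightharpoonup> "CONST finsum G (\<lambda>i. b) I"

section \<open>Identities for q-analogs\<close>

definition qv :: "int poly" where "qv = [:0, 1:]"

lemma qv_minus_one: "qv - 1 ~= 0"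
 by (simp add: qv_def one_pCons)

lemma q_int_mult: "q_int n * (qv - 1) = qv ^ n - 1"
proof -
 have "qv - 1 dvd qv ^ n - 1"
  using power_diff_1_eq[of qv n] by (metis dvd_triv_left)
 then show ?thesis
  unfolding q_int_def qv_def by (simp del: mult_pCons_left mult_pCons_right)
qed

lemma q_int_0 [simp]: "q_int 0 = 0"
 by (simp add: q_int_def)

lemma q_int_1 [simp]: "q_int (Suc 0) = 1"
 using q_int_mult[of 1] qv_minus_one by (metis One_nat_def mult_cancel_right1 mult.commute power_one_right)

lemma q_int_add: "q_int (a + b) = q_int a + qv ^ a * q_int b"
proof -
 have "(q_int a + qv ^ a * q_int b) * (qv - 1) = q_int a * (qv - 1) + qv ^ a * (q_int b * (qv - 1))"
  by (simp only: distrib_right mult.assoc)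
 also have "... = q_int (a + b) * (qv - 1)"
  unfolding q_int_mult by (simp add: algebra_simps power_add)
 finally show ?thesis using qv_minus_one by (metis mult_cancel_right)
qed

lemma q_int_add': "q_int (a + b) = q_int a + q_int b + (qv - 1) * q_int a * q_int b"
proof -
 have "q_int (a + b) = q_int a + (1 + (qv - 1) * q_int a) * q_int b"
  using q_int_add[of a b] q_int_mult[of a] by (simp add: algebra_simps)
 then show ?thesis by (simp add: algebra_simps)
qed

lemma q_int_Suc: "q_int (Suc n) = 1 + qv * q_int n" "q_int (Suc n) = q_int n + qv ^ n"
 using q_int_add[of 1 n] q_int_add[of n 1] by simp_all

lemma q_int_nonzero: "n > 0 ==> q_int n ~= 0"
proof
 assume n: "n > 0" and "q_int n = 0"
 then have "qv ^ n = 1" using q_int_mult[of n] by simp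
 then have "poly (qv ^ n) 0 = poly 1 0" by metis
 then show False using n by (simp add: qv_def power_0_left)
qed

lemma q_fact_0 [simp]: "q_fact 0 = 1"
 by (simp add: q_fact_def)

lemma q_fact_Suc: "q_fact (Suc n) = q_int (Suc n) * q_fact n"
 by (simp add: q_fact_def prod.nat_ivl_Suc' mult.commute)

lemma q_fact_nonzero: "q_fact n ~= 0"
 by (induction n) (auto simp: q_fact_Suc q_int_nonzero)

text \<open>The q-Pascal recursion produces the Gaussian binomials inside Z[q] without division;
  \<open>q_pascal_fact\<close> then shows that the division in \<open>q_binom\<close> is
  exact.\<close>

fun q_pascal :: "nat => nat => int poly" where
 "q_pascal n 0 = 1"
| "q_pascal 0 (Suc k) = 0"
| "q_pascal (Suc n) (Suc k) = q_pascal n k + qv ^ Suc k * q_pascal n (Suc k)"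

lemma q_pascal_eq_0: "n < k ==> q_pascal n k = 0"
 by (induction n k rule: q_pascal.induct) auto

lemma q_pascal_fact: "q_pascal (a + b) a * q_fact a * q_fact b = q_fact (a + b)"
proof (induction "a + b" arbitrary: a b)
 case 0
 then show ?case by simp
next
 case (Suc n)
 show ?case
 proof (cases a)
  case 0
  then show ?thesis by simp
 next
  case a: (Suc a')
  show ?thesis
  proof (cases b)
   case 0
   have "q_pascal a a = 1" for a
    by (induction a) (auto simp: q_pascal_eq_0)
   then show ?thesis using 0 by simp
  next
   case b: (Suc b')
   have 1: "q_pascal (a' + b) a' * q_fact a' * q_fact b = q_fact (a' + b)"
    using Suc.hyps(1)[of a' b] Suc.hyps(2) a by simp
   have 2: "q_pascal (a + b') a * q_fact a * q_fact b' = q_fact (a + b')"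
    using Suc.hyps(1)[of a b'] Suc.hyps(2) b by simp
   have e: "a' + b = a + b'" using a b by simp
   have "q_pascal (a + b) a = q_pascal (a' + b) a' + qv ^ a * q_pascal (a + b') a"
    using a b by simp
   then have "q_pascal (a + b) a * q_fact a * q_fact b
     = q_int a * (q_pascal (a' + b) a' * q_fact a' * q_fact b)
      + qv ^ a * q_int b * (q_pascal (a + b') a * q_fact a * q_fact b')"
    using a b by (simp add: q_fact_Suc algebra_simps)
   also have "... = q_int (a + b) * q_fact (a + b')"
    unfolding 1 2 unfolding e q_int_add by (simp add: algebra_simps)
   also have "... = q_fact (a + b)"
    using b by (simp add: q_fact_Suc)
   finally show ?thesis .
  qed
 qed
qed

lemma q_binom_eq_pascal: "q_binom n k = q_pascal n k"
proof (cases "k <= n")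
 case True
 then have "q_fact n = q_pascal n k * (q_fact k * q_fact (n - k))"
  using q_pascal_fact[of k "n - k"] by (simp add: mult.assoc)
 then show ?thesis
  using True q_fact_nonzero by (simp add: q_binom_def)
next
 case False
 then show ?thesis by (simp add: q_binom_def q_pascal_eq_0)
qed

lemma q_binom_fact: "q_binom (a + b) a * q_fact a * q_fact b = q_fact (a + b)"
 by (simp add: q_binom_eq_pascal q_pascal_fact)

lemma q_binom_eq_0: "n < k ==> q_binom n k = 0"
 by (simp add: q_binom_def)

lemma q_binom_n_0 [simp]: "q_binom n 0 = 1"
 by (simp add: q_binom_eq_pascal)

text \<open>\<open>qdp_str n m i\<close> and \<open>newton_str n m i\<close> are the coefficients at index \<open>n + m - i\<close> of the
 product of the basis elements of index \<open>n\<close> and \<open>m\<close>, without the factor $x^i$, for the twisted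
 divided powers $\xi^{[n]}$ and for the twisted powers $\xi^{(n)}$ respectively.\<close>

definition qdp_str :: "nat => nat => nat => int poly" where
 "qdp_str n m i = qv ^ (i * (i - 1) div 2) * q_binom (n + m - i) n * q_binom n i * (qv - 1) ^ i"

definition newton_str :: "nat => nat => nat => int poly" where
 "newton_str n m i =
  qv ^ (i * (i - 1) div 2) * (qv - 1) ^ i * q_binom n i * q_binom m i * q_fact i"

lemma qdp_str_eq_0: "i > n \<or> i > m ==> qdp_str n m i = 0"
proof -
 assume a: "i > n \<or> i > m"
 show ?thesis
 proof (cases "i > n")
  case False
  then have "n + m - i < n" using a by simp
  then show ?thesis by (simp add: qdp_str_def q_binom_eq_0)
 qed (simp add: qdp_str_def q_binom_eq_0)
qed

lemma newton_str_eq_0: "i > n \<or> i > m ==> newton_str n m i = 0"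
 by (auto simp: newton_str_def q_binom_eq_0)

text \<open>With n = i + a and m = i + b the binomials collapse to the symmetric quotient (i+a+b)_q!
  / ((i)_q! (a)_q! (b)_q!). Identities between structure constants are proved by clearing this
  denominator, Z[q] being a domain.\<close>

lemma qdp_str_fact:
 "qdp_str (i + a) (i + b) i * q_fact i * q_fact a * q_fact b =
  qv ^ (i * (i - 1) div 2) * (qv - 1) ^ i * q_fact (i + a + b)"
proof -
 have 1: "q_binom (i + a + b) (i + a) * q_fact (i + a) * q_fact b = q_fact (i + a + b)"
  using q_binom_fact[of "i + a" b] by simp
 have 2: "q_binom (i + a) i * q_fact i * q_fact a = q_fact (i + a)"
  by (rule q_binom_fact)
 have "qdp_str (i + a) (i + b) i * q_fact i * q_fact a * q_fact b =
  qv ^ (i * (i - 1) div 2) * (qv - 1) ^ i *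
  (q_binom (i + a + b) (i + a) * (q_binom (i + a) i * q_fact i * q_fact a) * q_fact b)"
  by (simp add: qdp_str_def algebra_simps)
 then show ?thesis unfolding 2 1 by simp
qed

lemma newton_str_fact:
 "newton_str (i + a) (i + b) i * q_fact i * q_fact a * q_fact b =
  qv ^ (i * (i - 1) div 2) * (qv - 1) ^ i * q_fact (i + a) * q_fact (i + b)"
proof -
 have "newton_str (i + a) (i + b) i * q_fact i * q_fact a * q_fact b =
  qv ^ (i * (i - 1) div 2) * (qv - 1) ^ i *
  ((q_binom (i + a) i * q_fact i * q_fact a) * (q_binom (i + b) i * q_fact i * q_fact b))"
  by (simp add: newton_str_def algebra_simps)
 then show ?thesis unfolding q_binom_fact by (simp add: mult.assoc)
qed

text \<open>Multiplicativity of \<xi>^(n) -> (n)_q! \<xi>^[n] on basis elements. Commutativity and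
  associativity of the divided constants are pulled back along it from the Newton constants.\<close>

lemma qdp_str_newton_str:
 "q_fact n * q_fact m * qdp_str n m i = newton_str n m i * q_fact (n + m - i)"
proof (cases "i > n \<or> i > m")
 case True
 then show ?thesis by (simp add: qdp_str_eq_0 newton_str_eq_0)
next
 case False
 then obtain a b where ab: "n = i + a" "m = i + b"
  by (metis le_add_diff_inverse not_less)
 let ?d = "q_fact i * q_fact a * q_fact b"
 let ?u = "qv ^ (i * (i - 1) div 2) * (qv - 1) ^ i * q_fact (i + a) * q_fact (i + b) * q_fact (i + a + b)"
 have "(q_fact n * q_fact m * qdp_str n m i) * ?d
   = (qdp_str (i + a) (i + b) i * q_fact i * q_fact a * q_fact b) * q_fact (i+a) * q_fact (i+b)"
  by (simp add: ab algebra_simps)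
 also have "... = ?u" unfolding qdp_str_fact by (simp add: algebra_simps)
 also have "... = (newton_str (i + a) (i + b) i * q_fact i * q_fact a * q_fact b) * q_fact (i+a+b)"
  unfolding newton_str_fact by (simp add: algebra_simps)
 also have "... = (newton_str n m i * q_fact (n + m - i)) * ?d"
  by (simp add: ab algebra_simps)
 finally show ?thesis using q_fact_nonzero by simp
qed

lemma newton_str_commute: "newton_str n m i = newton_str m n i"
 by (simp add: newton_str_def mult.assoc mult.left_commute)

lemma qdp_str_commute: "qdp_str n m i = qdp_str m n i"
proof -
 have "q_fact n * q_fact m * qdp_str n m i = q_fact n * q_fact m * qdp_str m n i"
  using qdp_str_newton_str[of n m i] qdp_str_newton_str[of m n i] newton_str_commute[of n m i]
  by (simp add: mult.commute add.commute)
 then show ?thesis using q_fact_nonzero by (metis mult_cancel_left mult_eq_0_iff)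
qed

lemma qdp_str_0 [simp]: "qdp_str 0 m 0 = 1"
 by (simp add: qdp_str_def)

lemma newton_str_0 [simp]: "newton_str 0 m 0 = 1"
 by (simp add: newton_str_def)

lemma triangle_Suc: "Suc i * (Suc i - 1) div 2 = i * (i - 1) div 2 + i"
 by (cases i) (auto simp: algebra_simps)

text \<open>The recurrence of \<open>qdp_str\<close> in the index of the product; it is the one satisfied by the
 coefficients of the iterated twisted Leibniz rule.\<close>

lemma qdp_str_rec:
 assumes "i + a + b > 0"
 shows "qdp_str (i + a) (i + b) i =
   (if a > 0 \<and> b > 0 then q_int (Suc i) * qdp_str (i + a) (i + b) (Suc i) else 0)
  + (if a > 0 then qv ^ i * qdp_str (i + a - 1) (i + b) i else 0)
  + (if b > 0 then qv ^ i * qdp_str (i + a) (i + b - 1) i else 0)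
  + (if i > 0 then qv ^ (i - 1) * (qv - 1) * qdp_str (i + a - 1) (i + b - 1) (i - 1) else 0)"
  (is "_ = ?t1 + ?t2 + ?t3 + ?t4")
proof -
 let ?d = "q_fact i * q_fact a * q_fact b"
 obtain N where N: "i + a + b = Suc N" using assms gr0_conv_Suc by blast
 let ?c = "qv ^ (i * (i - 1) div 2) * (qv - 1) ^ i * q_fact N"
 have t1: "?t1 * ?d = ?c * (qv ^ i * (qv - 1) * q_int a * q_int b)"
 proof (cases "a > 0 \<and> b > 0")
  case True
  then obtain a' b' where ab: "a = Suc a'" "b = Suc b'" by (metis gr0_conv_Suc)
  have "?t1 * ?d = qdp_str (Suc i + a') (Suc i + b') (Suc i) * q_fact (Suc i) * q_fact a' * q_fact b'
    * q_int a * q_int b"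
   using ab by (simp add: q_fact_Suc[of i] q_fact_Suc[of a'] q_fact_Suc[of b'] algebra_simps)
  also have "... = qv ^ (i * (i - 1) div 2 + i) * (qv - 1) ^ Suc i * q_fact N * q_int a * q_int b"
   unfolding qdp_str_fact triangle_Suc using N ab by simp
  finally show ?thesis by (simp add: power_add algebra_simps)
 qed auto
 have t2: "?t2 * ?d = ?c * (qv ^ i * q_int a)"
 proof (cases a)
  case (Suc a')
  have "?t2 * ?d = qdp_str (i + a') (i + b) i * q_fact i * q_fact a' * q_fact b * (qv ^ i * q_int a)"
   using Suc by (simp add: q_fact_Suc algebra_simps)
  then show ?thesis unfolding qdp_str_fact using N Suc by (simp add: algebra_simps)
 qed simp
 have t3: "?t3 * ?d = ?c * (qv ^ i * q_int b)"
 proof (cases b)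
  case (Suc b')
  have "?t3 * ?d = qdp_str (i + a) (i + b') i * q_fact i * q_fact a * q_fact b' * (qv ^ i * q_int b)"
   using Suc by (simp add: q_fact_Suc algebra_simps)
  then show ?thesis unfolding qdp_str_fact using N Suc by (simp add: algebra_simps)
 qed simp
 have t4: "?t4 * ?d = ?c * q_int i"
 proof (cases i)
  case (Suc i')
  have "?t4 * ?d = qdp_str (i' + a) (i' + b) i' * q_fact i' * q_fact a * q_fact b
    * (qv ^ i' * (qv - 1) * q_int i)"
   using Suc by (simp add: q_fact_Suc algebra_simps)
  also have "... = qv ^ (i' * (i' - 1) div 2 + i') * (qv - 1) ^ Suc i' * q_fact N * q_int i"
   unfolding qdp_str_fact using N Suc by (simp add: power_add algebra_simps)
  also have "... = ?c * q_int i" using Suc triangle_Suc[of i'] by simp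
  finally show ?thesis .
 qed simp
 \<comment> \<open>The cleared terms are (i)_q, q^i (a)_q, q^i (b)_q and q^i (q-1)(a)_q (b)_q: the
   splitting of (i+a+b)_q by \<open>q_int_add\<close> at i and then by \<open>q_int_add'\<close> for
   a + b.\<close>
 have "(?t1 + ?t2 + ?t3 + ?t4) * ?d =
   ?c * (q_int i + qv ^ i * (q_int a + q_int b + (qv - 1) * q_int a * q_int b))"
  unfolding distrib_right t1 t2 t3 t4 by (simp add: algebra_simps)
 also have "q_int i + qv ^ i * (q_int a + q_int b + (qv - 1) * q_int a * q_int b) = q_int (Suc N)"
  using q_int_add[of i "a + b"] q_int_add'[of a b] N by (simp add: add.assoc)
 also have "?c * q_int (Suc N) = qv ^ (i * (i - 1) div 2) * (qv - 1) ^ i * q_fact (i + a + b)"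
  unfolding N q_fact_Suc by (simp add: algebra_simps)
 also have "... = qdp_str (i + a) (i + b) i * ?d"
  using qdp_str_fact[of i a b] by (simp add: algebra_simps)
 finally show ?thesis using q_fact_nonzero by (metis mult_cancel_right mult_eq_0_iff)
qed

text \<open>This is \<xi>^(n) for x = 1 in the variable X = \<xi> + 1. By homogeneity the case x = 1
  determines the general one: the coefficient at index n + m - i acquires the factor x^i.\<close>

definition newton_poly :: "nat => int poly poly" where
 "newton_poly n = (\<Prod>i<n. [:- (qv ^ i), 1:])"

lemma newton_poly_0 [simp]: "newton_poly 0 = 1"
 by (simp add: newton_poly_def)

lemma newton_poly_Suc: "newton_poly (Suc n) = [:- (qv ^ n), 1:] * newton_poly n"
 by (simp add: newton_poly_def mult.commute)

lemma newton_poly_shift: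
 "[:- (qv ^ m), 1:] * newton_poly k = newton_poly (Suc k) + Polynomial.smult (qv ^ k - qv ^ m) (newton_poly k)"
proof -
 have "[:- (qv ^ m), 1:] = [:- (qv ^ k), 1:] + [:qv ^ k - qv ^ m:]" by simp
 then have "[:- (qv ^ m), 1:] * newton_poly k
   = [:- (qv ^ k), 1:] * newton_poly k + [:qv ^ k - qv ^ m:] * newton_poly k"
  by (metis distrib_right)
 then show ?thesis by (simp add: newton_poly_Suc)
qed

text \<open>Comes from multiplying the expansion of a product by X - q^m and rewriting X - q^m
  through the node of each term, as in \<open>newton_poly_shift\<close>.\<close>

lemma newton_str_Suc:
 assumes "i <= n"
 shows "newton_str n (Suc m) i = newton_str n m i +
  (case i of 0 => 0 | Suc j => (qv ^ (n + m - j) - qv ^ m) * newton_str n m j)"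
proof (cases i)
 case (Suc j)
 show ?thesis
 proof (cases "j <= m")
  case True
  obtain a where a: "n = Suc (j + a)" using assms Suc by (metis add_Suc le_add_diff_inverse)
  have fb: "q_binom n j * (qv ^ (n - j) - 1) = q_binom n i * q_int i * (qv - 1)"
  proof -
   have "q_binom n j * q_fact j * q_fact (Suc a) = q_fact n"
    using q_binom_fact[of j "Suc a"] a by simp
   moreover have "q_binom n i * q_fact i * q_fact a = q_fact n"
    using q_binom_fact[of i "a"] a Suc by simp
   ultimately have "(q_binom n j * q_int (Suc a)) * (q_fact j * q_fact a)
     = (q_binom n i * q_int i) * (q_fact j * q_fact a)"
    using Suc by (simp add: q_fact_Suc algebra_simps)
   then have "q_binom n j * q_int (Suc a) = q_binom n i * q_int i"
    using q_fact_nonzero by (metis mult_cancel_right mult_eq_0_iff)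
   then show ?thesis using q_int_mult[of "Suc a"] a
    by (metis add_Suc_right diff_add_inverse mult.assoc)
  qed
  \<comment> \<open>The dual q-Pascal rule: the power of q sits on the term with the lower index j,
    whereas the recursion of \<open>q_pascal\<close> puts it on the other term.\<close>
  have pas: "q_binom (Suc m) i = q_binom m i + qv ^ (m - j) * q_binom m j"
  proof -
   define e where "e = m - j"
   have m: "m = j + e" using True e_def by simp
   have 1: "q_binom (Suc m) i * q_fact i * q_fact e = q_fact (Suc m)"
    using q_binom_fact[of i e] m Suc by simp
   have 2: "q_binom m i * q_fact i * q_fact e = q_int e * q_fact m"
   proof (cases e)
    case 0 then show ?thesis using m Suc by (simp add: q_binom_eq_0)
   next
    case (Suc e')
    have "q_binom m i * q_fact i * q_fact e' = q_fact m"
     using q_binom_fact[of i e'] m \<open>i = Suc j\<close> Suc by simp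
    then show ?thesis using Suc by (metis mult.left_commute q_fact_Suc)
   qed
   have 3: "q_binom m j * q_fact j * q_fact e = q_fact m"
    using q_binom_fact[of j e] m by simp
   have "(q_binom m i + qv ^ e * q_binom m j) * (q_fact i * q_fact e)
     = q_binom m i * q_fact i * q_fact e + qv ^ e * q_int i * (q_binom m j * q_fact j * q_fact e)"
    using Suc by (simp add: q_fact_Suc algebra_simps)
   also have "... = (q_int e + qv ^ e * q_int i) * q_fact m"
    unfolding 2 3 by (simp add: algebra_simps)
   also have "... = q_fact (Suc m)"
    using q_int_add[of e i] Suc m by (simp add: q_fact_Suc add.commute)
   also have "... = q_binom (Suc m) i * (q_fact i * q_fact e)"
    using 1 by (simp add: mult.assoc)
   finally have "q_binom (Suc m) i * (q_fact i * q_fact e)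
     = (q_binom m i + qv ^ e * q_binom m j) * (q_fact i * q_fact e)" by (rule sym)
   then show ?thesis unfolding e_def using q_fact_nonzero by (metis mult_cancel_right mult_eq_0_iff)
  qed
  have "qv ^ (n + m - j) - qv ^ m = qv ^ m * (qv ^ (n - j) - 1)"
   using a by (simp add: algebra_simps power_add)
  then have "(qv ^ (n + m - j) - qv ^ m) * newton_str n m j
    = qv ^ m * qv ^ (j * (j - 1) div 2) * (qv - 1) ^ j
     * (q_binom n j * (qv ^ (n - j) - 1)) * q_binom m j * q_fact j"
   by (simp add: newton_str_def algebra_simps)
  also have "... = qv ^ (m - j) * (qv ^ (j * (j - 1) div 2 + j)) * (qv - 1) ^ i
     * q_binom n i * q_binom m j * q_fact i"
  proof -
   have "qv ^ m = qv ^ (m - j) * qv ^ j" using True by (simp flip: power_add)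
   then show ?thesis unfolding fb Suc by (simp add: power_add q_fact_Suc algebra_simps)
  qed
  also have "qv ^ (j * (j - 1) div 2 + j) = qv ^ (i * (i - 1) div 2)"
   using triangle_Suc[of j] Suc by simp
  finally show ?thesis using Suc pas by (simp add: newton_str_def algebra_simps)
 next
  case False
  then show ?thesis using Suc by (simp add: newton_str_eq_0)
 qed
qed (simp add: newton_str_def)

lemma newton_poly_mult:
 "newton_poly n * newton_poly m = (\<Sum>i\<le>n. Polynomial.smult (newton_str n m i) (newton_poly (n + m - i)))"
proof (induction m)
 case 0
 have "(\<Sum>i\<le>n. Polynomial.smult (newton_str n 0 i) (newton_poly (n + 0 - i)))
  = (\<Sum>i\<in>{0}. Polynomial.smult (newton_str n 0 i) (newton_poly (n + 0 - i)))"
  by (rule sum.mono_neutral_right) (auto simp: newton_str_eq_0)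
 then show ?case by (simp add: newton_str_def)
next
 case (Suc m)
 let ?g = "\<lambda>i. Polynomial.smult (newton_str n m i) (newton_poly (Suc n + m - i))"
 let ?k = "\<lambda>i. Polynomial.smult ((qv ^ (n + m - i) - qv ^ m) * newton_str n m i) (newton_poly (n + m - i))"
 have "newton_poly n * newton_poly (Suc m) = [:- (qv ^ m), 1:] * (newton_poly n * newton_poly m)"
  by (simp only: newton_poly_Suc mult.left_commute)
 also have "... = (\<Sum>i\<le>n. Polynomial.smult (newton_str n m i) ([:- (qv ^ m), 1:] * newton_poly (n + m - i)))"
  unfolding Suc sum_distrib_left by (simp only: mult_smult_right)
 also have "... = (\<Sum>i\<le>n. ?g i + ?k i)"
 proof (rule sum.cong)
  fix i assume i: "i : {..n}"
  have "Suc (n + m - i) = Suc n + m - i" using i by simp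
  then show "Polynomial.smult (newton_str n m i) ([:- (qv ^ m), 1:] * newton_poly (n + m - i)) = ?g i + ?k i"
   unfolding newton_poly_shift by (simp add: smult_add_right mult.commute)
 qed simp
 also have "... = sum ?g {..n} + sum ?k {..n}" by (rule sum.distrib)
 \<comment> \<open>The term i = n carries q^(n+m-n) - q^m = 0, so shifting the index by one loses
   nothing.\<close>
 also have "sum ?k {..n} = (\<Sum>i\<in>{..n}. case i of 0 => 0 | Suc j => ?k j)"
 proof -
  have kn: "?k n = 0" by (simp)
  have "sum ?k {..n} = sum ?k {..<n}" using kn by (metis (no_types, lifting) lessThan_Suc_atMost sum.lessThan_Suc add_0_right)
  also have "... = (\<Sum>i\<in>{..n}. case i of 0 => 0 | Suc j => ?k j)"
   by (simp add: sum.atMost_shift)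
  finally show ?thesis .
 qed
 also have "sum ?g {..n} + (\<Sum>i\<in>{..n}. case i of 0 => 0 | Suc j => ?k j)
  = (\<Sum>i\<le>n. Polynomial.smult (newton_str n (Suc m) i) (newton_poly (n + Suc m - i)))"
  unfolding sum.distrib[symmetric]
 proof (rule sum.cong)
  fix i assume "i : {..n}"
  then show "?g i + (case i of 0 => 0 | Suc j => ?k j)
   = Polynomial.smult (newton_str n (Suc m) i) (newton_poly (n + Suc m - i))"
   by (simp add: newton_str_Suc smult_add_left split: nat.split)
 qed simp
 finally show ?case .
qed

text \<open>\<open>str_at c a b k\<close> is the coefficient at index \<open>k\<close> of the product of the basis elements of
 index \<open>a\<close> and \<open>b\<close>.\<close>

definition str_at :: "(nat => nat => nat => int poly) => nat => nat => nat => int poly" where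
 "str_at c a b k = (if k <= a + b then c a b (a + b - k) else 0)"

lemma str_at_newton_eq_0: "k < a \<or> k < b \<or> a + b < k ==> str_at newton_str a b k = 0"
 unfolding str_at_def by (simp, intro impI newton_str_eq_0, arith)

lemma str_at_qdp_eq_0: "k < a \<or> k < b \<or> a + b < k ==> str_at qdp_str a b k = 0"
 unfolding str_at_def by (simp, intro impI qdp_str_eq_0, arith)

lemma newton_poly_mult_str_at:
 assumes "a + b <= N"
 shows "newton_poly a * newton_poly b = (\<Sum>k\<le>N. Polynomial.smult (str_at newton_str a b k) (newton_poly k))"
proof -
 have "(\<Sum>k\<le>N. Polynomial.smult (str_at newton_str a b k) (newton_poly k))
   = (\<Sum>k\<in>{b..a+b}. Polynomial.smult (str_at newton_str a b k) (newton_poly k))"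
  by (rule sum.mono_neutral_right) (use assms in \<open>auto simp: str_at_newton_eq_0\<close>)
 also have "... = (\<Sum>i\<le>a. Polynomial.smult (newton_str a b i) (newton_poly (a + b - i)))"
  by (rule sum.reindex_bij_witness[of _ "\<lambda>i. a + b - i" "\<lambda>k. a + b - k"]) (auto simp: str_at_def)
 finally show ?thesis by (simp add: newton_poly_mult)
qed

lemma degree_newton_poly: "Polynomial.degree (newton_poly n) = n" and lead_coeff_newton_poly: "Polynomial.coeff (newton_poly n) n = 1"
proof -
 have "Polynomial.degree (newton_poly n) = n \<and> Polynomial.coeff (newton_poly n) n = 1"
 proof (induction n)
  case (Suc n)
  have "newton_poly n ~= 0" using Suc by auto
  then have "Polynomial.degree (newton_poly (Suc n)) = Suc n"
   using Suc unfolding newton_poly_Suc by (subst degree_mult_eq) auto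
  moreover have "Polynomial.lead_coeff (newton_poly (Suc n)) = 1"
   using Suc unfolding newton_poly_Suc lead_coeff_mult by simp
  ultimately show ?case by simp
 qed simp
 then show "Polynomial.degree (newton_poly n) = n" "Polynomial.coeff (newton_poly n) n = 1" by auto
qed

lemma smult_sum_right: "Polynomial.smult a (\<Sum>k\<in>K. f k) = (\<Sum>k\<in>K. Polynomial.smult a (f k))"
 by (induction K rule: infinite_finite_induct) (simp_all add: smult_add_right)

text \<open>Newton polynomials are monic with pairwise distinct degrees, so the top coefficient is
  read off first.\<close>

lemma newton_poly_independent:
 "(\<Sum>k\<le>N. Polynomial.smult (a k) (newton_poly k)) = 0 ==> k <= N ==> a k = 0"
proof (induction N arbitrary: k)
 case 0
 then show ?case by simp
next
 case (Suc N)
 have "Polynomial.coeff (\<Sum>k\<le>Suc N. Polynomial.smult (a k) (newton_poly k)) (Suc N) = (\<Sum>k\<le>Suc N. if k = Suc N then a k else 0)"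
  unfolding coeff_sum by (rule sum.cong) (auto simp: lead_coeff_newton_poly coeff_eq_0 degree_newton_poly)
 also have "... = a (Suc N)" by simp
 finally have "a (Suc N) = 0" using Suc.prems(1) by (simp only: Polynomial.coeff_0)
 then show ?case using Suc by (cases "k = Suc N") auto
qed

text \<open>Both sides are the l-th Newton coefficient of a triple product, bracketed in two ways;
  independence of the Newton polynomials identifies them. For l > a + b + d both sums
  vanish.\<close>

lemma newton_str_assoc:
 "(\<Sum>k\<le>l. str_at newton_str a b k * str_at newton_str k d l)
 = (\<Sum>k\<le>l. str_at newton_str b d k * str_at newton_str a k l)" (is "?L l = ?R l")
proof (cases "l <= a + b + d")
 case True
 let ?N = "a + b + d"
 let ?s = "str_at newton_str"
 have trunc1: "(\<Sum>k\<le>l. ?s u v k * ?s k d l) = (\<Sum>k\<le>?N. ?s u v k * ?s k d l)" if "l <= ?N" for u v d l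
  by (rule sum.mono_neutral_left) (use that in \<open>auto simp: str_at_newton_eq_0\<close>)
 have trunc2: "(\<Sum>k\<le>l. ?s u v k * ?s a k l) = (\<Sum>k\<le>?N. ?s u v k * ?s a k l)" if "l <= ?N" for u v a l
  by (rule sum.mono_neutral_left) (use that in \<open>auto simp: str_at_newton_eq_0\<close>)
 have 1: "newton_poly a * newton_poly b * newton_poly d
   = (\<Sum>l\<le>?N. Polynomial.smult (\<Sum>k\<le>?N. ?s a b k * ?s k d l) (newton_poly l))"
 proof -
  have "newton_poly a * newton_poly b * newton_poly d
   = (\<Sum>k\<le>a+b. Polynomial.smult (?s a b k) (newton_poly k * newton_poly d))"
   by (subst newton_poly_mult_str_at[of a b "a+b"]) (auto simp: sum_distrib_right)
  also have "... = (\<Sum>k\<le>a+b. Polynomial.smult (?s a b k) (\<Sum>l\<le>?N. Polynomial.smult (?s k d l) (newton_poly l)))"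
   by (rule sum.cong[OF refl]) (subst newton_poly_mult_str_at[of _ d ?N], auto)
  also have "... = (\<Sum>k\<le>?N. Polynomial.smult (?s a b k) (\<Sum>l\<le>?N. Polynomial.smult (?s k d l) (newton_poly l)))"
   by (rule sum.mono_neutral_left) (auto simp: str_at_def)
  also have "... = (\<Sum>l\<le>?N. \<Sum>k\<le>?N. Polynomial.smult (?s a b k * ?s k d l) (newton_poly l))"
   by (simp only: smult_sum_right smult_smult, rule sum.swap)
  finally show ?thesis by (simp add: smult_sum)
 qed
 have 2: "newton_poly a * (newton_poly b * newton_poly d)
   = (\<Sum>l\<le>?N. Polynomial.smult (\<Sum>k\<le>?N. ?s b d k * ?s a k l) (newton_poly l))"
 proof -
  have "newton_poly a * (newton_poly b * newton_poly d)
   = (\<Sum>k\<le>b+d. Polynomial.smult (?s b d k) (newton_poly a * newton_poly k))"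
   by (subst newton_poly_mult_str_at[of b d "b+d"]) (auto simp: sum_distrib_left)
  also have "... = (\<Sum>k\<le>b+d. Polynomial.smult (?s b d k) (\<Sum>l\<le>?N. Polynomial.smult (?s a k l) (newton_poly l)))"
   by (rule sum.cong[OF refl]) (subst newton_poly_mult_str_at[of a _ ?N], auto)
  also have "... = (\<Sum>k\<le>?N. Polynomial.smult (?s b d k) (\<Sum>l\<le>?N. Polynomial.smult (?s a k l) (newton_poly l)))"
   by (rule sum.mono_neutral_left) (auto simp: str_at_def)
  also have "... = (\<Sum>l\<le>?N. \<Sum>k\<le>?N. Polynomial.smult (?s b d k * ?s a k l) (newton_poly l))"
   by (simp only: smult_sum_right smult_smult, rule sum.swap)
  finally show ?thesis by (simp add: smult_sum)
 qed
 have "(\<Sum>l\<le>?N. Polynomial.smult ((\<Sum>k\<le>?N. ?s a b k * ?s k d l) - (\<Sum>k\<le>?N. ?s b d k * ?s a k l)) (newton_poly l)) = 0"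
  using 1 2 by (simp add: smult_diff_left sum_subtractf mult.assoc)
 from newton_poly_independent[OF this True] trunc1[OF True, of a b d] trunc2[OF True, of b d a]
 show ?thesis by simp
next
 case False
 have "?L l = 0" using False by (auto intro!: sum.neutral simp: str_at_def)
 moreover have "?R l = 0" using False by (auto intro!: sum.neutral simp: str_at_def)
 ultimately show ?thesis by simp
qed

lemma str_at_qdp_newton:
 "q_fact a * q_fact b * str_at qdp_str a b k = str_at newton_str a b k * q_fact k"
 by (simp add: str_at_def qdp_str_newton_str)

text \<open>Multiplication by (a)_q! (b)_q! (d)_q! turns each divided summand into the Newton
  summand times (l)_q!; the intermediate factorial, (k)_q!, is handed from the first structure
  constant to the second.\<close>

lemma qdp_str_assoc:
 "(\<Sum>k\<le>l. str_at qdp_str a b k * str_at qdp_str k d l)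
 = (\<Sum>k\<le>l. str_at qdp_str b d k * str_at qdp_str a k l)" (is "?L = ?R")
proof -
 let ?d = "q_fact a * q_fact b * q_fact d"
 have 1: "?d * ?L = (\<Sum>k\<le>l. str_at newton_str a b k * str_at newton_str k d l) * q_fact l"
  unfolding sum_distrib_left sum_distrib_right
 proof (rule sum.cong)
  fix k
  have "?d * (str_at qdp_str a b k * str_at qdp_str k d l)
    = (q_fact a * q_fact b * str_at qdp_str a b k) * q_fact d * str_at qdp_str k d l"
   by (simp add: algebra_simps)
  also have "q_fact a * q_fact b * str_at qdp_str a b k = str_at newton_str a b k * q_fact k"
   by (rule str_at_qdp_newton)
  also have "str_at newton_str a b k * q_fact k * q_fact d * str_at qdp_str k d l
    = str_at newton_str a b k * (q_fact k * q_fact d * str_at qdp_str k d l)"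
   by (simp add: algebra_simps)
  also have "q_fact k * q_fact d * str_at qdp_str k d l = str_at newton_str k d l * q_fact l"
   by (rule str_at_qdp_newton)
  finally show "?d * (str_at qdp_str a b k * str_at qdp_str k d l)
    = str_at newton_str a b k * str_at newton_str k d l * q_fact l"
   by (simp only: mult.assoc)
 qed simp
 have 2: "?d * ?R = (\<Sum>k\<le>l. str_at newton_str b d k * str_at newton_str a k l) * q_fact l"
  unfolding sum_distrib_left sum_distrib_right
 proof (rule sum.cong)
  fix k
  have "?d * (str_at qdp_str b d k * str_at qdp_str a k l)
    = (q_fact b * q_fact d * str_at qdp_str b d k) * q_fact a * str_at qdp_str a k l"
   by (simp add: algebra_simps)
  also have "q_fact b * q_fact d * str_at qdp_str b d k = str_at newton_str b d k * q_fact k"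
   by (rule str_at_qdp_newton)
  also have "str_at newton_str b d k * q_fact k * q_fact a * str_at qdp_str a k l
    = str_at newton_str b d k * (q_fact a * q_fact k * str_at qdp_str a k l)"
   by (simp add: algebra_simps)
  also have "q_fact a * q_fact k * str_at qdp_str a k l = str_at newton_str a k l * q_fact l"
   by (rule str_at_qdp_newton)
  finally show "?d * (str_at qdp_str b d k * str_at qdp_str a k l)
    = str_at newton_str b d k * str_at newton_str a k l * q_fact l"
   by (simp only: mult.assoc)
 qed simp
 have "?d * ?L = ?d * ?R"
  unfolding 1 2 by (rule arg_cong[OF newton_str_assoc])
 moreover have "?d ~= 0" using q_fact_nonzero by (simp only: mult_eq_0_iff) blast
 ultimately show ?thesis using mult_left_cancel by blast
qed

section \<open>Powers of ideals\<close>

lemma ideals_set_simps [simp]: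
 "\<one>[ideals_set R] = car R" "I *[ideals_set R] J = ideal_prod R I J"
 by (simp_all add: ideals_set_def)

context ring
begin

lemma ideal_pow_0: "ideal_power R I 0 = car R"
 by simp

lemma ideal_pow_Suc: "ideal_power R I (Suc k) = ideal_prod R (ideal_power R I k) I"
 by simp

lemma ideal_pow_ideal: "ideal I R ==> ideal (ideal_power R I k) R"
 by (induction k) (simp_all add: oneideal ideal_prod_is_ideal)

lemma ideal_prod_subset:
 assumes "ideal K R" "!!a b. a : I ==> b : J ==> a \<otimes> b : K"
 shows "ideal_prod R I J <= K"
proof
 fix s assume "s : ideal_prod R I J"
 then show "s : K"
 proof induction
  case (sum s1 s2)
  then show ?case by (intro additive_subgroup.a_closed[OF ideal.axioms(1)[OF assms(1)]])
 qed (rule assms(2))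
qed

text \<open>Powers of I form the smallest filtration of this kind, so to bound them it suffices to
  exhibit some filtration.\<close>

lemma ideal_pow_least:
 assumes "!!k. ideal (K k) R" "K 0 = car R"
  "!!k a b. a : K k ==> b : I ==> a \<otimes> b : K (Suc k)"
 shows "ideal_power R I k <= K k"
proof (induction k)
 case (Suc k)
 then show ?case unfolding ideal_pow_Suc
  by (intro ideal_prod_subset) (use assms in blast)+
qed (simp add: assms)

lemma ideal_pow_carr: "ideal I R ==> a : ideal_power R I k ==> a : car R"
 using ideal_pow_ideal ideal.Icarr by metis

lemma ideal_minus_closed: "ideal I R ==> a : I ==> b : I ==> a \<ominus> b : I"
 by (simp add: a_minus_def additive_subgroup.a_closed additive_subgroup.a_inv_closed ideal.axioms(1))

lemma ideal_add_closed: "ideal I R ==> a : I ==> b : I ==> a \<oplus> b : I"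
 by (simp add: additive_subgroup.a_closed ideal.axioms(1))

lemma ideal_inv_closed: "ideal I R ==> a : I ==> \<ominus> a : I"
 by (simp add: additive_subgroup.a_inv_closed ideal.axioms(1))

lemma ideal_zero_closed: "ideal I R ==> \<zero> : I"
 by (simp add: additive_subgroup.zero_closed ideal.axioms(1))

lemma ideal_finsum_closed:
 assumes "ideal I R" "!!i. i : A ==> f i : I"
 shows "(\<Oplus>i\<in>A. f i) : I"
 using assms(2)
proof (induction A rule: infinite_finite_induct)
 case (insert x F)
 moreover have "f : F \<rightarrow> car R" "f x : car R"
  using insert assms(1) ideal.Icarr by (metis Pi_I insertCI)+
 ultimately show ?case by (simp add: ideal_add_closed[OF assms(1)])
qed (simp_all add: ideal_zero_closed[OF assms(1)] finsum_infinite)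

lemma rcos_eq_iff:
 "ideal I R ==> a : car R ==> b : car R ==> I +> a = I +> b \<longleftrightarrow> a \<ominus> b : I"
 using quotient_eq_iff_same_a_r_cos by metis

lemma in_rcos_iff:
 "ideal I R ==> a : car R ==> b : I +> a \<longleftrightarrow> b : car R \<and> b \<ominus> a : I"
 (is "_ ==> _ ==> ?l = ?r")
proof -
 assume I: "ideal I R" and a: "a : car R"
 interpret I: abelian_subgroup I R
  by (rule abelian_subgroupI3[OF ideal.axioms(1)[OF I] abelian_group_axioms])
 show "?l = ?r"
 proof
  assume b: ?l
  then have "b : car R"
   using a_r_coset_subset_G[OF additive_subgroup.a_subset[OF ideal.axioms(1)[OF I]] a] by auto
  moreover have "I +> b = I +> a" using I.a_repr_independence'[OF b a] by simp
  ultimately show ?r using rcos_eq_iff[OF I] a by blast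
 next
  assume b: ?r
  then have "I +> b = I +> a" using rcos_eq_iff[OF I] a by blast
  then show ?l using b I.a_rcos_self by metis
 qed
qed

end

context cring
begin

lemma ideal_pow_1: "ideal I R ==> ideal_power R I (Suc 0) = I"
 using ideal_prod_commute[OF oneideal] ideal_prod_one by simp

lemma ideal_pow_mult:
 assumes "ideal I R" "a : ideal_power R I m" "b : ideal_power R I n"
 shows "a \<otimes> b : ideal_power R I (m + n)"
 using assms(3)
proof (induction n arbitrary: b)
 case 0
 then show ?case using assms ideal.I_r_closed[OF ideal_pow_ideal[OF assms(1)]] by simp
next
 case (Suc n)
 have a: "a : car R" using assms ideal_pow_carr by blast
 from Suc.prems show ?case unfolding ideal_pow_Suc add_Suc_right
 proof (induction rule: ideal_prod.induct)
  case (prod i j)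
  then have "a \<otimes> i : ideal_power R I (m + n)" using Suc.IH by blast
  moreover have "i : car R" "j : car R"
   using prod ideal_pow_carr[OF assms(1)] ideal.Icarr[OF assms(1)] by auto
  ultimately show ?case using ideal_prod.prod[of "a \<otimes> i" _ j I R] prod(2) a by (simp add: m_assoc)
 next
  case (sum s1 s2)
  have "s1 : car R" "s2 : car R"
   using sum ideal_pow_carr[OF assms(1), of _ "Suc n"] by auto
  then show ?case using sum a by (simp add: r_distr ideal_prod.sum)
 qed
qed

lemma ideal_pow_antimono:
 assumes "ideal I R" "m <= n"
 shows "ideal_power R I n <= ideal_power R I m"
 using assms(2)
proof (induction rule: dec_induct)
 case (step n)
 have "ideal_power R I (Suc n) <= ideal_power R I n"
  using ideal_prod_inter[OF ideal_pow_ideal[OF assms(1)] assms(1)] by simp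
 then show ?case using step by blast
qed simp

lemma ideal_pow_mono:
 assumes "ideal I R" "ideal J R" "I <= J"
 shows "ideal_power R I k <= ideal_power R J k"
proof (rule ideal_pow_least)
 show "a \<otimes> b : ideal_power R J (Suc k)" if "a : ideal_power R J k" "b : I" for k a b
  unfolding ideal_pow_Suc using that assms(3) by (intro ideal_prod.prod) auto
qed (use assms ideal_pow_ideal in auto)

lemma ideal_pow_pow:
 assumes "ideal I R" "a : I"
 shows "a [^] n : ideal_power R I n"
proof (induction n)
 case (Suc n)
 then show ?case using assms(2) by (simp add: ideal_prod.prod)
qed simp

end

lemma ring_hom_ideal_pow:
 assumes "ring R" "ring S" "\<phi> : ring_hom R S" "ideal I R" "ideal J S" "\<phi> ` I <= J"
 shows "\<phi> ` ideal_power R I k <= ideal_power S J k"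
proof -
 interpret ring_hom_ring R S \<phi> by (rule ring_hom_ringI2) fact+
 have "ideal_power R I k <= {r : car R. \<phi> r : ideal_power S J k}" for k
 proof (rule R.ideal_pow_least)
  show "ideal {r : car R. \<phi> r : ideal_power S J k} R" for k
   by (rule ideal_vimage[OF S.ideal_pow_ideal[OF assms(5)]])
  show "{r : car R. \<phi> r : ideal_power S J 0} = car R" by auto
  show "a *[R] b : {r : car R. \<phi> r : ideal_power S J (Suc k)}"
   if "a : {r : car R. \<phi> r : ideal_power S J k}" "b : I" for a b k
   using that assms(6) ideal.Icarr[OF assms(4)]
   by (auto intro!: ideal_prod.prod)
 qed
 then show ?thesis by blast
qed

lemma ring_hom_genideal:
 assumes "ring R" "ring S" "\<phi> : ring_hom R S" "!!z. z : G ==> z : car R" "ideal J S" "\<phi> ` G <= J"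
  and z: "z : genideal R G"
 shows "\<phi> z : J"
proof -
 interpret ring_hom_ring R S \<phi> by (rule ring_hom_ringI2) fact+
 have "genideal R G <= {r : car R. \<phi> r : J}"
  by (rule R.genideal_minimal[OF ideal_vimage[OF assms(5)]]) (use assms(4,6) in auto)
 then show ?thesis using z by blast
qed

lemma (in ring_hom_ring) surj_image_ideal:
 assumes "ideal I R" "h ` car R = car S"
 shows "ideal (h ` I) S"
proof (rule idealI[OF S.ring_axioms])
 interpret I: ideal I R by fact
 show "subgroup (h ` I) (add_monoid S)"
 proof (rule S.add.subgroupI)
  show "h ` I <= car S" using I.Icarr by auto
  show "h ` I ~= {}" using R.ideal_zero_closed[OF assms(1)] by (metis emptyE image_is_empty)
  show "-[S] a : h ` I" if "a : h ` I" for a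
  proof -
   from that obtain b where "b : I" "a = h b" by auto
   then show ?thesis using I.Icarr R.ideal_inv_closed[OF assms(1)] by (intro image_eqI[of _ _ "\<ominus> b"]) auto
  qed
  show "a +[S] b : h ` I" if "a : h ` I" "b : h ` I" for a b
  proof -
   from that obtain c d where "c : I" "a = h c" "d : I" "b = h d" by auto
   then show ?thesis using I.Icarr R.ideal_add_closed[OF assms(1)] by (intro image_eqI[of _ _ "c \<oplus> d"]) auto
  qed
 qed
 fix a z assume "a : h ` I" "z : car S"
 then obtain b y where "b : I" "a = h b" "y : car R" "z = h y" using assms(2) by blast
 then show "z *[S] a : h ` I" "a *[S] z : h ` I"
  using I.Icarr I.I_l_closed I.I_r_closed
  by (auto intro: image_eqI[of _ _ "y \<otimes> b"] image_eqI[of _ _ "b \<otimes> y"])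
qed

section \<open>The ideal generated by p and q - 1\<close>

context cring
begin

lemma pq_gens_carrier: "c : car R ==> {add_pow R (p :: nat) \<one>, c \<ominus> \<one>} <= car R"
 using add.nat_pow_closed[OF one_closed] by auto

lemma pq_ideal_ideal: "c : car R ==> ideal (pq_ideal p R c) R"
 unfolding pq_ideal_def by (rule genideal_ideal[OF pq_gens_carrier])

lemma pq_ideal_p: "c : car R ==> add_pow R p \<one> : pq_ideal p R c"
 and pq_ideal_q: "c : car R ==> c \<ominus> \<one> : pq_ideal p R c"
 unfolding pq_ideal_def using genideal_self[OF pq_gens_carrier] by auto

lemma pq_ideal_least:
 assumes "ideal J R" "add_pow R p \<one> : J" "c \<ominus> \<one> : J"
 shows "pq_ideal p R c <= J"
 unfolding pq_ideal_def using assms by (intro genideal_minimal) auto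

text \<open>The explicit form with two generators is what allows series in the completion to be
  split termwise, see \<open>KK_Suc_subset\<close>.\<close>

lemma pq_ideal_elem:
 assumes "c : car R" "z : pq_ideal p R c"
 obtains a b where "a : car R" "b : car R" "z = add_pow R p \<one> \<otimes> a \<oplus> (c \<ominus> \<one>) \<otimes> b"
proof -
 let ?J = "PIdl (add_pow R p \<one>) <+>\<^bsub>R\<^esub> PIdl (c \<ominus> \<one>)"
 have J: "ideal ?J R"
  using assms(1) by (intro add_ideals cgenideal_ideal) auto
 have z: "\<zero> : PIdl a" if "a : car R" for a
  using cgenideal_ideal[OF that] ideal_zero_closed by blast
 have p: "add_pow R p \<one> : car R" and q: "c \<ominus> \<one> : car R"
  using add.nat_pow_closed[OF one_closed] assms(1) by auto
 have "pq_ideal p R c <= ?J"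
 proof (rule pq_ideal_least[OF J])
  have "add_pow R p \<one> \<oplus> \<zero> : ?J"
   unfolding set_add_def' using z[OF q] cgenideal_self[OF p] by blast
  then show "add_pow R p \<one> : ?J" using p by simp
  have "\<zero> \<oplus> (c \<ominus> \<one>) : ?J"
   unfolding set_add_def' using z[OF p] cgenideal_self[OF q] by blast
  then show "c \<ominus> \<one> : ?J" using q by simp
 qed
 then have "z : ?J" using assms by blast
 then obtain a b where "a : car R" "b : car R" "z = a \<otimes> (add_pow R p \<one>) \<oplus> b \<otimes> (c \<ominus> \<one>)"
  unfolding set_add_def' cgenideal_def by auto
 then show ?thesis using that[of a b] p q by (simp add: m_comm)
qed

end

lemma ring_hom_nat_mult:
 assumes "ring R" "ring S" "\<phi> : ring_hom R S" "a : car R"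
 shows "\<phi> (add_pow R (p :: nat) a) = add_pow S p (\<phi> a)"
proof -
 interpret ring_hom_ring R S \<phi> by (rule ring_hom_ringI2) fact+
 show ?thesis
  by (induction p) (use assms(4) in \<open>simp_all add: R.add.nat_pow_Suc S.add.nat_pow_Suc\<close>)
qed

lemma ring_hom_minus:
 assumes "ring R" "ring S" "\<phi> : ring_hom R S" "a : car R" "b : car R"
 shows "\<phi> (a -[R] b) = \<phi> a -[S] \<phi> b"
proof -
 interpret ring_hom_ring R S \<phi> by (rule ring_hom_ringI2) fact+
 show ?thesis using assms by (simp add: R.minus_eq S.minus_eq)
qed

lemma ring_hom_pq_ideal:
 assumes "cring R" "cring S" "\<phi> : ring_hom R S" "c : car R" "\<phi> c = d"
 shows "\<phi> ` pq_ideal p R c <= pq_ideal p S d"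
proof -
 interpret ring_hom_cring R S \<phi> by (rule ring_hom_cringI) fact+
 have "\<phi> z : pq_ideal p S d" if "z : pq_ideal p R c" for z
 proof (rule ring_hom_genideal[OF R.ring_axioms S.ring_axioms assms(3)])
  show "z : genideal R {add_pow R p \<one>[R], c -[R] \<one>[R]}"
   using that by (simp add: pq_ideal_def)
  show "\<phi> ` {add_pow R p \<one>[R], c -[R] \<one>[R]} <= pq_ideal p S d"
   using assms S.pq_ideal_p[of d p] S.pq_ideal_q[of d p]
    ring_hom_nat_mult[OF R.ring_axioms S.ring_axioms assms(3)]
    ring_hom_minus[OF R.ring_axioms S.ring_axioms assms(3)] by auto
  show "ideal (pq_ideal p S d) S"
   using assms(4,5) by (intro S.pq_ideal_ideal) auto
 qed (use assms in auto)
 then show ?thesis by blast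
qed

section \<open>Homomorphisms modulo an ideal and formally \'etale maps\<close>

text \<open>A homomorphism to C/K is kept as a map to C, so that approximations modulo varying
  ideals share one type and can be compared and passed to a limit.\<close>

definition hom_mod ::
 "('a, 'b) ring_scheme => ('c, 'd) ring_scheme => 'c set => ('a => 'c) => bool" where
 "hom_mod A C K w \<longleftrightarrow> w : car A \<rightarrow> car C \<and>
  (\<forall>a\<in>car A. \<forall>b\<in>car A. w (a +[A] b) -[C] (w a +[C] w b) : K) \<and>
  (\<forall>a\<in>car A. \<forall>b\<in>car A. w (a *[A] b) -[C] (w a *[C] w b) : K) \<and>
  w \<one>[A] -[C] \<one>[C] : K"

lemma hom_mod_closed: "hom_mod A C K w ==> a : car A ==> w a : car C"
 by (auto simp: hom_mod_def)

lemma ring_hom_imp_hom_mod: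
 assumes "ring A" "ring C" "w : ring_hom A C" "ideal K C"
 shows "hom_mod A C K w"
proof -
 interpret ring_hom_ring A C w by (rule ring_hom_ringI2) fact+
 have m: "a -[C] a : K" if "a : car C" for a
  using that S.ideal_zero_closed[OF assms(4)] by (simp add: S.minus_eq S.r_neg)
 show ?thesis
  unfolding hom_mod_def using assms(3) m by (auto simp: ring_hom_memI ring_hom_def)
qed

text \<open>Stated for any \<rho> whose fibres are the cosets of K: it is applied both to quotient
  maps and to a copy of a quotient on another type.\<close>

lemma hom_mod_iff_comp:
 assumes "ring A" "ring C" "ring D" "\<rho> : ring_hom C D" "w : car A \<rightarrow> car C"
  "!!a b. a : car C ==> b : car C ==> \<rho> a = \<rho> b \<longleftrightarrow> a -[C] b : K"
 shows "hom_mod A C K w \<longleftrightarrow> \<rho> \<circ> w : ring_hom A D"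
proof -
 interpret A: ring A by fact
 interpret ring_hom_ring C D \<rho> by (rule ring_hom_ringI2) fact+
 have w: "w a : car C" if "a : car A" for a using that assms(5) by auto
 show ?thesis
  unfolding hom_mod_def ring_hom_def
  using assms(5) w by (simp add: assms(6)[symmetric] Pi_iff) blast
qed

text \<open>In a formally \'etale situation, homomorphisms lift uniquely along \<open>C/K' \<rightarrow> C/K\<close> if
 \<open>K \<cdot> K \<subseteq> K'\<close>. The map \<open>e\<close> transports \<open>C/K'\<close> to the type of the test algebras.\<close>

lemma formally_etale_lift:
 fixes S :: "('s, 'x) ring_scheme" and A :: "('a, 'y) ring_scheme" and C :: "('c, 'z) ring_scheme"
  and e :: "'c => ('s + 'a) list"
 assumes et: "formally_etale S \<aa> A \<phi>"
  and S: "ring S" and A: "ring A" and C: "cring C" and \<phi>: "\<phi> : ring_hom S A" and \<aa>: "\<aa> <= car S"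
  and K: "ideal K C" and K': "ideal K' C" and sub: "K' <= K"
  and sq: "!!a b. a : K ==> b : K ==> a *[C] b : K'"
  and e: "!!a b. a : car C ==> b : car C ==> e a = e b ==> a -[C] b : K'"
  and \<psi>: "\<psi> : ring_hom S C"
  and nil: "\<psi> ` \<aa> <= \<bb>" "ideal \<bb> C" "ideal_power C \<bb> n <= K'"
  and w: "hom_mod A C K w" and w\<phi>: "!!s. s : car S ==> w (\<phi> s) -[C] \<psi> s : K"
 shows formally_etale_lift_ex: "\<exists>w'. hom_mod A C K' w' \<and>
   (\<forall>s\<in>car S. w' (\<phi> s) -[C] \<psi> s : K') \<and> (\<forall>a\<in>car A. w' a -[C] w a : K)" (is ?ex)
  and formally_etale_lift_unique: "!!w1 w2 a. [|hom_mod A C K' w1; hom_mod A C K' w2;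
   !!s. s : car S ==> w1 (\<phi> s) -[C] \<psi> s : K'; !!s. s : car S ==> w2 (\<phi> s) -[C] \<psi> s : K';
   !!a. a : car A ==> w1 a -[C] w a : K; !!a. a : car A ==> w2 a -[C] w a : K;
   a : car A|] ==> w1 a -[C] w2 a : K'"
proof -
 interpret S: ring S by fact
 interpret A: ring A by fact
 interpret C: cring C by fact
 define r where "r a = (SOME b. b : car C \<and> a -[C] b : K')" for a
 \<comment> \<open>Choosing a representative of the coset before encoding makes \<rho> constant on
   cosets of K', and the hypothesis on \<open>e\<close> separates them. The ring transported along
   \<rho> is a copy of C/K' on the type of the test algebras.\<close>
 define \<rho> where "\<rho> a = e (SOME b. b : K' +>[C] a)" for a
 have rep: "(SOME b. b : K' +>[C] a) : K' +>[C] a" if "a : car C" for a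
  using that C.in_rcos_iff[OF K', of a a] C.ideal_zero_closed[OF K']
  by (intro someI[of "\<lambda>b. b : K' +>[C] a" a]) (simp add: C.minus_eq C.r_neg)
 have \<rho>: "\<rho> a = \<rho> b \<longleftrightarrow> a -[C] b : K'" if "a : car C" "b : car C" for a b
 proof
  assume "a -[C] b : K'"
  then show "\<rho> a = \<rho> b" using C.rcos_eq_iff[OF K' that] by (simp add: \<rho>_def)
 next
  assume eq: "\<rho> a = \<rho> b"
  let ?a = "SOME c. c : K' +>[C] a" and ?b = "SOME c. c : K' +>[C] b"
  have ab: "?a : car C" "?a -[C] a : K'" "?b : car C" "?b -[C] b : K'"
   using rep that C.in_rcos_iff[OF K'] by auto
  moreover have "?a -[C] ?b : K'" using eq ab e unfolding \<rho>_def by blast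
  ultimately show "a -[C] b : K'"
   using C.rcos_eq_iff[OF K'] that by metis
 qed
 have weak: "weak_ring_morphism \<rho> K' C" by (rule weak_ring_morphismI[OF K' \<rho>])
 define D where "D = image_ring \<rho> C"
 have D: "ring D" unfolding D_def by (rule C.image_ring_is_ring[OF weak])
 interpret D: ring D by (rule D)
 have hom: "\<rho> : ring_hom C D"
  unfolding D_def using C.weak_ring_morphism_is_hom[OF weak] by blast
 have Dc: "car D = \<rho> ` car C" by (simp add: D_def image_ring_carrier)
 have Dcring: "cring D"
 proof
  fix x y assume "x : car D" "y : car D"
  then obtain a b where ab: "a : car C" "b : car C" "x = \<rho> a" "y = \<rho> b" using Dc by auto
  then show "x *[D] y = y *[D] x"
   using ring_hom_mult[OF hom ab(1,2)] ring_hom_mult[OF hom ab(2,1)] C.m_comm by simp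
 qed
 interpret D: cring D by (rule Dcring)
 interpret \<rho>: ring_hom_ring C D \<rho> by (rule ring_hom_ringI2) (fact C.ring_axioms D hom)+
 define J where "J = \<rho> ` K"
 have zero: "\<rho> a = \<zero>[D] \<longleftrightarrow> a : K'" if "a : car C" for a
  using \<rho>[OF that C.zero_closed] that by (simp add: C.minus_eq)
 have J: "ideal J D"
  unfolding J_def by (rule \<rho>.surj_image_ideal[OF K]) (simp add: Dc)
 have Jmem: "\<rho> a : J \<longleftrightarrow> a : K" if "a : car C" for a
 proof
  assume "\<rho> a : J"
  then obtain b where b: "b : K" "\<rho> a = \<rho> b" by (auto simp: J_def)
  then have "a -[C] b : K" using \<rho>[OF that] sub ideal.Icarr[OF K] by auto
  then show "a : K"
   using b(1) C.ideal_add_closed[OF K, of "a -[C] b" b] that ideal.Icarr[OF K b(1)]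
   by (simp add: C.minus_eq C.a_assoc C.l_neg)
 qed (simp add: J_def)
 have Jsq: "ideal_prod D J J = {\<zero>[D]}"
 proof
  show "ideal_prod D J J <= {\<zero>[D]}"
  proof (rule D.ideal_prod_subset[OF D.zeroideal])
   fix x y assume "x : J" "y : J"
   then obtain a b where ab: "a : K" "b : K" "x = \<rho> a" "y = \<rho> b" by (auto simp: J_def)
   then have c: "a : car C" "b : car C" using ideal.Icarr[OF K] by auto
   have "\<rho> (a *[C] b) = \<zero>[D]" using sq[OF ab(1,2)] zero[OF C.m_closed[OF c]] by blast
   then show "x *[D] y : {\<zero>[D]}" using ab c by simp
  qed
  show "{\<zero>[D]} <= ideal_prod D J J"
   using D.ideal_zero_closed[OF D.ideal_prod_is_ideal[OF J J]] by simp
 qed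
 define \<psi>' where "\<psi>' = \<rho> \<circ> \<psi>"
 have \<psi>c: "\<psi> s : car C" if "s : car S" for s using \<psi> that ring_hom_closed by metis
 have \<phi>c: "\<phi> s : car A" if "s : car S" for s using \<phi> that ring_hom_closed by metis
 have \<psi>': "\<psi>' : ring_hom S D" unfolding \<psi>'_def by (rule ring_hom_trans[OF \<psi> hom])
 have gen: "ideal (genideal D (\<psi>' ` \<aa>)) D"
 proof (rule D.genideal_ideal, rule image_subsetI)
  fix t assume "t : \<aa>"
  then show "\<psi>' t : car D" using ring_hom_closed[OF \<psi>'] \<aa> by blast
 qed
 \<comment> \<open>Surjectivity of \<rho> bounds powers of the image of \<bb> by images of its
   powers, and the image of \<bb>^n is zero because \<bb>^n lies in K'.\<close>
 have nilD: "ideal_power D (genideal D (\<psi>' ` \<aa>)) n = {\<zero>[D]}"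
 proof
  have b: "ideal (\<rho> ` \<bb>) D" by (rule \<rho>.surj_image_ideal[OF nil(2)]) (simp add: Dc)
  have "genideal D (\<psi>' ` \<aa>) <= \<rho> ` \<bb>"
   by (rule D.genideal_minimal[OF b]) (use nil(1) in \<open>auto simp: \<psi>'_def\<close>)
  then have 1: "ideal_power D (genideal D (\<psi>' ` \<aa>)) n <= ideal_power D (\<rho> ` \<bb>) n"
   by (rule D.ideal_pow_mono[OF gen b])
  have "ideal_power D (\<rho> ` \<bb>) k <= \<rho> ` ideal_power C \<bb> k" for k
  proof (rule D.ideal_pow_least)
   show "ideal (\<rho> ` ideal_power C \<bb> k) D" for k
    by (rule \<rho>.surj_image_ideal[OF C.ideal_pow_ideal[OF nil(2)]]) (simp add: Dc)
   show "\<rho> ` ideal_power C \<bb> 0 = car D" by (simp add: Dc)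
   fix k x y assume "x : \<rho> ` ideal_power C \<bb> k" "y : \<rho> ` \<bb>"
   then obtain a b where ab: "a : ideal_power C \<bb> k" "b : \<bb>" "x = \<rho> a" "y = \<rho> b" by auto
   then have "x *[D] y = \<rho> (a *[C] b)"
    using ideal.Icarr[OF nil(2)] C.ideal_pow_carr[OF nil(2)] by simp
   then show "x *[D] y : \<rho> ` ideal_power C \<bb> (Suc k)"
    using ideal_prod.prod[OF ab(1,2), of C] by auto
  qed
  then have "ideal_power D (genideal D (\<psi>' ` \<aa>)) n <= \<rho> ` ideal_power C \<bb> n" using 1 by blast
  also have "... <= {\<zero>[D]}"
   using nil(3) zero ideal.Icarr[OF K'] by auto
  finally show "ideal_power D (genideal D (\<psi>' ` \<aa>)) n <= {\<zero>[D]}" .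
  show "{\<zero>[D]} <= ideal_power D (genideal D (\<psi>' ` \<aa>)) n"
   using D.ideal_zero_closed[OF D.ideal_pow_ideal[OF gen]] by simp
 qed
 define u where "u a = J +>[D] \<rho> (w a)" for a
 have wc: "w a : car C" if "a : car A" for a using hom_mod_closed[OF w that] .
 have Jcos: "J +>[D] \<rho> a = J +>[D] \<rho> b \<longleftrightarrow> a -[C] b : K" if "a : car C" "b : car C" for a b
 proof -
  have "J +>[D] \<rho> a = J +>[D] \<rho> b \<longleftrightarrow> \<rho> (a -[C] b) : J"
   using that D.rcos_eq_iff[OF J] by (simp add: C.minus_eq D.minus_eq)
  then show ?thesis using Jmem that by simp
 qed
 have u: "u : ring_hom A (D Quot J)"
 proof -
  have "((+>\<^bsub>D\<^esub>) J \<circ> \<rho>) : ring_hom C (D Quot J)"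
   by (rule ring_hom_trans[OF hom ideal.rcos_ring_hom[OF J]])
  from hom_mod_iff_comp[OF A C.ring_axioms ideal.quotient_is_ring[OF J] this, of w K]
  have "((+>\<^bsub>D\<^esub>) J \<circ> \<rho>) \<circ> w : ring_hom A (D Quot J)"
   using w wc Jcos by auto
  moreover have "((+>\<^bsub>D\<^esub>) J \<circ> \<rho>) \<circ> w = u" by (auto simp: u_def)
  ultimately show ?thesis by simp
 qed
 have u\<phi>: "\<forall>s\<in>car S. u (\<phi> s) = J +>[D] \<psi>' s"
  using Jcos wc \<phi>c \<psi>c w\<phi> by (auto simp: u_def \<psi>'_def)
 have ex1: "\<exists>!v. v : extensional (car A) \<and> v : ring_hom A D \<and>
     (\<forall>s\<in>car S. v (\<phi> s) = \<psi>' s) \<and> (\<forall>a\<in>car A. J +>[D] v a = u a)"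
  by (rule et[unfolded formally_etale_def, rule_format, of D J \<psi>' n u])
   (intro conjI; fact Dcring J Jsq \<psi>' nilD u u\<phi>)
 \<comment> \<open>The lifting property speaks of extensional maps, so compositions with \<rho> are
   restricted to the carrier before uniqueness is invoked.\<close>
 have lift: "restrict (\<rho> \<circ> w') (car A) : extensional (car A) \<and> restrict (\<rho> \<circ> w') (car A) : ring_hom A D \<and>
     (\<forall>s\<in>car S. restrict (\<rho> \<circ> w') (car A) (\<phi> s) = \<psi>' s) \<and>
     (\<forall>a\<in>car A. J +>[D] restrict (\<rho> \<circ> w') (car A) a = u a)"
  if h: "hom_mod A C K' w'" and s: "!!s. s : car S ==> w' (\<phi> s) -[C] \<psi> s : K'"
   and a: "!!a. a : car A ==> w' a -[C] w a : K" for w'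
 proof (intro conjI ballI)
  have w'c: "w' a : car C" if "a : car A" for a using hom_mod_closed[OF h that] .
  have "\<rho> \<circ> w' : ring_hom A D"
   using hom_mod_iff_comp[OF A C.ring_axioms D hom _ \<rho>, of w'] h w'c by auto
  then show "restrict (\<rho> \<circ> w') (car A) : ring_hom A D"
   by (auto simp: ring_hom_def A.a_closed)
  show "restrict (\<rho> \<circ> w') (car A) (\<phi> t) = \<psi>' t" if "t : car S" for t
   using s[OF that] \<rho> w'c \<phi>c \<psi>c that by (simp add: \<psi>'_def)
  show "J +>[D] restrict (\<rho> \<circ> w') (car A) b = u b" if "b : car A" for b
   using a[OF that] Jcos w'c wc that by (simp add: u_def)
 qed auto
 show ?ex
 proof -
  from ex1 obtain v where v: "v : ring_hom A D" "\<forall>s\<in>car S. v (\<phi> s) = \<psi>' s"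
   "\<forall>a\<in>car A. J +>[D] v a = u a" by blast
  define w' where "w' a = (SOME c. c : car C \<and> \<rho> c = v a)" for a
  have w': "w' a : car C \<and> \<rho> (w' a) = v a" if "a : car A" for a
  proof -
   have "v a : car D" using v(1) that ring_hom_closed by metis
   then have "\<exists>c. c : car C \<and> \<rho> c = v a" using Dc by auto
   then show ?thesis unfolding w'_def by (rule someI_ex)
  qed
  have "\<rho> \<circ> w' : ring_hom A D"
   using v(1) w' by (auto simp: ring_hom_def A.a_closed)
  then have "hom_mod A C K' w'"
   using hom_mod_iff_comp[OF A C.ring_axioms D hom _ \<rho>, of w'] w' by auto
  moreover have "\<forall>s\<in>car S. w' (\<phi> s) -[C] \<psi> s : K'"
  proof
   fix t assume t: "t : car S"
   then have "\<rho> (w' (\<phi> t)) = \<rho> (\<psi> t)" using v(2) w'[OF \<phi>c[OF t]] by (simp add: \<psi>'_def)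
   then show "w' (\<phi> t) -[C] \<psi> t : K'" using \<rho> w'[OF \<phi>c[OF t]] \<psi>c[OF t] by blast
  qed
  moreover have "\<forall>a\<in>car A. w' a -[C] w a : K"
  proof
   fix b assume b: "b : car A"
   then have "J +>[D] \<rho> (w' b) = J +>[D] \<rho> (w b)" using v(3) w'[OF b] by (simp add: u_def)
   then show "w' b -[C] w b : K" using Jcos w'[OF b] wc[OF b] by blast
  qed
  ultimately show ?thesis by blast
 qed
 fix w1 w2 a
 assume h: "hom_mod A C K' w1" "hom_mod A C K' w2"
  and s: "!!s. s : car S ==> w1 (\<phi> s) -[C] \<psi> s : K'" "!!s. s : car S ==> w2 (\<phi> s) -[C] \<psi> s : K'"
  and ww: "!!a. a : car A ==> w1 a -[C] w a : K" "!!a. a : car A ==> w2 a -[C] w a : K"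
  and a: "a : car A"
 have "restrict (\<rho> \<circ> w1) (car A) = restrict (\<rho> \<circ> w2) (car A)"
  using ex1 lift[OF h(1) s(1) ww(1)] lift[OF h(2) s(2) ww(2)] by blast
 then have "\<rho> (w1 a) = \<rho> (w2 a)" using a by (metis comp_apply restrict_apply')
 then show "w1 a -[C] w2 a : K'" using \<rho> hom_mod_closed[OF h(1) a] hom_mod_closed[OF h(2) a] by blast
qed

section \<open>Finite sums\<close>

context abelian_monoid
begin

lemma finsum_swap:
 assumes "finite I" "finite J" "!!i j. i : I ==> j : J ==> f i j : car G"
 shows "(\<Oplus>i\<in>I. \<Oplus>j\<in>J. f i j) = (\<Oplus>j\<in>J. \<Oplus>i\<in>I. f i j)"
 using assms(1,3)
proof (induction I rule: finite_induct)
 case (insert a I)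
 have "(\<Oplus>i\<in>insert a I. \<Oplus>j\<in>J. f i j) = (\<Oplus>j\<in>J. f a j) \<oplus> (\<Oplus>i\<in>I. \<Oplus>j\<in>J. f i j)"
  using insert by (subst finsum_insert) (auto intro!: finsum_closed)
 also have "... = (\<Oplus>j\<in>J. f a j) \<oplus> (\<Oplus>j\<in>J. \<Oplus>i\<in>I. f i j)"
  using insert by simp
 also have "... = (\<Oplus>j\<in>J. f a j \<oplus> (\<Oplus>i\<in>I. f i j))"
  using insert by (subst finsum_addf) (auto intro!: finsum_closed)
 also have "... = (\<Oplus>j\<in>J. \<Oplus>i\<in>insert a I. f i j)"
  using insert by (intro finsum_cong') (auto intro!: finsum_closed)
 finally show ?case .
qed simp

lemma finsum_cong2':
 assumes "!!i. i : I ==> f i = g i" "!!i. i : I ==> g i : car G"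
 shows "finsum G f I = finsum G g I"
 using assms by (intro finsum_cong') auto

lemma finsum_neutral:
 assumes "finite J" "I <= J" "!!i. i : J - I ==> f i = \<zero>" "!!i. i : I ==> f i : car G"
 shows "finsum G f I = finsum G f J"
proof (rule add.finprod_mono_neutral_cong_left)
 show "f : J \<rightarrow> car G"
 proof
  fix i assume "i : J"
  then show "f i : car G" using assms(3,4) by (cases "i : I") auto
 qed
qed (use assms in auto)

lemma finsum_single:
 assumes "finite I" "i : I" "!!j. j : I ==> j ~= i ==> f j = \<zero>" "f i : car G"
 shows "finsum G f I = f i"
proof -
 have "finsum G f {i} = finsum G f I"
  by (rule finsum_neutral) (use assms in auto)
 then show ?thesis using assms(4) by simp
qed

lemma finsum_zero:
 assumes "!!i. i : I ==> f i = \<zero>"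
 shows "finsum G f I = \<zero>"
 using assms by (intro add.finprod_one_eqI)

end

lemma (in ring) finsum_minus:
 assumes "finite I" "!!i. i : I ==> f i : car R" "!!i. i : I ==> g i : car R"
 shows "finsum R f I \<ominus> finsum R g I = (\<Oplus>i\<in>I. f i \<ominus> g i)"
 using assms
proof (induction I rule: finite_induct)
 case (insert a I)
 have *: "finsum R f I : car R" "finsum R g I : car R" "(\<Oplus>i\<in>I. f i \<ominus> g i) : car R"
  "f a : car R" "g a : car R"
  using insert by (auto intro!: finsum_closed)
 have "finsum R f (insert a I) \<ominus> finsum R g (insert a I)
   = (f a \<oplus> finsum R f I) \<ominus> (g a \<oplus> finsum R g I)"
  using insert by (subst (1 2) finsum_insert) auto
 also have "... = (f a \<ominus> g a) \<oplus> (finsum R f I \<ominus> finsum R g I)"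
  using * by algebra
 also have "... = (\<Oplus>i\<in>insert a I. f i \<ominus> g i)"
  using insert by (subst finsum_insert) auto
 finally show ?case .
qed (simp add: minus_eq)

section \<open>Twisted power series\<close>

text \<open>\<open>h\<close> stands for the structure map Z[q] -> A and \<open>x\<close> for the
  coordinate. The structure constants are built from these two data.\<close>

locale zq_point = cring A for A (structure) +
 fixes h :: "int poly => 'a" and x :: 'a and p :: nat
 assumes h_closed [simp]: "h f : car A"
  and h_add: "h (f + g) = h f \<oplus> h g"
  and h_mult: "h (f * g) = h f \<otimes> h g"
  and h_one [simp]: "h 1 = \<one>"
  and x_closed [simp]: "x : car A"
begin

lemma h_zero [simp]: "h 0 = \<zero>"
proof -
 have "h 0 \<oplus> h 0 = h 0 \<oplus> \<zero>" using h_add[of 0 0] by simp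
 then show ?thesis by (metis h_closed zero_closed add.l_cancel)
qed

lemma h_minus: "h (f - g) = h f \<ominus> h g"
proof -
 have "h f = h (f - g) \<oplus> h g" by (simp flip: h_add)
 then show ?thesis by (simp add: minus_eq a_assoc r_neg)
qed

lemma h_power: "h (f ^ n) = h f [^] n"
 by (induction n) (simp_all add: h_mult m_comm)

lemma h_sum: "h (sum f I) = (\<Oplus>i\<in>I. h (f i))"
 by (induction I rule: infinite_finite_induct) (simp_all add: h_add)

lemma h_of_nat: "h (of_nat n) = add_pow A n \<one>"
 by (induction n) (simp_all add: h_add add.nat_pow_Suc a_comm)

end

definition tw_el ::
 "('a, 'b) ring_scheme => (int poly => 'a) => 'a => (nat => nat => nat => int poly) => nat => nat => nat => 'a" where
 "tw_el A h x c n m l = h (str_at c n m l) *[A] x [^]\<^bsub>A\<^esub> (n + m - l)"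

text \<open>All sequences are allowed, finite or not: the product coefficient at l involves only
  indices n, m \<le> l, since the structure constants vanish otherwise. With
  \<open>newton_str\<close> this is a model of A[[\<xi>]]_q, with \<open>qdp_str\<close> a ring of
  infinite divided series.\<close>

definition tw_ring ::
 "('a, 'b) ring_scheme => (int poly => 'a) => 'a => (nat => nat => nat => int poly) => (nat => 'a) ring" where
 "tw_ring A h x c = \<lparr>carrier = UNIV \<rightarrow> car A,
  monoid.mult = (\<lambda>F G l. \<Oplus>[A]n\<in>{..l}. \<Oplus>[A]m\<in>{..l}. F n *[A] G m *[A] tw_el A h x c n m l),
  one = (\<lambda>k. if k = 0 then \<one>[A] else \<zero>[A]), ring.zero = (\<lambda>k. \<zero>[A]),
  add = (\<lambda>F G k. F k +[A] G k)\<rparr>"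

text \<open>The common properties of both families of structure constants. Divisibility by (q-1)^i
  is what makes the weight filtration \<open>W\<close> multiplicative.\<close>

locale twisted = zq_point A h x p for A (structure) and h x p +
 fixes c :: "nat => nat => nat => int poly"
 assumes c_comm: "c n m i = c m n i"
  and c_0: "c 0 m 0 = 1"
  and c_eq_0: "i > n \<or> i > m ==> c n m i = 0"
  and c_dvd: "(qv - 1) ^ i dvd c n m i"
  and c_assoc: "(\<Sum>k\<le>l. str_at c a b k * str_at c k d l) = (\<Sum>k\<le>l. str_at c b d k * str_at c a k l)"
begin

abbreviation "T \<equiv> tw_ring A h x c"
abbreviation "s \<equiv> tw_el A h x c"

lemma T_simps:
 "car T = UNIV \<rightarrow> car A" "\<one>[T] = (\<lambda>k. if k = 0 then \<one> else \<zero>)" "\<zero>[T] = (\<lambda>k. \<zero>)"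
 "F +[T] G = (\<lambda>k. F k \<oplus> G k)"
 "F *[T] G = (\<lambda>l. \<Oplus>n\<in>{..l}. \<Oplus>m\<in>{..l}. F n \<otimes> G m \<otimes> s n m l)"
 by (simp_all add: tw_ring_def)

lemma T_carrier_iff: "F : car T \<longleftrightarrow> (\<forall>k. F k : car A)"
 by (auto simp: T_simps)

lemma T_closed [simp]: "F : car T ==> F k : car A"
 by (auto simp: T_simps)

lemma s_closed [simp]: "s n m l : car A"
 by (simp add: tw_el_def)

lemma str_at_c_eq_0: "l < n \<or> l < m \<or> n + m < l ==> str_at c n m l = 0"
 unfolding str_at_def by (simp, intro impI c_eq_0, arith)

lemma s_eq_0: "l < n \<or> l < m \<or> n + m < l ==> s n m l = \<zero>"
 by (simp add: tw_el_def str_at_c_eq_0)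

lemma str_at_c_comm: "str_at c n m l = str_at c m n l"
 using c_comm[of n m "n + m - l"] by (simp add: str_at_def add.commute)

lemma s_comm: "s n m l = s m n l"
 by (simp add: tw_el_def str_at_c_comm[of n m] add.commute)

lemma s_0: "s 0 m l = (if m = l then \<one> else \<zero>)"
proof (cases "m = l")
 case False
 then show ?thesis by (auto intro!: s_eq_0)
qed (simp add: tw_el_def str_at_def c_0)

lemma mult_closed: "F : car T ==> G : car T ==> F *[T] G : car T"
 by (auto simp: T_simps intro!: finsum_closed)

text \<open>A common bound for all indices lets sums be exchanged without tracking ranges.\<close>

lemma mult_ext:
 assumes "F : car T" "G : car T" "l <= L"
 shows "(F *[T] G) l = (\<Oplus>n\<in>{..L}. \<Oplus>m\<in>{..L}. F n \<otimes> G m \<otimes> s n m l)"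
proof -
 have "(F *[T] G) l = (\<Oplus>n\<in>{..l}. \<Oplus>m\<in>{..L}. F n \<otimes> G m \<otimes> s n m l)"
  unfolding T_simps
 proof (rule finsum_cong2')
  fix n assume "n : {..l}"
  show "(\<Oplus>m\<in>{..l}. F n \<otimes> G m \<otimes> s n m l) = (\<Oplus>m\<in>{..L}. F n \<otimes> G m \<otimes> s n m l)"
   by (rule finsum_neutral) (use assms s_eq_0 in auto)
 qed (use assms in \<open>auto intro!: finsum_closed\<close>)
 also have "... = (\<Oplus>n\<in>{..L}. \<Oplus>m\<in>{..L}. F n \<otimes> G m \<otimes> s n m l)"
  by (rule finsum_neutral) (use assms s_eq_0 in \<open>auto intro!: finsum_closed finsum_zero\<close>)
 finally show ?thesis .
qed

lemma mult_comm:
 assumes "F : car T" "G : car T"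
 shows "F *[T] G = G *[T] F"
proof
 fix l
 have "(F *[T] G) l = (\<Oplus>m\<in>{..l}. \<Oplus>n\<in>{..l}. F n \<otimes> G m \<otimes> s n m l)"
  unfolding T_simps by (rule finsum_swap) (use assms in auto)
 also have "... = (\<Oplus>m\<in>{..l}. \<Oplus>n\<in>{..l}. G m \<otimes> F n \<otimes> s m n l)"
  by (intro finsum_cong2' finsum_closed) (use assms s_comm m_comm in auto)
 finally show "(F *[T] G) l = (G *[T] F) l" by (simp add: T_simps)
qed

text \<open>The exponents of x add up to a number independent of k, so associativity of the ring
  reduces to the polynomial identity \<open>c_assoc\<close>.\<close>

lemma s_s:
 "s a b k \<otimes> s k d l = h (str_at c a b k * str_at c k d l) \<otimes> x [^] (a + b + d - l)"
proof (cases "k <= a + b \<and> l <= k + d")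
 case True
 have "s a b k \<otimes> s k d l = h (str_at c a b k) \<otimes> h (str_at c k d l)
   \<otimes> (x [^] (a + b - k) \<otimes> x [^] (k + d - l))"
  by (simp add: tw_el_def m_ac)
 also have "x [^] (a + b - k) \<otimes> x [^] (k + d - l) = x [^] (a + b + d - l)"
  using True by (subst nat_pow_mult) (auto intro: arg_cong[of _ _ "\<lambda>n. x [^] n"])
 finally show ?thesis by (simp add: h_mult)
next
 case False
 then have "str_at c a b k = 0 \<or> str_at c k d l = 0" by (auto simp: str_at_def)
 then show ?thesis by (auto simp: tw_el_def)
qed

lemma mult_mult:
 assumes "F : car T" "G : car T" "H : car T"
 shows "((F *[T] G) *[T] H) l = (\<Oplus>d\<in>{..l}. \<Oplus>a\<in>{..l}. \<Oplus>b\<in>{..l}. F a \<otimes> G b \<otimes> H d \<otimes>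
  (h (\<Sum>k\<le>l. str_at c a b k * str_at c k d l) \<otimes> x [^] (a + b + d - l)))"
proof -
 have "((F *[T] G) *[T] H) l
   = (\<Oplus>k\<in>{..l}. \<Oplus>d\<in>{..l}. (F *[T] G) k \<otimes> H d \<otimes> s k d l)"
  by (simp add: T_simps(5)[of _ H])
 also have "... = (\<Oplus>k\<in>{..l}. \<Oplus>d\<in>{..l}. \<Oplus>a\<in>{..l}. \<Oplus>b\<in>{..l}. F a \<otimes> G b \<otimes> H d \<otimes> (s a b k \<otimes> s k d l))"
 proof (intro finsum_cong2' finsum_closed)
  fix k d assume k: "k : {..l}" and d: "d : {..l}"
  have "(F *[T] G) k \<otimes> H d \<otimes> s k d l = (F *[T] G) k \<otimes> (H d \<otimes> s k d l)"
   using mult_closed assms by (simp add: m_assoc)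
  also have "... = (\<Oplus>a\<in>{..l}. \<Oplus>b\<in>{..l}. F a \<otimes> G b \<otimes> s a b k) \<otimes> (H d \<otimes> s k d l)"
   using mult_ext[OF assms(1,2)] k by simp
  also have "... = (\<Oplus>a\<in>{..l}. (\<Oplus>b\<in>{..l}. F a \<otimes> G b \<otimes> s a b k) \<otimes> (H d \<otimes> s k d l))"
   using assms by (intro finsum_ldistr) (auto intro!: finsum_closed)
  also have "... = (\<Oplus>a\<in>{..l}. \<Oplus>b\<in>{..l}. F a \<otimes> G b \<otimes> H d \<otimes> (s a b k \<otimes> s k d l))"
  proof (rule finsum_cong2')
   fix a
   have "(\<Oplus>b\<in>{..l}. F a \<otimes> G b \<otimes> s a b k) \<otimes> (H d \<otimes> s k d l)
    = (\<Oplus>b\<in>{..l}. F a \<otimes> G b \<otimes> s a b k \<otimes> (H d \<otimes> s k d l))"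
    using assms by (intro finsum_ldistr) auto
   also have "... = (\<Oplus>b\<in>{..l}. F a \<otimes> G b \<otimes> H d \<otimes> (s a b k \<otimes> s k d l))"
    using assms by (intro finsum_cong2') (auto simp: m_ac)
   finally show "(\<Oplus>b\<in>{..l}. F a \<otimes> G b \<otimes> s a b k) \<otimes> (H d \<otimes> s k d l)
    = (\<Oplus>b\<in>{..l}. F a \<otimes> G b \<otimes> H d \<otimes> (s a b k \<otimes> s k d l))" .
  qed (use assms in \<open>auto intro!: finsum_closed\<close>)
  finally show "(F *[T] G) k \<otimes> H d \<otimes> s k d l
   = (\<Oplus>a\<in>{..l}. \<Oplus>b\<in>{..l}. F a \<otimes> G b \<otimes> H d \<otimes> (s a b k \<otimes> s k d l))" .
 qed (use assms in \<open>auto intro!: finsum_closed\<close>)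
 also have "... = (\<Oplus>d\<in>{..l}. \<Oplus>k\<in>{..l}. \<Oplus>a\<in>{..l}. \<Oplus>b\<in>{..l}. F a \<otimes> G b \<otimes> H d \<otimes> (s a b k \<otimes> s k d l))"
  by (rule finsum_swap) (use assms in \<open>auto intro!: finsum_closed\<close>)
 also have "... = (\<Oplus>d\<in>{..l}. \<Oplus>a\<in>{..l}. \<Oplus>k\<in>{..l}. \<Oplus>b\<in>{..l}. F a \<otimes> G b \<otimes> H d \<otimes> (s a b k \<otimes> s k d l))"
  by (rule finsum_cong2', rule finsum_swap) (use assms in \<open>auto intro!: finsum_closed\<close>)
 also have "... = (\<Oplus>d\<in>{..l}. \<Oplus>a\<in>{..l}. \<Oplus>b\<in>{..l}. \<Oplus>k\<in>{..l}. F a \<otimes> G b \<otimes> H d \<otimes> (s a b k \<otimes> s k d l))"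
  by (rule finsum_cong2', rule finsum_cong2', rule finsum_swap) (use assms in \<open>auto intro!: finsum_closed\<close>)
 also have "... = (\<Oplus>d\<in>{..l}. \<Oplus>a\<in>{..l}. \<Oplus>b\<in>{..l}. F a \<otimes> G b \<otimes> H d \<otimes>
  (h (\<Sum>k\<le>l. str_at c a b k * str_at c k d l) \<otimes> x [^] (a + b + d - l)))"
 proof (intro finsum_cong2' finsum_closed)
  fix d a b
  have "(\<Oplus>k\<in>{..l}. F a \<otimes> G b \<otimes> H d \<otimes> (s a b k \<otimes> s k d l))
   = F a \<otimes> G b \<otimes> H d \<otimes> (\<Oplus>k\<in>{..l}. s a b k \<otimes> s k d l)"
   using assms by (intro finsum_rdistr[symmetric]) auto
  also have "(\<Oplus>k\<in>{..l}. s a b k \<otimes> s k d l)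
   = (\<Oplus>k\<in>{..l}. h (str_at c a b k * str_at c k d l) \<otimes> x [^] (a + b + d - l))"
   by (intro finsum_cong2') (auto simp: s_s)
  also have "... = (\<Oplus>k\<in>{..l}. h (str_at c a b k * str_at c k d l)) \<otimes> x [^] (a + b + d - l)"
   by (intro finsum_ldistr[symmetric]) auto
  finally show "(\<Oplus>k\<in>{..l}. F a \<otimes> G b \<otimes> H d \<otimes> (s a b k \<otimes> s k d l))
   = F a \<otimes> G b \<otimes> H d \<otimes> (h (\<Sum>k\<le>l. str_at c a b k * str_at c k d l) \<otimes> x [^] (a + b + d - l))"
   by (simp add: h_sum)
 qed (use assms in \<open>auto intro!: finsum_closed\<close>)
 finally show ?thesis .
qed

lemma mult_assoc:
 assumes "F : car T" "G : car T" "H : car T"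
 shows "(F *[T] G) *[T] H = F *[T] (G *[T] H)"
proof
 fix l
 let ?f = "\<lambda>a b d. F a \<otimes> G b \<otimes> H d \<otimes>
  (h (\<Sum>k\<le>l. str_at c a b k * str_at c k d l) \<otimes> x [^] (a + b + d - l))"
 have cl: "?f a b d : car A" for a b d using assms by simp
 have "(F *[T] (G *[T] H)) l = ((G *[T] H) *[T] F) l"
  using mult_comm[OF assms(1) mult_closed[OF assms(2,3)]] by simp
 also have "... = (\<Oplus>a\<in>{..l}. \<Oplus>b\<in>{..l}. \<Oplus>d\<in>{..l}. G b \<otimes> H d \<otimes> F a \<otimes>
  (h (\<Sum>k\<le>l. str_at c b d k * str_at c k a l) \<otimes> x [^] (b + d + a - l)))"
  by (rule mult_mult) fact+
 also have "... = (\<Oplus>a\<in>{..l}. \<Oplus>b\<in>{..l}. \<Oplus>d\<in>{..l}. ?f a b d)"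
 proof (intro finsum_cong2' finsum_closed)
  fix a b d
  have "(\<Sum>k\<le>l. str_at c b d k * str_at c k a l) = (\<Sum>k\<le>l. str_at c a b k * str_at c k d l)"
   unfolding c_assoc[of a b] using str_at_c_comm by simp
  then show "G b \<otimes> H d \<otimes> F a \<otimes> (h (\<Sum>k\<le>l. str_at c b d k * str_at c k a l) \<otimes> x [^] (b + d + a - l)) = ?f a b d"
   using assms by (simp add: m_ac add.commute add.left_commute)
 qed (use cl in \<open>auto intro!: finsum_closed\<close>)
 also have "... = (\<Oplus>a\<in>{..l}. \<Oplus>d\<in>{..l}. \<Oplus>b\<in>{..l}. ?f a b d)"
  by (rule finsum_cong2', rule finsum_swap) (use cl in \<open>auto intro!: finsum_closed\<close>)
 also have "... = (\<Oplus>d\<in>{..l}. \<Oplus>a\<in>{..l}. \<Oplus>b\<in>{..l}. ?f a b d)"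
  by (rule finsum_swap) (use cl in \<open>auto intro!: finsum_closed\<close>)
 also have "... = ((F *[T] G) *[T] H) l"
  using mult_mult[OF assms] by simp
 finally show "((F *[T] G) *[T] H) l = (F *[T] (G *[T] H)) l" by simp
qed

lemma one_closed_T: "\<one>[T] : car T"
 by (auto simp: T_simps)

lemma const_mult:
 assumes "F : car T" "G : car T" "!!k. k > 0 ==> F k = \<zero>"
 shows "F *[T] G = (\<lambda>k. F 0 \<otimes> G k)"
proof
 fix l
 have "(F *[T] G) l = (\<Oplus>m\<in>{..l}. F 0 \<otimes> G m \<otimes> s 0 m l)"
  unfolding T_simps
  by (rule finsum_single[of _ 0]) (use assms in \<open>auto intro!: finsum_closed finsum_zero\<close>)
 also have "... = F 0 \<otimes> G l \<otimes> s 0 l l"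
  by (rule finsum_single) (use assms s_0 in auto)
 finally show "(F *[T] G) l = F 0 \<otimes> G l" using assms by (simp add: s_0)
qed

lemma one_mult: "F : car T ==> \<one>[T] *[T] F = F"
 by (subst const_mult[OF one_closed_T]) (auto simp: T_simps(2))

lemma T_distr:
 assumes "F : car T" "G : car T" "H : car T"
 shows "(F +[T] G) *[T] H = F *[T] H +[T] G *[T] H"
proof
 fix l
 have "((F +[T] G) *[T] H) l
   = (\<Oplus>n\<in>{..l}. \<Oplus>m\<in>{..l}. F n \<otimes> H m \<otimes> s n m l \<oplus> G n \<otimes> H m \<otimes> s n m l)"
  unfolding T_simps
  by (intro finsum_cong2' finsum_closed) (use assms in \<open>auto simp: l_distr\<close>)
 also have "... = (\<Oplus>n\<in>{..l}. (\<Oplus>m\<in>{..l}. F n \<otimes> H m \<otimes> s n m l) \<oplus> (\<Oplus>m\<in>{..l}. G n \<otimes> H m \<otimes> s n m l))"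
  by (intro finsum_cong2' finsum_addf) (use assms in \<open>auto intro!: finsum_closed\<close>)
 also have "... = (F *[T] H +[T] G *[T] H) l"
  unfolding T_simps by (intro finsum_addf) (use assms in \<open>auto intro!: finsum_closed\<close>)
 finally show "((F +[T] G) *[T] H) l = (F *[T] H +[T] G *[T] H) l" .
qed

lemma T_cring: "cring T"
proof (rule cringI)
 show "abelian_group T"
 proof (rule abelian_groupI)
  fix F assume F: "F : car T"
  then show "\<exists>G\<in>car T. G +[T] F = \<zero>[T]"
   by (intro bexI[of _ "\<lambda>k. \<ominus> F k"]) (auto simp: T_simps l_neg)
 qed (auto simp: T_simps a_ac)
 show "comm_monoid T"
  by (rule comm_monoidI) (fact mult_closed one_closed_T mult_assoc one_mult mult_comm)+
qed (rule T_distr)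

lemma T_minus:
 assumes "F : car T" "G : car T"
 shows "F -[T] G = (\<lambda>k. F k \<ominus> G k)"
proof -
 interpret T: cring T by (rule T_cring)
 let ?D = "\<lambda>k. F k \<ominus> G k"
 have D: "?D : car T" using assms by (auto simp: T_simps)
 have "?D +[T] G = F"
 proof
  fix k show "(?D +[T] G) k = F k"
   using assms by (simp add: T_simps(4) minus_eq a_assoc l_neg)
 qed
 then have "F -[T] G = (?D +[T] G) -[T] G" by (rule arg_cong[OF sym])
 also have "... = ?D +[T] (G +[T] -[T] G)"
  unfolding T.minus_eq by (rule T.a_assoc[OF D assms(2) T.a_inv_closed[OF assms(2)]])
 also have "... = ?D" by (simp only: T.r_neg[OF assms(2)] T.r_zero[OF D])
 finally show ?thesis .
qed

end

lemma (in zq_point) twisted_qdp: "twisted A h x qdp_str"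
proof
 show "(qv - 1) ^ i dvd qdp_str n m i" for n m i unfolding qdp_str_def by (rule dvd_triv_right)
 show "qdp_str n m i = qdp_str m n i" for n m i by (rule qdp_str_commute)
 show "qdp_str 0 m 0 = 1" for m by (rule qdp_str_0)
 show "qdp_str n m i = 0" if "i > n \<or> i > m" for n m i using that by (rule qdp_str_eq_0)
 show "(\<Sum>k\<le>l. str_at qdp_str a b k * str_at qdp_str k d l)
   = (\<Sum>k\<le>l. str_at qdp_str b d k * str_at qdp_str a k l)" for a b d l by (rule qdp_str_assoc)
qed

lemma (in zq_point) twisted_newton: "twisted A h x newton_str"
proof
 show "(qv - 1) ^ i dvd newton_str n m i" for n m i
  unfolding newton_str_def by (intro dvd_mult2 dvd_triv_right)
 show "newton_str n m i = newton_str m n i" for n m i by (rule newton_str_commute)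
 show "newton_str 0 m 0 = 1" for m by (rule newton_str_0)
 show "newton_str n m i = 0" if "i > n \<or> i > m" for n m i using that by (rule newton_str_eq_0)
 show "(\<Sum>k\<le>l. str_at newton_str a b k * str_at newton_str k d l)
   = (\<Sum>k\<le>l. str_at newton_str b d k * str_at newton_str a k l)" for a b d l by (rule newton_str_assoc)
qed

sublocale zq_point \<subseteq> dp: twisted A h x p qdp_str
 by (rule twisted_qdp)

sublocale zq_point \<subseteq> nw: twisted A h x p newton_str
 by (rule twisted_newton)

section \<open>Filtrations of the ring of twisted power series\<close>

context zq_point
begin

abbreviation "\<cc> \<equiv> pq_ideal p A (h qv)"
abbreviation "cpw k \<equiv> ideal_power A \<cc> k"

lemma cc_ideal: "ideal \<cc> A"
 by (rule pq_ideal_ideal) simp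

lemma cpw_ideal: "ideal (cpw k) A"
 by (rule ideal_pow_ideal[OF cc_ideal])

lemma cpw_mono: "m <= n ==> a : cpw n ==> a : cpw m"
 using ideal_pow_antimono[OF cc_ideal] by blast

lemma cpw_mult: "a : cpw m ==> b : cpw n ==> a \<otimes> b : cpw (m + n)"
 by (rule ideal_pow_mult[OF cc_ideal])

lemma cpw_mult_r: "a : cpw m ==> b : car A ==> a \<otimes> b : cpw m"
 using ideal.I_r_closed[OF cpw_ideal] by blast

lemma cpw_carr: "a : cpw m ==> a : car A"
 using ideal.Icarr[OF cpw_ideal] .

lemma h_q1_pow: "h ((qv - 1) ^ i * g) : cpw i"
proof -
 have "h qv \<ominus> \<one> : \<cc>" by (rule pq_ideal_q) simp
 then have "h (qv - 1) [^] i : cpw i"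
  using ideal_pow_pow[OF cc_ideal] by (simp add: h_minus)
 then show ?thesis by (simp add: h_mult h_power cpw_mult_r)
qed

end

context twisted
begin

sublocale T: cring T by (rule T_cring)

definition coeff_ideal :: "(nat => 'a set) => (nat => 'a) set" where
 "coeff_ideal I = {F : car T. \<forall>j. F j : I j}"

text \<open>The coefficient of F G at l sees only the coefficients of F at indices n \<le> l;
  monotonicity puts all of those into the ideal attached to l.\<close>

lemma coeff_ideal_ideal:
 assumes I: "!!j. ideal (I j) A" and mono: "!!n l. n <= l ==> I n <= I l"
 shows "ideal (coeff_ideal I) T"
proof (rule idealI[OF T.ring_axioms])
 show "subgroup (coeff_ideal I) (add_monoid T)"
 proof (rule T.add.subgroupI)
  show "coeff_ideal I ~= {}"
   using ideal_zero_closed[OF I] by (auto simp: coeff_ideal_def T_simps intro!: exI[of _ "\<lambda>_. \<zero>"])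
  show "-[T] F : coeff_ideal I" if "F : coeff_ideal I" for F
  proof -
   have F: "F : car T" using that by (simp add: coeff_ideal_def)
   have "-[T] F = \<zero>[T] -[T] F" using F by (simp add: T.minus_eq)
   also have "... = (\<lambda>k. \<zero> \<ominus> F k)" using T_minus[OF T.zero_closed F] by (simp add: T_simps)
   finally show ?thesis
    using that F ideal_minus_closed[OF I ideal_zero_closed[OF I]] T.a_inv_closed[OF F]
    by (simp add: coeff_ideal_def)
  qed
  show "F +[T] G : coeff_ideal I" if "F : coeff_ideal I" "G : coeff_ideal I" for F G
   using that ideal_add_closed[OF I] by (auto simp: coeff_ideal_def T_simps)
 qed (auto simp: coeff_ideal_def)
 show "G *[T] F : coeff_ideal I" if "F : coeff_ideal I" "G : car T" for F G
 proof -
  have "(F *[T] G) l : I l" for l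
   unfolding T_simps(5)
  proof (intro ideal_finsum_closed[OF I])
   fix n m assume "n : {..l}"
   then have "F n : I l" using that mono by (auto simp: coeff_ideal_def)
   then show "F n \<otimes> G m \<otimes> s n m l : I l"
    using that by (simp add: ideal.I_r_closed[OF I])
  qed
  then show ?thesis using that mult_comm[of F G] mult_closed by (auto simp: coeff_ideal_def)
 qed
 then show "F *[T] G : coeff_ideal I" if "F : coeff_ideal I" "G : car T" for F G
  using that mult_comm[of F G] by (auto simp: coeff_ideal_def)
qed

text \<open>The weight filtration: the j-th basis element has weight j, p and q - 1 have weight 1,
  and step m consists of series whose terms all have weight at least m. Truncated subtraction
  imposes no condition from index m on.\<close>

definition W :: "nat => (nat => 'a) set" where "W m = coeff_ideal (\<lambda>j. cpw (m - j))"

definition Tr :: "nat => (nat => 'a) set" where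
 "Tr m = coeff_ideal (\<lambda>j. if j < m then {\<zero>} else car A)"

lemma W_iff: "F : W m \<longleftrightarrow> F : car T \<and> (\<forall>j. F j : cpw (m - j))"
 by (simp add: W_def coeff_ideal_def)

lemma Tr_iff: "F : Tr m \<longleftrightarrow> F : car T \<and> (\<forall>j<m. F j = \<zero>)"
 by (auto simp: Tr_def coeff_ideal_def)

lemma W_ideal: "ideal (W m) T"
 unfolding W_def by (rule coeff_ideal_ideal[OF cpw_ideal]) (auto elim: cpw_mono[rotated])

lemma Tr_ideal: "ideal (Tr m) T"
 unfolding Tr_def by (rule coeff_ideal_ideal) (auto simp: zeroideal oneideal)

lemma W_0: "W 0 = car T"
 by (auto simp: W_iff T_carrier_iff)

lemma s_cpw: "s n m l : cpw (n + m - l)"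
proof (cases "l <= n + m")
 case True
 then have "(qv - 1) ^ (n + m - l) dvd str_at c n m l" using c_dvd by (simp add: str_at_def)
 then obtain g where "str_at c n m l = (qv - 1) ^ (n + m - l) * g" by (elim dvdE)
 then show ?thesis using h_q1_pow by (simp add: tw_el_def cpw_mult_r)
next
 case False
 then show ?thesis by simp
qed

text \<open>A product of basis elements that loses i degrees carries a coefficient in (p,q-1)^i by
  \<open>s_cpw\<close>, so no weight is lost.\<close>

lemma W_mult:
 assumes "F : W a" "G : W b"
 shows "F *[T] G : W (a + b)"
proof -
 have FG: "F : car T" "G : car T" using assms by (auto simp: W_iff)
 have "(F *[T] G) l : cpw (a + b - l)" for l
  unfolding T_simps(5)
 proof (intro ideal_finsum_closed[OF cpw_ideal])
  fix n m
  show "F n \<otimes> G m \<otimes> s n m l : cpw (a + b - l)"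
  proof (cases "l <= n + m")
   case True
   have "F n \<otimes> G m \<otimes> s n m l : cpw ((a - n) + (b - m) + (n + m - l))"
    using assms s_cpw by (intro cpw_mult) (auto simp: W_iff)
   then show ?thesis by (rule cpw_mono[rotated]) (use True in auto)
  next
   case False
   then have "F n \<otimes> G m \<otimes> s n m l = \<zero>" using FG by (simp add: s_eq_0)
   then show ?thesis using ideal_zero_closed[OF cpw_ideal] by simp
  qed
 qed
 then show ?thesis using FG mult_closed by (simp add: W_iff)
qed

lemma W_antimono: "m <= n ==> W n <= W m"
proof
 fix F assume mn: "m <= n" and F: "F : W n"
 have "F j : cpw (m - j)" for j
  by (rule cpw_mono[of _ "n - j"]) (use mn F in \<open>auto simp: W_iff\<close>)
 then show "F : W m" using F by (simp add: W_iff)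
qed

text \<open>The coefficient at j lies in the power 2^i - j of (p,q-1), which is unbounded in i.
  Steps 2^i occur because lifting along square-zero ideals doubles the step.\<close>

lemma W_separated:
 assumes sep: "!!a. a : car A ==> (!!k. a : cpw k) ==> a = \<zero>"
  and F: "!!i. F : W (2 ^ i)"
 shows "F = \<zero>[T]"
proof
 fix j
 have "F j : cpw k" for k
 proof -
  have "F j : cpw (2 ^ (k + j) - j)" using F[of "k + j"] by (simp add: W_iff)
  moreover have "k + j < 2 ^ (k + j)" by (rule less_exp)
  then have "k <= 2 ^ (k + j) - j" by arith
  ultimately show ?thesis by (intro cpw_mono[of k "2 ^ (k + j) - j"])
 qed
 then show "F j = \<zero>[T] j" using sep[of "F j"] F[of 0] by (auto simp: T_simps W_iff)
qed

definition cst :: "'a => nat => 'a" where "cst a = (\<lambda>k. if k = 0 then a else \<zero>)"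

definition basis :: "nat => nat => 'a" where "basis n = (\<lambda>k. if k = n then \<one> else \<zero>)"

lemma cst_closed [simp]: "a : car A ==> cst a : car T"
 by (auto simp: cst_def T_simps)

lemma basis_closed [simp]: "basis n : car T"
 by (auto simp: basis_def T_simps)

lemma cst_mult: "a : car A ==> F : car T ==> cst a *[T] F = (\<lambda>k. a \<otimes> F k)"
 by (subst const_mult[OF cst_closed]) (auto simp: cst_def)

lemma cst_hom: "cst : ring_hom A T"
proof (rule ring_hom_memI)
 show "cst (a \<otimes> b) = cst a *[T] cst b" if "a : car A" "b : car A" for a b
  using that by (subst cst_mult[OF _ cst_closed]) (auto simp: cst_def)
qed (auto simp: T_simps cst_def)

lemma basis_mult: "(basis n *[T] basis m) l = s n m l"
proof (cases "n <= l \<and> m <= l")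
 case True
 have "(basis n *[T] basis m) l = (\<Oplus>k\<in>{..l}. basis n n \<otimes> basis m k \<otimes> s n k l)"
  unfolding T_simps(5) using True
  by (intro finsum_single) (auto simp: basis_def intro!: finsum_closed finsum_zero)
 also have "... = basis n n \<otimes> basis m m \<otimes> s n m l"
  using True by (intro finsum_single) (auto simp: basis_def)
 finally show ?thesis by (simp add: basis_def)
next
 case False
 then have "(basis n *[T] basis m) l = \<zero>"
  unfolding T_simps(5) by (intro finsum_zero) (auto simp: basis_def)
 then show ?thesis using False by (auto simp: s_eq_0)
qed

lemma pq_ideal_W: "pq_ideal p T (cst (h qv)) <= W 1"
proof (rule T.pq_ideal_least[OF W_ideal])
 have W1: "cst a : W 1" if "a : \<cc>" for a
  using that ideal.Icarr[OF cc_ideal that] ideal_pow_1[OF cc_ideal]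
   ideal_zero_closed[OF cpw_ideal] by (auto simp: W_iff cst_def T_carrier_iff)
 show "add_pow T p \<one>[T] : W 1"
  using ring_hom_nat_mult[OF ring_axioms T.ring_axioms cst_hom one_closed, of p]
   ring_hom_one[OF cst_hom] W1[OF pq_ideal_p[of "h qv" p]] by simp
 show "cst (h qv) -[T] \<one>[T] : W 1"
  using ring_hom_minus[OF ring_axioms T.ring_axioms cst_hom, of "h qv" \<one>]
   ring_hom_one[OF cst_hom] W1[OF pq_ideal_q[of "h qv" p]] by simp
qed

lemma pq_ideal_pow_W: "ideal_power T (pq_ideal p T (cst (h qv))) k <= W k"
proof (rule T.ideal_pow_least[of W, OF W_ideal W_0])
 show "F *[T] G : W (Suc k)" if "F : W k" "G : pq_ideal p T (cst (h qv))" for k F G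
  using W_mult[of F k G 1] that pq_ideal_W by auto
qed

end

section \<open>Evaluation of Newton series at the points $(q^i - 1)x$\<close>

lemma poly_newton_poly_0: "i < n ==> poly (newton_poly n) (qv ^ i) = 0"
 unfolding newton_poly_def poly_prod by (rule prod_zero) auto

lemma poly_newton_poly_same: "poly (newton_poly m) (qv ^ m) ~= 0"
proof -
 have "qv ^ m - qv ^ j ~= 0" if "j < m" for j
 proof
  assume "qv ^ m - qv ^ j = 0"
  then have "Polynomial.degree (qv ^ m) = Polynomial.degree (qv ^ j)" by simp
  then show False using that by (simp add: qv_def degree_power_eq)
 qed
 then show ?thesis by (simp add: newton_poly_def poly_prod)
qed

text \<open>Evaluate the product expansion at q^m: Newton polynomials of index above m vanish there,
  structure constants of index below m are zero, and the nonzero value of the m-th polynomial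
  cancels.\<close>

lemma str_at_newton_diag: 
 assumes "n <= m"
 shows "str_at newton_str n m m = poly (newton_poly n) (qv ^ m)"
proof -
 have "poly (newton_poly n) (qv ^ m) * poly (newton_poly m) (qv ^ m)
   = (\<Sum>k\<le>n+m. str_at newton_str n m k * poly (newton_poly k) (qv ^ m))"
  unfolding poly_mult[symmetric] newton_poly_mult_str_at[OF order_refl] poly_sum by simp
 also have "... = (\<Sum>k\<in>{m}. str_at newton_str n m k * poly (newton_poly k) (qv ^ m))"
 proof (rule sum.mono_neutral_right)
  show "\<forall>k\<in>{..n+m} - {m}. str_at newton_str n m k * poly (newton_poly k) (qv ^ m) = 0"
  proof
   fix k assume "k : {..n+m} - {m}"
   then have "k < m \<or> m < k" by auto
   then show "str_at newton_str n m k * poly (newton_poly k) (qv ^ m) = 0"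
    using str_at_newton_eq_0[of k n m] poly_newton_poly_0[of m k] by auto
  qed
 qed auto
 finally show ?thesis using poly_newton_poly_same by simp
qed

context zq_point
begin

text \<open>The value of \<xi>^(k) at \<xi> = (q^i - 1)x, the product of the (q^i - q^j)x for j < k.
  It vanishes for k > i, so an infinite series can be evaluated by a finite sum.\<close>

definition ev_el :: "nat => nat => 'a" where
 "ev_el i k = h (poly (newton_poly k) (qv ^ i)) \<otimes> x [^] k"

definition ev :: "nat => (nat => 'a) => 'a" where
 "ev i F = (\<Oplus>k\<in>{..i}. F k \<otimes> ev_el i k)"

lemma ev_el_closed [simp]: "ev_el i k : car A"
 by (simp add: ev_el_def)

lemma ev_el_eq_0: "i < k ==> ev_el i k = \<zero>"
 by (simp add: ev_el_def poly_newton_poly_0)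

lemma ev_el_mult:
 assumes "n + m <= N"
 shows "ev_el i n \<otimes> ev_el i m = (\<Oplus>k\<in>{..N}. nw.s n m k \<otimes> ev_el i k)"
proof -
 have "ev_el i n \<otimes> ev_el i m
  = h (poly (newton_poly n) (qv ^ i) * poly (newton_poly m) (qv ^ i)) \<otimes> x [^] (n + m)"
  by (simp add: ev_el_def h_mult m_ac nat_pow_mult[symmetric])
 also have "poly (newton_poly n) (qv ^ i) * poly (newton_poly m) (qv ^ i)
  = (\<Sum>k\<le>N. str_at newton_str n m k * poly (newton_poly k) (qv ^ i))"
  unfolding poly_mult[symmetric] newton_poly_mult_str_at[OF assms] poly_sum by simp
 also have "h ... \<otimes> x [^] (n + m)
  = (\<Oplus>k\<in>{..N}. h (str_at newton_str n m k * poly (newton_poly k) (qv ^ i)) \<otimes> x [^] (n + m))"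
  unfolding h_sum by (rule finsum_ldistr) auto
 also have "... = (\<Oplus>k\<in>{..N}. nw.s n m k \<otimes> ev_el i k)"
 proof (rule finsum_cong2')
  fix k
  show "h (str_at newton_str n m k * poly (newton_poly k) (qv ^ i)) \<otimes> x [^] (n + m)
   = nw.s n m k \<otimes> ev_el i k"
  proof (cases "k <= n + m")
   case True
   then have "x [^] (n + m) = x [^] (n + m - k) \<otimes> x [^] k"
    by (simp add: nat_pow_mult)
   then show ?thesis by (simp add: tw_el_def ev_el_def h_mult m_ac)
  next
   case False
   then show ?thesis by (simp add: tw_el_def str_at_def)
  qed
 qed simp
 finally show ?thesis .
qed

lemma ev_ext:
 assumes "F : car nw.T" "i <= N"
 shows "ev i F = (\<Oplus>k\<in>{..N}. F k \<otimes> ev_el i k)"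
 unfolding ev_def by (rule finsum_neutral) (use assms ev_el_eq_0 in auto)

lemma ev_hom: "ev i : ring_hom nw.T A"
proof (rule ring_hom_memI)
 show "ev i F : car A" if "F : car nw.T" for F
  using that by (auto simp: ev_def intro!: finsum_closed)
 show "ev i (F +[nw.T] G) = ev i F \<oplus> ev i G" if "F : car nw.T" "G : car nw.T" for F G
 proof -
  have "ev i (F +[nw.T] G) = (\<Oplus>k\<in>{..i}. F k \<otimes> ev_el i k \<oplus> G k \<otimes> ev_el i k)"
   unfolding ev_def by (rule finsum_cong2') (use that in \<open>auto simp: nw.T_simps(4) l_distr\<close>)
  also have "... = ev i F \<oplus> ev i G"
   unfolding ev_def by (rule finsum_addf) (use that in auto)
  finally show ?thesis .
 qed
 show "ev i \<one>[nw.T] = \<one>"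
 proof -
  have "ev i \<one>[nw.T] = \<one>[nw.T] 0 \<otimes> ev_el i 0"
   unfolding ev_def by (rule finsum_single) (auto simp: nw.T_simps(2))
  then show ?thesis by (simp add: nw.T_simps(2) ev_el_def)
 qed
 show "ev i (F *[nw.T] G) = ev i F \<otimes> ev i G" if F: "F : car nw.T" and G: "G : car nw.T" for F G
 proof -
  let ?N = "i + i"
  have "ev i (F *[nw.T] G) = (\<Oplus>k\<in>{..?N}. (F *[nw.T] G) k \<otimes> ev_el i k)"
   by (rule ev_ext) (use nw.mult_closed[OF F G] in auto)
  also have "... = (\<Oplus>k\<in>{..?N}. \<Oplus>n\<in>{..?N}. \<Oplus>m\<in>{..?N}. F n \<otimes> G m \<otimes> (nw.s n m k \<otimes> ev_el i k))"
  proof (rule finsum_cong2')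
   fix k assume k: "k : {..?N}"
   have "(F *[nw.T] G) k \<otimes> ev_el i k
    = (\<Oplus>n\<in>{..?N}. \<Oplus>m\<in>{..?N}. F n \<otimes> G m \<otimes> nw.s n m k) \<otimes> ev_el i k"
    using nw.mult_ext[OF F G, of k ?N] k by simp
   also have "... = (\<Oplus>n\<in>{..?N}. (\<Oplus>m\<in>{..?N}. F n \<otimes> G m \<otimes> nw.s n m k) \<otimes> ev_el i k)"
    by (rule finsum_ldistr) (use F G in \<open>auto intro!: finsum_closed\<close>)
   also have "... = (\<Oplus>n\<in>{..?N}. \<Oplus>m\<in>{..?N}. F n \<otimes> G m \<otimes> (nw.s n m k \<otimes> ev_el i k))"
   proof (rule finsum_cong2')
    fix n
    have "(\<Oplus>m\<in>{..?N}. F n \<otimes> G m \<otimes> nw.s n m k) \<otimes> ev_el i k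
     = (\<Oplus>m\<in>{..?N}. F n \<otimes> G m \<otimes> nw.s n m k \<otimes> ev_el i k)"
     by (rule finsum_ldistr) (use F G in auto)
    also have "... = (\<Oplus>m\<in>{..?N}. F n \<otimes> G m \<otimes> (nw.s n m k \<otimes> ev_el i k))"
     by (rule finsum_cong2') (use F G in \<open>auto simp: m_assoc\<close>)
    finally show "(\<Oplus>m\<in>{..?N}. F n \<otimes> G m \<otimes> nw.s n m k) \<otimes> ev_el i k = ..." .
   qed (use F G in \<open>auto intro!: finsum_closed\<close>)
   finally show "(F *[nw.T] G) k \<otimes> ev_el i k = ..." .
  qed (use F G in \<open>auto intro!: finsum_closed\<close>)
  also have "... = (\<Oplus>n\<in>{..?N}. \<Oplus>k\<in>{..?N}. \<Oplus>m\<in>{..?N}. F n \<otimes> G m \<otimes> (nw.s n m k \<otimes> ev_el i k))"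
   by (rule finsum_swap) (use F G in \<open>auto intro!: finsum_closed\<close>)
  also have "... = (\<Oplus>n\<in>{..?N}. \<Oplus>m\<in>{..?N}. \<Oplus>k\<in>{..?N}. F n \<otimes> G m \<otimes> (nw.s n m k \<otimes> ev_el i k))"
   by (rule finsum_cong2', rule finsum_swap) (use F G in \<open>auto intro!: finsum_closed\<close>)
  also have "... = (\<Oplus>n\<in>{..?N}. \<Oplus>m\<in>{..?N}. F n \<otimes> G m \<otimes> (ev_el i n \<otimes> ev_el i m))"
  proof (intro finsum_cong2' finsum_closed)
   fix n m
   have "(\<Oplus>k\<in>{..?N}. F n \<otimes> G m \<otimes> (nw.s n m k \<otimes> ev_el i k))
    = F n \<otimes> G m \<otimes> (\<Oplus>k\<in>{..?N}. nw.s n m k \<otimes> ev_el i k)"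
    by (rule finsum_rdistr[symmetric]) (use F G in auto)
   \<comment> \<open>The range is enlarged to reach n + m, as \<open>ev_el_mult\<close> requires;
     the added terms vanish because k > i.\<close>
   also have "(\<Oplus>k\<in>{..?N}. nw.s n m k \<otimes> ev_el i k) = (\<Oplus>k\<in>{..?N + (n + m)}. nw.s n m k \<otimes> ev_el i k)"
    by (rule finsum_neutral) (auto simp: ev_el_eq_0)
   also have "... = ev_el i n \<otimes> ev_el i m" by (rule ev_el_mult[symmetric]) simp
   finally show "(\<Oplus>k\<in>{..?N}. F n \<otimes> G m \<otimes> (nw.s n m k \<otimes> ev_el i k)) = F n \<otimes> G m \<otimes> (ev_el i n \<otimes> ev_el i m)" .
  qed (use F G in auto)
  also have "... = (\<Oplus>n\<in>{..?N}. F n \<otimes> ev_el i n \<otimes> ev i G)"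
  proof (rule finsum_cong2')
   fix n
   have "(\<Oplus>m\<in>{..?N}. F n \<otimes> G m \<otimes> (ev_el i n \<otimes> ev_el i m))
    = (\<Oplus>m\<in>{..?N}. F n \<otimes> ev_el i n \<otimes> (G m \<otimes> ev_el i m))"
    by (rule finsum_cong2') (use F G in \<open>auto simp: m_ac\<close>)
   also have "... = F n \<otimes> ev_el i n \<otimes> (\<Oplus>m\<in>{..?N}. G m \<otimes> ev_el i m)"
    by (rule finsum_rdistr[symmetric]) (use F G in auto)
   finally show "(\<Oplus>m\<in>{..?N}. F n \<otimes> G m \<otimes> (ev_el i n \<otimes> ev_el i m)) = F n \<otimes> ev_el i n \<otimes> ev i G"
    using ev_ext[OF G, of i ?N] by simp
  qed (use F G in \<open>auto simp: ev_def intro!: finsum_closed\<close>)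
  also have "... = (\<Oplus>n\<in>{..?N}. F n \<otimes> ev_el i n) \<otimes> ev i G"
   by (rule finsum_ldistr[symmetric]) (use F G in \<open>auto simp: ev_def intro!: finsum_closed\<close>)
  also have "... = ev i F \<otimes> ev i G" using ev_ext[OF F, of i ?N] by simp
  finally show ?thesis .
 qed
qed

lemma ev_cst: "a : car A ==> ev i (nw.cst a) = a"
proof -
 assume a: "a : car A"
 have "ev i (nw.cst a) = nw.cst a 0 \<otimes> ev_el i 0"
  unfolding ev_def by (rule finsum_single) (use a in \<open>auto simp: nw.cst_def\<close>)
 then show ?thesis using a by (simp add: nw.cst_def ev_el_def)
qed

lemma ev_basis_1: "ev i (nw.basis 1) = h (qv ^ i - 1) \<otimes> x"
proof -
 have "ev i (nw.basis 1) = (\<Oplus>k\<in>{..Suc i}. nw.basis 1 k \<otimes> ev_el i k)"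
  by (rule ev_ext) auto
 also have "... = nw.basis 1 1 \<otimes> ev_el i 1"
  by (rule finsum_single) (auto simp: nw.basis_def)
 finally show ?thesis by (simp add: nw.basis_def ev_el_def newton_poly_def)
qed

text \<open>For G of order at least m, \<open>str_at_newton_diag\<close> shows that the m-th
  coefficient of F G is G_m times the value of F at (q^m - 1)x. Vanishing at successive points thus
  raises the order one by one.\<close>

lemma Tr_step:
 assumes "F : car nw.T" "ev m F = \<zero>" "G : nw.Tr m"
 shows "F *[nw.T] G : nw.Tr (Suc m)"
proof -
 have G: "G : car nw.T" using assms(3) nw.Tr_iff by blast
 have 1: "F *[nw.T] G : nw.Tr m"
  using ideal.I_l_closed[OF nw.Tr_ideal assms(3) assms(1)] .
 have "(F *[nw.T] G) m = (\<Oplus>n\<in>{..m}. F n \<otimes> G m \<otimes> nw.s n m m)"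
  unfolding nw.T_simps(5)
 proof (rule finsum_cong2')
  fix n
  show "(\<Oplus>k\<in>{..m}. F n \<otimes> G k \<otimes> nw.s n k m) = F n \<otimes> G m \<otimes> nw.s n m m"
   by (rule finsum_single) (use assms G nw.Tr_iff in auto)
 qed (use assms G in auto)
 also have "... = (\<Oplus>n\<in>{..m}. G m \<otimes> (F n \<otimes> ev_el m n))"
  by (rule finsum_cong2') (use assms G in \<open>auto simp: tw_el_def ev_el_def str_at_newton_diag m_ac\<close>)
 also have "... = G m \<otimes> ev m F"
  unfolding ev_def by (rule finsum_rdistr[symmetric]) (use assms G in auto)
 finally have "(F *[nw.T] G) m = \<zero>" using assms G by simp
 then show ?thesis using 1 by (auto simp: nw.Tr_iff less_Suc_eq)
qed

section \<open>From Newton series to twisted divided power series\<close>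

text \<open>The map \<xi>^(k) -> (k)_q! \<xi>^[k], extended to infinite series.\<close>

definition sc :: "(nat => 'a) => nat => 'a" where "sc F = (\<lambda>k. h (q_fact k) \<otimes> F k)"

lemma sc_s: "h (q_fact l) \<otimes> nw.s n m l = h (q_fact n) \<otimes> h (q_fact m) \<otimes> dp.s n m l"
proof -
 have "h (q_fact l) \<otimes> nw.s n m l = h (str_at newton_str n m l * q_fact l) \<otimes> x [^] (n + m - l)"
  by (simp add: tw_el_def h_mult m_ac)
 also have "... = h (q_fact n) \<otimes> h (q_fact m) \<otimes> dp.s n m l"
  unfolding str_at_qdp_newton[symmetric] by (simp add: tw_el_def h_mult m_assoc)
 finally show ?thesis .
qed

lemma sc_hom: "sc : ring_hom nw.T dp.T"
proof (rule ring_hom_memI)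
 show "sc F : car dp.T" if "F : car nw.T" for F
  using that by (auto simp: sc_def dp.T_carrier_iff)
 show "sc (F +[nw.T] G) = sc F +[dp.T] sc G" if "F : car nw.T" "G : car nw.T" for F G
  using that by (auto simp: sc_def dp.T_simps(4) nw.T_simps(4) r_distr)
 show "sc \<one>[nw.T] = \<one>[dp.T]"
  by (auto simp: sc_def dp.T_simps(2) nw.T_simps(2))
 show "sc (F *[nw.T] G) = sc F *[dp.T] sc G" if F: "F : car nw.T" and G: "G : car nw.T" for F G
 proof
  fix l
  have "sc (F *[nw.T] G) l = (\<Oplus>n\<in>{..l}. h (q_fact l) \<otimes> (\<Oplus>m\<in>{..l}. F n \<otimes> G m \<otimes> nw.s n m l))"
   unfolding sc_def nw.T_simps(5)
   by (rule finsum_rdistr) (use F G in \<open>auto intro!: finsum_closed\<close>)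
  also have "... = (\<Oplus>n\<in>{..l}. \<Oplus>m\<in>{..l}. h (q_fact l) \<otimes> (F n \<otimes> G m \<otimes> nw.s n m l))"
   by (intro finsum_cong2' finsum_rdistr) (use F G in \<open>auto intro!: finsum_closed\<close>)
  also have "... = (sc F *[dp.T] sc G) l"
   unfolding dp.T_simps(5)
  proof (intro finsum_cong2' finsum_closed)
   fix n m
   have "h (q_fact l) \<otimes> (F n \<otimes> G m \<otimes> nw.s n m l) = F n \<otimes> G m \<otimes> (h (q_fact l) \<otimes> nw.s n m l)"
    using F G by (simp add: m_ac)
   also have "... = sc F n \<otimes> sc G m \<otimes> dp.s n m l"
    unfolding sc_s using F G by (simp add: sc_def m_ac)
   finally show "h (q_fact l) \<otimes> (F n \<otimes> G m \<otimes> nw.s n m l) = sc F n \<otimes> sc G m \<otimes> dp.s n m l" .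
  qed (use F G in \<open>auto simp: sc_def\<close>)
  finally show "sc (F *[nw.T] G) l = (sc F *[dp.T] sc G) l" .
 qed
qed

end

section \<open>Complete rings and lifting along the filtration\<close>

lemma (in ring) minus_trans:
 assumes "a : car R" "b : car R" "d : car R"
 shows "(a \<ominus> b) \<oplus> (b \<ominus> d) = a \<ominus> d"
 using assms by (simp add: minus_eq a_assoc) (simp add: a_assoc[symmetric] l_neg)

lemma rcos_in_Quot:
 assumes "ideal J B" "b : car B"
 shows "J +>[B] b : car (B Quot J)"
 using ring_hom_closed[OF ideal.rcos_ring_hom[OF assms(1)] assms(2)] .

lemma Quot_carrierE:
 assumes "Z : car (B Quot J)"
 obtains b where "b : car B" "Z = J +>[B] b"
 using assms unfolding FactRing_def A_RCOSETS_def' by auto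

lemma hom_mod_iff_rcos:
 assumes "ring A" "ring C" "ideal K C" "w : car A \<rightarrow> car C"
 shows "hom_mod A C K w \<longleftrightarrow> (\<lambda>a. K +>[C] w a) : ring_hom A (C Quot K)"
proof -
 interpret C: ring C by fact
 have "hom_mod A C K w \<longleftrightarrow> (+>\<^bsub>C\<^esub>) K \<circ> w : ring_hom A (C Quot K)"
  by (rule hom_mod_iff_comp[OF assms(1,2) ideal.quotient_is_ring[OF assms(3)] ideal.rcos_ring_hom[OF assms(3)] assms(4)])
   (rule C.rcos_eq_iff[OF assms(3)])
 then show ?thesis by (simp add: comp_def)
qed

lemma ring_hom_cong:
 assumes "ring A" "!!a. a : car A ==> f a = g a" "f : ring_hom A B"
 shows "g : ring_hom A B"
proof (rule ring_hom_memI)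
 interpret A: ring A by fact
 fix a b assume a: "a : car A" and b: "b : car A"
 show "g a : car B"
  using ring_hom_closed[OF assms(3) a] assms(2)[OF a] by simp
 show "g (a *[A] b) = g a *[B] g b"
  using ring_hom_mult[OF assms(3) a b] assms(2)[OF a] assms(2)[OF b] assms(2)[OF A.m_closed[OF a b]] by simp
 show "g (a +[A] b) = g a +[B] g b"
  using ring_hom_add[OF assms(3) a b] assms(2)[OF a] assms(2)[OF b] assms(2)[OF A.a_closed[OF a b]] by simp
next
 interpret A: ring A by fact
 show "g \<one>[A] = \<one>[B]"
  using ring_hom_one[OF assms(3)] assms(2)[OF A.one_closed] by simp
qed

lemma hom_mod_cong:
 assumes "ring A" "ring C" "ideal K C" "hom_mod A C K w" "w' : car A \<rightarrow> car C"
  "!!a. a : car A ==> w' a -[C] w a : K"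
 shows "hom_mod A C K w'"
proof -
 interpret C: ring C by fact
 have w: "w a : car C" if "a : car A" for a by (rule hom_mod_closed) fact+
 have "(\<lambda>a. K +>[C] w a) : ring_hom A (C Quot K)"
  using hom_mod_iff_rcos[OF assms(1-3), of w] assms(4) w by blast
 moreover have "K +>[C] w a = K +>[C] w' a" if "a : car A" for a
  using C.rcos_eq_iff[OF assms(3) funcset_mem[OF assms(5) that] w[OF that]] assms(6)[OF that] by blast
 ultimately have "(\<lambda>a. K +>[C] w' a) : ring_hom A (C Quot K)"
  by (rule ring_hom_cong[OF assms(1), rotated])
 then show ?thesis using hom_mod_iff_rcos[OF assms(1-3,5)] by simp
qed

lemma hom_mod_separated:
 assumes "ring A" "ring C" "!!i. hom_mod A C (K i) w"
  and sep: "!!z. z : car C ==> (!!i. z : K i) ==> z = \<zero>[C]"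
 shows "w : ring_hom A C"
proof -
 interpret A: ring A by fact
 interpret C: ring C by fact
 have w: "w a : car C" if "a : car A" for a
  using hom_mod_closed[OF assms(3)] that by blast
 have eq: "a = b" if "a : car C" "b : car C" "!!i. a -[C] b : K i" for a b
  using sep[of "a -[C] b"] that by (simp add: C.r_right_minus_eq)
 show ?thesis
 proof (rule ring_hom_memI)
  fix a b assume "a : car A" "b : car A"
  then show "w (a *[A] b) = w a *[C] w b" "w (a +[A] b) = w a +[C] w b"
   using assms(3) w by (auto intro!: eq simp: hom_mod_def)
 next
  show "w \<one>[A] = \<one>[C]" using assms(3) w by (auto intro!: eq simp: hom_mod_def)
 qed (rule w)
qed

locale complete_point = zq_point +
 assumes complete: "adically_complete A (pq_ideal p A (h qv))"
begin

lemma separated: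
 assumes a: "a : car A" and k: "!!k. a : cpw k"
 shows "a = \<zero>"
proof -
 have "a \<ominus> \<zero> = a" using a by (simp add: minus_eq)
 then have "cpw k +> a = cpw k +> \<zero>" for k
  using k[of k] rcos_eq_iff[OF cpw_ideal a zero_closed, of k] by simp
 then have "to_completion A \<cc> a = to_completion A \<cc> \<zero>"
  by (simp only: to_completion_def)
 then show ?thesis
  using complete a unfolding adically_complete_def bij_betw_def inj_on_def by blast
qed

text \<open>Surjectivity of A -> lim A/(p,q-1)^k, phrased for sequences with a prescribed rate of
  convergence.\<close>

lemma limit:
 fixes u :: "nat => 'a"
 assumes u: "!!k. u k : car A" "!!k. u (Suc k) \<ominus> u k : cpw k"
 shows "\<exists>a\<in>car A. \<forall>k. a \<ominus> u k : cpw k"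
proof -
 define z where "z = (\<lambda>k. cpw k +> u k)"
 have "z : car (adic_completion A \<cc>)"
 proof -
  have "z (Suc k) <= z k" for k
  proof
   fix b assume "b : z (Suc k)"
   then have b: "b : car A" "b \<ominus> u (Suc k) : cpw (Suc k)"
    using u(1) unfolding z_def by (simp_all only: in_rcos_iff[OF cpw_ideal])
   have "b \<ominus> u (Suc k) : cpw k" by (rule cpw_mono[OF _ b(2)]) simp
   then have "(b \<ominus> u (Suc k)) \<oplus> (u (Suc k) \<ominus> u k) : cpw k"
    using u(2) by (rule ideal_add_closed[OF cpw_ideal])
   also have "(b \<ominus> u (Suc k)) \<oplus> (u (Suc k) \<ominus> u k) = b \<ominus> u k"
    using b(1) u(1)[of "Suc k"] u(1)[of k] by algebra
   finally show "b : z k" unfolding z_def using b u(1) in_rcos_iff[OF cpw_ideal] by blast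
  qed
  moreover have "z k : car (A Quot cpw k)" for k
   unfolding z_def by (rule rcos_in_Quot[OF cpw_ideal u(1)])
  ultimately show ?thesis by (simp add: adic_completion_def quot_limit_def)
 qed
 then obtain a where a: "a : car A" "to_completion A \<cc> a = z"
  using complete unfolding adically_complete_def bij_betw_def by (metis imageE)
 have "a \<ominus> u k : cpw k" for k
  using fun_cong[OF a(2), of k] rcos_eq_iff[OF cpw_ideal a(1) u(1)]
  by (simp add: to_completion_def z_def)
 then show ?thesis using a(1) by blast
qed

end

locale etale_point = complete_point A h x p for A (structure) and h x p +
 fixes S :: "('s, 'x) ring_scheme" and qS :: 's and \<phi> :: "'s => 'a"
 assumes S_cring: "cring S" and qS: "qS : car S" and \<phi>: "\<phi> : ring_hom S A"
  and \<phi>_q: "\<phi> qS = h qv"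
  and etale: "formally_etale S (pq_ideal p S qS) A \<phi>"
begin

sublocale S: cring S by (rule S_cring)

lemma pq_ideal_S: "pq_ideal p S qS <= car S"
 using ideal.Icarr[OF S.pq_ideal_ideal[OF qS]] by blast

lemma \<phi>_closed: "t : car S ==> \<phi> t : car A"
 using ring_hom_closed[OF \<phi>] .

text \<open>Iterates uniqueness of lifts along a chain of ideals in which the square of each lies in
  the next. The ring C is arbitrary since the argument serves A itself, the series rings and the
  tensor square.\<close>

lemma etale_unique:
 fixes C :: "('c, 'z) ring_scheme" and e :: "nat => 'c => ('s + 'a) list"
 assumes C: "cring C" and K: "!!i. ideal (K i) C" "!!i. K (Suc i) <= K i"
  and sq: "!!i a b. a : K i ==> b : K i ==> a *[C] b : K (Suc i)"
  and e: "!!i a b. a : car C ==> b : car C ==> e i a = e i b ==> a -[C] b : K i"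
  and \<psi>: "\<psi> : ring_hom S C"
  and nil: "!!i. ideal_power C (pq_ideal p C (\<psi> qS)) (m i) <= K i"
  and u: "!!i. hom_mod A C (K i) u" "!!i t. t : car S ==> u (\<phi> t) -[C] \<psi> t : K i"
  and v: "!!i. hom_mod A C (K i) v" "!!i t. t : car S ==> v (\<phi> t) -[C] \<psi> t : K i"
  and base: "!!a. a : car A ==> u a -[C] v a : K 0"
  and a: "a : car A"
 shows "u a -[C] v a : K i"
 using a
proof (induction i arbitrary: a)
 case 0
 then show ?case by (rule base)
next
 case (Suc i)
 interpret C: cring C by fact
 have vv: "v b -[C] v b : K i" if "b : car A" for b
  using hom_mod_closed[OF v(1) that] C.ideal_zero_closed[OF K(1)] by (simp add: C.minus_eq C.r_neg)
 have q: "\<psi> qS : car C" using ring_hom_closed[OF \<psi> qS] .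
 show ?case
  by (rule formally_etale_lift_unique[where K = "K i" and w = v and \<psi> = \<psi> and e = "e (Suc i)"
     and n = "m (Suc i)" and \<bb> = "pq_ideal p C (\<psi> qS)",
     OF etale S.ring_axioms ring_axioms C \<phi> pq_ideal_S K(1) K(1) K(2) sq e \<psi>
      ring_hom_pq_ideal[OF S_cring C \<psi> qS refl] C.pq_ideal_ideal[OF q] nil v(1) v(2)
      u(1) v(1) u(2) v(2) Suc.IH vv Suc.prems])
qed

text \<open>Serves to recognise evaluations of the Taylor lift as powers of \<sigma>. The chain is
  (p,q-1)^(2^i), and separatedness turns the congruences into equality.\<close>

lemma endo_unique:
 assumes \<alpha>: "\<alpha> : ring_hom A A" and \<beta>: "\<beta> : ring_hom A A"
  and eq: "!!t. t : car S ==> \<alpha> (\<phi> t) = \<beta> (\<phi> t)" and q: "\<alpha> (h qv) = h qv"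
  and base: "!!a. a : car A ==> \<alpha> a \<ominus> \<beta> a : \<cc>"
  and a: "a : car A"
 shows "\<alpha> a = \<beta> a"
proof -
 let ?K = "\<lambda>i. cpw (2 ^ i)"
 have zero: "b \<ominus> b : cpw k" if "b : car A" for b k
  using that ideal_zero_closed[OF cpw_ideal] by (simp add: minus_eq r_neg)
 have c: "\<alpha> b : car A" "\<beta> b : car A" if "b : car A" for b
  using that \<alpha> \<beta> ring_hom_closed by metis+
 have K: "\<alpha> a \<ominus> \<beta> a : ?K i" for i
 proof (rule etale_unique[where u = \<alpha> and v = \<beta> and a = a and i = i and K = ?K and e = "\<lambda>i b. [Inr b]" and \<psi> = "\<alpha> \<circ> \<phi>" and m = "\<lambda>i. 2 ^ i"])
  show "a \<otimes> b : ?K (Suc i)" if "a : ?K i" "b : ?K i" for i a b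
   using cpw_mult[OF that] by (simp add: mult_2)
  show "?K (Suc i) <= ?K i" for i
   using cpw_mono[of "2 ^ i" "2 ^ Suc i"] by auto
  show "a \<ominus> b : ?K i" if "a : car A" "b : car A" "[Inr a] = [Inr b :: 's + 'a]" for i a b
   using that zero by simp
  show "\<alpha> \<circ> \<phi> : ring_hom S A" by (rule ring_hom_trans[OF \<phi> \<alpha>])
  show "ideal_power A (pq_ideal p A ((\<alpha> \<circ> \<phi>) qS)) (2 ^ i) <= ?K i" for i
   using q \<phi>_q by simp
  show "\<alpha> a \<ominus> \<beta> a : ?K 0" if "a : car A" for a
   using base[OF that] ideal_pow_1[OF cc_ideal] by simp
 qed (use \<alpha> \<beta> a eq c \<phi>_closed zero in \<open>auto intro!: ring_hom_imp_hom_mod ring_axioms cpw_ideal is_cring simp flip: eq\<close>)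
 have "\<alpha> a \<ominus> \<beta> a : cpw k" for k
  by (rule cpw_mono[OF _ K[of k]]) (rule less_imp_le[OF less_exp])
 then have "\<alpha> a \<ominus> \<beta> a = \<zero>" using separated c a by simp
 then show ?thesis using c a by (simp add: r_right_minus_eq)
qed

end

locale etale_twisted = etale_point A h x p S qS \<phi> + twisted A h x p c
 for A (structure) and h x p and S :: "('s, 'x) ring_scheme" and qS \<phi> c
begin

abbreviation "K i \<equiv> W (2 ^ i)"

text \<open>Modulo W(2^i) a series is determined by its first 2^i coefficients, hence by a finite
  list over A. This brings the quotients of the series ring onto the type of the test
  algebras.\<close>

definition enc :: "nat => (nat => 'a) => ('s + 'a) list" where
 "enc i F = map (\<lambda>j. Inr (F j)) [0..<2 ^ i]"

lemma enc_eq: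
 assumes "F : car T" "G : car T" "enc i F = enc i G"
 shows "F -[T] G : K i"
proof -
 have FG: "F j \<ominus> G j : cpw (2 ^ i - j)" for j
 proof (cases "j < 2 ^ i")
  case True
  then have "enc i F ! j = enc i G ! j" using assms(3) by simp
  then have "F j = G j" using True by (simp add: enc_def)
  then show ?thesis using assms ideal_zero_closed[OF cpw_ideal] by (simp add: minus_eq r_neg)
 next
  case False
  then show ?thesis using assms by simp
 qed
 have "F -[T] G : car T" using assms by simp
 then show ?thesis using FG unfolding W_iff T_minus[OF assms(1,2)] by simp
qed

lemma K_square: "F : K i ==> G : K i ==> F *[T] G : K (Suc i)"
 using W_mult[of F "2 ^ i" G "2 ^ i"] by (simp add: mult_2)

lemma K_antimono: "i <= j ==> K j <= K i"
 by (rule W_antimono) (simp add: power_increasing)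

lemma K_zero: "F : car T ==> F -[T] F : K i"
 using T.ideal_zero_closed[OF W_ideal] by (simp add: T.minus_eq T.r_neg)

lemma K_eq:
 assumes "F : car T" "G : car T" "!!i. F -[T] G : K i"
 shows "F = G"
 using W_separated[OF separated assms(3)] assms(1,2) by (simp add: T.r_right_minus_eq)

text \<open>Equal constant coefficients already give congruence modulo \<open>K 0\<close>, which is
  W 1 and leaves coefficients of positive index free; \<open>etale_unique\<close> and separatedness
  do the rest.\<close>

lemma series_unique:
 assumes u: "u : ring_hom A T" and v: "v : ring_hom A T"
  and eq: "!!t. t : car S ==> u (\<phi> t) = v (\<phi> t)" and q: "u (h qv) = cst (h qv)"
  and base: "!!a. a : car A ==> u a 0 = v a 0"
  and a: "a : car A"
 shows "u a = v a"
proof -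
 have c: "u b : car T" "v b : car T" if "b : car A" for b
  using that u v ring_hom_closed by metis+
 have "u a -[T] v a : K i" for i
 proof (rule etale_unique[where u = u and v = v and a = a and i = i and K = K and e = enc and \<psi> = "u \<circ> \<phi>" and m = "\<lambda>i. 2 ^ i"])
  show "u \<circ> \<phi> : ring_hom S T" by (rule ring_hom_trans[OF \<phi> u])
  show "ideal_power T (pq_ideal p T ((u \<circ> \<phi>) qS)) (2 ^ i) <= K i" for i
   using pq_ideal_pow_W q \<phi>_q by simp
  show "u b -[T] v b : K 0" if b: "b : car A" for b
  proof -
   have "u b j \<ominus> v b j : cpw (1 - j)" for j
   proof (cases j)
    case 0
    then have "u b j \<ominus> v b j = \<zero>"
     using base[OF b] c[OF b] by (simp add: minus_eq r_neg)
    then show ?thesis using ideal_zero_closed[OF cpw_ideal] by metis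
   next
    case (Suc n)
    then show ?thesis using c[OF b] by simp
   qed
   moreover have "u b -[T] v b : car T" using c[OF b] by simp
   ultimately show ?thesis unfolding W_iff T_minus[OF c[OF b]] by simp
  qed
  show "K (Suc i) <= K i" for i by (rule K_antimono) simp
 qed (use u v a eq c \<phi>_closed K_zero K_square enc_eq in
   \<open>auto intro!: ring_hom_imp_hom_mod ring_axioms T.ring_axioms T_cring W_ideal simp flip: eq\<close>)
 then show ?thesis using K_eq c a by blast
qed

lemma series_step:
 assumes \<psi>: "\<psi> : ring_hom S T" "\<psi> qS = cst (h qv)"
  and w: "hom_mod A T (K i) w" "!!t. t : car S ==> w (\<phi> t) -[T] \<psi> t : K i"
 shows "\<exists>w'. hom_mod A T (K (Suc i)) w' \<and>
   (\<forall>t\<in>car S. w' (\<phi> t) -[T] \<psi> t : K (Suc i)) \<and> (\<forall>a\<in>car A. w' a -[T] w a : K i)"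
proof (rule formally_etale_lift_ex[where K = "K i" and \<psi> = \<psi> and e = "enc (Suc i)"
   and n = "2 ^ Suc i" and \<bb> = "pq_ideal p T (cst (h qv))",
   OF etale S.ring_axioms ring_axioms T_cring \<phi> pq_ideal_S W_ideal W_ideal])
 show "\<psi> ` pq_ideal p S qS <= pq_ideal p T (cst (h qv))"
  by (rule ring_hom_pq_ideal[OF S_cring T_cring \<psi>(1) qS \<psi>(2)])
 show "ideal (pq_ideal p T (cst (h qv))) T" by (rule T.pq_ideal_ideal) simp
 show "K (Suc i) <= K i" by (rule K_antimono) simp
 show "!!a b. a : K i ==> b : K i ==> a *[T] b : K (Suc i)" by (rule K_square)
 show "!!a b. a : car T ==> b : car T ==> enc (Suc i) a = enc (Suc i) b
  ==> a -[T] b : K (Suc i)" by (rule enc_eq)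
 show "ideal_power T (pq_ideal p T (cst (h qv))) (2 ^ Suc i) <= K (Suc i)" by (rule pq_ideal_pow_W)
qed (use \<psi> w in auto)

text \<open>The constant coefficient is only controlled modulo (p,q-1), because the approximation
  starts from \<open>cst\<close> modulo \<open>K 0\<close>. Equality is obtained later by evaluation
  at \<xi> = 0.\<close>

lemma series_lift:
 assumes \<psi>: "\<psi> : ring_hom S T" "\<psi> qS = cst (h qv)" "!!t. t : car S ==> \<psi> t 0 = \<phi> t"
 shows "\<exists>\<tau>\<in>ring_hom A T. (\<forall>t\<in>car S. \<tau> (\<phi> t) = \<psi> t) \<and> (\<forall>a\<in>car A. \<tau> a 0 \<ominus> a : \<cc>)"
proof -
 have \<psi>c: "\<psi> t : car T" if "t : car S" for t using ring_hom_closed[OF \<psi>(1) that] .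
 define P where "P i w \<longleftrightarrow> hom_mod A T (K i) w \<and> (\<forall>t\<in>car S. w (\<phi> t) -[T] \<psi> t : K i)
  \<and> (i = 0 \<longrightarrow> w = cst)" for i w
 define Q where "Q i w w' \<longleftrightarrow> (\<forall>a\<in>car A. w' a -[T] w a : K i)" for i and w w' :: "'a => nat => 'a"
 have "\<exists>f. \<forall>i. P i (f i) \<and> Q i (f i) (f (Suc i))"
 proof (rule dependent_nat_choice)
  have "cst (\<phi> t) -[T] \<psi> t : K 0" if t: "t : car S" for t
  proof -
   have "cst (\<phi> t) j \<ominus> \<psi> t j : cpw (1 - j)" for j
   proof (cases j)
    case 0
    then have "cst (\<phi> t) j \<ominus> \<psi> t j = \<zero>"
     using \<psi>(3)[OF t] \<phi>_closed[OF t] by (simp add: cst_def minus_eq r_neg)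
    then show ?thesis using ideal_zero_closed[OF cpw_ideal] by metis
   next
    case (Suc n)
    then show ?thesis using \<psi>c[OF t] by (simp add: cst_def)
   qed
   moreover have "cst (\<phi> t) -[T] \<psi> t : car T" using \<phi>_closed[OF t] \<psi>c[OF t] by simp
   ultimately show ?thesis
    unfolding W_iff T_minus[OF cst_closed[OF \<phi>_closed[OF t]] \<psi>c[OF t]] by simp
  qed
  then show "\<exists>w. P 0 w" unfolding P_def
   using ring_hom_imp_hom_mod[OF ring_axioms T.ring_axioms cst_hom W_ideal] by blast
  show "\<exists>w'. P (Suc i) w' \<and> Q i w w'" if "P i w" for i w
   using series_step[OF \<psi>(1,2), of i w] that unfolding P_def Q_def by auto
 qed
 then obtain w where w: "!!i. P i (w i)" "!!i. Q i (w i) (w (Suc i))" by blast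
 have wh: "hom_mod A T (K i) (w i)" and w\<phi>: "t : car S ==> w i (\<phi> t) -[T] \<psi> t : K i"
  and w0: "w 0 = cst" for i t
  using w(1)[of i] w(1)[of 0] by (auto simp: P_def)
 have wc: "w i a : car T" if "a : car A" for i a using hom_mod_closed[OF wh that] .
 have step: "w (i + d) a -[T] w i a : K i" if a: "a : car A" for i d a
 proof (induction d)
  case 0
  then show ?case using K_zero wc a by simp
 next
  case (Suc d)
  have "w (Suc (i + d)) a -[T] w (i + d) a : K (i + d)" using w(2) a by (simp add: Q_def)
  then have 1: "w (Suc (i + d)) a -[T] w (i + d) a : K i" using K_antimono[of i "i + d"] by auto
  have "(w (Suc (i + d)) a -[T] w (i + d) a) +[T] (w (i + d) a -[T] w i a) : K i"
   by (rule T.ideal_add_closed[OF W_ideal 1 Suc])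
  moreover have "(w (Suc (i + d)) a -[T] w (i + d) a) +[T] (w (i + d) a -[T] w i a)
   = w (Suc (i + d)) a -[T] w i a"
   by (rule T.minus_trans[OF wc[OF a] wc[OF a] wc[OF a]])
  ultimately show ?case by simp
 qed
 have step_j: "w (i + d) a j \<ominus> w i a j : cpw (2 ^ i - j)" if a: "a : car A" for i d a j
  using step[OF a, of i d] unfolding T_minus[OF wc[OF a] wc[OF a]] by (simp add: W_iff)
 \<comment> \<open>The coefficient at j converges along the shifted index k + j: congruence modulo
   W(2^(k+j)) controls it modulo the power 2^(k+j) - j, which is at least k.\<close>
 define \<tau> where "\<tau> a j = (SOME b. b : car A \<and> (\<forall>k. b \<ominus> w (k + j) a j : cpw k))" for a j
 have \<tau>: "\<tau> a j : car A \<and> (\<forall>k. \<tau> a j \<ominus> w (k + j) a j : cpw k)" if a: "a : car A" for a j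
 proof -
  have "w (Suc k + j) a j \<ominus> w (k + j) a j : cpw k" for k
  proof (rule cpw_mono[of _ "2 ^ (k + j) - j"])
   have "k + j < 2 ^ (k + j)" by (rule less_exp)
   then show "k <= 2 ^ (k + j) - j" by arith
  qed (use step_j[OF a, of "k + j" 1] in simp)
  then have "\<exists>b. b : car A \<and> (\<forall>k. b \<ominus> w (k + j) a j : cpw k)"
   using limit[of "\<lambda>k. w (k + j) a j"] T_closed[OF wc[OF a]] by blast
  then show ?thesis unfolding \<tau>_def by (rule someI_ex)
 qed
 have \<tau>c: "\<tau> a : car T" if "a : car A" for a using \<tau>[OF that] by (simp add: T_carrier_iff)
 have \<tau>w: "\<tau> a -[T] w i a : K i" if a: "a : car A" for a i
 proof -
  have "\<tau> a j \<ominus> w i a j : cpw (2 ^ i - j)" for j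
  proof -
   \<comment> \<open>The index i + 2^i + j is far enough out for \<tau> to agree with the
     approximation beyond the power 2^i - j, and it comes after i, so \<open>step_j\<close>
     applies.\<close>
   have "\<tau> a j \<ominus> w (i + (2 ^ i + j)) a j : cpw (i + 2 ^ i)"
    using \<tau>[OF a, of j] by (metis add.assoc)
   then have 1: "\<tau> a j \<ominus> w (i + (2 ^ i + j)) a j : cpw (2 ^ i - j)"
    by (rule cpw_mono[rotated]) simp
   have "(\<tau> a j \<ominus> w (i + (2 ^ i + j)) a j) \<oplus> (w (i + (2 ^ i + j)) a j \<ominus> w i a j) : cpw (2 ^ i - j)"
    by (rule ideal_add_closed[OF cpw_ideal 1 step_j[OF a]])
   moreover have "(\<tau> a j \<ominus> w (i + (2 ^ i + j)) a j) \<oplus> (w (i + (2 ^ i + j)) a j \<ominus> w i a j)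
    = \<tau> a j \<ominus> w i a j"
    using \<tau>[OF a, of j] T_closed[OF wc[OF a, of i], of j] T_closed[OF wc[OF a, of "i + (2 ^ i + j)"], of j]
    by algebra
   ultimately show ?thesis by simp
  qed
  moreover have "\<tau> a -[T] w i a : car T" using \<tau>c[OF a] wc[OF a] by simp
  ultimately show ?thesis unfolding W_iff T_minus[OF \<tau>c[OF a] wc[OF a]] by simp
 qed
 have "hom_mod A T (K i) \<tau>" for i
  by (rule hom_mod_cong[OF ring_axioms T.ring_axioms W_ideal wh]) (use \<tau>c \<tau>w in auto)
 then have "\<tau> : ring_hom A T"
  by (rule hom_mod_separated[where K = K, OF ring_axioms T.ring_axioms]) (use W_separated[OF separated] in blast)
 moreover have "\<tau> (\<phi> t) = \<psi> t" if t: "t : car S" for t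
 proof (rule K_eq[OF \<tau>c[OF \<phi>_closed[OF t]] \<psi>c[OF t]])
  fix i
  have "(\<tau> (\<phi> t) -[T] w i (\<phi> t)) +[T] (w i (\<phi> t) -[T] \<psi> t) : K i"
   by (rule T.ideal_add_closed[OF W_ideal \<tau>w[OF \<phi>_closed[OF t]] w\<phi>[OF t]])
  moreover have "(\<tau> (\<phi> t) -[T] w i (\<phi> t)) +[T] (w i (\<phi> t) -[T] \<psi> t) = \<tau> (\<phi> t) -[T] \<psi> t"
   by (rule T.minus_trans[OF \<tau>c[OF \<phi>_closed[OF t]] wc[OF \<phi>_closed[OF t]] \<psi>c[OF t]])
  ultimately show "\<tau> (\<phi> t) -[T] \<psi> t : K i" by simp
 qed
 moreover have "\<tau> a 0 \<ominus> a : \<cc>" if a: "a : car A" for a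
 proof -
  have "\<tau> a -[T] cst a : W 1" using \<tau>w[OF a, of 0] w0 by simp
  then have "\<tau> a 0 \<ominus> cst a 0 : cpw 1"
   unfolding T_minus[OF \<tau>c[OF a] cst_closed[OF a]] W_iff by (metis diff_zero)
  then show ?thesis using ideal_pow_1[OF cc_ideal] by (simp add: cst_def)
 qed
 ultimately show ?thesis by blast
qed

end

section \<open>The iterated twisted Leibniz rule\<close>

locale q_deriv = zq_point A h x p for A (structure) and h x p +
 fixes \<sigma> \<delta> :: "'a => 'a"
 assumes \<sigma>_hom: "\<sigma> : ring_hom A A" and \<sigma>_h: "\<sigma> (h w) = h w" and \<sigma>_x: "\<sigma> x = h qv \<otimes> x"
  and \<delta>_closed [simp]: "f : car A ==> \<delta> f : car A"
  and \<delta>_add: "f : car A ==> g : car A ==> \<delta> (f \<oplus> g) = \<delta> f \<oplus> \<delta> g"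
  and \<delta>_mult: "f : car A ==> g : car A ==> \<delta> (f \<otimes> g) = \<delta> f \<otimes> g \<oplus> \<sigma> f \<otimes> \<delta> g"
  and \<delta>_x: "\<delta> x = \<one>" and \<delta>_h: "\<delta> (h w) = \<zero>"
begin

lemma \<sigma>_closed [simp]: "f : car A ==> \<sigma> f : car A"
 using ring_hom_closed[OF \<sigma>_hom] .

lemma \<sigma>_mult: "f : car A ==> g : car A ==> \<sigma> (f \<otimes> g) = \<sigma> f \<otimes> \<sigma> g"
 using ring_hom_mult[OF \<sigma>_hom] .

text \<open>Commutativity of \<open>A\<close> applied to \<open>x \<otimes> f\<close> determines \<open>\<sigma>\<close> by \<open>\<delta>\<close>.\<close>

lemma \<sigma>_eq:
 assumes f: "f : car A"
 shows "\<sigma> f = f \<oplus> h (qv - 1) \<otimes> x \<otimes> \<delta> f"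
proof -
 have "\<delta> f \<otimes> x \<oplus> \<sigma> f = \<delta> (f \<otimes> x)"
  using f by (simp add: \<delta>_mult \<delta>_x)
 also have "... = f \<oplus> h qv \<otimes> x \<otimes> \<delta> f"
  using f by (subst m_comm) (simp_all add: \<delta>_mult \<delta>_x \<sigma>_x)
 finally have "\<sigma> f = (f \<oplus> h qv \<otimes> x \<otimes> \<delta> f) \<ominus> \<delta> f \<otimes> x"
  using f by (metis \<delta>_closed \<sigma>_closed a_comm add.inv_solve_right m_closed minus_eq x_closed a_closed)
 also have "... = f \<oplus> (h qv \<ominus> \<one>) \<otimes> x \<otimes> \<delta> f"
  using f \<delta>_closed[OF f] h_closed[of qv] x_closed by algebra
 finally show ?thesis by (simp add: h_minus)
qed

lemma \<sigma>_x_pow: "\<sigma> (x [^] i) = h (qv ^ i) \<otimes> x [^] (i :: nat)"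
proof (induction i)
 case 0
 then show ?case using ring_hom_one[OF \<sigma>_hom] by simp
next
 case (Suc i)
 then show ?case by (simp add: \<sigma>_mult \<sigma>_x h_mult m_ac)
qed

lemma \<delta>_x_pow: "\<delta> (x [^] i) = h (q_int i) \<otimes> x [^] (i - 1)"
proof (induction i)
 case 0
 have "\<delta> \<one> = \<zero>" using \<delta>_h[of 1] by simp
 then show ?case by simp
next
 case (Suc i)
 have "\<delta> (x [^] Suc i) = h (q_int i) \<otimes> x [^] (i - 1) \<otimes> x \<oplus> h (qv ^ i) \<otimes> x [^] i"
  using Suc by (simp add: \<delta>_mult \<sigma>_x_pow \<delta>_x)
 also have "h (q_int i) \<otimes> x [^] (i - 1) \<otimes> x = h (q_int i) \<otimes> x [^] i"
  by (cases i) (simp_all add: m_assoc)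
 finally show ?case by (simp add: q_int_Suc(2) h_add l_distr)
qed

lemma \<delta>_coeff:
 assumes a: "a : car A"
 shows "\<delta> (h g \<otimes> x [^] i \<otimes> a) = h (g * q_int i) \<otimes> x [^] (i - 1) \<otimes> a \<oplus> h (g * qv ^ i) \<otimes> x [^] i \<otimes> \<delta> a"
proof -
 have "\<delta> (h g \<otimes> x [^] i \<otimes> a) = \<delta> (h g \<otimes> (x [^] i \<otimes> a))" using a by (simp add: m_assoc)
 also have "... = h g \<otimes> \<delta> (x [^] i \<otimes> a)" using a by (simp add: \<delta>_mult \<delta>_h \<sigma>_h)
 also have "\<delta> (x [^] i \<otimes> a) = h (q_int i) \<otimes> x [^] (i - 1) \<otimes> a \<oplus> h (qv ^ i) \<otimes> x [^] i \<otimes> \<delta> a"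
  using a by (simp add: \<delta>_mult \<sigma>_x_pow \<delta>_x_pow)
 finally show ?thesis using a by (simp add: r_distr h_mult m_assoc)
qed

lemma \<sigma>_coeff:
 assumes a: "a : car A"
 shows "\<sigma> (h g \<otimes> x [^] i \<otimes> a)
  = h (g * qv ^ i) \<otimes> x [^] i \<otimes> a \<oplus> h (g * qv ^ i * (qv - 1)) \<otimes> x [^] Suc i \<otimes> \<delta> a"
proof -
 have "\<sigma> (h g \<otimes> x [^] i \<otimes> a) = h (g * qv ^ i) \<otimes> x [^] i \<otimes> \<sigma> a"
  using a by (simp add: \<sigma>_mult \<sigma>_h \<sigma>_x_pow h_mult m_assoc)
 also have "... = h (g * qv ^ i) \<otimes> x [^] i \<otimes> a \<oplus> h (g * qv ^ i) \<otimes> x [^] i \<otimes> (h (qv - 1) \<otimes> x \<otimes> \<delta> a)"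
  using a by (subst \<sigma>_eq) (simp_all add: r_distr)
 also have "h (g * qv ^ i) \<otimes> x [^] i \<otimes> (h (qv - 1) \<otimes> x \<otimes> \<delta> a)
  = h (g * qv ^ i * (qv - 1)) \<otimes> x [^] Suc i \<otimes> \<delta> a"
  using a by (simp add: h_mult m_ac)
 finally show ?thesis .
qed

text \<open>Coefficients that arise when the derivation is applied to (c x^i f) v with c x^i a
  structure constant: \<open>lc1\<close> if x^i is differentiated, \<open>lc2\<close> if f or v
  alone is, \<open>lc4\<close> from the summand (q-1)x \<delta>(f) of \<sigma>(f) next to the
  derivative of v.\<close>

definition lc1 :: "nat => nat => nat => 'a" where
 "lc1 k n m = h (str_at qdp_str n m k * q_int (n + m - k)) \<otimes> x [^] (n + m - k - 1)"
definition lc2 :: "nat => nat => nat => 'a" where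
 "lc2 k n m = h (str_at qdp_str n m k * qv ^ (n + m - k)) \<otimes> x [^] (n + m - k)"
definition lc4 :: "nat => nat => nat => 'a" where
 "lc4 k n m = h (str_at qdp_str n m k * qv ^ (n + m - k) * (qv - 1)) \<otimes> x [^] Suc (n + m - k)"

lemma lc_closed [simp]: "lc1 k n m : car A" "lc2 k n m : car A" "lc4 k n m : car A"
 by (auto simp: lc1_def lc2_def lc4_def)

lemma lc_eq_0: "k < n \<or> k < m ==> lc1 k n m = \<zero>" "k < n \<or> k < m ==> lc2 k n m = \<zero>"
 "k < n \<or> k < m ==> lc4 k n m = \<zero>"
 by (auto simp: lc1_def lc2_def lc4_def str_at_qdp_eq_0)

abbreviation sf :: "(nat => 'a) => nat => 'a" where
 "sf f n \<equiv> case n of 0 => \<zero> | Suc j => f j"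

text \<open>This is \<open>qdp_str_rec\<close> with the powers of x put back; the shifts in n and m
  record which of f and v has been differentiated.\<close>

lemma s_Suc:
 "dp.s n m (Suc k) = lc1 k n m \<oplus> sf (\<lambda>j. lc2 k j m) n
  \<oplus> sf (lc2 k n) m
  \<oplus> sf (\<lambda>j. sf (lc4 k j) m) n"
proof (cases "n <= Suc k \<and> m <= Suc k \<and> Suc k <= n + m")
 case True
 define i where "i = n + m - Suc k"
 define a where "a = Suc k - m"
 define b where "b = Suc k - n"
 have n: "n = i + a" and m: "m = i + b" and k: "Suc k = i + a + b"
  using True by (auto simp: i_def a_def b_def)
 have "dp.s n m (Suc k) = h (qdp_str (i + a) (i + b) i) \<otimes> x [^] i"
 proof -
  have e: "n + m - Suc k = i" by (simp add: i_def)
  show ?thesis unfolding tw_el_def str_at_def e using True by (simp add: n[symmetric] m[symmetric])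
 qed
 also have "... = h (if a > 0 \<and> b > 0 then q_int (Suc i) * qdp_str (i + a) (i + b) (Suc i) else 0) \<otimes> x [^] i
  \<oplus> h (if a > 0 then qv ^ i * qdp_str (i + a - 1) (i + b) i else 0) \<otimes> x [^] i
  \<oplus> h (if b > 0 then qv ^ i * qdp_str (i + a) (i + b - 1) i else 0) \<otimes> x [^] i
  \<oplus> h (if i > 0 then qv ^ (i - 1) * (qv - 1) * qdp_str (i + a - 1) (i + b - 1) (i - 1) else 0) \<otimes> x [^] i"
  using k by (subst qdp_str_rec) (simp_all only: h_add l_distr h_closed nat_pow_closed x_closed a_closed)
 also have "h (if a > 0 \<and> b > 0 then q_int (Suc i) * qdp_str (i + a) (i + b) (Suc i) else 0) \<otimes> x [^] i
  = lc1 k n m"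
 proof -
  have e: "n + m - k = Suc i" using n m k by simp
  have "str_at qdp_str n m k = qdp_str (i + a) (i + b) (Suc i)"
   unfolding str_at_def e using n m k by simp
  moreover have "qdp_str (i + a) (i + b) (Suc i) = 0" if "\<not> (a > 0 \<and> b > 0)"
   using that by (intro qdp_str_eq_0) auto
  ultimately show ?thesis by (simp add: lc1_def e mult.commute)
 qed
 also have "h (if a > 0 then qv ^ i * qdp_str (i + a - 1) (i + b) i else 0) \<otimes> x [^] i
  = sf (\<lambda>j. lc2 k j m) n"
 proof (cases n)
  case (Suc n')
  have e: "n' + m - k = i" using n m k Suc by simp
  have le: "k <= n' + m" using n m k Suc by simp
  have "str_at qdp_str n' m k = qdp_str n' (i + b) i" using le e m by (simp add: str_at_def)
  moreover have "qdp_str n' (i + b) i = 0" if "a = 0"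
   using that n Suc by (intro qdp_str_eq_0) auto
  moreover have "i + a - 1 = n'" using n Suc by simp
  ultimately show ?thesis using Suc by (simp add: lc2_def e mult.commute)
 qed (use n in simp)
 also have "h (if b > 0 then qv ^ i * qdp_str (i + a) (i + b - 1) i else 0) \<otimes> x [^] i
  = sf (lc2 k n) m"
 proof (cases m)
  case (Suc m')
  have e: "n + m' - k = i" using n m k Suc by simp
  have le: "k <= n + m'" using n m k Suc by simp
  have "str_at qdp_str n m' k = qdp_str (i + a) m' i" using le e n by (simp add: str_at_def)
  moreover have "qdp_str (i + a) m' i = 0" if "b = 0"
   using that m Suc by (intro qdp_str_eq_0) auto
  moreover have "i + b - 1 = m'" using m Suc by simp
  ultimately show ?thesis using Suc by (simp add: lc2_def e mult.commute)
 qed (use m in simp)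
 also have "h (if i > 0 then qv ^ (i - 1) * (qv - 1) * qdp_str (i + a - 1) (i + b - 1) (i - 1) else 0) \<otimes> x [^] i
  = sf (\<lambda>j. sf (lc4 k j) m) n"
 proof (cases i)
  case 0
  have "lc4 k n' m' = \<zero>" if "n = Suc n'" "m = Suc m'" for n' m'
  proof -
   have "n' + m' < k" using that 0 n m k by simp
   then show ?thesis by (simp add: lc4_def str_at_def)
  qed
  then show ?thesis using 0 by (simp split: nat.split)
 next
  case (Suc i')
  obtain n' m' where nm: "n = Suc n'" "m = Suc m'" using Suc n m by simp
  have e: "n' + m' - k = i'" using n m k Suc nm by simp
  have le: "k <= n' + m'" using n m k Suc nm by simp
  have nm': "i + a - 1 = n'" "i + b - 1 = m'" using n m nm by auto
  have "str_at qdp_str n' m' k = qdp_str (i + a - 1) (i + b - 1) i'"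
   using le e unfolding nm' by (simp add: str_at_def)
  then have "lc4 k n' m' = h (qdp_str (i + a - 1) (i + b - 1) i' * qv ^ i' * (qv - 1)) \<otimes> x [^] i"
   unfolding lc4_def e Suc by (rule arg_cong)
  also have "qdp_str (i + a - 1) (i + b - 1) i' * qv ^ i' * (qv - 1)
   = qv ^ i' * (qv - 1) * qdp_str (i + a - 1) (i + b - 1) i'"
   by (simp add: algebra_simps)
  finally show ?thesis using Suc nm by simp
 qed
 finally show ?thesis .
next
 case False
 then consider "n > Suc k" | "m > Suc k" | "n + m < Suc k" by linarith
 then have z: "dp.s n m (Suc k) = \<zero> \<and> lc1 k n m = \<zero> \<and>
  sf (\<lambda>j. lc2 k j m) n = \<zero> \<and>
  sf (lc2 k n) m = \<zero> \<and>
  sf (\<lambda>j. sf (lc4 k j) m) n = \<zero>"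
 proof cases
  case 1
  then show ?thesis by (auto simp: dp.s_eq_0 lc_eq_0 split: nat.split)
 next
  case 2
  then show ?thesis by (auto simp: dp.s_eq_0 lc_eq_0 split: nat.split)
 next
  case 3
  \<comment> \<open>At k = n + m the structure constant need not vanish, but the factor
    \<open>q_int 0\<close> does.\<close>
  have "lc1 k n m = \<zero>"
   using 3 by (cases "k = n + m") (simp_all add: lc1_def str_at_def)
  then show ?thesis using 3
   by (auto simp: dp.s_eq_0 lc2_def lc4_def str_at_def split: nat.split)
 qed
 then show ?thesis by simp
qed

end

lemma (in abelian_monoid) finsum_shift:
 assumes "!!n. f n : car G" "f N = \<zero>"
 shows "(\<Oplus>n\<in>{..N}. f n) = (\<Oplus>n\<in>{..N}. case n of 0 => \<zero> | Suc j => f j)"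
proof (cases N)
 case 0
 then show ?thesis using assms by simp
next
 case (Suc N')
 have "(\<Oplus>n\<in>{..N}. case n of 0 => \<zero> | Suc j => f j)
   = (\<Oplus>n\<in>{..N'}. f n) \<oplus> \<zero>"
  unfolding Suc by (subst finsum_Suc2) (use assms in \<open>auto split: nat.split\<close>)
 also have "... = (\<Oplus>n\<in>{..N'}. f n)" using assms by simp
 also have "... = (\<Oplus>n\<in>{..N}. f n)"
  using assms Suc by (intro finsum_neutral) (auto simp: le_Suc_eq)
 finally show ?thesis by simp
qed

locale q_deriv_module = q_deriv A h x p \<sigma> \<delta> + M: module A M
 for A :: "('a, 'z) ring_scheme" (structure) and h x p \<sigma> \<delta> and M :: "('a, 'm, 'y) module_scheme" +
 fixes d :: "'m => 'm"
 assumes d_closed [simp]: "v : car M ==> d v : car M"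
  and d_add: "v : car M ==> w : car M ==> d (v +[M] w) = d v +[M] d w"
  and d_smult: "f : car A ==> v : car M ==> d (f \<odot>[M] v) = \<delta> f \<odot>[M] v +[M] \<sigma> f \<odot>[M] d v"
begin

lemma d_pow_closed [simp]: "v : car M ==> (d ^^ k) v : car M"
 by (induction k) auto

lemma \<delta>_pow_closed [simp]: "f : car A ==> (\<delta> ^^ k) f : car A"
 by (induction k) auto

lemma d_zero: "d \<zero>[M] = \<zero>[M]"
proof -
 have "d \<zero>[M] +[M] d \<zero>[M] = d \<zero>[M] +[M] \<zero>[M]" using d_add[of "\<zero>[M]" "\<zero>[M]"] by simp
 then show ?thesis by (metis M.M.add.l_cancel M.M.zero_closed d_closed)
qed

lemma d_finsum: "(!!i. i : I ==> f i : car M) ==> d (\<Oplus>[M]i\<in>I. f i) = (\<Oplus>[M]i\<in>I. d (f i))"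
proof (induction I rule: infinite_finite_induct)
 case (insert i I)
 then show ?case by (subst (1 2) M.M.finsum_insert) (auto simp: d_add intro!: M.M.finsum_closed)
qed (simp_all add: d_zero)

lemma d_pow_add: "v : car M ==> w : car M ==> (d ^^ k) (v +[M] w) = (d ^^ k) v +[M] (d ^^ k) w"
 by (induction k) (auto simp: d_add)

lemma d_coeff:
 assumes f: "f : car A" and v: "v : car M"
 shows "d ((dp.s n m k \<otimes> f) \<odot>[M] v) =
  (lc1 k n m \<otimes> f) \<odot>[M] v +[M] (lc2 k n m \<otimes> \<delta> f) \<odot>[M] v +[M] ((lc2 k n m \<otimes> f) \<odot>[M] d v
   +[M] (lc4 k n m \<otimes> \<delta> f) \<odot>[M] d v)"
 using f v
 by (simp add: d_smult tw_el_def \<delta>_coeff \<sigma>_coeff lc1_def lc2_def lc4_def M.smult_l_distr del: nat_pow_Suc)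

text \<open>The bound N stays free in the induction: \<open>finsum_shift\<close> needs a vanishing
  last term, and the coefficients at index N > k are zero.\<close>

lemma leibniz_aux:
 assumes f: "f : car A" and v: "v : car M"
 shows "k <= N ==> (d ^^ k) (f \<odot>[M] v) =
  (\<Oplus>[M]n\<in>{..N}. \<Oplus>[M]m\<in>{..N}. (dp.s n m k \<otimes> (\<delta> ^^ n) f) \<odot>[M] (d ^^ m) v)"
proof (induction k arbitrary: N)
 case 0
 have "(\<Oplus>[M]n\<in>{..N}. \<Oplus>[M]m\<in>{..N}. (dp.s n m 0 \<otimes> (\<delta> ^^ n) f) \<odot>[M] (d ^^ m) v)
  = (\<Oplus>[M]m\<in>{..N}. (dp.s 0 m 0 \<otimes> (\<delta> ^^ 0) f) \<odot>[M] (d ^^ m) v)"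
  by (rule M.M.finsum_single) (use f v in \<open>auto intro!: M.M.finsum_zero M.M.finsum_closed simp: dp.s_eq_0 simp del: funpow.simps\<close>)
 also have "... = (dp.s 0 0 0 \<otimes> (\<delta> ^^ 0) f) \<odot>[M] (d ^^ 0) v"
  by (rule M.M.finsum_single) (use f v in \<open>auto simp: dp.s_eq_0 simp del: funpow.simps\<close>)
 finally show ?case using f v by (simp add: dp.s_0)
next
 case (Suc k)
 let ?X = "\<lambda>n m. (\<delta> ^^ n) f"
 let ?S = "\<lambda>g. \<Oplus>[M]n\<in>{..N}. \<Oplus>[M]m\<in>{..N}. g n m"
 define Y where "Y c n m = (c \<otimes> (\<delta> ^^ n) f) \<odot>[M] (d ^^ m) v" for c n m
 have Y: "Y c n m : car M" if "c : car A" for c n m using that f v by (simp add: Y_def)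
 have Y0: "Y \<zero> n m = \<zero>[M]" for n m using f v by (simp add: Y_def)
 have Yadd: "Y (a \<oplus> b) n m = Y a n m +[M] Y b n m" if "a : car A" "b : car A" for a b n m
  using that f v by (simp add: Y_def l_distr M.smult_l_distr)
 have sum2: "?S (\<lambda>n m. g n m +[M] g' n m)
  = ?S (\<lambda>n m. g n m) +[M] ?S (\<lambda>n m. g' n m)"
  if "!!n m. g n m : car M" "!!n m. g' n m : car M" for g g'
 proof -
  have "?S (\<lambda>n m. g n m +[M] g' n m)
   = (\<Oplus>[M]n\<in>{..N}. (\<Oplus>[M]m\<in>{..N}. g n m) +[M] (\<Oplus>[M]m\<in>{..N}. g' n m))"
   using that by (intro M.M.finsum_cong2' M.M.finsum_addf) (auto intro!: M.M.finsum_closed)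
  also have "... = ?S (\<lambda>n m. g n m) +[M] ?S (\<lambda>n m. g' n m)"
   using that by (intro M.M.finsum_addf) (auto intro!: M.M.finsum_closed)
  finally show ?thesis .
 qed
 have kN: "k < N" using Suc.prems by simp
 have "(d ^^ Suc k) (f \<odot>[M] v) = d (?S (\<lambda>n m. Y (dp.s n m k) n m))"
  using Suc.IH[of N] kN by (simp add: Y_def)
 also have "... = ?S (\<lambda>n m. d (Y (dp.s n m k) n m))"
  using Y by (subst d_finsum, auto intro!: M.M.finsum_closed M.M.finsum_cong2' d_finsum)
 also have "... = ?S (\<lambda>n m. (Y (lc1 k n m) n m +[M] Y (lc2 k n m) (Suc n) m)
   +[M] (Y (lc2 k n m) n (Suc m) +[M] Y (lc4 k n m) (Suc n) (Suc m)))"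
  using Y by (intro M.M.finsum_cong2' M.M.finsum_closed) (use f v in \<open>auto simp: Y_def d_coeff\<close>)
 also have "... = (?S (\<lambda>n m. Y (lc1 k n m) n m)
   +[M] ?S (\<lambda>n m. Y (lc2 k n m) (Suc n) m))
   +[M] (?S (\<lambda>n m. Y (lc2 k n m) n (Suc m))
   +[M] ?S (\<lambda>n m. Y (lc4 k n m) (Suc n) (Suc m)))"
  using Y by (simp add: sum2)
 also have "?S (\<lambda>n m. Y (lc2 k n m) (Suc n) m)
  = ?S (\<lambda>n m. Y (sf (\<lambda>j. lc2 k j m) n) n m)"
 proof -
  have "?S (\<lambda>n m. Y (lc2 k n m) (Suc n) m)
   = (\<Oplus>[M]n\<in>{..N}. case n of 0 => \<zero>[M] | Suc j => \<Oplus>[M]m\<in>{..N}. Y (lc2 k j m) (Suc j) m)"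
   using kN Y by (intro M.M.finsum_shift M.M.finsum_zero) (auto simp: lc_eq_0 Y0 intro!: M.M.finsum_closed)
  also have "... = ?S (\<lambda>n m. Y (sf (\<lambda>j. lc2 k j m) n) n m)"
   by (rule M.M.finsum_cong2') (use Y in \<open>auto simp: Y0 split: nat.split intro!: M.M.finsum_closed\<close>)
  finally show ?thesis .
 qed
 also have "?S (\<lambda>n m. Y (lc2 k n m) n (Suc m))
  = ?S (\<lambda>n m. Y (sf (lc2 k n) m) n m)"
 proof (rule M.M.finsum_cong2')
  fix n
  have "(\<Oplus>[M]m\<in>{..N}. Y (lc2 k n m) n (Suc m))
   = (\<Oplus>[M]m\<in>{..N}. case m of 0 => \<zero>[M] | Suc m' => Y (lc2 k n m') n (Suc m'))"
   using kN Y by (intro M.M.finsum_shift) (simp_all add: lc_eq_0 Y0)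
  also have "... = (\<Oplus>[M]m\<in>{..N}. Y (sf (lc2 k n) m) n m)"
   by (rule M.M.finsum_cong2') (use Y in \<open>auto simp: Y0 split: nat.split\<close>)
  finally show "(\<Oplus>[M]m\<in>{..N}. Y (lc2 k n m) n (Suc m)) = ..." .
 qed (use Y in \<open>auto split: nat.split intro!: M.M.finsum_closed\<close>)
 also have "?S (\<lambda>n m. Y (lc4 k n m) (Suc n) (Suc m))
  = ?S (\<lambda>n m. Y (sf (\<lambda>j. sf (lc4 k j) m) n) n m)"
 proof -
  have in_shift: "(\<Oplus>[M]m\<in>{..N}. Y (lc4 k j m) (Suc j) (Suc m))
   = (\<Oplus>[M]m\<in>{..N}. Y (case m of 0 => \<zero> | Suc m' => lc4 k j m') (Suc j) m)" for j
  proof -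
   have "(\<Oplus>[M]m\<in>{..N}. Y (lc4 k j m) (Suc j) (Suc m))
    = (\<Oplus>[M]m\<in>{..N}. case m of 0 => \<zero>[M] | Suc m' => Y (lc4 k j m') (Suc j) (Suc m'))"
    using kN Y by (intro M.M.finsum_shift) (simp_all add: lc_eq_0 Y0)
   also have "... = (\<Oplus>[M]m\<in>{..N}. Y (case m of 0 => \<zero> | Suc m' => lc4 k j m') (Suc j) m)"
    by (rule M.M.finsum_cong2') (use Y in \<open>auto simp: Y0 split: nat.split\<close>)
   finally show ?thesis .
  qed
  have "?S (\<lambda>n m. Y (lc4 k n m) (Suc n) (Suc m))
   = (\<Oplus>[M]n\<in>{..N}. case n of 0 => \<zero>[M] | Suc j => \<Oplus>[M]m\<in>{..N}. Y (lc4 k j m) (Suc j) (Suc m))"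
   using kN Y by (intro M.M.finsum_shift M.M.finsum_zero) (auto simp: lc_eq_0 Y0 intro!: M.M.finsum_closed)
  also have "... = ?S (\<lambda>n m. Y (sf (\<lambda>j. sf (lc4 k j) m) n) n m)"
   unfolding in_shift
   by (rule M.M.finsum_cong2') (use Y in \<open>auto simp: Y0 split: nat.split intro!: M.M.finsum_closed\<close>)
  finally show ?thesis .
 qed
 also have "(?S (\<lambda>n m. Y (lc1 k n m) n m)
   +[M] ?S (\<lambda>n m. Y (sf (\<lambda>j. lc2 k j m) n) n m))
   +[M] (?S (\<lambda>n m. Y (sf (lc2 k n) m) n m)
   +[M] ?S (\<lambda>n m. Y (sf (\<lambda>j. sf (lc4 k j) m) n) n m))
  = ?S (\<lambda>n m. Y (dp.s n m (Suc k)) n m)"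
 proof -
  have cl: "sf (\<lambda>j. lc2 k j m) n : car A" "sf (lc2 k n) m : car A"
   "sf (\<lambda>j. sf (lc4 k j) m) n : car A" for n m
   by (auto split: nat.split)
  have "Y (dp.s n m (Suc k)) n m = (Y (lc1 k n m) n m +[M] Y (sf (\<lambda>j. lc2 k j m) n) n m)
   +[M] (Y (sf (lc2 k n) m) n m
   +[M] Y (sf (\<lambda>j. sf (lc4 k j) m) n) n m)" for n m
   unfolding s_Suc using cl Y by (simp add: Yadd M.M.a_assoc)
  then show ?thesis using Y cl by (simp add: sum2)
 qed
 finally show ?case by (simp add: Y_def)
qed

theorem leibniz:
 assumes "f : car A" "v : car M"
 shows "(d ^^ k) (f \<odot>[M] v) =
  (\<Oplus>[M]n\<in>{..k}. \<Oplus>[M]m\<in>{..k}. (dp.s n m k \<otimes> (\<delta> ^^ n) f) \<odot>[M] (d ^^ m) v)"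
 by (rule leibniz_aux[OF assms order_refl])

end

definition self_module :: "('a, 'b) ring_scheme => ('a, 'a) module" where
 "self_module A = \<lparr>carrier = car A, monoid.mult = monoid.mult A, one = one A,
  ring.zero = ring.zero A, add = add A, smult = monoid.mult A\<rparr>"

lemma self_module_simps [simp]:
 "car (self_module A) = car A" "\<zero>[self_module A] = \<zero>[A]"
 "a +[self_module A] b = a +[A] b" "a \<odot>[self_module A] b = a *[A] b"
 "a *[self_module A] b = a *[A] b" "\<one>[self_module A] = \<one>[A]"
 by (simp_all add: self_module_def)

lemma finsum_self_module [simp]: "finsum (self_module A) f I = finsum A f I"
 by (simp add: finsum_def finprod_def self_module_def)

lemma (in cring) module_self_module: "module R (self_module R)"
proof (rule moduleI[OF is_cring])
 show "abelian_group (self_module R)"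
  by (rule abelian_groupI) (auto simp: a_ac intro: l_neg[THEN subst] add.l_inv_ex)
qed (auto simp: m_assoc l_distr r_distr)

context q_deriv
begin

text \<open>The iterated Leibniz rule for A as a module over itself says exactly that the divided
  Taylor series is multiplicative.\<close>

lemma taylor_hom: "(\<lambda>f k. (\<delta> ^^ k) f) : ring_hom A dp.T"
proof -
 interpret q_deriv_module A h x p \<sigma> \<delta> "self_module A" \<delta>
  by (intro q_deriv_module.intro q_deriv_axioms module_self_module q_deriv_module_axioms.intro)
   (auto simp: \<delta>_add \<delta>_mult)
 have \<delta>1: "(\<delta> ^^ k) \<one> = (if k = 0 then \<one> else \<zero>)" for k
 proof (induction k)
  case (Suc k)
  have "\<delta> \<one> = \<zero>" using \<delta>_h[of 1] by simp
  moreover have "\<delta> \<zero> = \<zero>" using \<delta>_h[of 0] by simp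
  ultimately show ?case using Suc by simp
 qed simp
 show ?thesis
 proof (rule ring_hom_memI)
  fix f g assume f: "f : car A" and g: "g : car A"
  show "(\<lambda>k. (\<delta> ^^ k) f) : car dp.T" using f by (simp add: dp.T_carrier_iff)
  show "(\<lambda>k. (\<delta> ^^ k) (f \<oplus> g)) = (\<lambda>k. (\<delta> ^^ k) f) +[dp.T] (\<lambda>k. (\<delta> ^^ k) g)"
   using f g d_pow_add by (simp add: dp.T_simps(4))
  show "(\<lambda>k. (\<delta> ^^ k) (f \<otimes> g)) = (\<lambda>k. (\<delta> ^^ k) f) *[dp.T] (\<lambda>k. (\<delta> ^^ k) g)"
  proof
   fix k
   have "(\<delta> ^^ k) (f \<otimes> g) = (\<Oplus>n\<in>{..k}. \<Oplus>m\<in>{..k}. (dp.s n m k \<otimes> (\<delta> ^^ n) f) \<otimes> (\<delta> ^^ m) g)"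
    using leibniz[of f g k] f g by simp
   also have "... = ((\<lambda>k. (\<delta> ^^ k) f) *[dp.T] (\<lambda>k. (\<delta> ^^ k) g)) k"
    unfolding dp.T_simps(5) using f g by (intro finsum_cong2' finsum_closed) (auto simp: m_ac)
   finally show "(\<delta> ^^ k) (f \<otimes> g) = ((\<lambda>k. (\<delta> ^^ k) f) *[dp.T] (\<lambda>k. (\<delta> ^^ k) g)) k" .
  qed
 next
  show "(\<lambda>k. (\<delta> ^^ k) \<one>) = \<one>[dp.T]" by (auto simp: \<delta>1 dp.T_simps(2))
 qed
qed

end

section \<open>The canonical homomorphisms attached to a topologically \'etale coordinate\<close>

text \<open>If 1 were in (p, q-1), evaluation at q = 1 would make p divide 1.\<close>

lemma loc_Zq_of_int_poly:
 assumes "prime p"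
 shows "Fract f 1 : car (loc_Zq p)"
proof -
 have "1 ~: {[:int p:] * u + [:-1, 1:] * v | u v. True}"
 proof
  assume "1 : {[:int p:] * u + [:-1, 1:] * v | u v. True}"
  then obtain u v where "1 = [:int p:] * u + [:-1, 1:] * v" by auto
  then have "poly 1 1 = poly ([:int p:] * u + [:-1, 1:] * v) 1" by metis
  then have "1 = int p * poly u 1" by simp
  then have "int p dvd 1" by (metis dvd_triv_left)
  then show False using assms by (simp add: prime_nat_iff)
 qed
 then show ?thesis unfolding loc_Zq_def partial_object.select_convs by blast
qed

lemma (in algebra) smult_one_hom: "(\<lambda>r. r \<odot>[M] \<one>[M]) : ring_hom R M"
proof (rule ring_hom_memI)
 fix a b assume a: "a : car R" and b: "b : car R"
 have "(a \<odot>[M] \<one>[M]) *[M] (b \<odot>[M] \<one>[M]) = a \<odot>[M] (\<one>[M] *[M] (b \<odot>[M] \<one>[M]))"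
  using a b by (intro smult_assoc2) auto
 also have "... = (a \<otimes> b) \<odot>[M] \<one>[M]" using a b by (simp add: smult_assoc1)
 finally show "(a \<otimes> b) \<odot>[M] \<one>[M] = (a \<odot>[M] \<one>[M]) *[M] (b \<odot>[M] \<one>[M])" by simp
qed (auto simp: smult_l_distr)

lemma (in algebra) smult_eq_mult:
 "r : car R ==> b : car M ==> r \<odot>[M] b = (r \<odot>[M] \<one>[M]) *[M] b"
 by (simp add: smult_assoc2)

locale zq_base =
 fixes p :: nat and R :: "(int poly fract, 'r) module"
 assumes prime: "prime p" and algR: "algebra (loc_Zq p) R"
begin

sublocale LR: algebra "loc_Zq p" R by (rule algR)

definition hR :: "int poly => 'r" where "hR f = Fract f 1 \<odot>[R] \<one>[R]"

lemma hR_closed [simp]: "hR f : car R"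
 unfolding hR_def using loc_Zq_of_int_poly[OF prime] by simp

lemma hR_add: "hR (f + g) = hR f +[R] hR g"
 using ring_hom_add[OF LR.smult_one_hom loc_Zq_of_int_poly[OF prime] loc_Zq_of_int_poly[OF prime], of f g]
 by (simp add: hR_def loc_Zq_def)

lemma hR_mult: "hR (f * g) = hR f *[R] hR g"
 using ring_hom_mult[OF LR.smult_one_hom loc_Zq_of_int_poly[OF prime] loc_Zq_of_int_poly[OF prime], of f g]
 by (simp add: hR_def loc_Zq_def)

lemma hR_one: "hR 1 = \<one>[R]"
 using ring_hom_one[OF LR.smult_one_hom] by (simp add: hR_def loc_Zq_def One_fract_def)

lemma zq_image_hR: "zq_image R B f = hR f \<odot>[B] \<one>[B]"
 by (simp add: zq_image_def hR_def)

lemma q_in_hR: "q_in R B = hR qv \<odot>[B] \<one>[B]"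
 by (simp add: zq_image_hR qv_def)

lemma R_cring: "cring R"
 using algR by (simp add: algebra_def)

end

lemma eval_UP_hom:
 assumes "cring R" "cring B" "f : ring_hom R B" "b : car B"
 shows "eval R B f b : ring_hom (UP R) B" "r : car R ==> eval R B f b (monom (UP R) r 0) = f r"
  "eval R B f b (monom (UP R) \<one>[R] 1) = b"
proof -
 interpret H: UP_pre_univ_prop R B f "UP R" by (simp_all add: UP_pre_univ_propI assms)
 show "eval R B f b : ring_hom (UP R) B" by (rule H.eval_ring_hom[OF assms(4)])
 show "r : car R ==> eval R B f b (monom (UP R) r 0) = f r" by (rule H.eval_const[OF assms(4)])
 show "eval R B f b (monom (UP R) \<one>[R] 1) = b" by (rule H.eval_monom1[OF assms(4)])
qed

lemma UP_hom_ext: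
 assumes "cring R" "cring B" "f : ring_hom (UP R) B" "g : ring_hom (UP R) B"
  and c: "!!r. r : car R ==> f (monom (UP R) r 0) = g (monom (UP R) r 0)"
  and m: "f (monom (UP R) \<one>[R] 1) = g (monom (UP R) \<one>[R] 1)"
  and t: "t : car (UP R)"
 shows "f t = g t"
proof -
 interpret R: cring R by fact
 interpret B: cring B by fact
 interpret U: UP_cring R "UP R" by (simp add: UP_cring_def assms(1))
 have k: "(\<lambda>a. monom (UP R) a 0) : ring_hom R (UP R)" by (rule U.const_ring_hom)
 have "f \<circ> (\<lambda>a. monom (UP R) a 0) : ring_hom R B" by (rule ring_hom_trans[OF k assms(3)])
 then interpret H: UP_pre_univ_prop R B "f \<circ> (\<lambda>a. monom (UP R) a 0)" "UP R"
  by (simp_all add: UP_pre_univ_propI assms(1,2))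
 have mc: "monom (UP R) \<one>[R] 1 : car (UP R)" by simp
 show ?thesis
 proof (rule H.UP_hom_unique[where s = "f (monom (UP R) \<one>[R] 1)"])
  show "ring_hom_cring (UP R) B f" "ring_hom_cring (UP R) B g"
   using assms(3,4) by (auto intro: H.ring_homD)
  show "f (monom (UP R) \<one>[R] 1) : car B" by (rule ring_hom_closed[OF assms(3) mc])
 qed (use c m t in auto)
qed

locale q_setting = zq_base p R for p :: nat and R :: "(int poly fract, 'r) module" +
 fixes A :: "('r, 'a) module" (structure) and x :: 'a and \<sigma> \<delta> :: "'a => 'a"
 assumes algA: "algebra R A"
  and compl: "adically_complete A (pq_ideal p A (q_in R A))"
  and coord: "top_etale_coordinate p R A x"
  and endo: "is_q_endomorphism R A x \<sigma>"
  and deri: "is_q_derivation R A x \<sigma> \<delta>"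
begin

sublocale Ac: cring A using algA by (simp add: algebra_def)

sublocale RA: algebra R A by (rule algA)

abbreviation hA :: "int poly => 'a" where "hA \<equiv> zq_image R A"
abbreviation \<iota> :: "'r => 'a" where "\<iota> r \<equiv> r \<odot>[A] \<one>"

lemma A_cring: "cring A"
 using algA by (simp add: algebra_def)

lemma \<iota>_hom: "\<iota> : ring_hom R A"
 by (rule RA.smult_one_hom)

lemma hA_eq: "hA f = \<iota> (hR f)"
 by (rule zq_image_hR)

lemma x_closed: "x : car A"
 using coord by (simp add: top_etale_coordinate_def)

sublocale zp: zq_point A hA x p
proof (intro zq_point.intro zq_point_axioms.intro A_cring)
 show "hA f : car A" for f using ring_hom_closed[OF \<iota>_hom hR_closed] by (simp add: hA_eq)
 show "hA (f + g) = hA f \<oplus> hA g" for f g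
  using ring_hom_add[OF \<iota>_hom hR_closed hR_closed] by (simp add: hA_eq hR_add)
 show "hA (f * g) = hA f \<otimes> hA g" for f g
  using ring_hom_mult[OF \<iota>_hom hR_closed hR_closed] by (simp add: hA_eq hR_mult)
 show "hA 1 = \<one>" using ring_hom_one[OF \<iota>_hom] by (simp add: hA_eq hR_one)
qed (rule x_closed)

lemma q_in_A: "q_in R A = hA qv"
 by (simp add: qv_def)

lemma \<delta>_one: "\<delta> \<one> = \<zero>"
proof -
 have d: "\<delta> \<one> : car A" using deri by (auto simp: is_q_derivation_def)
 have "\<sigma> \<one> = \<one>" using endo ring_hom_one by (auto simp: is_q_endomorphism_def)
 moreover have "\<delta> (\<one> \<otimes> \<one>) = \<delta> \<one> \<otimes> \<one> \<oplus> \<sigma> \<one> \<otimes> \<delta> \<one>"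
  using deri Ac.one_closed unfolding is_q_derivation_def by blast
 ultimately have "\<delta> \<one> \<oplus> \<delta> \<one> = \<delta> \<one> \<oplus> \<zero>" using d by simp
 then show ?thesis using d by (metis Ac.add.l_cancel Ac.zero_closed)
qed

lemma \<delta>_\<iota>: "r : car R ==> \<delta> (\<iota> r) = \<zero>"
 using deri \<delta>_one by (auto simp: is_q_derivation_def)

lemma \<sigma>_\<iota>: "r : car R ==> \<sigma> (\<iota> r) = \<iota> r"
 using endo ring_hom_one[of \<sigma> A A] by (auto simp: is_q_endomorphism_def)

sublocale qd: q_deriv A hA x p \<sigma> \<delta>
proof (intro q_deriv.intro q_deriv_axioms.intro zp.zq_point_axioms)
 show "\<sigma> : ring_hom A A" "\<sigma> x = hA qv \<otimes> x"
  using endo by (auto simp: is_q_endomorphism_def q_in_A)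
 show "\<sigma> (hA w) = hA w" "\<delta> (hA w) = \<zero>" for w
  unfolding hA_eq by (rule \<sigma>_\<iota> \<delta>_\<iota>; simp)+
qed (use deri in \<open>auto simp: is_q_derivation_def\<close>)

abbreviation S where "S \<equiv> UP R"
abbreviation \<phi> where "\<phi> \<equiv> eval R A \<iota> x"
abbreviation qS where "qS \<equiv> q_in R S"
abbreviation X1 where "X1 \<equiv> monom S \<one>[R] 1"

sublocale U: UP_cring R S
 by (simp_all add: UP_cring_def R_cring)

lemmas \<phi>_hom = eval_UP_hom[OF R_cring A_cring \<iota>_hom x_closed]

lemma qS_eq: "qS = monom S (hR qv) 0"
 using U.monom_mult_is_smult[OF hR_closed, of "\<one>[S]" qv]
 by (simp add: q_in_hR)

lemma qS_closed: "qS : car S"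
 unfolding qS_eq by simp

sublocale ep: etale_point A hA x p S qS \<phi>
proof (intro etale_point.intro complete_point.intro complete_point_axioms.intro etale_point_axioms.intro zp.zq_point_axioms)
 show "adically_complete A (pq_ideal p A (hA qv))" using compl by (simp add: q_in_A)
 show "cring S" by (rule U.UP_cring)
 show "\<phi> qS = hA qv" unfolding qS_eq \<phi>_hom(2)[OF hR_closed] by (simp add: hA_eq)
 show "formally_etale S (pq_ideal p S qS) A \<phi>"
  using coord by (simp add: top_etale_coordinate_def Let_def)
qed (rule qS_closed \<phi>_hom)+

sublocale nwe: etale_twisted A hA x p S qS \<phi> newton_str
 by (intro etale_twisted.intro ep.etale_point_axioms zp.twisted_newton)

sublocale dpe: etale_twisted A hA x p S qS \<phi> qdp_str
 by (intro etale_twisted.intro ep.etale_point_axioms zp.twisted_qdp)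

abbreviation "NT \<equiv> tw_ring A hA x newton_str"
abbreviation "DT \<equiv> tw_ring A hA x qdp_str"

definition \<psi> :: "(nat => 'r) => nat => 'a" where
 "\<psi> = eval R NT (\<lambda>r. zp.nw.cst (\<iota> r)) (zp.nw.cst x +[NT] zp.nw.basis 1)"

lemma \<psi>_hom: "\<psi> : ring_hom S NT" "r : car R ==> \<psi> (monom S r 0) = zp.nw.cst (\<iota> r)"
 "\<psi> X1 = zp.nw.cst x +[NT] zp.nw.basis 1"
proof -
 have 1: "(\<lambda>r. zp.nw.cst (\<iota> r)) : ring_hom R NT"
  using ring_hom_trans[OF \<iota>_hom zp.nw.cst_hom] by (simp add: comp_def)
 have 2: "zp.nw.cst x +[NT] zp.nw.basis 1 : car NT" using x_closed by simp
 show "\<psi> : ring_hom S NT" "r : car R ==> \<psi> (monom S r 0) = zp.nw.cst (\<iota> r)"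
  "\<psi> X1 = zp.nw.cst x +[NT] zp.nw.basis 1"
  unfolding \<psi>_def using eval_UP_hom[OF R_cring zp.nw.T_cring 1 2] by auto
qed

lemma \<psi>_q: "\<psi> qS = zp.nw.cst (hA qv)"
 unfolding qS_eq \<psi>_hom(2)[OF hR_closed] by (simp add: hA_eq)

lemma \<psi>_0: "t : car S ==> \<psi> t 0 = \<phi> t"
proof -
 assume t: "t : car S"
 have c: "\<psi> t : car NT" using ring_hom_closed[OF \<psi>_hom(1) t] .
 have "(zp.ev 0 \<circ> \<psi>) t = \<phi> t"
 proof (rule UP_hom_ext[OF R_cring A_cring ring_hom_trans[OF \<psi>_hom(1) zp.ev_hom] \<phi>_hom(1)])
  show "(zp.ev 0 \<circ> \<psi>) (monom S r 0) = \<phi> (monom S r 0)" if "r : car R" for r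
   using that ring_hom_closed[OF \<iota>_hom that] \<phi>_hom(2) by (simp add: \<psi>_hom zp.ev_cst)
  have "zp.ev 0 (zp.nw.cst x +[NT] zp.nw.basis 1) = x"
   using x_closed ring_hom_add[OF zp.ev_hom, of "zp.nw.cst x" "zp.nw.basis 1" 0] zp.ev_basis_1[of 0]
   by (simp add: zp.ev_cst)
  then show "(zp.ev 0 \<circ> \<psi>) X1 = \<phi> X1" by (simp only: comp_apply \<psi>_hom \<phi>_hom)
 qed fact
 then show ?thesis using c by (simp add: zp.ev_def zp.ev_el_def)
qed

definition \<tau> :: "'a => nat => 'a" where
 "\<tau> = (SOME \<tau>. \<tau> : ring_hom A NT \<and> (\<forall>t\<in>car S. \<tau> (\<phi> t) = \<psi> t) \<and> (\<forall>a\<in>car A. \<tau> a 0 \<ominus> a : zp.\<cc>))"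

lemma \<tau>: "\<tau> : ring_hom A NT" "t : car S ==> \<tau> (\<phi> t) = \<psi> t"
 "a : car A ==> \<tau> a 0 \<ominus> a : zp.\<cc>"
proof -
 have "\<exists>\<tau>. \<tau> : ring_hom A NT \<and> (\<forall>t\<in>car S. \<tau> (\<phi> t) = \<psi> t) \<and> (\<forall>a\<in>car A. \<tau> a 0 \<ominus> a : zp.\<cc>)"
  using nwe.series_lift[OF \<psi>_hom(1) \<psi>_q \<psi>_0] by blast
 from someI_ex[OF this, folded \<tau>_def]
 show "\<tau> : ring_hom A NT" "t : car S ==> \<tau> (\<phi> t) = \<psi> t"
  "a : car A ==> \<tau> a 0 \<ominus> a : zp.\<cc>" by auto
qed

lemma \<tau>_closed: "a : car A ==> \<tau> a : car NT"
 using ring_hom_closed[OF \<tau>(1)] .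

lemma \<tau>_\<iota>: "r : car R ==> \<tau> (\<iota> r) = zp.nw.cst (\<iota> r)"
 using \<tau>(2)[of "monom S r 0"] \<psi>_hom(2)[of r] \<phi>_hom(2)[of r] by simp

lemma \<tau>_x: "\<tau> x = zp.nw.cst x +[NT] zp.nw.basis 1"
 using \<tau>(2)[of X1] \<psi>_hom(3) \<phi>_hom(3) by simp

lemma \<sigma>_pow_hom: "\<sigma> ^^ i : ring_hom A A"
proof (induction i)
 case 0
 then show ?case by (auto simp: ring_hom_def)
next
 case (Suc i)
 then show ?case unfolding funpow.simps(2) by (rule ring_hom_trans[OF _ qd.\<sigma>_hom])
qed

lemma \<sigma>_pow_x: "(\<sigma> ^^ i) x = hA (qv ^ i) \<otimes> x"
proof (induction i)
 case (Suc i)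
 then show ?case
  using x_closed by (simp add: qd.\<sigma>_mult qd.\<sigma>_h qd.\<sigma>_x zp.h_mult Ac.m_ac)
qed (use x_closed in simp)

lemma \<sigma>_cong: "a : car A ==> (\<sigma> ^^ i) a \<ominus> a : zp.\<cc>"
proof (induction i)
 case 0
 then show ?case using Ac.ideal_zero_closed[OF zp.cc_ideal] by (simp add: Ac.minus_eq Ac.r_neg)
next
 case (Suc i)
 have c: "(\<sigma> ^^ i) a : car A" using ring_hom_closed[OF \<sigma>_pow_hom Suc.prems] .
 have "genideal A {hA qv \<ominus> \<one>} <= zp.\<cc>"
  using Ac.pq_ideal_q[of "hA qv" p] by (intro Ac.genideal_minimal[OF zp.cc_ideal]) auto
 then have 1: "\<sigma> ((\<sigma> ^^ i) a) \<ominus> (\<sigma> ^^ i) a : zp.\<cc>"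
  using endo c by (auto simp: is_q_endomorphism_def q_in_A)
 have "(\<sigma> ((\<sigma> ^^ i) a) \<ominus> (\<sigma> ^^ i) a) \<oplus> ((\<sigma> ^^ i) a \<ominus> a) : zp.\<cc>"
  by (rule Ac.ideal_add_closed[OF zp.cc_ideal 1 Suc.IH[OF Suc.prems]])
 then show ?case using Ac.minus_trans[OF qd.\<sigma>_closed[OF c] c Suc.prems] by simp
qed

text \<open>The factor j = 0 of the product is q^i - 1, a multiple of q - 1.\<close>

lemma ev_el_cc: "0 < k ==> zp.ev_el i k : zp.\<cc>"
proof -
 assume "0 < k"
 then have "[:- (qv ^ 0), 1:] dvd newton_poly k"
  unfolding newton_poly_def by (intro dvd_prodI) auto
 then have "poly [:- (qv ^ 0), 1:] (qv ^ i) dvd poly (newton_poly k) (qv ^ i)"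
  by (metis dvd_def poly_mult)
 then have "qv ^ i - 1 dvd poly (newton_poly k) (qv ^ i)" by simp
 moreover have "qv - 1 dvd qv ^ i - 1" using q_int_mult by (metis dvd_triv_right)
 ultimately obtain w where "poly (newton_poly k) (qv ^ i) = (qv - 1) ^ 1 * w"
  by (metis dvd_def dvd_trans power_one_right)
 then show ?thesis
  using zp.cpw_mult_r[OF zp.h_q1_pow[of 1 w] Ac.nat_pow_closed[OF x_closed, of k]] Ac.ideal_pow_1[OF zp.cc_ideal]
  by (simp add: zp.ev_el_def)
qed

lemma ev_cong: "F : car NT ==> zp.ev i F \<ominus> F 0 : zp.\<cc>"
proof -
 assume F: "F : car NT"
 have e0: "zp.ev_el i 0 = \<one>" by (simp add: zp.ev_el_def)
 have c: "F 0 : car A" using F zp.nw.T_closed by blast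
 show ?thesis
 proof (cases i)
  case 0
  then have "zp.ev i F \<ominus> F 0 = \<zero>" using c F by (simp add: zp.ev_def e0[unfolded 0] Ac.minus_eq Ac.r_neg)
  then show ?thesis using Ac.ideal_zero_closed[OF zp.cc_ideal] by simp
 next
  case (Suc i')
  have z: "(\<Oplus>k\<in>{..i'}. F (Suc k) \<otimes> zp.ev_el i (Suc k)) : zp.\<cc>"
   using F by (intro Ac.ideal_finsum_closed[OF zp.cc_ideal] ideal.I_l_closed[OF zp.cc_ideal] ev_el_cc) auto
  have "zp.ev i F = (\<Oplus>k\<in>{..i'}. F (Suc k) \<otimes> zp.ev_el i (Suc k)) \<oplus> F 0 \<otimes> zp.ev_el i 0"
   unfolding zp.ev_def Suc by (rule Ac.finsum_Suc2) (use F in auto)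
  then have "zp.ev i F \<ominus> F 0 = (\<Oplus>k\<in>{..i'}. F (Suc k) \<otimes> zp.ev_el i (Suc k))"
   using c ideal.Icarr[OF zp.cc_ideal z] by (simp add: e0 Ac.minus_eq Ac.a_assoc Ac.r_neg)
  then show ?thesis using z by simp
 qed
qed

text \<open>Both sides fix R, send x to q^i x and are the identity modulo (p,q-1), so
  \<open>endo_unique\<close> applies.\<close>

lemma ev_\<tau>:
 assumes a: "a : car A"
 shows "zp.ev i (\<tau> a) = (\<sigma> ^^ i) a"
proof -
 have hom: "zp.ev i \<circ> \<tau> : ring_hom A A" by (rule ring_hom_trans[OF \<tau>(1) zp.ev_hom])
 have "(zp.ev i \<circ> \<tau>) a = (\<sigma> ^^ i) a"
 proof (rule ep.endo_unique[OF hom \<sigma>_pow_hom])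
  have x_eq: "zp.ev i (zp.nw.cst x +[NT] zp.nw.basis 1) = hA (qv ^ i) \<otimes> x"
  proof -
   have "zp.ev i (zp.nw.cst x +[NT] zp.nw.basis 1) = x \<oplus> hA (qv ^ i - 1) \<otimes> x"
    using x_closed ring_hom_add[OF zp.ev_hom, of "zp.nw.cst x" "zp.nw.basis 1" i] zp.ev_basis_1[of i]
    by (simp add: zp.ev_cst)
   also have "... = hA (1 + (qv ^ i - 1)) \<otimes> x"
    unfolding zp.h_add using x_closed by (simp add: Ac.l_distr)
   finally show ?thesis by simp
  qed
  show "(zp.ev i \<circ> \<tau>) (\<phi> t) = (\<sigma> ^^ i) (\<phi> t)" if t: "t : car S" for t
  proof -
   have "((zp.ev i \<circ> \<tau>) \<circ> \<phi>) t = ((\<sigma> ^^ i) \<circ> \<phi>) t"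
   proof (rule UP_hom_ext[OF R_cring A_cring ring_hom_trans[OF \<phi>_hom(1) hom] ring_hom_trans[OF \<phi>_hom(1) \<sigma>_pow_hom]])
    fix r assume r: "r : car R"
    have "(\<sigma> ^^ i) (\<iota> r) = \<iota> r" by (induction i) (simp_all add: \<sigma>_\<iota>[OF r])
    then show "((zp.ev i \<circ> \<tau>) \<circ> \<phi>) (monom S r 0) = ((\<sigma> ^^ i) \<circ> \<phi>) (monom S r 0)"
     using ring_hom_closed[OF \<iota>_hom r] by (simp add: \<phi>_hom(2)[OF r] \<tau>_\<iota>[OF r] zp.ev_cst)
   next
    show "((zp.ev i \<circ> \<tau>) \<circ> \<phi>) X1 = ((\<sigma> ^^ i) \<circ> \<phi>) X1"
     by (simp only: comp_apply \<phi>_hom(3) \<tau>_x x_eq \<sigma>_pow_x)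
   qed fact
   then show ?thesis by simp
  qed
  show "(zp.ev i \<circ> \<tau>) (hA qv) = hA qv"
   using \<tau>_\<iota>[OF hR_closed, of qv] zp.ev_cst[of "hA qv" i] by (simp add: hA_eq)
  show "(zp.ev i \<circ> \<tau>) b \<ominus> (\<sigma> ^^ i) b : zp.\<cc>" if b: "b : car A" for b
  proof -
   have c: "zp.ev i (\<tau> b) : car A" "\<tau> b 0 : car A" "(\<sigma> ^^ i) b : car A"
    using ring_hom_closed[OF zp.ev_hom \<tau>_closed[OF b]] zp.nw.T_closed[OF \<tau>_closed[OF b]]
     ring_hom_closed[OF \<sigma>_pow_hom b] by auto
   have "zp.ev i (\<tau> b) \<ominus> b : zp.\<cc>"
    using Ac.ideal_add_closed[OF zp.cc_ideal ev_cong[OF \<tau>_closed[OF b]] \<tau>(3)[OF b], of i]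
     Ac.minus_trans[OF c(1,2) b] by simp
   from Ac.ideal_minus_closed[OF zp.cc_ideal this \<sigma>_cong[OF b, of i]]
   have "(zp.ev i (\<tau> b) \<ominus> b) \<ominus> ((\<sigma> ^^ i) b \<ominus> b) : zp.\<cc>" .
   also have "(zp.ev i (\<tau> b) \<ominus> b) \<ominus> ((\<sigma> ^^ i) b \<ominus> b) = zp.ev i (\<tau> b) \<ominus> (\<sigma> ^^ i) b"
    using c b by (simp add: Ac.minus_eq Ac.minus_add Ac.a_ac Ac.r_neg Ac.r_neg2)
   finally show ?thesis by simp
  qed
 qed fact
 then show ?thesis by simp
qed

text \<open>Evaluation at i = 0 reads off the constant coefficient, and \<open>\<sigma> ^^ 0\<close>
  is the identity.\<close>

lemma \<tau>_0: "a : car A ==> \<tau> a 0 = a"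
 using ev_\<tau>[of a 0] zp.nw.T_closed[OF \<tau>_closed, of a 0]
 by (simp add: zp.ev_def zp.ev_el_def)

text \<open>The series with coefficients (k)_q! \<tau>_k(f) and the one with coefficients
  \<delta>^k(f) both define homomorphisms from A to the divided series, with constant coefficient f
  and equal values on R and x. They coincide by \<open>series_unique\<close>, without any division
  by factorials.\<close>

theorem \<delta>_pow_\<tau>:
 assumes a: "a : car A"
 shows "(\<delta> ^^ k) a = hA (q_fact k) \<otimes> \<tau> a k"
proof -
 have hom: "zp.sc \<circ> \<tau> : ring_hom A DT" by (rule ring_hom_trans[OF \<tau>(1) zp.sc_hom])
 have sc_cst: "zp.sc (zp.nw.cst b) = zp.dp.cst b" if "b : car A" for b
  using that by (auto simp: zp.sc_def zp.nw.cst_def zp.dp.cst_def)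
 have \<delta>0: "\<delta> \<zero> = \<zero>" using qd.\<delta>_h[of 0] by simp
 have "(zp.sc \<circ> \<tau>) a = (\<lambda>k. (\<delta> ^^ k) a)"
 proof (rule dpe.series_unique[OF hom qd.taylor_hom])
  show "(zp.sc \<circ> \<tau>) (\<phi> t) = (\<lambda>k. (\<delta> ^^ k) (\<phi> t))" if t: "t : car S" for t
  proof -
   have "((zp.sc \<circ> \<tau>) \<circ> \<phi>) t = ((\<lambda>a k. (\<delta> ^^ k) a) \<circ> \<phi>) t"
   proof (rule UP_hom_ext[OF R_cring zp.dp.T_cring ring_hom_trans[OF \<phi>_hom(1) hom] ring_hom_trans[OF \<phi>_hom(1) qd.taylor_hom]])
    fix r assume r: "r : car R"
    have "(\<delta> ^^ k) (\<iota> r) = (if k = 0 then \<iota> r else \<zero>)" for k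
    proof (induction k)
     case (Suc k)
     then show ?case using \<delta>0 \<delta>_\<iota>[OF r] by simp
    qed simp
    then show "((zp.sc \<circ> \<tau>) \<circ> \<phi>) (monom S r 0) = ((\<lambda>a k. (\<delta> ^^ k) a) \<circ> \<phi>) (monom S r 0)"
     using ring_hom_closed[OF \<iota>_hom r] by (simp add: \<phi>_hom(2)[OF r] \<tau>_\<iota>[OF r] sc_cst) (simp add: zp.dp.cst_def)
   next
    have dk: "(\<delta> ^^ k) x = (if k = 0 then x else if k = 1 then \<one> else \<zero>)" for k
    proof (induction k)
     case (Suc k)
     then show ?case using \<delta>0 \<delta>_one qd.\<delta>_x by simp
    qed simp
    have "zp.sc (\<tau> x) k = (\<delta> ^^ k) x" for k
    proof -
     have "q_fact 1 = 1" using q_fact_Suc[of 0] by simp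
     then show ?thesis unfolding dk using x_closed
      by (auto simp: \<tau>_x zp.sc_def zp.nw.T_simps(4) zp.nw.cst_def zp.nw.basis_def)
    qed
    then show "((zp.sc \<circ> \<tau>) \<circ> \<phi>) X1 = ((\<lambda>a k. (\<delta> ^^ k) a) \<circ> \<phi>) X1"
     unfolding comp_apply \<phi>_hom(3) by (intro ext)
   qed fact
   then show ?thesis by simp
  qed
  show "(zp.sc \<circ> \<tau>) (hA qv) = zp.dp.cst (hA qv)"
   using \<tau>_\<iota>[OF hR_closed, of qv] sc_cst[of "hA qv"] by (simp add: hA_eq)
  show "(zp.sc \<circ> \<tau>) b 0 = (\<delta> ^^ 0) b" if "b : car A" for b
   using that \<tau>_0[OF that] by (simp add: zp.sc_def)
 qed fact
 then have "(\<delta> ^^ k) a = (zp.sc \<circ> \<tau>) a k" by metis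
 then show ?thesis by (simp add: zp.sc_def)
qed

end

section \<open>Tensor products\<close>

lemma add_pow_int_0: "add_pow B (0 :: int) a = \<zero>[B]"
 by (simp add: add_pow_def)

definition balanced ::
 "('a, 'c) ring_scheme => ('a, 'm, 'd) module_scheme => ('a, 'n, 'e) module_scheme =>
  ('t, 'f) ring_scheme => ('m => 'n => 't) => bool" where
 "balanced A M N B g \<longleftrightarrow>
  (\<forall>s\<in>car M. \<forall>t\<in>car N. g s t : car B) \<and>
  (\<forall>s\<in>car M. \<forall>s'\<in>car M. \<forall>t\<in>car N. g (s +[M] s') t = g s t +[B] g s' t) \<and>
  (\<forall>s\<in>car M. \<forall>t\<in>car N. \<forall>t'\<in>car N. g s (t +[N] t') = g s t +[B] g s t') \<and>
  (\<forall>a\<in>car A. \<forall>s\<in>car M. \<forall>t\<in>car N. g (a \<odot>[M] s) t = g s (a \<odot>[N] t))"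

lemma balancedI:
 assumes "!!s t. s : car M ==> t : car N ==> g s t : car B"
  "!!s s' t. s : car M ==> s' : car M ==> t : car N ==> g (s +[M] s') t = g s t +[B] g s' t"
  "!!s t t'. s : car M ==> t : car N ==> t' : car N ==> g s (t +[N] t') = g s t +[B] g s t'"
  "!!a s t. a : car A ==> s : car M ==> t : car N ==> g (a \<odot>[M] s) t = g s (a \<odot>[N] t)"
 shows "balanced A M N B g"
 using assms unfolding balanced_def by blast

lemma balancedD:
 assumes "balanced A M N B g"
 shows "!!s t. s : car M ==> t : car N ==> g s t : car B"
  "!!s s' t. s : car M ==> s' : car M ==> t : car N ==> g (s +[M] s') t = g s t +[B] g s' t"
  "!!s t t'. s : car M ==> t : car N ==> t' : car N ==> g s (t +[N] t') = g s t +[B] g s t'"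
  "!!a s t. a : car A ==> s : car M ==> t : car N ==> g (a \<odot>[M] s) t = g s (a \<odot>[N] t)"
 using assms unfolding balanced_def by blast+

locale tensor_pair =
 fixes A :: "('a, 'c) ring_scheme" and M :: "('a, 'm, 'd) module_scheme"
  and N :: "('a, 'n, 'e) module_scheme"
 assumes M_grp: "abelian_group M" and N_grp: "abelian_group N"
  and M_smult: "a : car A ==> s : car M ==> a \<odot>[M] s : car M"
  and N_smult: "a : car A ==> t : car N ==> a \<odot>[N] t : car N"
begin

sublocale M: abelian_group M by (rule M_grp)
sublocale N: abelian_group N by (rule N_grp)

abbreviation "F \<equiv> free_Abelian_group (car M \<times> car N)"
abbreviation "H \<equiv> tensor_rels A M N"
abbreviation "MN \<equiv> tensor A M N"
abbreviation "cl \<equiv> tensor_class A M N"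
abbreviation "supp c \<equiv> Poly_Mapping.keys c <= car M \<times> car N"

sublocale F: comm_group F by (rule abelian_free_Abelian_group)

lemma supp_add: "supp c ==> supp d ==> supp (c + d)"
 by (rule order_trans[OF keys_add Un_least])

lemma supp_diff: "supp c ==> supp d ==> supp (c - d)"
 by (rule order_trans[OF keys_diff Un_least])

lemma supp_of: "s : car M ==> t : car N ==> supp (frag_of (s, t))"
 by simp

definition gens :: "('m \<times> 'n \<Rightarrow>\<^sub>0 int) set" where
 "gens = {frag_of (s +[M] s', t) - frag_of (s, t) - frag_of (s', t) | s s' t.
    s : car M \<and> s' : car M \<and> t : car N} \<union>
   {frag_of (s, t +[N] t') - frag_of (s, t) - frag_of (s, t') | s t t'.
    s : car M \<and> t : car N \<and> t' : car N} \<union>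
   {frag_of (a \<odot>[M] s, t) - frag_of (s, a \<odot>[N] t) | a s t.
    a : car A \<and> s : car M \<and> t : car N}"

lemma H_eq: "H = generate F gens"
 by (simp add: tensor_rels_def gens_def)

lemma gens_carrier: "gens <= car F"
proof
 fix c assume "c : gens"
 then consider s s' t where "c = frag_of (s +[M] s', t) - frag_of (s, t) - frag_of (s', t)"
   "s : car M" "s' : car M" "t : car N"
  | s t t' where "c = frag_of (s, t +[N] t') - frag_of (s, t) - frag_of (s, t')"
   "s : car M" "t : car N" "t' : car N"
  | a s t where "c = frag_of (a \<odot>[M] s, t) - frag_of (s, a \<odot>[N] t)"
   "a : car A" "s : car M" "t : car N"
  unfolding gens_def by blast
 then have "supp c"
  by cases (simp_all only: supp_diff supp_of M.a_closed N.a_closed M_smult N_smult)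
 then show "c : car F" by simp
qed

lemma H_subgroup: "subgroup H F"
 unfolding H_eq by (rule F.generate_is_subgroup[OF gens_carrier])

lemma H_normal: "H \<lhd> F"
 by (rule F.subgroup_imp_normal[OF H_subgroup])

sublocale H: normal H F by (rule H_normal)

lemma cl_def': "cl c = H #>\<^bsub>F\<^esub> c"
 by (simp add: tensor_class_def)

lemma MN_simps: "car MN = car (F Mod H)" "Z +[MN] Y = Z <#>\<^bsub>F\<^esub> Y" "\<zero>[MN] = H"
 by (simp_all add: tensor_def Let_def FactGroup_def)

lemma cl_closed: "supp c ==> cl c : car MN"
 by (auto simp: MN_simps cl_def' FactGroup_def RCOSETS_def)

lemma MN_E:
 assumes "Z : car MN"
 obtains c where "supp c" "Z = cl c"
 using assms by (auto simp: MN_simps cl_def' FactGroup_def RCOSETS_def)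

lemma cl_add: "supp c ==> supp d ==> cl (c + d) = cl c +[MN] cl d"
 using H.rcos_sum[of c d] by (simp add: MN_simps cl_def')

lemma cl_zero: "cl 0 = \<zero>[MN]"
 using F.coset_mult_one[OF H.subset] by (simp add: MN_simps cl_def')

lemma MN_abelian_group: "abelian_group MN"
proof (rule abelian_groupI)
 show "Z +[MN] Y : car MN" if "Z : car MN" "Y : car MN" for Z Y
  using that by (elim MN_E) (metis cl_add cl_closed supp_add)
 show "\<zero>[MN] : car MN" using cl_closed[of 0] cl_zero by simp
 show "Z +[MN] Y +[MN] W = Z +[MN] (Y +[MN] W)"
  if Z: "Z : car MN" and Y: "Y : car MN" and W: "W : car MN" for Z Y W
 proof -
  obtain c where c: "supp c" "Z = cl c" using Z by (elim MN_E)
  obtain d where d: "supp d" "Y = cl d" using Y by (elim MN_E)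
  obtain e where e: "supp e" "W = cl e" using W by (elim MN_E)
  show ?thesis
   using c d e by (simp only: supp_add cl_add[symmetric] add.assoc)
 qed
 show "Z +[MN] Y = Y +[MN] Z" if Z: "Z : car MN" and Y: "Y : car MN" for Z Y
 proof -
  obtain c where c: "supp c" "Z = cl c" using Z by (elim MN_E)
  obtain d where d: "supp d" "Y = cl d" using Y by (elim MN_E)
  show ?thesis using c d cl_add[of c d] cl_add[of d c] by (simp add: add.commute)
 qed
 show "\<zero>[MN] +[MN] Z = Z" if Z: "Z : car MN" for Z
 proof -
  obtain c where c: "supp c" "Z = cl c" using Z by (elim MN_E)
  show ?thesis using c cl_add[of 0 c] cl_zero by simp
 qed
 show "\<exists>Y\<in>car MN. Y +[MN] Z = \<zero>[MN]" if Z: "Z : car MN" for Z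
 proof -
  obtain c where c: "supp c" "Z = cl c" using Z by (elim MN_E)
  have "supp (- c)" using c by simp
  then show ?thesis using c cl_add[of "- c" c] cl_zero by (intro bexI[of _ "cl (- c)"] cl_closed) auto
 qed
qed

sublocale MN: abelian_group MN by (rule MN_abelian_group)

lemma cl_eqI:
 assumes "supp c" "supp d" "c - d : H"
 shows "cl c = cl d"
proof -
 have "c : H #>\<^bsub>F\<^esub> d"
  using assms(3) unfolding r_coset_def by (auto intro!: bexI[of _ "c - d"])
 then show ?thesis
  unfolding cl_def' using F.repr_independence[OF _ _ H_subgroup] assms(2) by simp
qed

lemma tens_closed: "s : car M ==> t : car N ==> tens A M N s t : car MN"
 unfolding tens_def by (rule cl_closed[OF supp_of])

lemma tens_balanced: "balanced A M N MN (tens A M N)"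
proof (rule balancedI)
 show "tens A M N (s +[M] s') t = tens A M N s t +[MN] tens A M N s' t"
  if "s : car M" "s' : car M" "t : car N" for s s' t
 proof -
  have "frag_of (s +[M] s', t) - frag_of (s, t) - frag_of (s', t) : gens"
   unfolding gens_def using that by blast
  then have "frag_of (s +[M] s', t) - (frag_of (s, t) + frag_of (s', t)) : H"
   unfolding H_eq diff_diff_eq by (rule generate.incl)
  from cl_eqI[OF _ _ this] show ?thesis
   using that by (simp add: tens_def supp_add cl_add)
 qed
 show "tens A M N s (t +[N] t') = tens A M N s t +[MN] tens A M N s t'"
  if "s : car M" "t : car N" "t' : car N" for s t t'
 proof -
  have "frag_of (s, t +[N] t') - frag_of (s, t) - frag_of (s, t') : gens"
   unfolding gens_def using that by blast
  then have "frag_of (s, t +[N] t') - (frag_of (s, t) + frag_of (s, t')) : H"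
   unfolding H_eq diff_diff_eq by (rule generate.incl)
  from cl_eqI[OF _ _ this] show ?thesis
   using that by (simp add: tens_def supp_add cl_add)
 qed
 show "tens A M N (a \<odot>[M] s) t = tens A M N s (a \<odot>[N] t)"
  if "a : car A" "s : car M" "t : car N" for a s t
 proof -
  have "frag_of (a \<odot>[M] s, t) - frag_of (s, a \<odot>[N] t) : gens"
   unfolding gens_def using that by blast
  then have "frag_of (a \<odot>[M] s, t) - frag_of (s, a \<odot>[N] t) : H"
   unfolding H_eq by (rule generate.incl)
  from cl_eqI[OF _ _ this] show ?thesis
   using that M_smult N_smult by (simp add: tens_def)
 qed
qed (rule tens_closed)

lemmas tens_add_l = balancedD(2)[OF tens_balanced]
 and tens_add_r = balancedD(3)[OF tens_balanced]
 and tens_smult = balancedD(4)[OF tens_balanced]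

lemma tens_zero_l: "t : car N ==> tens A M N \<zero>[M] t = \<zero>[MN]"
 by (metis M.zero_closed M.r_zero MN.add.r_cancel_one' tens_add_l tens_closed)

lemma tens_zero_r: "s : car M ==> tens A M N s \<zero>[N] = \<zero>[MN]"
 by (metis N.zero_closed N.r_zero MN.add.r_cancel_one' tens_add_r tens_closed)

lemma tens_minus_l: "s : car M ==> t : car N ==> tens A M N (-[M] s) t = -[MN] tens A M N s t"
 using tens_add_l[of "-[M] s" s t] tens_zero_l[of t]
 by (simp add: M.l_neg MN.minus_equality tens_closed)

text \<open>Zero and negatives need no case of their own, being pure tensors: 0 = 0 \<otimes> 0 and
  -(s \<otimes> t) = (-s) \<otimes> t.\<close>

lemma tensor_induct [consumes 1, case_names tens add]:
 assumes Z: "Z : car MN"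
  and t: "!!s t. s : car M ==> t : car N ==> P (tens A M N s t)"
  and add: "!!Y Z. Y : car MN ==> Z : car MN ==> P Y ==> P Z ==> P (Y +[MN] Z)"
 shows "P Z"
proof -
 obtain c where c: "supp c" "Z = cl c" using Z by (rule MN_E)
 \<comment> \<open>Induction on the free abelian group proceeds by differences, so c and -c are
   carried together.\<close>
 have "supp c \<and> P (cl c) \<and> P (cl (- c))"
  using c(1)
 proof (induction c rule: frag_induction)
  case zero
  have "P (tens A M N \<zero>[M] \<zero>[N])" by (rule t) auto
  then show ?case using tens_zero_l by (simp add: cl_zero)
 next
  case (one z)
  then obtain s u where z: "z = (s, u)" "s : car M" "u : car N" by auto
  have "cl (- frag_of z) +[MN] tens A M N s u = \<zero>[MN]"
   using z cl_add[of "- frag_of z" "frag_of z"] cl_zero by (simp add: tens_def)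
  then have "cl (- frag_of z) = tens A M N (-[M] s) u"
   using z tens_minus_l[OF z(2,3)] cl_closed[of "- frag_of z"] tens_closed[OF z(2,3)]
   by (metis MN.minus_equality MN.minus_minus keys_minus supp_of)
  then show ?case using z t[of s u] t[of "-[M] s" u] by (simp add: tens_def)
 next
  case (diff a b)
  have "cl (a - b) = cl a +[MN] cl (- b)" using diff cl_add[of a "- b"] by simp
  moreover have "cl (- (a - b)) = cl b +[MN] cl (- a)" using diff cl_add[of b "- a"] by simp
  moreover have "supp (a - b)" "supp (- a)" "supp (- b)" using diff supp_diff by auto
  ultimately show ?case using diff add[OF cl_closed cl_closed] by metis
 qed
 then show ?thesis using c by simp
qed

lemma hom_kills_rels:
 assumes B: "abelian_group B" and g: "balanced A M N B g"
  and cl: "!!c. supp c ==> \<epsilon> c : car B"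
  and add: "!!c d. supp c ==> supp d ==> \<epsilon> (c + d) = \<epsilon> c +[B] \<epsilon> d"
  and of: "!!s t. s : car M ==> t : car N ==> \<epsilon> (frag_of (s, t)) = g s t"
  and c: "c : H"
 shows "\<epsilon> c = \<zero>[B]"
proof -
 interpret B: abelian_group B by fact
 have zero: "\<epsilon> 0 = \<zero>[B]"
  using add[of 0 0] cl[of 0] by (simp add: B.add.r_cancel_one')
 have minus: "\<epsilon> (- c) = -[B] \<epsilon> c" if "supp c" for c
  using add[of "- c" c] cl[of c] cl[of "- c"] that zero by (simp add: B.minus_equality)
 have diff: "\<epsilon> (c - d) = \<epsilon> c +[B] -[B] \<epsilon> d" if "supp c" "supp d" for c d
  using add[of c "- d"] minus[of d] that by simp
 let ?K = "{c : car F. \<epsilon> c = \<zero>[B]}"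
 have "subgroup ?K F"
 proof (rule F.subgroupI)
  show "?K ~= {}" using zero by (auto intro: exI[of _ 0])
  show "inv\<^bsub>F\<^esub> c : ?K" if "c : ?K" for c using that minus by simp
  show "c *[F] d : ?K" if "c : ?K" "d : ?K" for c d
  proof -
   have "supp c" "supp d" using that by auto
   then show ?thesis using that add[of c d] supp_add[of c d] by simp
  qed
 qed auto
 moreover have "gens <= ?K"
 proof
  fix c assume c: "c : gens"
  then consider s s' t where "c = frag_of (s +[M] s', t) - frag_of (s, t) - frag_of (s', t)"
    "s : car M" "s' : car M" "t : car N"
   | s t t' where "c = frag_of (s, t +[N] t') - frag_of (s, t) - frag_of (s, t')"
    "s : car M" "t : car N" "t' : car N"
   | a s t where "c = frag_of (a \<odot>[M] s, t) - frag_of (s, a \<odot>[N] t)"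
    "a : car A" "s : car M" "t : car N"
   unfolding gens_def by blast
  then have "\<epsilon> c = \<zero>[B]"
  proof cases
   case 1
   then have "\<epsilon> c = (g s t +[B] g s' t) +[B] -[B] g s t +[B] -[B] g s' t"
    using of balancedD[OF g] by (simp add: diff supp_diff)
   then show ?thesis using balancedD(1)[OF g] 1 by (simp add: B.a_ac B.r_neg B.r_neg2)
  next
   case 2
   then have "\<epsilon> c = (g s t +[B] g s t') +[B] -[B] g s t +[B] -[B] g s t'"
    using of balancedD[OF g] by (simp add: diff supp_diff)
   then show ?thesis using balancedD(1)[OF g] 2 by (simp add: B.a_ac B.r_neg B.r_neg2)
  next
   case 3
   then have "\<epsilon> c = g s (a \<odot>[N] t) +[B] -[B] g s (a \<odot>[N] t)"
    using of balancedD[OF g] by (simp add: diff M_smult N_smult)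
   then show ?thesis using balancedD(1)[OF g] 3 by (simp add: B.r_neg N_smult)
  qed
  moreover have "c : car F" using c gens_carrier by blast
  ultimately show "c : ?K" by simp
 qed
 ultimately have "H <= ?K" unfolding H_eq by (intro F.generate_subgroup_incl)
 then show ?thesis using c by blast
qed

text \<open>\<open>tensor_lift\<close> takes the single element of an image; constancy on classes is
  what gives it a value.\<close>

lemma hom_const_on_cl:
 assumes B: "abelian_group B" and g: "balanced A M N B g"
  and cl: "!!c. supp c ==> \<epsilon> c : car B"
  and add: "!!c d. supp c ==> supp d ==> \<epsilon> (c + d) = \<epsilon> c +[B] \<epsilon> d"
  and of: "!!s t. s : car M ==> t : car N ==> \<epsilon> (frag_of (s, t)) = g s t"
  and c: "supp c" and d: "d : cl c"
 shows "\<epsilon> d = \<epsilon> c"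
proof -
 interpret B: abelian_group B by fact
 obtain z where z: "z : H" "d = z + c" using d unfolding cl_def' r_coset_def by auto
 have "z : car F" using z(1) H.subset by blast
 then have "supp z" by simp
 then show ?thesis
  using z add[of z c] c hom_kills_rels[OF B g cl add of z(1)] cl[OF c] by simp
qed

lemma cl_self: "supp c ==> c : cl c"
 unfolding cl_def' using F.rcos_self[OF _ H_subgroup] by simp

lemma cl_supp: "supp c ==> d : cl c ==> supp d"
proof -
 assume c: "supp c" and d: "d : cl c"
 have "d : car F"
  using subsetD[OF F.r_coset_subset_G[OF H.subset], of c d] c d unfolding cl_def' by simp
 then show ?thesis by simp
qed

context
 fixes B :: "('t, 'f) ring_scheme" and g :: "'m => 'n => 't"
 assumes B: "abelian_group B" and g: "balanced A M N B g"
begin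

interpretation B: abelian_group B by (rule B)

definition lift_frag :: "('m \<times> 'n \<Rightarrow>\<^sub>0 int) => 't" where
 "lift_frag c = (\<Oplus>[B]z\<in>Poly_Mapping.keys c. add_pow B (Poly_Mapping.lookup c z) (g (fst z) (snd z)))"

lemma lift_frag_ext:
 assumes "finite K" "Poly_Mapping.keys c <= K" "K <= car M \<times> car N"
 shows "lift_frag c = (\<Oplus>[B]z\<in>K. add_pow B (Poly_Mapping.lookup c z) (g (fst z) (snd z)))"
 unfolding lift_frag_def
proof (rule B.finsum_neutral[OF assms(1,2)])
 show "add_pow B (Poly_Mapping.lookup c z) (g (fst z) (snd z)) = \<zero>[B]" if "z : K - Poly_Mapping.keys c" for z
  using that by (simp add: in_keys_iff add_pow_int_0)
 show "add_pow B (Poly_Mapping.lookup c z) (g (fst z) (snd z)) : car B" if "z : Poly_Mapping.keys c" for z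
  using that assms balancedD(1)[OF g] by (intro B.add.int_pow_closed) auto
qed

lemma lift_frag_closed: "supp c ==> lift_frag c : car B"
 unfolding lift_frag_def using balancedD(1)[OF g]
 by (intro B.finsum_closed Pi_I B.add.int_pow_closed) auto

lemma lift_frag_add:
 assumes "supp c" "supp d"
 shows "lift_frag (c + d) = lift_frag c +[B] lift_frag d"
proof -
 let ?K = "Poly_Mapping.keys c \<union> Poly_Mapping.keys d"
 have K: "finite ?K" "?K <= car M \<times> car N" using assms by auto
 have gc: "g (fst z) (snd z) : car B" if "z : ?K" for z
  using that K(2) balancedD(1)[OF g] by (auto simp: mem_Times_iff)
 have "lift_frag (c + d) = (\<Oplus>[B]z\<in>?K. add_pow B (Poly_Mapping.lookup (c + d) z) (g (fst z) (snd z)))"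
  by (rule lift_frag_ext[OF K(1) keys_add K(2)])
 also have "... = (\<Oplus>[B]z\<in>?K. add_pow B (Poly_Mapping.lookup c z) (g (fst z) (snd z))
   +[B] add_pow B (Poly_Mapping.lookup d z) (g (fst z) (snd z)))"
  using gc by (intro B.finsum_cong2') (auto simp: lookup_add B.add.int_pow_mult B.add.int_pow_closed)
 also have "... = lift_frag c +[B] lift_frag d"
  using gc lift_frag_ext[OF K(1) Un_upper1 K(2)] lift_frag_ext[OF K(1) Un_upper2 K(2)]
  by (subst B.finsum_addf) (auto simp: B.add.int_pow_closed)
 finally show ?thesis .
qed

lemma lift_frag_of:
 assumes "s : car M" "t : car N"
 shows "lift_frag (frag_of (s, t)) = g s t"
 using assms balancedD(1)[OF g assms] by (simp add: lift_frag_def B.add.int_pow_1)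

lemma tensor_lift_cl: "supp c ==> tensor_lift B g (cl c) = lift_frag c"
proof -
 assume c: "supp c"
 have const: "lift_frag d = lift_frag c" if "d : cl c" for d
  by (rule hom_const_on_cl[OF B g lift_frag_closed lift_frag_add lift_frag_of c that])
 have "lift_frag ` cl c = (\<lambda>_. lift_frag c) ` cl c"
  by (rule image_cong[OF refl const])
 also have "... = {lift_frag c}"
  by (rule image_constant[OF cl_self[OF c]])
 finally have "lift_frag ` cl c = {lift_frag c}" .
 moreover have "tensor_lift B g (cl c) = the_elem (lift_frag ` cl c)"
  unfolding tensor_lift_def lift_frag_def[abs_def] by (rule refl)
 ultimately show ?thesis by simp
qed

lemma tensor_lift_tens:
 "s : car M ==> t : car N ==> tensor_lift B g (tens A M N s t) = g s t"
 using tensor_lift_cl[OF supp_of] lift_frag_of by (simp add: tens_def)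

lemma tensor_lift_closed: "Z : car MN ==> tensor_lift B g Z : car B"
 by (elim MN_E) (simp add: tensor_lift_cl lift_frag_closed)

lemma tensor_lift_add:
 assumes "Y : car MN" "Z : car MN"
 shows "tensor_lift B g (Y +[MN] Z) = tensor_lift B g Y +[B] tensor_lift B g Z"
proof -
 obtain c where c: "supp c" "Y = cl c" using assms(1) by (elim MN_E)
 obtain d where d: "supp d" "Z = cl d" using assms(2) by (elim MN_E)
 have "tensor_lift B g (Y +[MN] Z) = lift_frag (c + d)"
  using tensor_lift_cl[OF supp_add[OF c(1) d(1)]] cl_add[OF c(1) d(1)] c(2) d(2) by simp
 then show ?thesis
  using lift_frag_add[OF c(1) d(1)] tensor_lift_cl[OF c(1)] tensor_lift_cl[OF d(1)] c(2) d(2) by simp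
qed

end

end

lemma additive_finsum:
 assumes "abelian_group G" "abelian_group B" and f: "!!i. i : I ==> f i : car G"
  and L: "!!y. y : car G ==> L y : car B"
  and add: "!!y z. y : car G ==> z : car G ==> L (y +[G] z) = L y +[B] L z"
 shows "L (\<Oplus>[G]i\<in>I. f i) = (\<Oplus>[B]i\<in>I. L (f i))"
proof -
 interpret G: abelian_group G by fact
 interpret B: abelian_group B by fact
 have zero: "L \<zero>[G] = \<zero>[B]"
  using add[of "\<zero>[G]" "\<zero>[G]"] L[of "\<zero>[G]"] by (simp add: B.add.r_cancel_one')
 show ?thesis
  using f by (induction I rule: infinite_finite_induct)
   (simp_all add: zero add L G.finsum_closed Pi_I')
qed

context tensor_pair
begin

lemma frag_hom_unique:
 assumes B: "abelian_group B"
  and e1: "!!c. supp c ==> \<epsilon> c : car B" "!!c d. supp c ==> supp d ==> \<epsilon> (c + d) = \<epsilon> c +[B] \<epsilon> d"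
  and e2: "!!c. supp c ==> \<epsilon>' c : car B" "!!c d. supp c ==> supp d ==> \<epsilon>' (c + d) = \<epsilon>' c +[B] \<epsilon>' d"
  and of: "!!s t. s : car M ==> t : car N ==> \<epsilon> (frag_of (s, t)) = \<epsilon>' (frag_of (s, t))"
  and c: "supp c"
 shows "\<epsilon> c = \<epsilon>' c"
proof -
 interpret B: abelian_group B by fact
 have "supp c \<and> \<epsilon> c = \<epsilon>' c"
  using c
 proof (induction c rule: frag_induction)
  case zero
  have "\<epsilon> 0 = \<zero>[B]" "\<epsilon>' 0 = \<zero>[B]"
   using e1(2)[of 0 0] e1(1)[of 0] e2(2)[of 0 0] e2(1)[of 0] by (simp_all add: B.add.r_cancel_one')
  then show ?case by simp
 next
  case (one z)
  then show ?case using of by (cases z) auto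
 next
  case (diff a b)
  have ab: "supp (a - b)" using diff supp_diff by blast
  have "\<epsilon> (a - b) +[B] \<epsilon> b = \<epsilon> a" "\<epsilon>' (a - b) +[B] \<epsilon>' b = \<epsilon>' a"
   using e1(2)[OF ab, of b] e2(2)[OF ab, of b] diff by auto
  then have "\<epsilon> (a - b) +[B] \<epsilon> b = \<epsilon>' (a - b) +[B] \<epsilon> b" using diff by simp
  moreover have "\<epsilon> b : car B" using diff e1(1) by blast
  ultimately show ?case
   using ab B.add.right_cancel[OF _ e1(1)[OF ab] e2(1)[OF ab], of "\<epsilon> b"] by blast
 qed
 then show ?thesis ..
qed

lemma cl_const: "supp c ==> d : cl c ==> cl d = cl c"
 unfolding cl_def' using F.repr_independence[OF _ _ H_subgroup, of d c] by simp

text \<open>Products and scalar multiples in \<open>tensor\<close> are unions over representatives;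
  when all of them give one class, the union is that class.\<close>

lemma UN_cl:
 assumes c: "supp c" and f: "!!d. supp d ==> f d = g (cl d)"
 shows "(\<Union>d\<in>cl c. f d) = g (cl c)"
proof -
 have "f d = g (cl c)" if "d : cl c" for d
  using f[OF cl_supp[OF c that]] cl_const[OF c that] by simp
 then show ?thesis using cl_self[OF c] by (metis (no_types, lifting) SUP_eq_const empty_iff)
qed

lemma frag_extend_supp:
 assumes "!!s t. s : car M ==> t : car N ==> supp (f (s, t))" "supp c"
 shows "supp (frag_extend f c)"
proof -
 have "(\<Union>z\<in>Poly_Mapping.keys c. Poly_Mapping.keys (f z)) <= car M \<times> car N"
 proof (rule UN_least)
  fix z assume "z : Poly_Mapping.keys c"
  then have "z : car M \<times> car N" using assms(2) by blast
  then show "supp (f z)" using assms(1) by (cases z) blast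
 qed
 then show ?thesis using keys_frag_extend[of f c] by (rule order_trans[rotated])
qed

lemma smult_tensor:
 assumes sm: "!!a b s. a : car A ==> b : car A ==> s : car M ==> a \<odot>[M] (b \<odot>[M] s) = b \<odot>[M] (a \<odot>[M] s)"
  and sa: "!!a s s'. a : car A ==> s : car M ==> s' : car M ==> a \<odot>[M] (s +[M] s') = a \<odot>[M] s +[M] a \<odot>[M] s'"
  and a: "a : car A"
 shows "!!Z. Z : car MN ==> a \<odot>[MN] Z : car MN"
  "!!Y Z. Y : car MN ==> Z : car MN ==> a \<odot>[MN] (Y +[MN] Z) = a \<odot>[MN] Y +[MN] a \<odot>[MN] Z"
  "!!s t. s : car M ==> t : car N ==> a \<odot>[MN] tens A M N s t = tens A M N (a \<odot>[M] s) t"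
proof -
 let ?g = "\<lambda>s t. tens A M N (a \<odot>[M] s) t"
 let ?f = "\<lambda>(s, t). frag_of (a \<odot>[M] s, t)"
 have bal: "balanced A M N MN ?g"
  by (rule balancedI) (simp_all add: tens_closed M_smult N_smult a sa sm tens_add_l tens_add_r tens_smult)
 have fs: "supp (?f (s, t))" if "s : car M" "t : car N" for s t
  using that a by (simp add: M_smult)
 have fe: "supp (frag_extend ?f c)" if "supp c" for c
  by (rule frag_extend_supp[where f = ?f]) (use fs that in auto)
 have eq: "cl (frag_extend ?f c) = tensor_lift MN ?g (cl c)" if c: "supp c" for c
 proof (rule frag_hom_unique[OF MN_abelian_group _ _ _ _ _ c])
  show "cl (frag_extend ?f c) : car MN" if "supp c" for c
   using fe[OF that] by (rule cl_closed)
  show "cl (frag_extend ?f (c + d)) = cl (frag_extend ?f c) +[MN] cl (frag_extend ?f d)"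
   if "supp c" "supp d" for c d
   unfolding frag_extend_add by (rule cl_add[OF fe[OF that(1)] fe[OF that(2)]])
  show "tensor_lift MN ?g (cl c) : car MN" if "supp c" for c
   by (rule tensor_lift_closed[OF MN_abelian_group bal cl_closed[OF that]])
  show "tensor_lift MN ?g (cl (c + d)) = tensor_lift MN ?g (cl c) +[MN] tensor_lift MN ?g (cl d)"
   if "supp c" "supp d" for c d
   using tensor_lift_add[OF MN_abelian_group bal cl_closed[OF that(1)] cl_closed[OF that(2)]] cl_add[OF that] by simp
  show "cl (frag_extend ?f (frag_of (s, t))) = tensor_lift MN ?g (cl (frag_of (s, t)))"
   if "s : car M" "t : car N" for s t
   using tensor_lift_tens[OF MN_abelian_group bal that] by (simp add: tens_def)
 qed
 have sm: "a \<odot>[MN] Z = tensor_lift MN ?g Z" if "Z : car MN" for Z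
 proof -
  obtain c where c: "supp c" "Z = cl c" using \<open>Z : car MN\<close> by (rule MN_E)
  have "a \<odot>[MN] Z = (\<Union>c\<in>Z. cl (frag_extend ?f c))"
   by (simp add: tensor_def Let_def)
  also have "... = tensor_lift MN ?g Z"
   unfolding c(2) by (rule UN_cl[where g = "tensor_lift MN ?g", OF c(1)]) (rule eq)
  finally show ?thesis .
 qed
 show "a \<odot>[MN] Z : car MN" if "Z : car MN" for Z
  using sm[OF that] tensor_lift_closed[OF MN_abelian_group bal that] by simp
 show "a \<odot>[MN] (Y +[MN] Z) = a \<odot>[MN] Y +[MN] a \<odot>[MN] Z" if "Y : car MN" "Z : car MN" for Y Z
  using sm tensor_lift_add[OF MN_abelian_group bal that] that by simp
 show "a \<odot>[MN] tens A M N s t = tens A M N (a \<odot>[M] s) t" if "s : car M" "t : car N" for s t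
  using sm[OF tens_closed[OF that]] tensor_lift_tens[OF MN_abelian_group bal that] by simp
qed

end

locale tensor_alg = tensor_pair A M N
 for A :: "('a, 'c) ring_scheme" and M :: "('a, 'm, 'd) module_scheme" and N :: "('a, 'n, 'e) module_scheme" +
 assumes algM: "algebra A M" and algN: "algebra A N"
begin

sublocale cA: cring A using algM by (simp add: algebra_def module_def)
sublocale cM: cring M using algM by (simp add: algebra_def)
sublocale cN: cring N using algN by (simp add: algebra_def)
sublocale aM: algebra A M by (rule algM)
sublocale aN: algebra A N by (rule algN)

lemmas M_mult = cM.m_closed and N_mult = cN.m_closed

lemma smult_r_M: "a : car A ==> s : car M ==> s' : car M ==> s *[M] (a \<odot>[M] s') = a \<odot>[M] (s *[M] s')"
 by (metis cM.m_comm aM.smult_assoc2 M_smult)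

lemma smult_r_N: "a : car A ==> t : car N ==> t' : car N ==> t *[N] (a \<odot>[N] t') = a \<odot>[N] (t *[N] t')"
 by (metis cN.m_comm aN.smult_assoc2 N_smult)

text \<open>Multiplication by a pure tensor, from the universal property in the other factor.
  Lifting it once more in s and t gives \<open>mul\<close>, a product that is well defined and
  additive by construction.\<close>

definition mulL :: "'m => 'n => ('m \<times> 'n \<Rightarrow>\<^sub>0 int) set => ('m \<times> 'n \<Rightarrow>\<^sub>0 int) set" where
 "mulL s t = tensor_lift MN (\<lambda>s' t'. tens A M N (s *[M] s') (t *[N] t'))"

lemma mulL_bal:
 assumes "s : car M" "t : car N"
 shows "balanced A M N MN (\<lambda>s' t'. tens A M N (s *[M] s') (t *[N] t'))"
 by (rule balancedI)
  (use assms in \<open>simp_all add: tens_closed M_mult N_mult cM.r_distr cN.r_distr tens_add_l tens_add_r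
   smult_r_M smult_r_N tens_smult\<close>)

lemmas mulL_closed = tensor_lift_closed[OF MN_abelian_group mulL_bal, folded mulL_def]
 and mulL_add = tensor_lift_add[OF MN_abelian_group mulL_bal, folded mulL_def]
 and mulL_tens = tensor_lift_tens[OF MN_abelian_group mulL_bal, folded mulL_def]

lemma mulL_bal2:
 assumes W: "W : car MN"
 shows "balanced A M N MN (\<lambda>s t. mulL s t W)"
proof (rule balancedI)
 show "mulL s t W : car MN" if "s : car M" "t : car N" for s t
  by (rule mulL_closed[OF that W])
 show "mulL (s +[M] s') t W = mulL s t W +[MN] mulL s' t W"
  if "s : car M" "s' : car M" "t : car N" for s s' t
  using W
 proof (induction W rule: tensor_induct)
  case (tens u v)
  then show ?case using that by (simp add: mulL_tens cM.l_distr tens_add_l M_mult N_mult)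
 next
  case (add Y Z)
  then show ?case using that by (simp add: mulL_add mulL_closed MN.a_ac)
 qed
 show "mulL s (t +[N] t') W = mulL s t W +[MN] mulL s t' W"
  if "s : car M" "t : car N" "t' : car N" for s t t'
  using W
 proof (induction W rule: tensor_induct)
  case (tens u v)
  then show ?case using that by (simp add: mulL_tens cN.l_distr tens_add_r M_mult N_mult)
 next
  case (add Y Z)
  then show ?case using that by (simp add: mulL_add mulL_closed MN.a_ac)
 qed
 show "mulL (a \<odot>[M] s) t W = mulL s (a \<odot>[N] t) W"
  if "a : car A" "s : car M" "t : car N" for a s t
  using W
 proof (induction W rule: tensor_induct)
  case (tens u v)
  then show ?case using that
   by (simp add: mulL_tens aM.smult_assoc2 aN.smult_assoc2 tens_smult M_mult N_mult M_smult N_smult)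
 next
  case (add Y Z)
  then show ?case using that by (simp add: mulL_add M_smult N_smult)
 qed
qed

definition mul :: "('m \<times> 'n \<Rightarrow>\<^sub>0 int) set => ('m \<times> 'n \<Rightarrow>\<^sub>0 int) set => ('m \<times> 'n \<Rightarrow>\<^sub>0 int) set" where
 "mul Z W = tensor_lift MN (\<lambda>s t. mulL s t W) Z"

lemma mul_closed: "W : car MN ==> Z : car MN ==> mul Z W : car MN"
 and mul_add_l: "W : car MN ==> Y : car MN ==> Z : car MN ==> mul (Y +[MN] Z) W = mul Y W +[MN] mul Z W"
 and mul_tens: "W : car MN ==> s : car M ==> t : car N ==> mul (tens A M N s t) W = mulL s t W"
 unfolding mul_def
 by (rule tensor_lift_closed[OF MN_abelian_group mulL_bal2] tensor_lift_add[OF MN_abelian_group mulL_bal2]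
   tensor_lift_tens[OF MN_abelian_group mulL_bal2]; assumption)+

abbreviation gam :: "'m => 'n => ('m \<times> 'n \<Rightarrow>\<^sub>0 int) => ('m \<times> 'n \<Rightarrow>\<^sub>0 int)" where
 "gam s t d \<equiv> frag_extend (\<lambda>(s', t'). frag_of (s *[M] s', t *[N] t')) d"

lemma gam_supp: "s : car M ==> t : car N ==> supp d ==> supp (gam s t d)"
 by (rule frag_extend_supp) (simp_all add: M_mult N_mult)

lemma cl_gam:
 assumes s: "s : car M" and t: "t : car N" and d: "supp d"
 shows "cl (gam s t d) = mulL s t (cl d)"
proof (rule frag_hom_unique[OF MN_abelian_group _ _ _ _ _ d])
 show "cl (gam s t c) : car MN" if "supp c" for c
  using gam_supp[OF s t that] by (rule cl_closed)
 show "cl (gam s t (c + d)) = cl (gam s t c) +[MN] cl (gam s t d)" if "supp c" "supp d" for c d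
  unfolding frag_extend_add by (rule cl_add[OF gam_supp[OF s t that(1)] gam_supp[OF s t that(2)]])
 show "mulL s t (cl c) : car MN" if "supp c" for c
  by (rule mulL_closed[OF s t cl_closed[OF that]])
 show "mulL s t (cl (c + d)) = mulL s t (cl c) +[MN] mulL s t (cl d)" if "supp c" "supp d" for c d
  using mulL_add[OF s t cl_closed[OF that(1)] cl_closed[OF that(2)]] cl_add[OF that] by simp
 show "cl (gam s t (frag_of (s', t'))) = mulL s t (cl (frag_of (s', t')))" if "s' : car M" "t' : car N" for s' t'
  using mulL_tens[OF s t that] by (simp add: tens_def)
qed

lemma cl_gam2:
 assumes c: "supp c" and d: "supp d"
 shows "cl (frag_extend (\<lambda>(s, t). gam s t d) c) = mul (cl c) (cl d)"
proof (rule frag_hom_unique[OF MN_abelian_group _ _ _ _ _ c])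
 have g: "supp ((\<lambda>(s, t). gam s t d) (s, t))" if "s : car M" "t : car N" for s t
  using gam_supp[OF that d] by simp
 have s: "supp (frag_extend (\<lambda>(s, t). gam s t d) c)" if "supp c" for c
  by (rule frag_extend_supp[where f = "\<lambda>(s, t). gam s t d"]) (use g that in blast)+
 show "cl (frag_extend (\<lambda>(s, t). gam s t d) c) : car MN" if "supp c" for c
  using s[OF that] by (rule cl_closed)
 show "cl (frag_extend (\<lambda>(s, t). gam s t d) (c + c')) =
   cl (frag_extend (\<lambda>(s, t). gam s t d) c) +[MN] cl (frag_extend (\<lambda>(s, t). gam s t d) c')"
  if "supp c" "supp c'" for c c'
  by (subst frag_extend_add) (rule cl_add[OF s[OF that(1)] s[OF that(2)]])
 show "mul (cl c) (cl d) : car MN" if "supp c" for c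
  by (rule mul_closed[OF cl_closed[OF d] cl_closed[OF that]])
 show "mul (cl (c + c')) (cl d) = mul (cl c) (cl d) +[MN] mul (cl c') (cl d)" if "supp c" "supp c'" for c c'
  using mul_add_l[OF cl_closed[OF d] cl_closed[OF that(1)] cl_closed[OF that(2)]] cl_add[OF that] by simp
 show "cl (frag_extend (\<lambda>(s, t). gam s t d) (frag_of (s, t))) = mul (cl (frag_of (s, t))) (cl d)"
  if "s : car M" "t : car N" for s t
  using mul_tens[OF cl_closed[OF d] that] cl_gam[OF that d] by (simp add: tens_def)
qed

lemma mult_eq_mul:
 assumes Z: "Z : car MN" and W: "W : car MN"
 shows "Z *[MN] W = mul Z W"
proof -
 obtain c where c: "supp c" "Z = cl c" using Z by (rule MN_E)
 obtain d where d: "supp d" "W = cl d" using W by (rule MN_E)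
 have "Z *[MN] W = (\<Union>c\<in>Z. \<Union>d\<in>W. cl (frag_extend (\<lambda>(s, t). gam s t d) c))"
  by (simp add: tensor_def Let_def)
 also have "... = mul Z W"
  unfolding c(2) d(2)
 proof (rule UN_cl[where g = "\<lambda>Z. mul Z (cl d)", OF c(1)])
  show "(\<Union>d\<in>cl d. cl (frag_extend (\<lambda>(s, t). gam s t d) c)) = mul (cl c) (cl d)" if "supp c" for c
   by (rule UN_cl[where g = "mul (cl c)", OF d(1)]) (rule cl_gam2[OF that])
 qed
 finally show ?thesis .
qed

lemma tens_mult:
 assumes "s : car M" "t : car N" "s' : car M" "t' : car N"
 shows "tens A M N s t *[MN] tens A M N s' t' = tens A M N (s *[M] s') (t *[N] t')"
 using assms by (simp add: mult_eq_mul tens_closed mul_tens mulL_tens)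

lemma MN_m_closed: "Z : car MN ==> W : car MN ==> Z *[MN] W : car MN"
 by (simp add: mult_eq_mul mul_closed)

lemma MN_l_distr:
 "Y : car MN ==> Z : car MN ==> W : car MN ==> (Y +[MN] Z) *[MN] W = Y *[MN] W +[MN] Z *[MN] W"
 by (simp add: mult_eq_mul mul_add_l)

lemma MN_r_distr:
 assumes "Y : car MN" "Z : car MN" "W : car MN"
 shows "W *[MN] (Y +[MN] Z) = W *[MN] Y +[MN] W *[MN] Z"
 using assms(3)
proof (induction W rule: tensor_induct)
 case (tens s t)
 then show ?case using assms by (simp add: mult_eq_mul mul_tens mulL_add tens_closed)
next
 case (add U V)
 then show ?case using assms by (simp add: MN_l_distr MN_m_closed MN.a_ac)
qed

lemma MN_m_comm:
 assumes "Y : car MN" "Z : car MN"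
 shows "Y *[MN] Z = Z *[MN] Y"
 using assms(1)
proof (induction Y rule: tensor_induct)
 case (tens s t)
 show ?case using assms(2)
 proof (induction Z rule: tensor_induct)
  case (tens s' t')
  then show ?case using \<open>s : _\<close> \<open>t : _\<close> by (simp add: tens_mult cM.m_comm cN.m_comm)
 next
  case (add U V)
  then show ?case using \<open>s : _\<close> \<open>t : _\<close> by (simp add: MN_l_distr MN_r_distr tens_closed)
 qed
next
 case (add U V)
 then show ?case using assms by (simp add: MN_l_distr MN_r_distr)
qed

lemma MN_m_assoc:
 assumes "Y : car MN" "Z : car MN" "W : car MN"
 shows "Y *[MN] Z *[MN] W = Y *[MN] (Z *[MN] W)"
 using assms(1)
proof (induction Y rule: tensor_induct)
 case (tens s t)
 show ?case using assms(2)
 proof (induction Z rule: tensor_induct)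
  case (tens s' t')
  show ?case using assms(3)
  proof (induction W rule: tensor_induct)
   case (tens s'' t'')
   then show ?case using \<open>s : _\<close> \<open>t : _\<close> \<open>s' : _\<close> \<open>t' : _\<close>
    by (simp add: tens_mult cM.m_assoc cN.m_assoc M_mult N_mult)
  next
   case (add U V)
   then show ?case using \<open>s : _\<close> \<open>t : _\<close> \<open>s' : _\<close> \<open>t' : _\<close>
    by (simp add: MN_r_distr tens_closed MN_m_closed)
  qed
 next
  case (add U V)
  then show ?case using \<open>s : _\<close> \<open>t : _\<close> assms(3)
   by (simp add: MN_l_distr MN_r_distr tens_closed MN_m_closed)
 qed
next
 case (add U V)
 then show ?case using assms by (simp add: MN_l_distr MN_m_closed)
qed

lemma one_MN: "\<one>[MN] = tens A M N \<one>[M] \<one>[N]"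
 by (simp add: tensor_def Let_def tens_def)

lemma MN_cring: "cring MN"
proof (rule cringI[OF MN_abelian_group])
 show "comm_monoid MN"
 proof (rule comm_monoidI)
  show "\<one>[MN] : car MN" by (simp add: one_MN tens_closed)
  show "\<one>[MN] *[MN] Z = Z" if "Z : car MN" for Z
   using that
  proof (induction Z rule: tensor_induct)
   case (tens s t)
   then show ?case by (simp add: one_MN tens_mult)
  next
   case (add U V)
   then show ?case by (simp add: MN_r_distr one_MN tens_closed)
  qed
 qed (fact MN_m_closed MN_m_assoc MN_m_comm)+
qed (fact MN_l_distr)

lemma smult_comm_M: "a : car A ==> b : car A ==> s : car M ==> a \<odot>[M] (b \<odot>[M] s) = b \<odot>[M] (a \<odot>[M] s)"
 by (metis aM.smult_assoc1 cA.m_comm)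

lemmas MN_smult_tens = smult_tensor(3)[OF smult_comm_M aM.smult_r_distr]

end

section \<open>The Taylor homomorphism and the tensor square of A\<close>

lemma (in cring) ideal_pow_add:
 assumes "ideal I R"
 shows "ideal_power R I (m + n) = ideal_prod R (ideal_power R I m) (ideal_power R I n)"
proof -
 interpret IS: comm_monoid "ideals_set R" by (rule ideals_set_is_comm_monoid)
 have "I : car (ideals_set R)" using assms by (simp add: ideals_set_def)
 then show ?thesis using IS.nat_pow_mult[of I m n] by simp
qed

lemma (in cring) sub_distr_cancel:
 "a : car R ==> b : car R ==> d : car R ==> a \<otimes> b \<ominus> a \<otimes> (b \<ominus> d) = a \<otimes> d"
 by algebra

lemma (in ring) set_add_iff: "z : I <+>\<^bsub>R\<^esub> J \<longleftrightarrow> (\<exists>a\<in>I. \<exists>b\<in>J. z = a \<oplus> b)"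
 unfolding set_add_def' by blast

lemma (in ring) subset_set_add_l:
 assumes "ideal I R" "ideal J R"
 shows "I <= I <+>\<^bsub>R\<^esub> J"
proof
 fix a assume "a : I"
 then have "a = a \<oplus> \<zero>" using ideal.Icarr[OF assms(1)] by simp
 then show "a : I <+>\<^bsub>R\<^esub> J" unfolding set_add_iff using \<open>a : I\<close> ideal_zero_closed[OF assms(2)] by blast
qed

lemma (in ring) subset_set_add_r:
 assumes "ideal I R" "ideal J R"
 shows "J <= I <+>\<^bsub>R\<^esub> J"
proof
 fix a assume "a : J"
 then have "a = \<zero> \<oplus> a" using ideal.Icarr[OF assms(2)] by simp
 then show "a : I <+>\<^bsub>R\<^esub> J" unfolding set_add_iff using \<open>a : J\<close> ideal_zero_closed[OF assms(1)] by blast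
qed

lemma (in cring) set_add_mult:
 assumes I: "ideal I R" and J: "ideal J R" and I': "ideal I' R" and J': "ideal J' R" and K: "ideal K R"
  and II: "!!a b. a : I ==> b : I' ==> a \<otimes> b : K" and IJ: "!!a b. a : I ==> b : J' ==> a \<otimes> b : K"
  and JI: "!!a b. a : J ==> b : I' ==> a \<otimes> b : K" and JJ: "!!a b. a : J ==> b : J' ==> a \<otimes> b : K"
  and z: "z : I <+>\<^bsub>R\<^esub> J" and w: "w : I' <+>\<^bsub>R\<^esub> J'"
 shows "z \<otimes> w : K"
proof -
 obtain a b where ab: "a : I" "b : J" "z = a \<oplus> b" using z set_add_iff by blast
 obtain c d where cd: "c : I'" "d : J'" "w = c \<oplus> d" using w set_add_iff by blast
 have c: "a : car R" "b : car R" "c : car R" "d : car R"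
  using ab cd ideal.Icarr[OF I] ideal.Icarr[OF J] ideal.Icarr[OF I'] ideal.Icarr[OF J'] by auto
 have "z \<otimes> w = (a \<otimes> c \<oplus> b \<otimes> c) \<oplus> (a \<otimes> d \<oplus> b \<otimes> d)"
  unfolding ab(3) cd(3) using c by (simp add: l_distr r_distr)
 then show ?thesis
  using II[OF ab(1) cd(1)] IJ[OF ab(1) cd(2)] JI[OF ab(2) cd(1)] JJ[OF ab(2) cd(2)]
   ideal_add_closed[OF K] by simp
qed

context q_setting
begin

lemma tensor_alg_A: "tensor_alg R A A"
proof (intro tensor_alg.intro tensor_pair.intro tensor_alg_axioms.intro algA)
 show "abelian_group A" by (rule Ac.abelian_group_axioms)
 then show "abelian_group A" .
 show "!!a s. a : car R ==> s : car A ==> a \<odot>[A] s : car A" by (rule RA.smult_closed)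
 then show "!!a s. a : car R ==> s : car A ==> a \<odot>[A] s : car A" .
qed

abbreviation P where "P \<equiv> tensor R A A"

sublocale P: cring P by (rule tensor_alg.MN_cring[OF tensor_alg_A])
sublocale tp: tensor_alg R A A by (rule tensor_alg_A)

abbreviation tt where "tt \<equiv> tens R A A"
abbreviation lf where "lf f \<equiv> tens R A A f \<one>"
abbreviation rt where "rt f \<equiv> tens R A A \<one> f"

lemma lf_hom: "lf : ring_hom A P"
 by (rule ring_hom_memI) (simp_all add: tp.tens_closed tp.tens_mult tp.tens_add_l tp.one_MN)

lemma rt_hom: "rt : ring_hom A P"
 by (rule ring_hom_memI) (simp_all add: tp.tens_closed tp.tens_mult tp.tens_add_r tp.one_MN)

lemma tt_eq: "f : car A ==> g : car A ==> tt f g = lf f *[P] rt g"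
 by (simp add: tp.tens_mult)

lemma rt_\<iota>: "r : car R ==> rt (\<iota> r) = lf (\<iota> r)"
 by (rule tp.tens_smult[symmetric]) auto

lemma q_in_P: "q_in R P = lf (hA qv)"
 by (simp add: q_in_hR hA_eq tp.one_MN tp.MN_smult_tens)

abbreviation cP where "cP \<equiv> P_adic p R A"

lemma cP_eq: "cP = pq_ideal p P (lf (hA qv))"
 by (simp add: P_adic_def q_in_P)

lemma cP_ideal: "ideal cP P"
 unfolding cP_eq by (rule P.pq_ideal_ideal) (simp add: tp.tens_closed)

lemma tensor_lift_hom:
 assumes B: "cring B" and g: "balanced R A A B g"
  and mult: "!!f f' h h'. f : car A ==> f' : car A ==> h : car A ==> h' : car A ==>
   g (f \<otimes> f') (h \<otimes> h') = g f h *[B] g f' h'"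
  and one: "g \<one> \<one> = \<one>[B]"
 shows "tensor_lift B g : ring_hom P B"
proof -
 interpret B: cring B by fact
 have Bg: "abelian_group B" by (rule B.abelian_group_axioms)
 note L_cl = tp.tensor_lift_closed[OF Bg g] and L_add = tp.tensor_lift_add[OF Bg g]
  and L_tens = tp.tensor_lift_tens[OF Bg g]
 show ?thesis
 proof (rule ring_hom_memI)
  fix Y Z assume Y: "Y : car P" and Z: "Z : car P"
  show "tensor_lift B g (Y *[P] Z) = tensor_lift B g Y *[B] tensor_lift B g Z"
   using Y
  proof (induction Y rule: tp.tensor_induct)
   case (tens s t)
   show ?case using Z
   proof (induction Z rule: tp.tensor_induct)
    case (tens s' t')
    then show ?case using \<open>s : _\<close> \<open>t : _\<close> by (simp add: tp.tens_mult L_tens mult)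
   next
    case (add U V)
    then show ?case using \<open>s : _\<close> \<open>t : _\<close>
     by (simp add: tp.tens_closed P.r_distr B.r_distr L_cl L_add)
   qed
  next
   case (add U V)
   then show ?case using Z by (simp add: P.l_distr B.l_distr L_cl L_add)
  qed
  show "tensor_lift B g (Y +[P] Z) = tensor_lift B g Y +[B] tensor_lift B g Z"
   by (rule L_add[OF Y Z])
 qed (simp_all add: L_cl tp.one_MN L_tens one)
qed

lemma P_additive_eq:
 assumes B: "abelian_group B"
  and "!!z. z : car P ==> f z : car B" "!!z. z : car P ==> g z : car B"
  and "!!y z. y : car P ==> z : car P ==> f (y +[P] z) = f y +[B] f z"
  and "!!y z. y : car P ==> z : car P ==> g (y +[P] z) = g y +[B] g z"
  and "!!a b. a : car A ==> b : car A ==> f (tt a b) = g (tt a b)"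
  and "z : car P"
 shows "f z = g z"
 using assms(7)
proof (induction z rule: tp.tensor_induct)
 case (tens s t)
 then show ?case by (rule assms(6))
next
 case (add Y Z)
 then show ?case using assms(4,5) by simp
qed

section \<open>The diagonal ideal and its twisted powers\<close>

definition mu where "mu = tensor_lift A (\<lambda>f g. f \<otimes> g)"

lemma mu_bal: "balanced R A A A (\<lambda>f g. f \<otimes> g)"
proof (rule balancedI)
 show "(a \<odot>[A] s) \<otimes> t = s \<otimes> (a \<odot>[A] t)" if "a : car R" "s : car A" "t : car A" for a s t
  using that RA.smult_assoc2 Ac.m_comm RA.smult_closed by metis
qed (simp_all add: Ac.l_distr Ac.r_distr)

lemma mu_hom: "mu : ring_hom P A"
 unfolding mu_def by (rule tensor_lift_hom[OF A_cring mu_bal]) (simp_all add: Ac.m_ac)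

lemma mu_tt: "f : car A ==> g : car A ==> mu (tt f g) = f \<otimes> g"
 unfolding mu_def by (rule tp.tensor_lift_tens[OF Ac.abelian_group_axioms mu_bal])

abbreviation dI where "dI \<equiv> diag_ideal R A"

lemma dI_iff: "z : dI \<longleftrightarrow> z : car P \<and> mu z = \<zero>"
 by (auto simp: diag_ideal_def mu_def a_kernel_def')

lemma dI_ideal: "ideal dI P"
proof -
 interpret ring_hom_ring P A mu by (rule ring_hom_ringI2[OF P.ring_axioms Ac.ring_axioms mu_hom])
 have "ideal {z : car P. mu z : {\<zero>}} P" by (rule ideal_vimage[OF Ac.zeroideal])
 moreover have "{z : car P. mu z : {\<zero>}} = dI" using dI_iff by auto
 ultimately show ?thesis by simp
qed

abbreviation sP where "sP \<equiv> sigma_P R A \<sigma>"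

lemma \<sigma>_smult: "r : car R ==> f : car A ==> \<sigma> (r \<odot>[A] f) = r \<odot>[A] \<sigma> f"
 using endo by (auto simp: is_q_endomorphism_def)

lemma sP_bal: "balanced R A A P (\<lambda>f g. tt (\<sigma> f) g)"
proof (rule balancedI)
 show "tt (\<sigma> (s \<oplus> s')) t = tt (\<sigma> s) t +[P] tt (\<sigma> s') t" if "s : car A" "s' : car A" "t : car A" for s s' t
  using that by (simp add: ring_hom_add[OF qd.\<sigma>_hom] tp.tens_add_l)
 show "tt (\<sigma> (a \<odot>[A] s)) t = tt (\<sigma> s) (a \<odot>[A] t)" if "a : car R" "s : car A" "t : car A" for a s t
  using that by (simp add: \<sigma>_smult tp.tens_smult)
qed (simp_all add: tp.tens_closed tp.tens_add_r)

lemma sP_hom: "sP : ring_hom P P"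
 unfolding sigma_P_def
 by (rule tensor_lift_hom[OF tp.MN_cring sP_bal])
  (simp_all add: qd.\<sigma>_mult tp.tens_mult tp.one_MN ring_hom_one[OF qd.\<sigma>_hom])

lemma sP_tt: "f : car A ==> g : car A ==> sP (tt f g) = tt (\<sigma> f) g"
 unfolding sigma_P_def by (rule tp.tensor_lift_tens[OF P.abelian_group_axioms sP_bal])

lemma sP_pow_hom: "sP ^^ i : ring_hom P P"
proof (induction i)
 case 0
 then show ?case by (auto simp: ring_hom_def)
next
 case (Suc i)
 then show ?case unfolding funpow.simps(2) by (rule ring_hom_trans[OF _ sP_hom])
qed

lemma \<sigma>_pow_closed: "a : car A ==> (\<sigma> ^^ i) a : car A"
 by (rule ring_hom_closed[OF \<sigma>_pow_hom])

lemma sP_pow_tt: "f : car A ==> g : car A ==> (sP ^^ i) (tt f g) = tt ((\<sigma> ^^ i) f) g"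
 by (induction i) (simp_all add: sP_tt \<sigma>_pow_closed)

abbreviation tI where "tI \<equiv> diag_twisted_power R A \<sigma>"
abbreviation gI where "gI i \<equiv> genideal P ((sP ^^ i) ` dI)"

lemma sP_dI_carrier: "(sP ^^ i) ` dI <= car P"
 using ring_hom_closed[OF sP_pow_hom] dI_iff by blast

lemma gI_ideal: "ideal (gI i) P"
 by (rule P.genideal_ideal[OF sP_dI_carrier])

lemma tI_ideal: "ideal (tI n) P"
 by (induction n) (simp_all add: P.oneideal P.ideal_prod_is_ideal gI_ideal)

lemma tI_Suc_subset: "tI (Suc n) <= tI n"
 using P.ideal_prod_inter[OF tI_ideal gI_ideal] by auto

lemma tI_antimono: "m <= n ==> tI n <= tI m"
 by (induction rule: dec_induct) (use tI_Suc_subset in blast)+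

lemma tI_1_subset: "tI (Suc 0) <= dI"
proof -
 have "gI 0 <= dI" by (rule P.genideal_minimal[OF dI_ideal]) simp
 moreover have "tI (Suc 0) <= gI 0"
  using P.ideal_prod_inter[OF P.oneideal gI_ideal[of 0]] by simp
 ultimately show ?thesis by blast
qed

section \<open>Extension of the Taylor lift to the tensor square\<close>

definition Th where "Th = tensor_lift NT (\<lambda>f g. zp.nw.cst f *[NT] \<tau> g)"

lemma NT_cring: "cring NT" by (rule zp.nw.T_cring)

lemma cst_mult: "a : car A ==> b : car A ==> zp.nw.cst (a \<otimes> b) = zp.nw.cst a *[NT] zp.nw.cst b"
 by (rule ring_hom_mult[OF zp.nw.cst_hom])

lemma Th_bal: "balanced R A A NT (\<lambda>f g. zp.nw.cst f *[NT] \<tau> g)"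
proof (rule balancedI)
 show "zp.nw.cst (s \<oplus> s') *[NT] \<tau> t = zp.nw.cst s *[NT] \<tau> t +[NT] zp.nw.cst s' *[NT] \<tau> t"
  if "s : car A" "s' : car A" "t : car A" for s s' t
  using that by (simp add: ring_hom_add[OF zp.nw.cst_hom] zp.nw.T.l_distr \<tau>_closed)
 show "zp.nw.cst s *[NT] \<tau> (t \<oplus> t') = zp.nw.cst s *[NT] \<tau> t +[NT] zp.nw.cst s *[NT] \<tau> t'"
  if "s : car A" "t : car A" "t' : car A" for s t t'
  using that by (simp add: ring_hom_add[OF \<tau>(1)] zp.nw.T.r_distr \<tau>_closed)
 show "zp.nw.cst (a \<odot>[A] s) *[NT] \<tau> t = zp.nw.cst s *[NT] \<tau> (a \<odot>[A] t)"
  if a: "a : car R" and s: "s : car A" and t: "t : car A" for a s t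
 proof -
  have i: "\<iota> a : car A" using a by simp
  have "zp.nw.cst (a \<odot>[A] s) = zp.nw.cst (\<iota> a) *[NT] zp.nw.cst s"
   using RA.smult_eq_mult[OF a s] cst_mult[OF i s] by simp
  moreover have "\<tau> (a \<odot>[A] t) = zp.nw.cst (\<iota> a) *[NT] \<tau> t"
   using RA.smult_eq_mult[OF a t] ring_hom_mult[OF \<tau>(1) i t] \<tau>_\<iota>[OF a] by simp
  ultimately show ?thesis using i s t by (simp add: zp.nw.T.m_ac \<tau>_closed)
 qed
qed (simp_all add: \<tau>_closed)

lemma Th_hom: "Th : ring_hom P NT"
 unfolding Th_def
proof (rule tensor_lift_hom[OF NT_cring Th_bal])
 show "zp.nw.cst (f \<otimes> f') *[NT] \<tau> (h \<otimes> h') = zp.nw.cst f *[NT] \<tau> h *[NT] (zp.nw.cst f' *[NT] \<tau> h')"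
  if "f : car A" "f' : car A" "h : car A" "h' : car A" for f f' h h'
  using that by (simp add: cst_mult ring_hom_mult[OF \<tau>(1)] \<tau>_closed zp.nw.T.m_ac)
 show "zp.nw.cst \<one> *[NT] \<tau> \<one> = \<one>[NT]"
  using ring_hom_one[OF \<tau>(1)] ring_hom_one[OF zp.nw.cst_hom] by simp
qed

lemma Th_tt: "f : car A ==> g : car A ==> Th (tt f g) = zp.nw.cst f *[NT] \<tau> g"
 unfolding Th_def by (rule tp.tensor_lift_tens[OF zp.nw.T.abelian_group_axioms Th_bal])

lemma Th_lf: "f : car A ==> Th (lf f) = zp.nw.cst f"
 using ring_hom_one[OF \<tau>(1)] by (simp add: Th_tt)

lemma Th_rt: "f : car A ==> Th (rt f) = \<tau> f"
 using ring_hom_one[OF zp.nw.cst_hom] by (simp add: Th_tt \<tau>_closed)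

text \<open>On f \<otimes> g both sides equal \<sigma>^m(f) \<sigma>^m(g) by
  \<open>ev_\<tau>\<close>. Since \<open>mu\<close> kills I, evaluation at (q^m - 1)x kills the
  image of \<sigma>^m(I).\<close>

lemma ev_Th_sP:
 assumes z: "z : car P"
 shows "zp.ev m (Th ((sP ^^ m) z)) = (\<sigma> ^^ m) (mu z)"
proof -
 have h1: "zp.ev m \<circ> (Th \<circ> (sP ^^ m)) : ring_hom P A"
  by (intro ring_hom_trans[OF _ zp.ev_hom] ring_hom_trans[OF sP_pow_hom Th_hom])
 have h2: "(\<sigma> ^^ m) \<circ> mu : ring_hom P A" by (rule ring_hom_trans[OF mu_hom \<sigma>_pow_hom])
 have "(zp.ev m \<circ> (Th \<circ> (sP ^^ m))) z = ((\<sigma> ^^ m) \<circ> mu) z"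
 proof (rule P_additive_eq[OF Ac.abelian_group_axioms ring_hom_closed[OF h1] ring_hom_closed[OF h2]
    ring_hom_add[OF h1] ring_hom_add[OF h2] _ z])
  fix a b assume a: "a : car A" and b: "b : car A"
  have "zp.ev m (zp.nw.cst ((\<sigma> ^^ m) a) *[NT] \<tau> b) = (\<sigma> ^^ m) a \<otimes> (\<sigma> ^^ m) b"
   using ring_hom_mult[OF zp.ev_hom zp.nw.cst_closed[OF \<sigma>_pow_closed[OF a]] \<tau>_closed[OF b]]
   by (simp add: zp.ev_cst \<sigma>_pow_closed a ev_\<tau>[OF b])
  then show "(zp.ev m \<circ> (Th \<circ> (sP ^^ m))) (tt a b) = ((\<sigma> ^^ m) \<circ> mu) (tt a b)"
   using a b by (simp add: sP_pow_tt Th_tt \<sigma>_pow_closed mu_tt ring_hom_mult[OF \<sigma>_pow_hom])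
 qed
 then show ?thesis by simp
qed

lemma ev_Th_gI:
 assumes z: "z : gI m"
 shows "zp.ev m (Th z) = \<zero>"
proof -
 have h: "zp.ev m \<circ> Th : ring_hom P A" by (rule ring_hom_trans[OF Th_hom zp.ev_hom])
 interpret ring_hom_ring P A "zp.ev m \<circ> Th" by (rule ring_hom_ringI2[OF P.ring_axioms Ac.ring_axioms h])
 have \<sigma>0: "(\<sigma> ^^ m) \<zero> = \<zero>"
  using ring_hom_add[OF \<sigma>_pow_hom, of \<zero> \<zero> m] \<sigma>_pow_closed[of \<zero> m] by (simp add: Ac.add.r_cancel_one')
 have "gI m <= {z : car P. (zp.ev m \<circ> Th) z : {\<zero>}}"
 proof (rule P.genideal_minimal[OF ideal_vimage[OF Ac.zeroideal]])
  show "(sP ^^ m) ` dI <= {z : car P. (zp.ev m \<circ> Th) z : {\<zero>}}"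
   using sP_dI_carrier ev_Th_sP dI_iff \<sigma>0 by auto
 qed
 then show ?thesis using z by auto
qed

text \<open>The factor \<sigma>^m(I) of I^(m+1) vanishes at (q^m - 1)x, so \<open>Tr_step\<close>
  raises the order by one per factor.\<close>

lemma Th_tI: "z : tI m ==> Th z : zp.nw.Tr m"
proof (induction m arbitrary: z)
 case 0
 then show ?case using ring_hom_closed[OF Th_hom] by (simp add: zp.nw.Tr_iff)
next
 case (Suc m)
 interpret ring_hom_ring P NT Th by (rule ring_hom_ringI2[OF P.ring_axioms zp.nw.T.ring_axioms Th_hom])
 have "tI (Suc m) <= {z : car P. Th z : zp.nw.Tr (Suc m)}"
  unfolding diag_twisted_power.simps
 proof (rule P.ideal_prod_subset[OF ideal_vimage[OF zp.nw.Tr_ideal]])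
  fix a b assume a: "a : tI m" and b: "b : gI m"
  have ac: "a : car P" "b : car P" using a b ideal.Icarr[OF tI_ideal] ideal.Icarr[OF gI_ideal] by auto
  have "Th b *[NT] Th a : zp.nw.Tr (Suc m)"
   by (rule zp.Tr_step[OF ring_hom_closed[OF Th_hom ac(2)] ev_Th_gI[OF b] Suc.IH[OF a]])
  then show "a *[P] b : {z : car P. Th z : zp.nw.Tr (Suc m)}"
   using ac ring_hom_closed[OF Th_hom] by (simp add: zp.nw.T.m_comm)
 qed
 then show ?case using Suc.prems by blast
qed

lemma Th_cP: "z : ideal_power P cP k ==> Th z : zp.nw.W k"
proof -
 assume z: "z : ideal_power P cP k"
 have 1: "Th ` cP <= pq_ideal p NT (zp.nw.cst (hA qv))"
  unfolding cP_eq by (rule ring_hom_pq_ideal[OF tp.MN_cring NT_cring Th_hom]) (simp_all add: tp.tens_closed Th_lf)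
 have "Th ` ideal_power P cP k <= ideal_power NT (pq_ideal p NT (zp.nw.cst (hA qv))) k"
  by (rule ring_hom_ideal_pow[OF P.ring_axioms zp.nw.T.ring_axioms Th_hom cP_ideal _ 1]) (rule zp.nw.T.pq_ideal_ideal, simp)
 then show ?thesis using z zp.nw.pq_ideal_pow_W[of k] by blast
qed

lemma sP_cong:
 assumes z: "z : car P"
 shows "(sP ^^ m) z -[P] z : cP"
 using z
proof (induction z rule: tp.tensor_induct)
 case (tens f g)
 have "(sP ^^ m) (tt f g) -[P] tt f g = tt ((\<sigma> ^^ m) f \<ominus> f) g"
  using tens by (simp add: sP_pow_tt \<sigma>_pow_closed P.minus_eq Ac.minus_eq tp.tens_add_l tp.tens_minus_l)
 also have "... = lf ((\<sigma> ^^ m) f \<ominus> f) *[P] rt g"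
  using tens by (intro tt_eq) (simp_all add: \<sigma>_pow_closed)
 also have "... : cP"
 proof (rule ideal.I_r_closed[OF cP_ideal])
  have "lf ` zp.\<cc> <= cP"
   unfolding cP_eq by (rule ring_hom_pq_ideal[OF A_cring tp.MN_cring lf_hom]) auto
  then show "lf ((\<sigma> ^^ m) f \<ominus> f) : cP" using \<sigma>_cong[OF tens(1)] by blast
 qed (use tens in \<open>simp add: tp.tens_closed\<close>)
 finally show ?case .
next
 case (add Y Z)
 have c: "(sP ^^ m) Y : car P" "(sP ^^ m) Z : car P"
  using ring_hom_closed[OF sP_pow_hom] add by blast+
 have "(sP ^^ m) (Y +[P] Z) -[P] (Y +[P] Z) = ((sP ^^ m) Y -[P] Y) +[P] ((sP ^^ m) Z -[P] Z)"
  using add(1,2) c ring_hom_add[OF sP_pow_hom add(1,2)] by (simp add: P.minus_eq P.minus_add P.a_ac)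
 then show ?case using P.ideal_add_closed[OF cP_ideal add(3,4)] by simp
qed

abbreviation dJ where "dJ \<equiv> dI <+>\<^bsub>P\<^esub> cP"

lemma dJ_ideal: "ideal dJ P"
 by (rule P.add_ideals[OF dI_ideal cP_ideal])

text \<open>Since \<sigma>^m is the identity modulo (p,q-1), replacing a factor in I by its image
  under \<sigma>^m costs only an element of (p,q-1). Ordinary powers are thereby controlled by
  twisted ones.\<close>

lemma dJ_pow: "ideal_power P dJ m <= tI m <+>\<^bsub>P\<^esub> cP"
proof (induction m)
 case 0
 then show ?case using P.subset_set_add_l[OF P.oneideal cP_ideal] by simp
next
 case (Suc m)
 have id: "ideal (tI (Suc m) <+>\<^bsub>P\<^esub> cP) P" by (rule P.add_ideals[OF tI_ideal cP_ideal])
 have c: "cP <= tI (Suc m) <+>\<^bsub>P\<^esub> cP" by (rule P.subset_set_add_r[OF tI_ideal cP_ideal])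
 have step: "a *[P] i : tI (Suc m) <+>\<^bsub>P\<^esub> cP" if a: "a : tI m" and i: "i : dI" for a i
 proof -
  have ac: "a : car P" "i : car P" using a i ideal.Icarr[OF tI_ideal] dI_iff by auto
  have sc: "(sP ^^ m) i : car P" using ring_hom_closed[OF sP_pow_hom ac(2)] .
  have 1: "a *[P] (sP ^^ m) i : tI (Suc m)"
   using P.genideal_self[OF sP_dI_carrier[of m]] i a by (auto intro!: ideal_prod.prod)
  have 2: "a *[P] ((sP ^^ m) i -[P] i) : cP"
   by (rule ideal.I_l_closed[OF cP_ideal sP_cong[OF ac(2)] ac(1)])
  have "a *[P] (sP ^^ m) i -[P] a *[P] ((sP ^^ m) i -[P] i) : tI (Suc m) <+>\<^bsub>P\<^esub> cP"
   by (rule P.ideal_minus_closed[OF id subsetD[OF P.subset_set_add_l[OF tI_ideal cP_ideal] 1] subsetD[OF c 2]])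
  then show ?thesis unfolding P.sub_distr_cancel[OF ac(1) sc ac(2)] .
 qed
 show ?case unfolding P.ideal_pow_Suc
 proof (rule P.ideal_prod_subset[OF id])
  fix a b assume a: "a : ideal_power P dJ m" and b: "b : dJ"
  show "a *[P] b : tI (Suc m) <+>\<^bsub>P\<^esub> cP"
  proof (rule P.set_add_mult[OF tI_ideal cP_ideal dI_ideal cP_ideal id step])
   show "a : tI m <+>\<^bsub>P\<^esub> cP" using a Suc by blast
   show "x *[P] y : tI (Suc m) <+>\<^bsub>P\<^esub> cP" if "x : tI m" "y : cP" for x y
    using ideal.I_l_closed[OF cP_ideal that(2)] ideal.Icarr[OF tI_ideal that(1)] c by blast
   show "x *[P] y : tI (Suc m) <+>\<^bsub>P\<^esub> cP" if "x : cP" "y : dI" for x y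
    using ideal.I_r_closed[OF cP_ideal that(1)] that(2) dI_iff c by blast
   show "x *[P] y : tI (Suc m) <+>\<^bsub>P\<^esub> cP" if "x : cP" "y : cP" for x y
    using ideal.I_r_closed[OF cP_ideal that(1)] ideal.Icarr[OF cP_ideal that(2)] c by blast
  qed (use b in auto)
 qed
qed

text \<open>Multiply k copies of \<open>dJ_pow\<close>: each product either contains a factor from
  I^(m) or has all k factors in (p,q-1).\<close>

lemma dJ_pow_pow: "ideal_power P dJ (m * k) <= tI m <+>\<^bsub>P\<^esub> ideal_power P cP k"
proof (induction k)
 case 0
 have "tI m <+>\<^bsub>P\<^esub> car P \<supseteq> car P" by (rule P.subset_set_add_r[OF tI_ideal P.oneideal])
 then show ?case by simp
next
 case (Suc k)
 note ck = P.ideal_pow_ideal[OF cP_ideal]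
 have id: "ideal (tI m <+>\<^bsub>P\<^esub> ideal_power P cP (Suc k)) P" by (rule P.add_ideals[OF tI_ideal ck])
 have t: "tI m <= tI m <+>\<^bsub>P\<^esub> ideal_power P cP (Suc k)" by (rule P.subset_set_add_l[OF tI_ideal ck])
 have e: "m * Suc k = m * k + m" by simp
 show ?case unfolding e P.ideal_pow_add[OF dJ_ideal]
 proof (rule P.ideal_prod_subset[OF id])
  fix a b assume a: "a : ideal_power P dJ (m * k)" and b: "b : ideal_power P dJ m"
  show "a *[P] b : tI m <+>\<^bsub>P\<^esub> ideal_power P cP (Suc k)"
  proof (rule P.set_add_mult[OF tI_ideal ck tI_ideal cP_ideal id])
   show "a : tI m <+>\<^bsub>P\<^esub> ideal_power P cP k" using a Suc by blast
   show "b : tI m <+>\<^bsub>P\<^esub> cP" using b dJ_pow by blast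
   show "x *[P] y : tI m <+>\<^bsub>P\<^esub> ideal_power P cP (Suc k)" if "x : tI m" "y : tI m" for x y
    using ideal.I_r_closed[OF tI_ideal that(1)] ideal.Icarr[OF tI_ideal that(2)] t by blast
   show "x *[P] y : tI m <+>\<^bsub>P\<^esub> ideal_power P cP (Suc k)" if "x : tI m" "y : cP" for x y
    using ideal.I_r_closed[OF tI_ideal that(1)] ideal.Icarr[OF cP_ideal that(2)] t by blast
   show "x *[P] y : tI m <+>\<^bsub>P\<^esub> ideal_power P cP (Suc k)" if "x : ideal_power P cP k" "y : tI m" for x y
    using ideal.I_l_closed[OF tI_ideal that(2)] ideal.Icarr[OF ck that(1)] t by blast
   show "x *[P] y : tI m <+>\<^bsub>P\<^esub> ideal_power P cP (Suc k)" if "x : ideal_power P cP k" "y : cP" for x y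
    using ideal_prod.prod[OF that, of P] subsetD[OF P.subset_set_add_r[OF tI_ideal[of m] ck[of "Suc k"]]] by simp
  qed
 qed
qed

end

lemma (in cring) add_sub_cancel: "a : car R ==> b : car R ==> (a \<oplus> b) \<ominus> a = b"
 by algebra

lemma (in cring) sub_sub_sub: "a : car R ==> b : car R ==> c : car R ==> (a \<ominus> b) \<ominus> (c \<ominus> b) = a \<ominus> c"
 by algebra

lemma (in cring) add_sub_cancel2: "a : car R ==> b : car R ==> a \<oplus> (b \<ominus> a) = b"
 by algebra

context q_setting
begin

section \<open>The Newton basis of A[\<xi>] and its images in P and in the series ring\<close>

abbreviation UA where "UA \<equiv> UP A"
abbreviation XA where "XA \<equiv> monom UA \<one> 1"
abbreviation xp where "xp \<equiv> xi_pow R A x"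
abbreviation xI where "xI \<equiv> xi_ideal R A x"

lemma UA_cring: "cring UA" by (rule UP_cring.UP_cring) (simp add: UP_cring_def A_cring)

sublocale UAc: cring UA by (rule UA_cring)

sublocale UA: UP_cring A "UP A"
 by (simp_all add: UP_cring_def A_cring)

definition fac where "fac i = XA +[UA] monom UA (x \<ominus> hA (qv ^ i) \<otimes> x) 0"

lemma XA_closed: "XA : car UA" by simp

lemma fac_closed [simp]: "fac i : car UA"
 unfolding fac_def using x_closed by simp

lemma xp_eq: "xp n = (\<Otimes>\<^bsub>UA\<^esub>i\<in>{..<n}. fac i)"
 unfolding xi_pow_def fac_def q_in_A zp.h_power ..

lemma xp_0: "xp 0 = \<one>[UA]"
 by (simp add: xp_eq)

lemma xp_closed [simp]: "xp n : car UA"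
 unfolding xp_eq by (rule UAc.finprod_closed) auto

lemma xp_Suc: "xp (Suc n) = xp n *[UA] fac n"
proof -
 have "xp (Suc n) = fac n *[UA] xp n"
  unfolding xp_eq lessThan_Suc by (rule UAc.finprod_insert) auto
 then show ?thesis by (simp add: UAc.m_comm)
qed

lemma cst_hom_UA: "(\<lambda>a. monom UA a 0) : ring_hom A UA"
 by (rule UA.const_ring_hom)

text \<open>The map A[\<xi>] -> P that induces \<open>xi_to_P\<close> after completion and passage
  to quotients.\<close>

definition E where "E = eval A P lf (rt x -[P] lf x)"

lemma E_hom: "E : ring_hom UA P" "a : car A ==> E (monom UA a 0) = lf a" "E XA = rt x -[P] lf x"
proof -
 have "rt x -[P] lf x : car P" using x_closed by (simp add: tp.tens_closed)
 note e = eval_UP_hom[OF A_cring tp.MN_cring lf_hom this]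
 show "E : ring_hom UA P" "a : car A ==> E (monom UA a 0) = lf a" "E XA = rt x -[P] lf x"
  unfolding E_def using e by auto
qed

lemma E_closed: "g : car UA ==> E g : car P"
 by (rule ring_hom_closed[OF E_hom(1)])

definition Ps where "Ps g = Th (E g)"

lemma Ps_hom: "Ps : ring_hom UA NT"
 using ring_hom_trans[OF E_hom(1) Th_hom] by (simp add: Ps_def[abs_def] comp_def)

lemma Ps_closed: "g : car UA ==> Ps g : car NT"
 by (rule ring_hom_closed[OF Ps_hom])

lemma Ps_cst: "a : car A ==> Ps (monom UA a 0) = zp.nw.cst a"
 by (simp add: Ps_def E_hom(2) Th_lf)

lemma Ps_XA: "Ps XA = zp.nw.basis 1"
proof -
 have "Ps XA = Th (rt x) -[NT] Th (lf x)"
  unfolding Ps_def E_hom(3)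
  by (rule ring_hom_minus[OF P.ring_axioms zp.nw.T.ring_axioms Th_hom]) (simp_all add: x_closed tp.tens_closed)
 also have "... = (zp.nw.cst x +[NT] zp.nw.basis 1) -[NT] zp.nw.cst x"
  using x_closed by (simp add: Th_rt Th_lf \<tau>_x)
 also have "... = zp.nw.basis 1"
  using zp.nw.cst_closed[OF x_closed] zp.nw.basis_closed[of 1] by (rule zp.nw.T.add_sub_cancel)
 finally show ?thesis .
qed

text \<open>The basis elements of the series ring obey the recursion that defines \<xi>^(n): the
  coefficient (q^n - 1)x at index n is cancelled by x - q^n x.\<close>

lemma basis_Suc:
 "zp.nw.basis n *[NT] (zp.nw.basis 1 +[NT] zp.nw.cst (x \<ominus> hA (qv ^ n) \<otimes> x)) = zp.nw.basis (Suc n)"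
proof
 fix l
 let ?y = "x \<ominus> hA (qv ^ n) \<otimes> x"
 have y: "?y : car A" using x_closed by simp
 have "zp.nw.basis n *[NT] (zp.nw.basis 1 +[NT] zp.nw.cst ?y)
   = zp.nw.basis n *[NT] zp.nw.basis 1 +[NT] zp.nw.cst ?y *[NT] zp.nw.basis n"
  using y by (simp add: zp.nw.T.r_distr zp.nw.T.m_comm)
 then have "(zp.nw.basis n *[NT] (zp.nw.basis 1 +[NT] zp.nw.cst ?y)) l
   = zp.nw.s n 1 l \<oplus> ?y \<otimes> zp.nw.basis n l"
  using y zp.nw.cst_mult[OF y zp.nw.basis_closed[of n]] zp.nw.basis_mult[of n 1 l]
  by (simp add: zp.nw.T_simps(4))
 also have "... = zp.nw.basis (Suc n) l"
 proof -
  consider "l = n" | "l = Suc n" | "l ~= n" "l ~= Suc n" by blast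
  then show ?thesis
  proof cases
   case 1
   have "newton_str n 1 1 = qv ^ n - 1"
   proof (cases n)
    case 0
    then show ?thesis by (simp add: newton_str_def q_binom_eq_0)
   next
    case (Suc n')
    have "q_binom (1 + n') 1 * q_fact 1 * q_fact n' = q_fact (1 + n')" by (rule q_binom_fact)
    then have "q_binom n 1 * q_fact n' = q_int n * q_fact n'" using Suc by (simp add: q_fact_Suc)
    then have "q_binom n 1 = q_int n" using q_fact_nonzero by simp
    moreover have "q_binom 1 1 = 1" using q_binom_fact[of 1 0] by (simp add: q_fact_Suc)
    ultimately show ?thesis
     using q_int_mult[of n] by (simp add: newton_str_def q_fact_Suc mult.commute)
   qed
   then have "zp.nw.s n 1 l = (hA (qv ^ n) \<ominus> \<one>) \<otimes> x"
    using 1 x_closed by (simp add: tw_el_def str_at_def zp.h_minus)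
   then have "zp.nw.s n 1 l \<oplus> ?y \<otimes> zp.nw.basis n l
     = (hA (qv ^ n) \<ominus> \<one>) \<otimes> x \<oplus> (x \<ominus> hA (qv ^ n) \<otimes> x)"
    using 1 y by (simp add: zp.nw.basis_def)
   also have "... = \<zero>"
    using x_closed zp.h_closed[of "qv ^ n"] by algebra
   finally show ?thesis using 1 by (simp add: zp.nw.basis_def)
  next
   case 2
   have "newton_str n 1 0 = 1" by (simp add: newton_str_def)
   then show ?thesis using 2 x_closed y by (simp add: tw_el_def str_at_def zp.nw.basis_def)
  next
   case 3
   then have "zp.nw.s n 1 l = \<zero>" by (intro zp.nw.s_eq_0) auto
   then show ?thesis using 3 y by (simp add: zp.nw.basis_def)
  qed
 qed
 finally show "(zp.nw.basis n *[NT] (zp.nw.basis 1 +[NT] zp.nw.cst ?y)) l = zp.nw.basis (Suc n) l" .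
qed

lemma Ps_fac: "Ps (fac i) = zp.nw.basis 1 +[NT] zp.nw.cst (x \<ominus> hA (qv ^ i) \<otimes> x)"
 unfolding fac_def using x_closed ring_hom_add[OF Ps_hom XA_closed, of "monom UA (x \<ominus> hA (qv ^ i) \<otimes> x) 0"] Ps_XA Ps_cst
 by simp

lemma Ps_xp: "Ps (xp n) = zp.nw.basis n"
proof (induction n)
 case 0
 then show ?case using ring_hom_one[OF Ps_hom]
  by (auto simp: xp_0 zp.nw.T_simps(2) zp.nw.basis_def)
next
 case (Suc n)
 have "Ps (xp (Suc n)) = Ps (xp n) *[NT] Ps (fac n)"
  unfolding xp_Suc by (rule ring_hom_mult[OF Ps_hom]) auto
 then show ?case using Suc basis_Suc by (simp add: Ps_fac)
qed

lemma Ps_coeff: "a : car A ==> Ps (monom UA a 0 *[UA] xp n) = (\<lambda>k. if k = n then a else \<zero>)"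
 using ring_hom_mult[OF Ps_hom, of "monom UA a 0" "xp n"] zp.nw.cst_mult[of a "zp.nw.basis n"]
 by (auto simp: Ps_cst Ps_xp zp.nw.basis_def zp.nw.T_carrier_iff)

definition newt :: "nat => (nat => 'a) => nat => 'a" where
 "newt N F = (\<Oplus>[UA]k\<in>{..N}. monom UA (F k) 0 *[UA] xp k)"

lemma newt_closed: "F : car NT ==> newt N F : car UA"
 unfolding newt_def by (rule UAc.finsum_closed) (auto intro: zp.nw.T_closed)

lemma Ps_newt:
 assumes F: "F : car NT"
 shows "Ps (newt N F) = (\<lambda>k. if k <= N then F k else \<zero>)"
proof
 fix j
 let ?L = "\<lambda>g. Ps g j"
 have "Ps (newt N F) j = (\<Oplus>k\<in>{..N}. Ps (monom UA (F k) 0 *[UA] xp k) j)"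
  unfolding newt_def
 proof (rule additive_finsum[OF UAc.abelian_group_axioms Ac.abelian_group_axioms, where L = ?L])
  show "Ps y j : car A" if "y : car UA" for y using Ps_closed[OF that] by simp
  show "Ps (y +[UA] z) j = Ps y j \<oplus> Ps z j" if "y : car UA" "z : car UA" for y z
   using ring_hom_add[OF Ps_hom that] by (simp add: zp.nw.T_simps(4))
 qed (use F in simp)
 also have "... = (\<Oplus>k\<in>{..N}. if j = k then F k else \<zero>)"
  by (rule Ac.finsum_cong2') (use F in \<open>auto simp: Ps_coeff\<close>)
 also have "... = (if j <= N then F j else \<zero>)"
 proof (cases "j <= N")
  case True
  have "(\<Oplus>k\<in>{..N}. if j = k then F k else \<zero>) = (if j = j then F j else \<zero>)"
   by (rule Ac.finsum_single) (use True F in auto)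
  then show ?thesis using True by simp
 next
  case False
  then show ?thesis by (auto intro!: Ac.finsum_zero)
 qed
 finally show "Ps (newt N F) j = (if j <= N then F j else \<zero>)" .
qed

lemma newt_ext:
 assumes F: "F : car NT" and "N <= N'" and z: "!!k. k > N ==> F k = \<zero>"
 shows "newt N F = newt N' F"
 unfolding newt_def
 by (rule UAc.finsum_neutral) (use assms in \<open>auto simp: zp.nw.T_closed\<close>)

text \<open>The Newton sums contain the constants and are closed under addition and under
  multiplication by \<xi>, hence exhaust A[\<xi>].\<close>

lemma newt_ex:
 assumes g: "g : car UA"
 shows "\<exists>N F. F : car NT \<and> (\<forall>k>N. F k = \<zero>) \<and> g = newt N F"
proof -
 let ?Q = "\<lambda>g. \<exists>N F. F : car NT \<and> (\<forall>k>N. F k = \<zero>) \<and> g = newt N F"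
 have Qcoef: "?Q (monom UA a 0 *[UA] xp n)" if a: "a : car A" for a n
 proof -
  let ?F = "\<lambda>k. if k = n then a else \<zero>"
  have F: "?F : car NT" using a by (simp add: zp.nw.T_carrier_iff)
  have "newt n ?F = monom UA (?F n) 0 *[UA] xp n"
   unfolding newt_def by (rule UAc.finsum_single) (use a in auto)
  then show ?thesis using F by (intro exI[of _ n] exI[of _ ?F]) auto
 qed
 have Qadd: "?Q (g +[UA] g')" if Q: "?Q g" "?Q g'" for g g'
 proof -
  obtain N F where F: "F : car NT" "!!k. k > N ==> F k = \<zero>" "g = newt N F" using Q by blast
  obtain N' F' where F': "F' : car NT" "!!k. k > N' ==> F' k = \<zero>" "g' = newt N' F'" using Q by blast
  let ?M = "max N N'"
  have "g +[UA] g' = newt ?M F +[UA] newt ?M F'"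
   using F F' newt_ext[OF F(1), of N ?M] newt_ext[OF F'(1), of N' ?M] by simp
  also have "... = newt ?M (F +[NT] F')"
  proof -
   let ?g = "\<lambda>F k. monom UA (F k) 0 *[UA] xp k"
   have c: "F k : car A" "F' k : car A" for k using F(1) F'(1) by (auto intro: zp.nw.T_closed)
   have "newt ?M F +[UA] newt ?M F' = (\<Oplus>[UA]k\<in>{..?M}. ?g F k +[UA] ?g F' k)"
    unfolding newt_def by (rule UAc.finsum_addf[symmetric]) (use c in auto)
   also have "... = newt ?M (F +[NT] F')"
    unfolding newt_def
   proof (rule UAc.finsum_cong2')
    fix k
    have "monom UA (F k \<oplus> F' k) 0 = monom UA (F k) 0 +[UA] monom UA (F' k) 0" by (rule UA.monom_add[OF c])
    then show "?g F k +[UA] ?g F' k = ?g (F +[NT] F') k"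
     using c by (simp add: zp.nw.T_simps(4) UAc.l_distr)
   qed (use c in \<open>simp add: zp.nw.T_simps(4)\<close>)
   finally show ?thesis .
  qed
  finally show ?thesis using F F' by (intro exI[of _ ?M] exI[of _ "F +[NT] F'"]) (auto simp: zp.nw.T_simps(4) zp.nw.T_carrier_iff)
 qed
 have Qsum: "?Q (\<Oplus>[UA]k\<in>I. f k)" if "finite I" "!!k. k : I ==> ?Q (f k)" "!!k. k : I ==> f k : car UA" for I :: "nat set" and f
  using that
 proof (induction I rule: finite_induct)
  case empty
  have "newt 0 \<zero>[NT] = \<zero>[UA]" by (simp add: newt_def zp.nw.T_simps(3))
  then show ?case by (intro exI[of _ 0] exI[of _ "\<zero>[NT]"]) (simp add: zp.nw.T_simps(3) zp.nw.T_carrier_iff)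
 next
  case (insert i I)
  have "(\<Oplus>[UA]k\<in>insert i I. f k) = f i +[UA] (\<Oplus>[UA]k\<in>I. f k)"
   using insert by (intro UAc.finsum_insert) auto
  then show ?case using Qadd insert by simp
 qed
 have Qmult: "?Q (g *[UA] XA)" if Q: "?Q g" for g
 proof -
  obtain N F where F: "F : car NT" "g = newt N F" using Q by blast
  have Fk: "F k : car A" for k using F by simp
  have xk: "xp k *[UA] XA = xp (Suc k) +[UA] monom UA (hA (qv ^ k) \<otimes> x \<ominus> x) 0 *[UA] xp k" for k
  proof -
   let ?c = "hA (qv ^ k) \<otimes> x \<ominus> x"
   have "monom UA (x \<ominus> hA (qv ^ k) \<otimes> x) 0 +[UA] monom UA ?c 0 = monom UA (x \<ominus> hA (qv ^ k) \<otimes> x \<oplus> ?c) 0"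
    using x_closed by (intro UA.monom_add[symmetric]) auto
   also have "x \<ominus> hA (qv ^ k) \<otimes> x \<oplus> ?c = \<zero>"
    using x_closed zp.h_closed[of "qv ^ k"] by algebra
   finally have "fac k +[UA] monom UA ?c 0 = XA"
    unfolding fac_def using x_closed by (simp add: UAc.a_assoc)
   then have "xp k *[UA] XA = xp k *[UA] (fac k +[UA] monom UA ?c 0)" by simp
   also have "... = xp (Suc k) +[UA] monom UA ?c 0 *[UA] xp k"
    unfolding xp_Suc using x_closed by (simp add: UAc.r_distr UAc.m_comm)
   finally show ?thesis .
  qed
  have "g *[UA] XA = (\<Oplus>[UA]k\<in>{..N}. monom UA (F k) 0 *[UA] xp k *[UA] XA)"
   unfolding F(2) newt_def by (rule UAc.finsum_ldistr) (use Fk in auto)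
  also have "... = (\<Oplus>[UA]k\<in>{..N}. monom UA (F k) 0 *[UA] xp (Suc k)
    +[UA] monom UA (F k \<otimes> (hA (qv ^ k) \<otimes> x \<ominus> x)) 0 *[UA] xp k)"
  proof (rule UAc.finsum_cong2')
   fix k
   have m: "monom UA (F k \<otimes> (hA (qv ^ k) \<otimes> x \<ominus> x)) 0 = monom UA (F k) 0 *[UA] monom UA (hA (qv ^ k) \<otimes> x \<ominus> x) 0"
    using ring_hom_mult[OF cst_hom_UA Fk, of "hA (qv ^ k) \<otimes> x \<ominus> x" k] x_closed by simp
   show "monom UA (F k) 0 *[UA] xp k *[UA] XA = monom UA (F k) 0 *[UA] xp (Suc k)
    +[UA] monom UA (F k \<otimes> (hA (qv ^ k) \<otimes> x \<ominus> x)) 0 *[UA] xp k"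
    unfolding m UAc.m_assoc[OF UA.monom_closed[OF Fk] xp_closed XA_closed] xk
    using Fk x_closed by (simp add: UAc.r_distr UAc.m_assoc)
  qed (use Fk x_closed in auto)
  finally have *: "g *[UA] XA = (\<Oplus>[UA]k\<in>{..N}. monom UA (F k) 0 *[UA] xp (Suc k)
    +[UA] monom UA (F k \<otimes> (hA (qv ^ k) \<otimes> x \<ominus> x)) 0 *[UA] xp k)" .
  have c: "F k \<otimes> (hA (qv ^ k) \<otimes> x \<ominus> x) : car A" for k using Fk x_closed by simp
  show ?thesis unfolding *
   by (rule Qsum, simp, rule Qadd[OF Qcoef[OF Fk] Qcoef[OF c]]) (use Fk c in simp)
 qed
 have Qpow: "?Q (monom UA a k)" if a: "a : car A" for a k
 proof (induction k)
  case 0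
  show ?case using Qcoef[OF a, of 0] a by (simp add: xp_0)
 next
  case (Suc k)
  have "monom UA a (Suc k) = monom UA a k *[UA] XA"
   using UA.monom_mult[OF a Ac.one_closed, of k 1] a by simp
  then show ?case using Qmult[OF Suc] by simp
 qed
 have "(\<Oplus>[UA]i\<in>{..deg A g}. monom UA (coeff UA g i) i) = g" by (rule UA.up_repr[OF g])
 then show ?thesis using Qsum[of "{..deg A g}" "\<lambda>i. monom UA (coeff UA g i) i"] Qpow g by simp
qed

lemma xI_ideal: "ideal (xI n) UA"
 unfolding xi_ideal_def by (rule UAc.genideal_ideal) simp

lemma xp_in_xI: "n < k ==> xp k : xI n"
proof (induction k)
 case (Suc k)
 show ?case
 proof (cases "k = n")
  case True
  then show ?thesis unfolding xi_ideal_def using UAc.genideal_self'[of "xp (n + 1)"] by simp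
 next
  case False
  then show ?thesis using Suc ideal.I_r_closed[OF xI_ideal, of "xp k" n "fac k"] by (simp add: xp_Suc)
 qed
qed simp

text \<open>Makes membership in the ideal of \<xi>^(n+1) a condition on coefficients. For the
  converse direction the polynomial is expanded in Newton form, where terms of index above n lie in
  the ideal.\<close>

lemma xI_iff:
 assumes g: "g : car UA"
 shows "g : xI n \<longleftrightarrow> Ps g : zp.nw.Tr (Suc n)"
proof
 assume "g : xI n"
 moreover have "Ps (xp (n + 1)) : zp.nw.Tr (Suc n)"
  unfolding Ps_xp by (simp add: zp.nw.Tr_iff) (simp add: zp.nw.basis_def)
 ultimately show "Ps g : zp.nw.Tr (Suc n)"
  unfolding xi_ideal_def
  by (intro ring_hom_genideal[OF UAc.ring_axioms zp.nw.T.ring_axioms Ps_hom, of "{xp (n + 1)}"])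
   (auto intro: zp.nw.Tr_ideal)
next
 assume T: "Ps g : zp.nw.Tr (Suc n)"
 obtain N F where F: "F : car NT" "!!k. k > N ==> F k = \<zero>" "g = newt N F" using newt_ex[OF g] by blast
 have "monom UA (F k) 0 *[UA] xp k : xI n" if k: "k : {..N}" for k
 proof (cases "k <= n")
  case True
  have "Ps g k = F k" unfolding F(3) Ps_newt[OF F(1)] using k by simp
  then have "F k = \<zero>" using T True by (simp add: zp.nw.Tr_iff)
  then show ?thesis using UAc.ideal_zero_closed[OF xI_ideal] by simp
 next
  case False
  then show ?thesis using F(1) by (intro ideal.I_l_closed[OF xI_ideal xp_in_xI]) auto
 qed
 then show "g : xI n" unfolding F(3) newt_def by (rule UAc.ideal_finsum_closed[OF xI_ideal])
qed

text \<open>The nodes are chosen for this: \<sigma>^i moves x \<otimes> 1 to q^i x \<otimes> 1, so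
  the i-th factor of \<xi>^(n) goes to an element of \<sigma>^i(I).\<close>

lemma E_fac: "E (fac i) = (sP ^^ i) (rt x -[P] lf x)"
proof -
 let ?y = "hA (qv ^ i) \<otimes> x"
 have y: "?y : car A" using x_closed by simp
 have "E (fac i) = (rt x -[P] lf x) +[P] lf (x \<ominus> ?y)"
  unfolding fac_def using x_closed ring_hom_add[OF E_hom(1) XA_closed, of "monom UA (x \<ominus> ?y) 0"] E_hom
  by simp
 also have "lf (x \<ominus> ?y) = lf x -[P] lf ?y"
  using x_closed y by (intro ring_hom_minus[OF Ac.ring_axioms P.ring_axioms lf_hom])
 also have "(rt x -[P] lf x) +[P] (lf x -[P] lf ?y) = rt x -[P] lf ?y"
  using x_closed y by (intro P.minus_trans) (simp_all add: tp.tens_closed)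
 also have "... = (sP ^^ i) (rt x) -[P] (sP ^^ i) (lf x)"
  using x_closed ring_hom_one[OF \<sigma>_pow_hom, of i] by (simp add: sP_pow_tt \<sigma>_pow_x)
 also have "... = (sP ^^ i) (rt x -[P] lf x)"
  using x_closed by (intro ring_hom_minus[OF P.ring_axioms P.ring_axioms sP_pow_hom, symmetric]) (simp_all add: tp.tens_closed)
 finally show ?thesis .
qed

lemma rt_lf_dI: "f : car A ==> rt f -[P] lf f : dI"
 unfolding dI_iff using ring_hom_minus[OF P.ring_axioms Ac.ring_axioms mu_hom, of "rt f" "lf f"]
 by (simp add: tp.tens_closed mu_tt Ac.minus_eq Ac.r_neg)

lemma E_xp: "E (xp n) : tI n"
proof (induction n)
 case 0
 then show ?case using E_closed by simp
next
 case (Suc n)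
 have "E (fac n) : gI n"
  unfolding E_fac using P.genideal_self[OF sP_dI_carrier[of n]] rt_lf_dI[OF x_closed] by blast
 then show ?case
  unfolding xp_Suc using Suc ring_hom_mult[OF E_hom(1), of "xp n" "fac n"] by (simp add: ideal_prod.prod)
qed

lemma E_xI: "g : xI n ==> E g : tI (Suc n)"
 unfolding xi_ideal_def
 by (rule ring_hom_genideal[OF UAc.ring_axioms P.ring_axioms E_hom(1), of "{xp (n + 1)}"])
  (use E_xp[of "Suc n"] in \<open>auto intro: tI_ideal simp del: diag_twisted_power.simps\<close>)

definition Phi where "Phi n f = newt n (\<tau> f)"

lemma Phi_closed: "f : car A ==> Phi n f : car UA"
 unfolding Phi_def by (rule newt_closed[OF \<tau>_closed])

lemma Ps_Phi: "f : car A ==> Ps (Phi n f) = (\<lambda>k. if k <= n then \<tau> f k else \<zero>)"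
 unfolding Phi_def by (rule Ps_newt[OF \<tau>_closed])

lemma Ps_Phi_cong: "f : car A ==> Ps (Phi n f) -[NT] \<tau> f : zp.nw.Tr (Suc n)"
proof -
 assume f: "f : car A"
 note c = Ps_closed[OF Phi_closed[OF f]] \<tau>_closed[OF f]
 show ?thesis
  unfolding zp.nw.Tr_iff zp.nw.T_minus[OF c] using zp.nw.T.minus_closed[OF c, of n] c
  by (auto simp: Ps_Phi[OF f] Ac.minus_eq Ac.r_neg zp.nw.T_carrier_iff)
qed

text \<open>Truncation changes \<tau>(f) only in order above n, and \<open>xI_iff\<close> reflects
  multiplicativity modulo that order back to A[\<xi>].\<close>

lemma Phi_hom_mod: "hom_mod A UA (xI n) (Phi n)"
proof -
 let ?Tr = "zp.nw.Tr (Suc n)"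
 have hT: "hom_mod A NT ?Tr (\<lambda>f. Ps (Phi n f))"
 proof (rule hom_mod_cong[OF Ac.ring_axioms zp.nw.T.ring_axioms zp.nw.Tr_ideal])
  show "hom_mod A NT ?Tr \<tau>"
   by (rule ring_hom_imp_hom_mod[OF Ac.ring_axioms zp.nw.T.ring_axioms \<tau>(1) zp.nw.Tr_ideal])
 qed (auto intro: Ps_closed Phi_closed Ps_Phi_cong)
 have m: "a -[UA] b : xI n \<longleftrightarrow> Ps a -[NT] Ps b : ?Tr" if "a : car UA" "b : car UA" for a b
  using that xI_iff[of "a -[UA] b" n] ring_hom_minus[OF UAc.ring_axioms zp.nw.T.ring_axioms Ps_hom that] by simp
 show ?thesis
  using hT Phi_closed unfolding hom_mod_def
  by (auto simp: m ring_hom_add[OF Ps_hom] ring_hom_mult[OF Ps_hom] ring_hom_one[OF Ps_hom])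
qed

text \<open>The map R[X] -> A[\<xi>] with X -> x + \<xi>. Through it the values of
  \<open>Phi\<close> on the image of R[X] are compared with those of \<tau> and of f -> 1 \<otimes>
  f.\<close>

definition kap where "kap = eval R UA (\<lambda>r. monom UA (\<iota> r) 0) (monom UA x 0 +[UA] XA)"

lemma kap_hom: "kap : ring_hom S UA" "r : car R ==> kap (monom S r 0) = monom UA (\<iota> r) 0"
 "kap X1 = monom UA x 0 +[UA] XA"
proof -
 have 1: "(\<lambda>r. monom UA (\<iota> r) 0) : ring_hom R UA"
  using ring_hom_trans[OF \<iota>_hom cst_hom_UA] by (simp add: comp_def)
 have 2: "monom UA x 0 +[UA] XA : car UA" using x_closed by simp
 show "kap : ring_hom S UA" "r : car R ==> kap (monom S r 0) = monom UA (\<iota> r) 0"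
  "kap X1 = monom UA x 0 +[UA] XA"
  unfolding kap_def using eval_UP_hom[OF R_cring UA_cring 1 2] by auto
qed

lemma Ps_kap: "t : car S ==> Ps (kap t) = \<tau> (\<phi> t)"
proof -
 assume t: "t : car S"
 have "(Ps \<circ> kap) t = (\<tau> \<circ> \<phi>) t"
 proof (rule UP_hom_ext[OF R_cring NT_cring ring_hom_trans[OF kap_hom(1) Ps_hom] ring_hom_trans[OF \<phi>_hom(1) \<tau>(1)]])
  show "(Ps \<circ> kap) (monom S r 0) = (\<tau> \<circ> \<phi>) (monom S r 0)" if "r : car R" for r
   using that by (simp add: kap_hom(2) Ps_cst \<phi>_hom(2) \<tau>_\<iota>)
  have "Ps (monom UA x 0 +[UA] XA) = zp.nw.cst x +[NT] zp.nw.basis 1"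
   using x_closed ring_hom_add[OF Ps_hom _ XA_closed, of "monom UA x 0"] Ps_XA Ps_cst by simp
  then show "(Ps \<circ> kap) X1 = (\<tau> \<circ> \<phi>) X1" by (simp only: comp_apply kap_hom(3) \<phi>_hom(3) \<tau>_x)
 qed fact
 then show ?thesis by simp
qed

lemma E_kap: "t : car S ==> E (kap t) = rt (\<phi> t)"
proof -
 assume t: "t : car S"
 have "(E \<circ> kap) t = (rt \<circ> \<phi>) t"
 proof (rule UP_hom_ext[OF R_cring tp.MN_cring ring_hom_trans[OF kap_hom(1) E_hom(1)] ring_hom_trans[OF \<phi>_hom(1) rt_hom]])
  show "(E \<circ> kap) (monom S r 0) = (rt \<circ> \<phi>) (monom S r 0)" if "r : car R" for r
   using that by (simp add: kap_hom(2) E_hom(2) \<phi>_hom(2) rt_\<iota>)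
  have "E (monom UA x 0 +[UA] XA) = lf x +[P] (rt x -[P] lf x)"
   using x_closed ring_hom_add[OF E_hom(1) _ XA_closed, of "monom UA x 0"] E_hom by simp
  also have "... = rt x"
   using x_closed by (simp add: tp.tens_closed P.add_sub_cancel2)
  finally show "(E \<circ> kap) X1 = (rt \<circ> \<phi>) X1" by (simp only: comp_apply kap_hom(3) \<phi>_hom(3))
 qed fact
 then show ?thesis by simp
qed

text \<open>P consists of finite sums of pure tensors, so an element is named by a list over A read
  two entries at a time. This places P itself on the type of the test algebras.\<close>

fun encP_list :: "'a list => ('a \<times> 'a \<Rightarrow>\<^sub>0 int) set" where
 "encP_list (a # b # l) = tt a b +[P] encP_list l"
| "encP_list _ = \<zero>[P]"

text \<open>Even length of the first list keeps the pairing in the second one aligned.\<close>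

lemma encP_list_append:
 assumes "set l <= car A" "even (length l)" "set l' <= car A"
 shows "encP_list (l @ l') = encP_list l +[P] encP_list l' \<and> encP_list l : car P"
proof -
 have cl: "encP_list l : car P" if "set l <= car A" for l
  using that by (induction l rule: encP_list.induct) (auto simp: tp.tens_closed)
 have "encP_list (l @ l') = encP_list l +[P] encP_list l'"
  using assms by (induction l rule: encP_list.induct) (auto simp: cl tp.tens_closed P.a_assoc)
 then show ?thesis using cl assms by blast
qed

lemma encP_list_surj:
 assumes "z : car P"
 shows "\<exists>l. set l <= car A \<and> even (length l) \<and> encP_list l = z"
 using assms
proof (induction z rule: tp.tensor_induct)
 case (tens s t)
 then show ?case by (intro exI[of _ "[s, t]"]) (simp add: tp.tens_closed)
next
 case (add Y Z)
 then obtain l l' where l: "set l <= car A" "even (length l)" "encP_list l = Y"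
  "set l' <= car A" "even (length l')" "encP_list l' = Z" by blast
 then show ?case using encP_list_append[OF l(1,2,4)] by (intro exI[of _ "l @ l'"]) auto
qed

definition encP :: "('a \<times> 'a \<Rightarrow>\<^sub>0 int) set => ((nat => 'r) + 'a) list" where
 "encP z = map Inr (SOME l. encP_list l = z)"

lemma encP_inj:
 assumes "z : car P" "w : car P" "encP z = encP w"
 shows "z = w"
proof -
 have 1: "encP_list (SOME l. encP_list l = z) = z" if "z : car P" for z
  using encP_list_surj[OF that] by (metis (mono_tags, lifting) someI_ex)
 have "inj (Inr :: 'a => (nat => 'r) + 'a)" by (rule injI) simp
 then have "(SOME l. encP_list l = z) = (SOME l. encP_list l = w)"
  using assms(3) unfolding encP_def by (metis inj_map_eq_map)
 then show ?thesis using 1[OF assms(1)] 1[OF assms(2)] by metis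
qed

text \<open>Both sides are homomorphisms modulo $I^{(n+1)}$ that agree on \<open>R\<close> and \<open>x\<close>, and they agree
 modulo the ideal $I + (p, q - 1)$, which is nilpotent modulo $I^{(n+1)} + (p, q-1)^k$.\<close>

theorem rt_cong_Phi:
 assumes f: "f : car A"
 shows "rt f -[P] E (Phi n f) : tI (Suc n) <+>\<^bsub>P\<^esub> ideal_power P cP k"
proof -
 let ?N = "tI (Suc n)"
 \<comment> \<open>The powers J^(2^i) square into the next step; I^(n+1) stays in every step because
   \<open>Phi n\<close> is a homomorphism only up to it.\<close>
 define K where "K i = ideal_power P dJ (2 ^ i) <+>\<^bsub>P\<^esub> ?N" for i :: nat
 note Jp = P.ideal_pow_ideal[OF dJ_ideal] and Np = tI_ideal[of "Suc n"]
 have Ki: "ideal (K i) P" for i unfolding K_def by (rule P.add_ideals[OF Jp Np])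
 have NK: "?N <= K i" for i unfolding K_def by (rule P.subset_set_add_r[OF Jp Np])
 have JK: "ideal_power P dJ (2 ^ i) <= K i" for i unfolding K_def by (rule P.subset_set_add_l[OF Jp Np])
 have zero: "z -[P] z : K i" if "z : car P" for z i
  using that P.ideal_zero_closed[OF Ki] by (simp add: P.minus_eq P.r_neg)
 have Ec: "E (Phi n a) : car P" if "a : car A" for a by (rule E_closed[OF Phi_closed[OF that]])
 have "rt f -[P] E (Phi n f) : K i" for i
 proof (rule ep.etale_unique[where u = rt and v = "\<lambda>f. E (Phi n f)" and a = f and i = i and K = K
    and e = "\<lambda>i. encP" and \<psi> = "rt \<circ> \<phi>" and m = "\<lambda>i. 2 ^ i"])
  show "K (Suc i) <= K i" for i
  proof
   fix z assume "z : K (Suc i)"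
   then obtain a b where ab: "a : ideal_power P dJ (2 ^ Suc i)" "b : ?N" "z = a +[P] b"
    unfolding K_def P.set_add_iff by blast
   have "(2::nat) ^ i <= 2 ^ Suc i" by simp
   then have "a : ideal_power P dJ (2 ^ i)" using P.ideal_pow_antimono[OF dJ_ideal] ab(1) by blast
   then show "z : K i" unfolding K_def P.set_add_iff using ab(2,3) by blast
  qed
  show "a *[P] b : K (Suc i)" if "a : K i" "b : K i" for i a b
  proof (rule P.set_add_mult[OF Jp Np Jp Np Ki _ _ _ _ that[unfolded K_def]])
   show "a *[P] b : K (Suc i)" if "a : ideal_power P dJ (2 ^ i)" "b : ideal_power P dJ (2 ^ i)" for a b
    using P.ideal_pow_mult[OF dJ_ideal that] JK[of "Suc i"] by (auto simp: mult_2)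
   show "a *[P] b : K (Suc i)" if "a : ideal_power P dJ (2 ^ i)" "b : ?N" for a b
    using ideal.I_l_closed[OF Np that(2)] ideal.Icarr[OF Jp that(1)] NK by blast
   show "a *[P] b : K (Suc i)" if "a : ?N" "b : ideal_power P dJ (2 ^ i)" for a b
    using ideal.I_r_closed[OF Np that(1)] ideal.Icarr[OF Jp that(2)] NK by blast
   show "a *[P] b : K (Suc i)" if "a : ?N" "b : ?N" for a b
    using ideal.I_r_closed[OF Np that(1)] ideal.Icarr[OF Np that(2)] NK by blast
  qed
  show "a -[P] b : K i" if "a : car P" "b : car P" "encP a = encP b" for i a b
   using encP_inj[OF that] zero that by simp
  show "rt \<circ> \<phi> : ring_hom S P" by (rule ring_hom_trans[OF \<phi>_hom(1) rt_hom])
  have qq: "(rt \<circ> \<phi>) qS = lf (hA qv)"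
   unfolding qS_eq comp_apply \<phi>_hom(2)[OF hR_closed] rt_\<iota>[OF hR_closed] hA_eq ..
  show "ideal_power P (pq_ideal p P ((rt \<circ> \<phi>) qS)) (2 ^ i) <= K i" for i
   unfolding qq cP_eq[symmetric]
   using P.ideal_pow_mono[OF cP_ideal dJ_ideal P.subset_set_add_r[OF dI_ideal cP_ideal]] JK by blast
  show "hom_mod A P (K i) rt" for i
   by (rule ring_hom_imp_hom_mod[OF Ac.ring_axioms P.ring_axioms rt_hom Ki])
  show "rt (\<phi> t) -[P] (rt \<circ> \<phi>) t : K i" if "t : car S" for i t
   using zero ep.\<phi>_closed[OF that] by (simp add: tp.tens_closed)
  have EN: "E a -[P] E b : K i" if "a : car UA" "b : car UA" "a -[UA] b : xI n" for a b i
   using E_xI[OF that(3)] NK ring_hom_minus[OF UAc.ring_axioms P.ring_axioms E_hom(1) that(1,2)] by auto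
  show "hom_mod A P (K i) (\<lambda>f. E (Phi n f))" for i
   unfolding hom_mod_def
  proof (intro conjI ballI)
   show "(\<lambda>f. E (Phi n f)) : car A \<rightarrow> car P" using Ec by blast
   show "E (Phi n (a \<oplus> b)) -[P] (E (Phi n a) +[P] E (Phi n b)) : K i" if "a : car A" "b : car A" for a b
    using EN[of "Phi n (a \<oplus> b)" "Phi n a +[UA] Phi n b" i] Phi_hom_mod that Phi_closed
    by (simp add: hom_mod_def ring_hom_add[OF E_hom(1)])
   show "E (Phi n (a \<otimes> b)) -[P] (E (Phi n a) *[P] E (Phi n b)) : K i" if "a : car A" "b : car A" for a b
    using EN[of "Phi n (a \<otimes> b)" "Phi n a *[UA] Phi n b" i] Phi_hom_mod that Phi_closed
    by (simp add: hom_mod_def ring_hom_mult[OF E_hom(1)])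
   show "E (Phi n \<one>) -[P] \<one>[P] : K i"
    using EN[of "Phi n \<one>" "\<one>[UA]" i] Phi_hom_mod Phi_closed
    by (simp add: hom_mod_def ring_hom_one[OF E_hom(1)])
  qed
  show "E (Phi n (\<phi> t)) -[P] (rt \<circ> \<phi>) t : K i" if t: "t : car S" for i t
  proof -
   have k: "kap t : car UA" using ring_hom_closed[OF kap_hom(1) t] .
   note a = ep.\<phi>_closed[OF t]
   have "Ps (Phi n (\<phi> t) -[UA] kap t) = Ps (Phi n (\<phi> t)) -[NT] \<tau> (\<phi> t)"
    using ring_hom_minus[OF UAc.ring_axioms zp.nw.T.ring_axioms Ps_hom Phi_closed[OF a] k] Ps_kap[OF t] by simp
   then have "Phi n (\<phi> t) -[UA] kap t : xI n"
    using xI_iff[of "Phi n (\<phi> t) -[UA] kap t" n] Ps_Phi_cong[OF a, of n] Phi_closed[OF a] k by simp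
   then show ?thesis using EN[OF Phi_closed[OF a] k] E_kap[OF t] by simp
  qed
  \<comment> \<open>At the bottom both sides are congruent to a \<otimes> 1 modulo I: the constant
    term of \<open>Phi n a\<close> is a, and the higher \<xi>^(k) go into I.\<close>
  show "rt a -[P] E (Phi n a) : K 0" if a: "a : car A" for a
  proof -
   have JJ: "dJ <= K 0" using JK[of 0] P.ideal_pow_1[OF dJ_ideal] by simp
   have IJ: "dI <= dJ" by (rule P.subset_set_add_l[OF dI_ideal cP_ideal])
   note \<tau>k = zp.nw.T_closed[OF \<tau>_closed[OF a]]
   have "E (Phi n a) = (\<Oplus>[P]k\<in>{..n}. lf (\<tau> a k) *[P] E (xp k))"
    unfolding Phi_def newt_def
    by (subst additive_finsum[OF UAc.abelian_group_axioms P.abelian_group_axioms, where L = E])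
     (use \<tau>k in \<open>auto simp: E_closed ring_hom_add[OF E_hom(1)] ring_hom_mult[OF E_hom(1)] E_hom(2)
      tp.tens_closed intro!: P.finsum_cong2'\<close>)
   also have "... -[P] lf a : dI"
   proof (cases n)
    case 0
    have "lf (\<tau> a 0) *[P] E (xp 0) = lf a"
     using a ring_hom_one[OF E_hom(1)] by (simp add: \<tau>_0 xp_0 tp.tens_closed)
    then show ?thesis using 0 a P.ideal_zero_closed[OF dI_ideal] by (simp add: tp.tens_closed P.minus_eq P.r_neg)
   next
    case (Suc n')
    have t: "(\<Oplus>[P]k\<in>{..n'}. lf (\<tau> a (Suc k)) *[P] E (xp (Suc k))) : dI"
    proof (rule P.ideal_finsum_closed[OF dI_ideal], rule ideal.I_l_closed[OF dI_ideal])
     show "E (xp (Suc k)) : dI" for k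
      using E_xp[of "Suc k"] tI_antimono[of "Suc 0" "Suc k"] tI_1_subset by blast
    qed (use \<tau>k in \<open>simp add: tp.tens_closed\<close>)
    have "(\<Oplus>[P]k\<in>{..n}. lf (\<tau> a k) *[P] E (xp k))
     = (\<Oplus>[P]k\<in>{..n'}. lf (\<tau> a (Suc k)) *[P] E (xp (Suc k))) +[P] lf (\<tau> a 0) *[P] E (xp 0)"
     unfolding Suc by (rule P.finsum_Suc2) (use \<tau>k in \<open>auto simp: tp.tens_closed E_closed\<close>)
    also have "lf (\<tau> a 0) *[P] E (xp 0) = lf a"
     using a ring_hom_one[OF E_hom(1)] by (simp add: \<tau>_0 xp_0 tp.tens_closed)
    finally show ?thesis
     using t a ideal.Icarr[OF dI_ideal t] by (simp add: P.minus_eq P.a_assoc P.r_neg tp.tens_closed)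
   qed
   finally have 1: "E (Phi n a) -[P] lf a : dI" .
   have "(rt a -[P] lf a) -[P] (E (Phi n a) -[P] lf a) : dI"
    by (rule P.ideal_minus_closed[OF dI_ideal rt_lf_dI[OF a] 1])
   also have "(rt a -[P] lf a) -[P] (E (Phi n a) -[P] lf a) = rt a -[P] E (Phi n a)"
    using Ec[OF a] a by (simp add: tp.tens_closed P.sub_sub_sub)
   finally show ?thesis using IJ JJ by blast
  qed
 qed (use f tp.MN_cring Ki in auto)
 \<comment> \<open>Any i with 2^i \<ge> (n+1)k would do; i = (n+1)k is a convenient one, and
   \<open>dJ_pow_pow\<close> bounds that power of J.\<close>
 moreover have "K (Suc n * k) <= tI (Suc n) <+>\<^bsub>P\<^esub> ideal_power P cP k"
 proof
  note ck = P.ideal_pow_ideal[OF cP_ideal]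
  have id: "ideal (tI (Suc n) <+>\<^bsub>P\<^esub> ideal_power P cP k) P" by (rule P.add_ideals[OF Np ck])
  fix z assume "z : K (Suc n * k)"
  then obtain a b where ab: "a : ideal_power P dJ (2 ^ (Suc n * k))" "b : ?N" "z = a +[P] b"
   unfolding K_def P.set_add_iff by blast
  have "Suc n * k <= 2 ^ (Suc n * k)" by (rule less_imp_le[OF less_exp])
  then have "a : ideal_power P dJ (Suc n * k)" using P.ideal_pow_antimono[OF dJ_ideal] ab(1) by blast
  then have "a : tI (Suc n) <+>\<^bsub>P\<^esub> ideal_power P cP k" using dJ_pow_pow by blast
  then show "z : tI (Suc n) <+>\<^bsub>P\<^esub> ideal_power P cP k"
   unfolding ab(3) using ab(2) P.subset_set_add_l[OF Np ck] by (intro P.ideal_add_closed[OF id]) auto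
 qed
 ultimately show ?thesis by blast
qed

end

section \<open>Completions\<close>

locale pq_completion = cring B for B (structure) +
 fixes p :: nat and c :: 'a
 assumes c_closed [simp]: "c : car B"
begin

abbreviation I where "I \<equiv> pq_ideal p B c"
abbreviation J where "J k \<equiv> ideal_power B I k"
abbreviation H where "H \<equiv> adic_completion B I"
abbreviation tc where "tc \<equiv> to_completion B I"

lemma I_ideal: "ideal I B" by (rule pq_ideal_ideal) simp
lemma J_ideal: "ideal (J k) B" by (rule ideal_pow_ideal[OF I_ideal])
lemma J_Suc: "J (Suc k) <= J k" by (rule ideal_pow_antimono[OF I_ideal]) simp
lemma Q_cring: "cring (B Quot J k)" by (rule ideal.quotient_is_cring[OF J_ideal cring_axioms])
lemma rc_hom: "(+>) (J k) : ring_hom B (B Quot J k)" by (rule ideal.rcos_ring_hom[OF J_ideal])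

lemma H_simps:
 "car H = {s. \<forall>n. s n : car (B Quot J n) \<and> s (Suc n) <= s n}"
 "s *[H] t = (\<lambda>n. s n *[B Quot J n] t n)" "s +[H] t = (\<lambda>n. s n +[B Quot J n] t n)"
 "\<one>[H] = (\<lambda>n. \<one>[B Quot J n])" "\<zero>[H] = (\<lambda>n. \<zero>[B Quot J n])"
 by (simp_all add: adic_completion_def quot_limit_def)

lemma rc_subset:
 assumes "a : car B" "b : car B"
 shows "J (Suc k) +> a <= J k +> b \<longleftrightarrow> a \<ominus> b : J k"
proof
 assume "J (Suc k) +> a <= J k +> b"
 moreover have "a : J (Suc k) +> a"
  unfolding in_rcos_iff[OF J_ideal assms(1)] using assms ideal_zero_closed[OF J_ideal, of "Suc k"]
  by (simp add: minus_eq r_neg)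
 ultimately show "a \<ominus> b : J k" using in_rcos_iff[OF J_ideal assms(2)] by blast
next
 assume ab: "a \<ominus> b : J k"
 show "J (Suc k) +> a <= J k +> b"
 proof
  fix z assume "z : J (Suc k) +> a"
  then have z: "z : car B" "z \<ominus> a : J k" using in_rcos_iff[OF J_ideal assms(1)] J_Suc by blast+
  have "z \<ominus> b : J k" using ideal_add_closed[OF J_ideal z(2) ab] minus_trans[OF z(1) assms] by simp
  then show "z : J k +> b" using in_rcos_iff[OF J_ideal assms(2)] z(1) by blast
 qed
qed

lemma H_I:
 assumes "!!k. f k : car B" "!!k. f (Suc k) \<ominus> f k : J k"
 shows "(\<lambda>k. J k +> f k) : car H"
 unfolding H_simps mem_Collect_eq
proof (intro allI conjI)
 show "J n +> f n : car (B Quot J n)" for n by (rule ring_hom_closed[OF rc_hom assms(1)])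
 show "J (Suc n) +> f (Suc n) <= J n +> f n" for n unfolding rc_subset[OF assms(1) assms(1)] by (rule assms(2))
qed

lemma H_E:
 assumes "s : car H"
 obtains f where "!!k. f k : car B" "!!k. f (Suc k) \<ominus> f k : J k" "s = (\<lambda>k. J k +> f k)"
proof -
 have "\<forall>k. \<exists>b. b : car B \<and> s k = J k +> b"
 proof
  fix k
  have "s k : car (B Quot J k)" using assms unfolding H_simps by simp
  then obtain b where "b : car B" "s k = J k +> b" by (rule Quot_carrierE)
  then show "\<exists>b. b : car B \<and> s k = J k +> b" by (intro exI conjI)
 qed
 then have "\<exists>f. \<forall>k. f k : car B \<and> s k = J k +> f k" by (rule choice)
 then obtain f where f: "!!k. f k : car B" "!!k. s k = J k +> f k" by auto
 have "f (Suc k) \<ominus> f k : J k" for k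
 proof -
  have "s (Suc k) <= s k" using assms unfolding H_simps by simp
  then show ?thesis unfolding f(2) using rc_subset[OF f(1) f(1)] by simp
 qed
 then show ?thesis using that[of f] f by blast
qed

lemma rc_add: "a : car B ==> b : car B ==> (J k +> a) +[B Quot J k] (J k +> b) = J k +> (a \<oplus> b)"
 by (rule ring_hom_add[OF rc_hom, symmetric])
lemma rc_mult: "a : car B ==> b : car B ==> (J k +> a) *[B Quot J k] (J k +> b) = J k +> (a \<otimes> b)"
 by (rule ring_hom_mult[OF rc_hom, symmetric])
lemma rc_one: "\<one>[B Quot J k] = J k +> \<one>"
 by (rule ring_hom_one[OF rc_hom, symmetric])
lemma rc_zero: "\<zero>[B Quot J k] = J k +> \<zero>"
 by (rule ring_hom_zero[OF rc_hom ring_axioms cring.axioms(1)[OF Q_cring], symmetric])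

lemma H_at: "s : car H ==> s k : car (B Quot J k)"
 unfolding H_simps by blast

lemma J_minus_zero: "a : car B ==> a \<ominus> a : J k"
 using ideal_zero_closed[OF J_ideal] by (simp add: minus_eq r_neg)

lemma tc_closed: "b : car B ==> tc b : car H"
 unfolding to_completion_def by (rule H_I) (simp_all add: J_minus_zero)

lemma H_add_closed:
 assumes s: "s : car H" and t: "t : car H"
 shows "s +[H] t : car H"
proof -
 obtain f where f: "!!k. f k : car B" "!!k. f (Suc k) \<ominus> f k : J k" "s = (\<lambda>k. J k +> f k)" using H_E[OF s] by blast
 obtain g where g: "!!k. g k : car B" "!!k. g (Suc k) \<ominus> g k : J k" "t = (\<lambda>k. J k +> g k)" using H_E[OF t] by blast
 have "s +[H] t = (\<lambda>k. J k +> (f k \<oplus> g k))" unfolding H_simps f(3) g(3) using f(1) g(1) by (simp add: rc_add)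
 moreover have "(\<lambda>k. J k +> (f k \<oplus> g k)) : car H"
 proof (rule H_I)
  fix k
  have "(f (Suc k) \<oplus> g (Suc k)) \<ominus> (f k \<oplus> g k) = (f (Suc k) \<ominus> f k) \<oplus> (g (Suc k) \<ominus> g k)"
   using f(1) g(1) by (simp add: minus_eq minus_add a_ac)
  then show "(f (Suc k) \<oplus> g (Suc k)) \<ominus> (f k \<oplus> g k) : J k" using ideal_add_closed[OF J_ideal f(2) g(2)] by simp
 qed (use f(1) g(1) in simp)
 ultimately show ?thesis by simp
qed

lemma H_mult_closed:
 assumes s: "s : car H" and t: "t : car H"
 shows "s *[H] t : car H"
proof -
 obtain f where f: "!!k. f k : car B" "!!k. f (Suc k) \<ominus> f k : J k" "s = (\<lambda>k. J k +> f k)" using H_E[OF s] by blast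
 obtain g where g: "!!k. g k : car B" "!!k. g (Suc k) \<ominus> g k : J k" "t = (\<lambda>k. J k +> g k)" using H_E[OF t] by blast
 have "s *[H] t = (\<lambda>k. J k +> (f k \<otimes> g k))" unfolding H_simps f(3) g(3) using f(1) g(1) by (simp add: rc_mult)
 moreover have "(\<lambda>k. J k +> (f k \<otimes> g k)) : car H"
 proof (rule H_I)
  fix k
  have "(f (Suc k) \<otimes> g (Suc k)) \<ominus> (f k \<otimes> g k) = (f (Suc k) \<ominus> f k) \<otimes> g (Suc k) \<oplus> f k \<otimes> (g (Suc k) \<ominus> g k)"
   using f(1)[of k] f(1)[of "Suc k"] g(1)[of k] g(1)[of "Suc k"] by algebra
  then show "(f (Suc k) \<otimes> g (Suc k)) \<ominus> (f k \<otimes> g k) : J k"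
   using ideal_add_closed[OF J_ideal ideal.I_r_closed[OF J_ideal f(2) g(1)] ideal.I_l_closed[OF J_ideal g(2) f(1)]] by simp
 qed (use f(1) g(1) in simp)
 ultimately show ?thesis by simp
qed

lemma H_inv: "s : car H ==> \<exists>t\<in>car H. t +[H] s = \<zero>[H]"
proof -
 assume s: "s : car H"
 obtain f where f: "!!k. f k : car B" "!!k. f (Suc k) \<ominus> f k : J k" "s = (\<lambda>k. J k +> f k)" using H_E[OF s] by blast
 have "(\<lambda>k. J k +> (\<ominus> f k)) : car H"
 proof (rule H_I)
  fix k
  have "\<ominus> f (Suc k) \<ominus> \<ominus> f k = \<ominus> (f (Suc k) \<ominus> f k)" using f(1) by (simp add: minus_eq minus_add a_ac)
  then show "\<ominus> f (Suc k) \<ominus> \<ominus> f k : J k" using ideal_inv_closed[OF J_ideal f(2)] by simp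
 qed (use f(1) in simp)
 moreover have "(\<lambda>k. J k +> (\<ominus> f k)) +[H] s = \<zero>[H]"
  unfolding H_simps f(3) using f(1) by (simp add: rc_add rc_zero l_neg)
 ultimately show ?thesis by blast
qed

lemma H_cring: "cring H"
proof -
 have Qr: "ring (B Quot J k)" "comm_monoid (B Quot J k)" "abelian_group (B Quot J k)" for k
  using Q_cring[of k] by (simp_all add: cring_def ring_def)
 show ?thesis
 proof (rule cringI)
  show "abelian_group H"
  proof (rule abelian_groupI)
   show "\<zero>[H] : car H" unfolding H_simps(5) rc_zero by (rule H_I) (simp_all add: J_minus_zero)
   show "a +[H] b +[H] d = a +[H] (b +[H] d)" if "a : car H" "b : car H" "d : car H" for a b d
    unfolding H_simps by (rule ext, rule abelian_monoid.a_assoc) (use that H_at abelian_group.axioms(1)[OF Qr(3)] in auto)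
   show "a +[H] b = b +[H] a" if "a : car H" "b : car H" for a b
    unfolding H_simps by (rule ext, rule abelian_monoid.a_comm) (use that H_at abelian_group.axioms(1)[OF Qr(3)] in auto)
   show "\<zero>[H] +[H] a = a" if "a : car H" for a
    unfolding H_simps by (rule ext, rule abelian_monoid.l_zero) (use that H_at abelian_group.axioms(1)[OF Qr(3)] in auto)
  qed (simp_all add: H_add_closed H_inv)
  show "comm_monoid H"
  proof (rule comm_monoidI)
   show "\<one>[H] : car H" unfolding H_simps(4) rc_one by (rule H_I) (simp_all add: J_minus_zero)
   show "a *[H] b *[H] d = a *[H] (b *[H] d)" if "a : car H" "b : car H" "d : car H" for a b d
    unfolding H_simps by (rule ext, rule monoid.m_assoc) (use that H_at comm_monoid.axioms(1)[OF Qr(2)] in auto)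
   show "a *[H] b = b *[H] a" if "a : car H" "b : car H" for a b
    unfolding H_simps by (rule ext, rule comm_monoid.m_comm) (use that H_at Qr(2) in auto)
   show "\<one>[H] *[H] a = a" if "a : car H" for a
    unfolding H_simps by (rule ext, rule monoid.l_one) (use that H_at comm_monoid.axioms(1)[OF Qr(2)] in auto)
  qed (simp_all add: H_mult_closed)
  show "(a +[H] b) *[H] d = a *[H] d +[H] b *[H] d" if "a : car H" "b : car H" "d : car H" for a b d
   unfolding H_simps
  proof (rule ext)
   fix n
   interpret Q: cring "B Quot J n" by (rule Q_cring)
   show "(a n +[B Quot J n] b n) *[B Quot J n] d n = a n *[B Quot J n] d n +[B Quot J n] b n *[B Quot J n] d n"
    by (rule Q.l_distr) (use that H_at in auto)
  qed
 qed
qed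

sublocale H: cring H by (rule H_cring)

lemma tc_hom: "tc : ring_hom B H"
 by (rule ring_hom_memI) (simp_all add: tc_closed, simp_all add: to_completion_def H_simps rc_add rc_mult rc_one)

text \<open>The kernel of the projection from the completion to B/I^k. Closures are defined with
  powers of the ideal generated by p and q - 1 in the completion, and \<open>hI_pow_eq\<close>
  replaces those powers by these kernels.\<close>

definition KK where "KK k = {s : car H. s k = J k}"

lemma rc_eq_J: "a : car B ==> J k +> a = J k \<longleftrightarrow> a : J k"
proof -
 assume a: "a : car B"
 have "J k +> a = J k +> \<zero> \<longleftrightarrow> a \<ominus> \<zero> : J k" by (rule rcos_eq_iff[OF J_ideal a zero_closed])
 then show ?thesis using a rc_zero[of k] by (simp add: minus_eq FactRing_def)
qed

lemma proj_hom: "(\<lambda>s. s k) : ring_hom H (B Quot J k)"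
 by (rule ring_hom_memI) (simp_all add: H_at, simp_all add: H_simps)

lemma KK_ideal: "ideal (KK k) H"
proof -
 interpret Q: cring "B Quot J k" by (rule Q_cring)
 interpret ring_hom_ring H "B Quot J k" "\<lambda>s. s k"
  by (rule ring_hom_ringI2[OF H.ring_axioms Q.ring_axioms proj_hom])
 have "ideal {s : car H. s k : {\<zero>[B Quot J k]}} H" by (rule ideal_vimage[OF Q.zeroideal])
 then show ?thesis by (simp add: KK_def FactRing_def)
qed

abbreviation hI where "hI \<equiv> pq_ideal p H (tc c)"

lemma hI_ideal: "ideal hI H" by (rule H.pq_ideal_ideal[OF tc_closed[OF c_closed]])

lemma J_0: "J 0 = car B" by simp

lemma KK_0: "KK 0 = car H"
proof -
 have "s 0 = J 0" if s: "s : car H" for s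
 proof -
  obtain a where "a : car B" "s 0 = J 0 +> a" using Quot_carrierE[OF H_at[OF s]] by metis
  then show ?thesis using rc_eq_J[of a 0] J_0 by metis
 qed
 then show ?thesis by (auto simp: KK_def)
qed

lemma rep2:
 assumes "s : car H"
 obtains a where "a : car B" "s (Suc k) = J (Suc k) +> a" "s k = J k +> a"
proof -
 obtain f where f: "!!k. f k : car B" "!!k. f (Suc k) \<ominus> f k : J k" "s = (\<lambda>k. J k +> f k)" using H_E[OF assms] by blast
 have "J k +> f k = J k +> f (Suc k)" using rcos_eq_iff[OF J_ideal f(1) f(1), of k "Suc k" k] f(2) by simp
 then show ?thesis using that[of "f (Suc k)"] f(1,3) by simp
qed

lemma KK_tc: "b : car B ==> tc b : KK k \<longleftrightarrow> b : J k"
 unfolding KK_def using tc_closed rc_eq_J[of b k] by (simp add: to_completion_def)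

lemma hI_KK_1: "hI <= KK (Suc 0)"
proof (rule H.pq_ideal_least[OF KK_ideal])
 have "add_pow H p \<one>[H] = tc (add_pow B p \<one>)"
  using ring_hom_nat_mult[OF ring_axioms H.ring_axioms tc_hom one_closed] ring_hom_one[OF tc_hom] by simp
 moreover have "add_pow B p \<one> : I" by (rule pq_ideal_p) simp
 ultimately show "add_pow H p \<one>[H] : KK (Suc 0)"
  using KK_tc[of "add_pow B p \<one>" "Suc 0"] ideal_pow_1[OF I_ideal] ideal.Icarr[OF I_ideal] by simp
 have "tc c -[H] \<one>[H] = tc (c \<ominus> \<one>)"
  using ring_hom_minus[OF ring_axioms H.ring_axioms tc_hom c_closed one_closed] ring_hom_one[OF tc_hom] by simp
 moreover have "c \<ominus> \<one> : I" by (rule pq_ideal_q) simp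
 ultimately show "tc c -[H] \<one>[H] : KK (Suc 0)"
  using KK_tc[of "c \<ominus> \<one>" "Suc 0"] ideal_pow_1[OF I_ideal] ideal.Icarr[OF I_ideal] by simp
qed

lemma hI_pow_KK: "ideal_power H hI k <= KK k"
proof (rule H.ideal_pow_least[where K = KK, OF KK_ideal KK_0])
 fix k a b assume a: "a : KK k" and b: "b : hI"
 then have b1: "b : KK (Suc 0)" using hI_KK_1 by blast
 have aH: "a : car H" and bH: "b : car H" using a b1 by (auto simp: KK_def)
 obtain f where f: "f : car B" "a (Suc k) = J (Suc k) +> f" "a k = J k +> f" using rep2[OF aH] by blast
 obtain gg where g: "!!k. gg k : car B" "!!k. gg (Suc k) \<ominus> gg k : J k" "b = (\<lambda>k. J k +> gg k)" using H_E[OF bH] by blast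
 have fk: "f : J k" using a rc_eq_J[OF f(1)] f(3) by (simp add: KK_def)
 \<comment> \<open>b vanishes in B/I, hence so do its representatives at all levels from 1 on; the
   one at level k + 1 is multiplied with f.\<close>
 have g1: "gg (Suc k) : I"
 proof (induction k)
  case 0
  then show ?case using b1 rc_eq_J[OF g(1), of "Suc 0" "Suc 0"] g(3) ideal_pow_1[OF I_ideal] by (simp add: KK_def)
 next
  case (Suc k)
  have "J (Suc k) <= I" using ideal_pow_antimono[OF I_ideal, of "Suc 0" "Suc k"] ideal_pow_1[OF I_ideal] by simp
  then have "gg (Suc (Suc k)) \<ominus> gg (Suc k) \<oplus> gg (Suc k) : I" using g(2) Suc ideal_add_closed[OF I_ideal] by blast
  then show ?case using g(1) by (simp add: minus_eq a_assoc l_neg)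
 qed
 have "f \<otimes> gg (Suc k) : J (Suc k)"
  using ideal_prod.prod[OF fk g1] by (simp add: ideal_pow_Suc)
 then have "(a *[H] b) (Suc k) = J (Suc k)"
  unfolding H_simps f(2) g(3) rc_mult[OF f(1) g(1)] using rc_eq_J[of "f \<otimes> gg (Suc k)" "Suc k"] f(1) g(1) by simp
 then show "a *[H] b : KK (Suc k)" using aH bH by (simp add: KK_def)
qed

lemma J_elem:
 assumes "b : J (Suc k)"
 shows "\<exists>u\<in>J k. \<exists>v\<in>J k. b = add_pow B p \<one> \<otimes> u \<oplus> (c \<ominus> \<one>) \<otimes> v"
proof -
 let ?p = "add_pow B p \<one>" and ?q = "c \<ominus> \<one>"
 have pc: "?p : car B" "?q : car B" by auto
 from assms show ?thesis unfolding ideal_pow_Suc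
 proof induction
  case (prod i j)
  obtain a d where ad: "a : car B" "d : car B" "j = ?p \<otimes> a \<oplus> ?q \<otimes> d"
   using pq_ideal_elem[OF c_closed prod(2)] by blast
  have ic: "i : car B" by (rule ideal.Icarr[OF J_ideal prod(1)])
  have "i \<otimes> j = ?p \<otimes> (i \<otimes> a) \<oplus> ?q \<otimes> (i \<otimes> d)"
   unfolding ad(3) using ad(1,2) ic pc by (simp add: r_distr m_lcomm)
  then show ?case using ideal.I_r_closed[OF J_ideal prod(1)] ad by blast
 next
  case (sum s t)
  then obtain u v u' v' where *: "u : J k" "v : J k" "s = ?p \<otimes> u \<oplus> ?q \<otimes> v" "u' : J k" "v' : J k" "t = ?p \<otimes> u' \<oplus> ?q \<otimes> v'"
   by blast
  have cl: "u : car B" "v : car B" "u' : car B" "v' : car B" using * ideal.Icarr[OF J_ideal] by auto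
  have "s \<oplus> t = ?p \<otimes> (u \<oplus> u') \<oplus> ?q \<otimes> (v \<oplus> v')"
   unfolding *(3,6) using cl pc by (simp add: r_distr a_ac)
  then show ?case using ideal_add_closed[OF J_ideal] * by blast
 qed
qed

text \<open>An element of $K_{k+1}$ is a telescoping series whose terms lie in $I^n$ with $n > k$;
 splitting each term as $p u_n + (q-1) v_n$ writes it as $p U + (q-1) V$ with \<open>U, V \<in> K\<^sub>k\<close>.\<close>

lemma KK_Suc_subset: "KK (Suc k) <= ideal_prod H (KK k) hI"
proof
 fix s assume s: "s : KK (Suc k)"
 let ?p = "add_pow B p \<one>" and ?q = "c \<ominus> \<one>"
 have pc: "?p : car B" "?q : car B" by auto
 have sH: "s : car H" using s by (simp add: KK_def)
 obtain f where f: "!!k. f k : car B" "!!k. f (Suc k) \<ominus> f k : J k" "s = (\<lambda>k. J k +> f k)" using H_E[OF sH] by blast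
 have "s (Suc k) = J (Suc k)" using s unfolding KK_def by blast
 then have fk: "f (Suc k) : J (Suc k)" unfolding f(3) rc_eq_J[OF f(1)] .
 \<comment> \<open>The first term absorbs f (k+1) and the later ones are consecutive differences, so
   the sum up to m is f (m+k+1).\<close>
 define b where "b n = (if n = 0 then f (Suc k) else f (n + Suc k) \<ominus> f (n + k))" for n
 have bJ: "b n : J (Suc k) \<and> b n : J (n + k)" for n
 proof (cases n)
  case 0
  then show ?thesis using fk J_Suc by (auto simp: b_def)
 next
  case (Suc m)
  have "b n : J (n + k)" using f(2)[of "n + k"] Suc by (simp add: b_def)
  moreover have "J (n + k) <= J (Suc k)" by (rule ideal_pow_antimono[OF I_ideal]) (use Suc in simp)
  ultimately show ?thesis by blast
 qed
 \<comment> \<open>Membership in the power n + k - 1 makes the series converge; membership in the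
   power k places their sums in \<open>KK k\<close>.\<close>
 have "\<exists>u v. u : J (n + k - 1) \<and> v : J (n + k - 1) \<and> u : J k \<and> v : J k \<and> b n = ?p \<otimes> u \<oplus> ?q \<otimes> v" for n
 proof (cases n)
  case 0
  have "J k <= J (k - 1)" by (rule ideal_pow_antimono[OF I_ideal]) simp
  then show ?thesis using J_elem[of "b n" k] bJ[of n] 0 by auto
 next
  case (Suc m)
  have "J (m + k) <= J k" by (rule ideal_pow_antimono[OF I_ideal]) simp
  then show ?thesis using J_elem[of "b n" "m + k"] bJ[of n] Suc by auto
 qed
 then obtain u v where uv: "!!n. u n : J (n + k - 1)" "!!n. v n : J (n + k - 1)" "!!n. u n : J k" "!!n. v n : J k"
  "!!n. b n = ?p \<otimes> u n \<oplus> ?q \<otimes> v n" by metis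
 have uvc: "u n : car B" "v n : car B" for n using uv(3,4) ideal.Icarr[OF J_ideal] by auto
 define S where "S w m = (\<Oplus>n\<in>{..m}. w n)" for w :: "nat => 'a" and m
 have KS: "(\<lambda>m. J m +> S w m) : KK k"
  if w: "!!n. w n : J (n + k - 1)" "!!n. w n : J k" for w
 proof -
  have wc: "w n : car B" for n using w(2) ideal.Icarr[OF J_ideal] by blast
  have Sc: "S w m : car B" for m unfolding S_def using wc by simp
  have "(\<lambda>m. J m +> S w m) : car H"
  proof (rule H_I[OF Sc])
   fix m
   have "S w (Suc m) \<ominus> S w m = w (Suc m)"
    unfolding S_def using wc by (simp add: minus_eq a_assoc r_neg)
   moreover have "J (Suc m + k - 1) <= J m" by (rule ideal_pow_antimono[OF I_ideal]) simp
   ultimately show "S w (Suc m) \<ominus> S w m : J m" using w(1)[of "Suc m"] by auto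
  qed
  moreover have "S w k : J k" unfolding S_def by (rule ideal_finsum_closed[OF J_ideal w(2)])
  ultimately show ?thesis using rc_eq_J[OF Sc] by (simp add: KK_def)
 qed
 let ?U = "\<lambda>m. J m +> S u m" and ?V = "\<lambda>m. J m +> S v m"
 have UV: "?U : KK k" "?V : KK k" using KS uv by auto
 then have UVH: "?U : car H" "?V : car H" by (auto simp: KK_def)
 have "s = (?U *[H] tc ?p) +[H] (?V *[H] tc ?q)"
 proof
  fix m
  have Sc: "S u m : car B" "S v m : car B" unfolding S_def using uvc by auto
  have fs: "S u m \<otimes> ?p \<oplus> S v m \<otimes> ?q = f (m + Suc k)"
  proof (induction m)
   case 0
   show ?case using uv(5)[of 0] uvc pc unfolding S_def b_def by (simp add: m_comm)
  next
   case (Suc m)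
   have Sc: "S u m : car B" "S v m : car B" unfolding S_def using uvc by auto
   have "S u (Suc m) \<otimes> ?p \<oplus> S v (Suc m) \<otimes> ?q = (S u m \<otimes> ?p \<oplus> S v m \<otimes> ?q) \<oplus> b (Suc m)"
   proof -
    have "S u (Suc m) = S u m \<oplus> u (Suc m)" "S v (Suc m) = S v m \<oplus> v (Suc m)"
     unfolding S_def using uvc by (simp_all add: a_comm)
    then show ?thesis unfolding uv(5)
     using uvc[of "Suc m"] Sc pc by (simp only:) algebra
   qed
   also have "... = f (m + Suc k) \<oplus> (f (Suc m + Suc k) \<ominus> f (m + Suc k))"
    unfolding Suc.IH b_def by simp
   also have "... = f (Suc m + Suc k)" using f(1)[of "m + Suc k"] f(1)[of "Suc m + Suc k"] by algebra
   finally show ?case .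
  qed
  have fm: "f (m + j) \<ominus> f m : J m" for j
  proof (induction j)
   case 0
   then show ?case using J_minus_zero[OF f(1)] by simp
  next
   case (Suc j)
   have "J (m + j) <= J m" by (rule ideal_pow_antimono[OF I_ideal]) simp
   then have "(f (m + Suc j) \<ominus> f (m + j)) \<oplus> (f (m + j) \<ominus> f m) : J m"
    using f(2)[of "m + j"] Suc ideal_add_closed[OF J_ideal] by auto
   then show ?case using minus_trans[OF f(1) f(1) f(1)] by simp
  qed
  have "((?U *[H] tc ?p) +[H] (?V *[H] tc ?q)) m = J m +> (S u m \<otimes> ?p \<oplus> S v m \<otimes> ?q)"
   unfolding H_simps to_completion_def using Sc pc by (simp add: rc_mult rc_add)
  also have "... = J m +> f m" unfolding fs rcos_eq_iff[OF J_ideal f(1) f(1)] by (rule fm)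
  finally show "s m = ((?U *[H] tc ?p) +[H] (?V *[H] tc ?q)) m" using f(3) by simp
 qed
 moreover have "tc ?p : hI"
  using ring_hom_nat_mult[OF ring_axioms H.ring_axioms tc_hom one_closed] ring_hom_one[OF tc_hom]
   H.pq_ideal_p[OF tc_closed[OF c_closed]] by simp
 moreover have "tc ?q : hI"
  using ring_hom_minus[OF ring_axioms H.ring_axioms tc_hom c_closed one_closed] ring_hom_one[OF tc_hom]
   H.pq_ideal_q[OF tc_closed[OF c_closed]] by simp
 ultimately show "s : ideal_prod H (KK k) hI" using UV by (auto intro: ideal_prod.intros)
qed

lemma KK_hI_pow: "KK k <= ideal_power H hI k"
proof (induction k)
 case 0
 then show ?case by (auto simp: KK_def)
next
 case (Suc k)
 have "ideal_prod H (KK k) hI <= ideal_power H hI (Suc k)"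
  by (rule H.ideal_prod_subset[OF H.ideal_pow_ideal[OF hI_ideal]]) (use Suc in \<open>auto intro: ideal_prod.prod\<close>)
 then show ?case using KK_Suc_subset by blast
qed

lemma hI_pow_eq: "ideal_power H hI k = KK k"
 using KK_hI_pow hI_pow_KK by blast

text \<open>The closure is the intersection over k of the preimages of the images of N in B/I^k, and
  each of those is an ideal. This is what makes the quotient of the completed tensor square a
  ring.\<close>

lemma closure_ideal:
 assumes N: "ideal N B"
 shows "ideal (adic_closure H hI (tc ` N)) H"
proof -
 have eq: "adic_closure H hI (tc ` N) = {s : car H. \<forall>k. \<exists>z\<in>N. s k = J k +> z}"
 proof -
  have "s -[H] tc z : ideal_power H hI k \<longleftrightarrow> s k = J k +> z" if s: "s : car H" and z: "z : N" for s z k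
  proof -
   have zc: "z : car B" by (rule ideal.Icarr[OF N z])
   obtain a where a: "a : car B" "s k = J k +> a" using Quot_carrierE[OF H_at[OF s]] by metis
   have "s -[H] tc z : KK k \<longleftrightarrow> (s -[H] tc z) k = \<zero>[B Quot J k]"
    using s tc_closed[OF zc] by (simp add: KK_def FactRing_def)
   also have "(s -[H] tc z) k = s k -[B Quot J k] tc z k"
    using ring_hom_minus[OF H.ring_axioms cring.axioms(1)[OF Q_cring] proj_hom s tc_closed[OF zc]] by simp
   also have "... = J k +> (a \<ominus> z)" unfolding a(2) to_completion_def
    by (rule ring_hom_minus[OF ring_axioms cring.axioms(1)[OF Q_cring] rc_hom a(1) zc, symmetric])
   also have "... = \<zero>[B Quot J k] \<longleftrightarrow> a \<ominus> z : J k"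
    using rc_eq_J[of "a \<ominus> z" k] a(1) zc by (simp add: FactRing_def)
   also have "... \<longleftrightarrow> s k = J k +> z" unfolding a(2) rcos_eq_iff[OF J_ideal a(1) zc] ..
   finally show ?thesis unfolding hI_pow_eq .
  qed
  then show ?thesis unfolding adic_closure_def by auto
 qed
 have id: "ideal {s : car H. s k : (+>) (J k) ` N} H" for k
 proof -
  interpret q: ring_hom_ring B "B Quot J k" "(+>) (J k)"
   by (rule ring_hom_ringI2[OF ring_axioms cring.axioms(1)[OF Q_cring] rc_hom])
  interpret pr: ring_hom_ring H "B Quot J k" "\<lambda>s. s k"
   by (rule ring_hom_ringI2[OF H.ring_axioms cring.axioms(1)[OF Q_cring] proj_hom])
  have "(+>) (J k) ` car B = car (B Quot J k)" by (simp only: FactRing_def A_RCOSETS_def' UNION_singleton_eq_range partial_object.select_convs)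
  then show ?thesis by (intro pr.ideal_vimage q.surj_image_ideal[OF N])
 qed
 have e2: "{s : car H. \<forall>k. \<exists>z\<in>N. s k = J k +> z} = \<Inter> (range (\<lambda>k. {s : car H. s k : (+>) (J k) ` N}))"
  by auto
 show ?thesis unfolding eq e2
  by (rule H.i_Intersect) (use id in auto)
qed

text \<open>Brings congruences modulo a closure in the completion back to congruences in B.\<close>

lemma tc_closure_iff:
 assumes N: "ideal N B" and z: "z : car B"
 shows "tc z : adic_closure H hI (tc ` N) \<longleftrightarrow> (\<forall>k. z : N <+> J k)"
proof -
 have "(\<exists>s\<in>tc ` N. tc z -[H] s : ideal_power H hI k) \<longleftrightarrow> z : N <+> J k" for k
 proof -
  have "tc z -[H] tc w : ideal_power H hI k \<longleftrightarrow> z \<ominus> w : J k" if w: "w : car B" for w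
   using ring_hom_minus[OF ring_axioms H.ring_axioms tc_hom z w] KK_tc[of "z \<ominus> w" k] z w hI_pow_eq by simp
  then have "(\<exists>s\<in>tc ` N. tc z -[H] s : ideal_power H hI k) \<longleftrightarrow> (\<exists>w\<in>N. z \<ominus> w : J k)"
   using ideal.Icarr[OF N] by auto
  also have "... \<longleftrightarrow> z : N <+> J k"
  proof
   assume "\<exists>w\<in>N. z \<ominus> w : J k"
   then obtain w where w: "w : N" "z \<ominus> w : J k" by blast
   have "z = w \<oplus> (z \<ominus> w)" using z ideal.Icarr[OF N w(1)] by algebra
   then show "z : N <+> J k" using w unfolding set_add_def' by blast
  next
   assume "z : N <+> J k"
   then obtain w v where w: "w : N" "v : J k" "z = w \<oplus> v" unfolding set_add_def' by blast
   have "z \<ominus> w = v" using w ideal.Icarr[OF N w(1)] ideal.Icarr[OF J_ideal w(2)] by (simp add: minus_eq a_ac r_neg2 r_neg)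
   then show "\<exists>w\<in>N. z \<ominus> w : J k" using w by blast
  qed
  finally show ?thesis .
 qed
 then show ?thesis unfolding adic_closure_def using tc_closed[OF z] by simp
qed

end

section \<open>The Taylor series\<close>

context q_setting
begin

lemma lf_closed [simp]: "a : car A ==> lf a : car P"
 and rt_closed [simp]: "a : car A ==> rt a : car P"
 by (simp_all add: tp.tens_closed)

sublocale pc: pq_completion P p "lf (hA qv)"
 by unfold_locales simp

lemma P_hat_eq: "P_hat p R A = pc.H" "to_P_hat p R A = pc.tc"
 by (simp_all only: P_hat_def to_P_hat_def cP_eq)

abbreviation "Cl n \<equiv> P_closure p R A \<sigma> n"
abbreviation "PQ n \<equiv> pc.H Quot Cl n"

lemma Cl_eq: "Cl n = adic_closure pc.H pc.hI (pc.tc ` tI (Suc n))"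
 unfolding P_closure_def P_hat_eq q_in_P by simp

lemma Cl_ideal: "ideal (Cl n) pc.H"
 unfolding Cl_eq by (rule pc.closure_ideal[OF tI_ideal])

lemma PQ_cring: "cring (PQ n)"
 by (rule ideal.quotient_is_cring[OF Cl_ideal pc.H_cring])

definition rho :: "nat => ('a \<times> 'a \<Rightarrow>\<^sub>0 int) set => (nat => ('a \<times> 'a \<Rightarrow>\<^sub>0 int) set set) set" where
 "rho n z = Cl n +>[pc.H] pc.tc z"

lemma rho_hom: "rho n : ring_hom P (PQ n)"
 using ring_hom_trans[OF pc.tc_hom ideal.rcos_ring_hom[OF Cl_ideal[of n]]]
 by (simp add: rho_def[abs_def] comp_def)

lemma rho_eq_iff:
 assumes "z : car P" "w : car P"
 shows "rho n z = rho n w \<longleftrightarrow> (\<forall>k. z -[P] w : tI (Suc n) <+>\<^bsub>P\<^esub> ideal_power P cP k)"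
proof -
 have "rho n z = rho n w \<longleftrightarrow> pc.tc z -[pc.H] pc.tc w : Cl n"
  unfolding rho_def by (rule pc.H.rcos_eq_iff[OF Cl_ideal pc.tc_closed[OF assms(1)] pc.tc_closed[OF assms(2)]])
 also have "pc.tc z -[pc.H] pc.tc w = pc.tc (z -[P] w)"
  by (rule ring_hom_minus[OF P.ring_axioms pc.H.ring_axioms pc.tc_hom assms, symmetric])
 also have "... : Cl n \<longleftrightarrow> (\<forall>k. z -[P] w : tI (Suc n) <+>\<^bsub>P\<^esub> pc.J k)"
  unfolding Cl_eq by (rule pc.tc_closure_iff[OF tI_ideal P.minus_closed[OF assms]])
 finally show ?thesis unfolding cP_eq .
qed

lemma P_class_eq: "P_class p R A \<sigma> n f g = rho n (tt f g)"
 by (simp add: P_class_def P_hat_eq rho_def)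

lemma xi_eval:
 assumes g: "g : car UA"
 shows "eval A (PQ n) (\<lambda>a. P_class p R A \<sigma> n a \<one>)
   (P_class p R A \<sigma> n \<one> x -[PQ n] P_class p R A \<sigma> n x \<one>) g = rho n (E g)"
proof -
 have 1: "(\<lambda>a. P_class p R A \<sigma> n a \<one>) : ring_hom A (PQ n)"
  unfolding P_class_eq using ring_hom_trans[OF lf_hom rho_hom[of n]] by (simp add: comp_def)
 have x: "P_class p R A \<sigma> n \<one> x -[PQ n] P_class p R A \<sigma> n x \<one> = rho n (rt x -[P] lf x)"
  unfolding P_class_eq
  by (rule ring_hom_minus[OF P.ring_axioms cring.axioms(1)[OF PQ_cring] rho_hom, symmetric]) (simp_all add: x_closed)
 have 2: "rho n (rt x -[P] lf x) : car (PQ n)"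
  by (rule ring_hom_closed[OF rho_hom]) (simp add: x_closed)
 note e = eval_UP_hom[OF A_cring PQ_cring 1 2]
 have "eval A (PQ n) (\<lambda>a. P_class p R A \<sigma> n a \<one>) (rho n (rt x -[P] lf x)) g = (rho n \<circ> E) g"
 proof (rule UP_hom_ext[OF A_cring PQ_cring e(1) ring_hom_trans[OF E_hom(1) rho_hom] _ _ g])
  show "eval A (PQ n) (\<lambda>a. P_class p R A \<sigma> n a \<one>) (rho n (rt x -[P] lf x)) (monom UA a 0) = (rho n \<circ> E) (monom UA a 0)"
   if "a : car A" for a using e(2)[OF that] by (simp add: E_hom(2)[OF that] P_class_eq)
  show "eval A (PQ n) (\<lambda>a. P_class p R A \<sigma> n a \<one>) (rho n (rt x -[P] lf x)) XA = (rho n \<circ> E) XA"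
   unfolding e(3) comp_apply E_hom(3) ..
 qed
 then show ?thesis unfolding x by simp
qed

lemma xi_to_P_rcos:
 assumes g: "g : car UA"
 shows "xi_to_P p R A x \<sigma> n (xI n +>[UA] g) = rho n (E g)"
proof -
 let ?e = "eval A (PQ n) (\<lambda>a. P_class p R A \<sigma> n a \<one>)
   (P_class p R A \<sigma> n \<one> x -[PQ n] P_class p R A \<sigma> n x \<one>)"
 have "?e g' = rho n (E g)" if g': "g' : xI n +>[UA] g" for g'
 proof -
  have c: "g' : car UA" "g' -[UA] g : xI n" using UAc.in_rcos_iff[OF xI_ideal g] g' by auto
  have "E g' -[P] E g : tI (Suc n)"
   using E_xI[OF c(2)] ring_hom_minus[OF UAc.ring_axioms P.ring_axioms E_hom(1) c(1) g] by simp
  then have "rho n (E g') = rho n (E g)"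
   unfolding rho_eq_iff[OF E_closed[OF c(1)] E_closed[OF g]]
   using P.subset_set_add_l[OF tI_ideal P.ideal_pow_ideal[OF cP_ideal]] by blast
  then show ?thesis using xi_eval[OF c(1)] by simp
 qed
 moreover have "g : xI n +>[UA] g"
  using UAc.in_rcos_iff[OF xI_ideal g] g UAc.ideal_zero_closed[OF xI_ideal] by (simp add: UAc.minus_eq UAc.r_neg)
 ultimately have "?e ` (xI n +>[UA] g) = {rho n (E g)}" by blast
 then show ?thesis by (simp add: xi_to_P_def Let_def P_hat_eq)
qed

text \<open>Apply \<open>Th\<close>: if the image of g - g' lies in I^(n+1) + (p,q-1)^k for all k,
  the coefficients of index at most n lie in every power of (p,q-1) and vanish by
  separatedness.\<close>

lemma xi_to_P_inj: "inj_on (xi_to_P p R A x \<sigma> n) (car (UA Quot xI n))"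
proof (rule inj_onI)
 fix Z Z' assume Z: "Z : car (UA Quot xI n)" and Z': "Z' : car (UA Quot xI n)"
  and eq: "xi_to_P p R A x \<sigma> n Z = xi_to_P p R A x \<sigma> n Z'"
 obtain g where g: "g : car UA" "Z = xI n +>[UA] g" using Quot_carrierE[OF Z] .
 obtain g' where g': "g' : car UA" "Z' = xI n +>[UA] g'" using Quot_carrierE[OF Z'] .
 note gg = UAc.minus_closed[OF g(1) g'(1)]
 have "rho n (E g) = rho n (E g')" using eq unfolding g(2) g'(2) xi_to_P_rcos[OF g(1)] xi_to_P_rcos[OF g'(1)] .
 then have E: "E (g -[UA] g') : tI (Suc n) <+>\<^bsub>P\<^esub> ideal_power P cP k" for k
  unfolding rho_eq_iff[OF E_closed[OF g(1)] E_closed[OF g'(1)]]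
   ring_hom_minus[OF UAc.ring_axioms P.ring_axioms E_hom(1) g(1) g'(1)] by blast
 have "Ps (g -[UA] g') j = \<zero>" if j: "j < Suc n" for j
 proof (rule ep.separated)
  show "Ps (g -[UA] g') j : car A" by (rule zp.nw.T_closed[OF Ps_closed[OF gg]])
  fix k
  \<comment> \<open>The exponent is raised by j because W loses j at the coefficient of index
    j.\<close>
  obtain a b where ab: "a : tI (Suc n)" "b : ideal_power P cP (k + j)" "E (g -[UA] g') = a +[P] b"
   using E[of "k + j"] unfolding P.set_add_iff by blast
  have c: "a : car P" "b : car P"
   using ideal.Icarr[OF tI_ideal ab(1)] ideal.Icarr[OF P.ideal_pow_ideal[OF cP_ideal] ab(2)] .
  have "Ps (g -[UA] g') = Th a +[NT] Th b" unfolding Ps_def ab(3) by (rule ring_hom_add[OF Th_hom c])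
  moreover have "Th a j = \<zero>" using Th_tI[OF ab(1)] j unfolding zp.nw.Tr_iff by blast
  moreover have "Th b j : zp.cpw (k + j - j)" using Th_cP[OF ab(2)] unfolding zp.nw.W_iff by blast
  ultimately show "Ps (g -[UA] g') j : zp.cpw k" using zp.cpw_carr by (simp add: zp.nw.T_simps(4))
 qed
 then have "g -[UA] g' : xI n" using xI_iff[OF gg] Ps_closed[OF gg] zp.nw.Tr_iff by blast
 then show "Z = Z'" unfolding g(2) g'(2) UAc.rcos_eq_iff[OF xI_ideal g(1) g'(1)] .
qed

text \<open>\<open>inv_into\<close> is evaluated by injectivity together with the explicit preimage
  that \<open>rt_cong_Phi\<close> supplies.\<close>

theorem taylor_series_eq:
 assumes f: "f : car A"
 shows "taylor_series p R A x \<sigma> f n = xI n +>[UA] Phi n f"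
proof -
 have "rho n (E (Phi n f)) = rho n (rt f)"
  using rho_eq_iff[OF rt_closed[OF f] E_closed[OF Phi_closed[OF f]]] rt_cong_Phi[OF f] by metis
 then have "xi_to_P p R A x \<sigma> n (xI n +>[UA] Phi n f) = P_class p R A \<sigma> n \<one> f"
  by (simp only: xi_to_P_rcos[OF Phi_closed[OF f]] P_class_eq)
 then show ?thesis
  unfolding taylor_series_def
  using inv_into_f_f[OF xi_to_P_inj rcos_in_Quot[OF xI_ideal Phi_closed[OF f]], of n n] by simp
qed

end

section \<open>Twisted divided polynomials and their truncations\<close>

lemma (in cring) sub_add_cancel: "a : car R ==> b : car R ==> (a \<ominus> b) \<oplus> b = a"
 by algebra

context q_setting
begin

abbreviation QD where "QD \<equiv> qdp R A x"
abbreviation cst where "cst \<equiv> zp.dp.cst"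
abbreviation basis where "basis \<equiv> zp.dp.basis"

lemma up_iff: "F : up A \<longleftrightarrow> (\<forall>k. F k : car A) \<and> (\<exists>N. \<forall>k>N. F k = \<zero>)"
 by (auto simp: up_def bound_def Pi_iff)

lemma upI: "(!!k. F k : car A) ==> (!!k. k > N ==> F k = \<zero>) ==> F : up A"
 unfolding up_iff by blast

lemma up_at [simp]: "F : up A ==> F k : car A"
 by (simp add: up_iff)

lemma up_DT: "F : up A ==> F : car DT"
 by (simp add: zp.dp.T_carrier_iff)

lemma up_trunc: "(!!k. f k : car A) ==> (\<lambda>k. if k <= n then f k else \<zero>) : up A"
 by (rule upI[of _ n]) auto

lemma cst_up [simp]: "a : car A ==> cst a : up A"
 by (rule upI[of _ 0]) (auto simp: zp.dp.cst_def)

lemma basis_up [simp]: "basis n : up A"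
 by (rule upI[of _ n]) (auto simp: zp.dp.basis_def)

lemma xi_div_eq: "xi_div A n = basis n"
 by (simp add: xi_div_def zp.dp.basis_def)

lemma QD_simps:
 "car QD = up A" "\<one>[QD] = \<one>[DT]" "\<zero>[QD] = \<zero>[DT]" "F +[QD] G = F +[DT] G"
 "a \<odot>[QD] F = (\<lambda>k. a \<otimes> F k)"
 by (simp_all add: qdp_def zp.dp.T_simps)

text \<open>Identifies the divided polynomials with the finitely supported divided series, from
  which the ring axioms and ideals are inherited.\<close>

lemma QD_mult: 
 assumes F: "F : up A" and G: "G : up A"
 shows "F *[QD] G = F *[DT] G"
proof
 fix l
 have "(F *[QD] G) l = (\<Oplus>n\<in>{..l}. \<Oplus>m\<in>{l - n..l}. F n \<otimes> G m \<otimes> qdp_coeff R A x n m (n + m - l))"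
  by (simp add: qdp_def)
 also have "... = (\<Oplus>n\<in>{..l}. \<Oplus>m\<in>{..l}. F n \<otimes> G m \<otimes> zp.dp.s n m l)"
 proof (rule Ac.finsum_cong2')
  fix n assume n: "n : {..l}"
  have "(\<Oplus>m\<in>{l - n..l}. F n \<otimes> G m \<otimes> qdp_coeff R A x n m (n + m - l)) = (\<Oplus>m\<in>{l - n..l}. F n \<otimes> G m \<otimes> zp.dp.s n m l)"
  proof (rule Ac.finsum_cong2')
   fix m assume m: "m : {l - n..l}"
   then have "l <= n + m" by auto
   then have "qdp_coeff R A x n m (n + m - l) = zp.dp.s n m l"
    unfolding qdp_coeff_def tw_el_def str_at_def qdp_str_def qv_def by (simp add: one_pCons)
   then show "F n \<otimes> G m \<otimes> qdp_coeff R A x n m (n + m - l) = F n \<otimes> G m \<otimes> zp.dp.s n m l" by simp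
  qed (use F G in simp)
  also have "... = (\<Oplus>m\<in>{..l}. F n \<otimes> G m \<otimes> zp.dp.s n m l)"
   by (rule Ac.finsum_neutral) (use n F G zp.dp.s_eq_0 in auto)
  finally show "(\<Oplus>m\<in>{l - n..l}. F n \<otimes> G m \<otimes> qdp_coeff R A x n m (n + m - l)) = (\<Oplus>m\<in>{..l}. F n \<otimes> G m \<otimes> zp.dp.s n m l)" .
 qed (use F G in \<open>auto intro!: Ac.finsum_closed\<close>)
 also have "... = (F *[DT] G) l" by (simp add: zp.dp.T_simps(5))
 finally show "(F *[QD] G) l = (F *[DT] G) l" .
qed

lemma up_mult: "F : up A ==> G : up A ==> F *[DT] G : up A"
proof -
 assume F: "F : up A" and G: "G : up A"
 obtain N M where N: "!!k. k > N ==> F k = \<zero>" and M: "!!k. k > M ==> G k = \<zero>" using F G unfolding up_iff by blast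
 show ?thesis
 proof (rule upI[of _ "N + M"])
  show "(F *[DT] G) k : car A" for k
   by (rule zp.dp.T_closed[OF zp.dp.mult_closed[OF up_DT[OF F] up_DT[OF G]]])
  fix l assume l: "l > N + M"
  have "F n \<otimes> G m \<otimes> zp.dp.s n m l = \<zero>" for n m
  proof (cases "n > N \<or> m > M")
   case True
   then have "F n = \<zero> \<or> G m = \<zero>" using N M by blast
   then show ?thesis using F G by auto
  next
   case False
   then show ?thesis using l F G by (simp add: zp.dp.s_eq_0)
  qed
  then show "(F *[DT] G) l = \<zero>" unfolding zp.dp.T_simps(5) by (intro Ac.finsum_zero) auto
 qed
qed

lemma up_add: "F : up A ==> G : up A ==> F +[DT] G : up A"
proof -
 assume F: "F : up A" and G: "G : up A"
 obtain N M where N: "!!k. k > N ==> F k = \<zero>" and M: "!!k. k > M ==> G k = \<zero>" using F G unfolding up_iff by blast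
 show ?thesis unfolding zp.dp.T_simps(4) by (rule upI[of _ "N + M"]) (use F G N M in auto)
qed

lemma QD_cring: "cring QD"
proof (rule cringI)
 show "abelian_group QD"
 proof (rule abelian_groupI)
  show "\<exists>G\<in>car QD. G +[QD] F = \<zero>[QD]" if F: "F : car QD" for F
  proof
   obtain N where N: "!!k. k > N ==> F k = \<zero>" and c: "!!k. F k : car A" using F unfolding QD_simps up_iff by blast
   show "(\<lambda>k. \<ominus> F k) : car QD" unfolding QD_simps by (rule upI[of _ N]) (use N c in auto)
   show "(\<lambda>k. \<ominus> F k) +[QD] F = \<zero>[QD]" unfolding QD_simps zp.dp.T_simps using c by (simp add: Ac.l_neg)
  qed
  show "\<zero>[QD] : car QD" unfolding QD_simps zp.dp.T_simps by (rule upI[of _ 0]) auto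
 qed (auto simp: QD_simps up_add up_DT zp.dp.T.a_ac)
 show "comm_monoid QD"
 proof (rule comm_monoidI)
  show "\<one>[QD] : car QD" unfolding QD_simps zp.dp.T_simps by (rule upI[of _ 0]) auto
  show "F *[QD] G *[QD] K = F *[QD] (G *[QD] K)" if "F : car QD" "G : car QD" "K : car QD" for F G K
   using that by (simp add: QD_simps QD_mult up_mult up_DT zp.dp.T.m_assoc)
  show "\<one>[QD] *[QD] F = F" if "F : car QD" for F
  proof -
   have "\<one>[DT] : up A" unfolding zp.dp.T_simps by (rule upI[of _ 0]) auto
   then show ?thesis using that by (simp add: QD_simps QD_mult up_DT)
  qed
  show "F *[QD] G = G *[QD] F" if "F : car QD" "G : car QD" for F G
   using that by (simp add: QD_simps QD_mult up_DT zp.dp.T.m_comm)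
 qed (simp add: QD_simps QD_mult up_mult)
 show "(F +[QD] G) *[QD] K = F *[QD] K +[QD] G *[QD] K" if "F : car QD" "G : car QD" "K : car QD" for F G K
  using that by (simp add: QD_simps QD_mult up_add up_DT zp.dp.T.l_distr)
qed

sublocale Qc: cring QD by (rule QD_cring)

lemma QD_minus_at: "F : up A ==> G : up A ==> (F -[QD] G) k = F k \<ominus> G k"
proof -
 assume F: "F : up A" and G: "G : up A"
 have c: "F -[QD] G : up A" using Qc.minus_closed[of F G] F G by (simp add: QD_simps)
 have "(F -[QD] G) +[QD] G = F" using F G by (simp add: QD_simps(1) Qc.sub_add_cancel)
 then have "(F -[QD] G) k \<oplus> G k = F k" unfolding QD_simps zp.dp.T_simps by metis
 then show ?thesis using up_at[OF c, of k] up_at[OF G, of k] up_at[OF F, of k]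
  by (metis Ac.add_sub_cancel Ac.a_comm)
qed

lemma QD_minus_closed: "F : up A ==> G : up A ==> F -[QD] G : up A"
 using Qc.minus_closed[of F G] by (simp add: QD_simps)

lemma cst_hom_QD: "cst : ring_hom A QD"
 by (rule ring_hom_memI)
  (simp_all add: QD_simps(1,2,4) QD_mult ring_hom_mult[OF zp.dp.cst_hom] ring_hom_add[OF zp.dp.cst_hom]
   ring_hom_one[OF zp.dp.cst_hom])

lemma smult_one_QD: "a : car A ==> a \<odot>[QD] \<one>[QD] = cst a"
 by (auto simp: QD_simps zp.dp.T_simps zp.dp.cst_def)

lemma cst_mult_QD: "a : car A ==> F : up A ==> cst a *[QD] F = (\<lambda>k. a \<otimes> F k)"
 by (simp add: QD_mult zp.dp.cst_mult up_DT)

text \<open>A finitely supported sequence is the sum of its terms F_k \<xi>^[k]; adding them one at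
  a time never leaves the ideal.\<close>

lemma coeff_induct:
 assumes J: "ideal J QD" and F: "F : up A"
  and c: "!!k. F k ~= \<zero> ==> cst (F k) *[QD] basis k : J"
 shows "F : J"
proof -
 obtain N where N: "!!k. k > N ==> F k = \<zero>" using F unfolding up_iff by blast
 have "(\<lambda>k. if k < m then F k else \<zero>) : J" for m
 proof (induction m)
  case 0
  then show ?case using Qc.ideal_zero_closed[OF J] by (simp add: QD_simps zp.dp.T_simps)
 next
  case (Suc m)
  have b: "cst (F m) *[QD] basis m = (\<lambda>k. if k = m then F m else \<zero>)"
   unfolding cst_mult_QD[OF up_at[OF F] basis_up] using F by (auto simp: zp.dp.basis_def)
  have eq: "(\<lambda>k. if k < Suc m then F k else \<zero>) = (\<lambda>k. if k < m then F k else \<zero>) +[QD] (cst (F m) *[QD] basis m)"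
   unfolding b QD_simps zp.dp.T_simps using F by (auto simp: fun_eq_iff less_Suc_eq)
  have "cst (F m) *[QD] basis m : J"
  proof (cases "F m = \<zero>")
   case True
   then have "cst (F m) *[QD] basis m = \<zero>[QD]" unfolding b by (auto simp: QD_simps zp.dp.T_simps)
   then show ?thesis using Qc.ideal_zero_closed[OF J] by simp
  qed (rule c)
  then show ?case unfolding eq using Qc.ideal_add_closed[OF J Suc] by blast
 qed
 moreover have "(\<lambda>k. if k < Suc N then F k else \<zero>) = F" using N by (auto simp: fun_eq_iff)
 ultimately show ?thesis by metis
qed

abbreviation qI where "qI \<equiv> qdp_ideal R A x"
abbreviation Qn where "Qn \<equiv> qdp_trunc R A x"
abbreviation cl where "cl \<equiv> qdp_class R A x"

lemma inter_DT_ideal: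
 assumes "ideal J DT"
 shows "ideal {F : up A. F : J} QD"
proof -
 have h: "(\<lambda>F. F) : ring_hom QD DT"
  by (rule ring_hom_memI) (simp_all add: QD_simps(1,2,4) QD_mult up_DT)
 interpret ring_hom_ring QD DT "\<lambda>F. F" by (rule ring_hom_ringI2[OF Qc.ring_axioms zp.dp.T.ring_axioms h])
 show ?thesis using ideal_vimage[OF assms] by (simp add: QD_simps)
qed

lemma qI_eq: "qI n = {F : up A. \<forall>k\<le>n. F k = \<zero>}"
proof
 let ?K = "{F : up A. \<forall>k\<le>n. F k = \<zero>}"
 have K: "?K = {F : up A. F : zp.dp.Tr (Suc n)}"
  using up_DT by (auto simp: zp.dp.Tr_iff less_Suc_eq_le)
 have "ideal ?K QD" unfolding K by (rule inter_DT_ideal[OF zp.dp.Tr_ideal])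
 moreover have "{xi_div A k |k. n + 1 <= k} <= ?K" by (auto simp: xi_div_eq) (simp add: zp.dp.basis_def)
 ultimately show "qI n <= ?K" unfolding qdp_ideal_def by (rule Qc.genideal_minimal)
 have gc: "{xi_div A k |k. n + 1 <= k} <= car QD" by (auto simp: xi_div_eq QD_simps)
 have id: "ideal (qI n) QD" unfolding qdp_ideal_def by (rule Qc.genideal_ideal[OF gc])
 show "?K <= qI n"
 proof
  fix F assume F: "F : ?K"
  show "F : qI n"
  proof (rule coeff_induct[OF id])
   show "F : up A" using F by blast
   fix k assume "F k ~= \<zero>"
   then have "n + 1 <= k" using F by (metis (mono_tags, lifting) mem_Collect_eq not_less_eq_eq Suc_eq_plus1)
   then have "basis k : qI n" unfolding qdp_ideal_def using Qc.genideal_self[OF gc] by (auto simp: xi_div_eq)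
   then show "cst (F k) *[QD] basis k : qI n"
    using F by (intro ideal.I_l_closed[OF id]) (simp_all add: QD_simps)
  qed
 qed
qed

lemma qI_ideal: "ideal (qI n) QD"
 unfolding qdp_ideal_def by (rule Qc.genideal_ideal) (auto simp: xi_div_eq QD_simps)

lemma cl_eq_iff: "F : up A ==> G : up A ==> cl n F = cl n G \<longleftrightarrow> (\<forall>k\<le>n. F k = G k)"
proof -
 assume F: "F : up A" and G: "G : up A"
 have "cl n F = cl n G \<longleftrightarrow> F -[QD] G : qI n"
  unfolding qdp_class_def by (rule Qc.rcos_eq_iff[OF qI_ideal]) (use F G in \<open>simp_all add: QD_simps\<close>)
 also have "... \<longleftrightarrow> (\<forall>k\<le>n. F k \<ominus> G k = \<zero>)"
  unfolding qI_eq using QD_minus_closed[OF F G] QD_minus_at[OF F G] by simp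
 also have "... \<longleftrightarrow> (\<forall>k\<le>n. F k = G k)"
  using up_at[OF F] up_at[OF G] by (metis Ac.r_right_minus_eq)
 finally show ?thesis .
qed

lemma in_cl_iff: "F : up A ==> G : cl n F \<longleftrightarrow> G : up A \<and> (\<forall>k\<le>n. G k = F k)"
proof -
 assume F: "F : up A"
 have "G : cl n F \<longleftrightarrow> G : up A \<and> G -[QD] F : qI n"
  unfolding qdp_class_def using Qc.in_rcos_iff[OF qI_ideal, of F G n] F by (simp add: QD_simps)
 also have "... \<longleftrightarrow> G : up A \<and> cl n G = cl n F"
  unfolding qdp_class_def using Qc.rcos_eq_iff[OF qI_ideal, of G F n] F by (auto simp: QD_simps)
 also have "... \<longleftrightarrow> G : up A \<and> (\<forall>k\<le>n. G k = F k)" using cl_eq_iff[OF _ F] by blast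
 finally show ?thesis .
qed

lemma Qn_simps: "car (Qn n) = car (QD Quot qI n)" "u *[Qn n] v = u *[QD Quot qI n] v"
 "u +[Qn n] v = u +[QD Quot qI n] v" "\<one>[Qn n] = \<one>[QD Quot qI n]" "\<zero>[Qn n] = \<zero>[QD Quot qI n]"
 by (simp_all add: qdp_trunc_def quot_algebra_def)

lemma Qn_cring: "cring (Qn n)"
proof -
 interpret Q: cring "QD Quot qI n" by (rule ideal.quotient_is_cring[OF qI_ideal QD_cring])
 show ?thesis
 proof (rule cringI)
  show "abelian_group (Qn n)"
  proof (rule abelian_groupI)
   show "\<exists>v\<in>car (Qn n). v +[Qn n] u = \<zero>[Qn n]" if "u : car (Qn n)" for u
    using that Q.l_neg[of u] Q.a_inv_closed[of u] unfolding Qn_simps by blast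
  qed (auto simp: Qn_simps Q.a_ac)
  show "comm_monoid (Qn n)" by (rule comm_monoidI) (auto simp: Qn_simps Q.m_ac)
 qed (simp add: Qn_simps Q.l_distr)
qed

lemma Qn_grp: "abelian_group (Qn n)"
 using Qn_cring by (simp add: cring_def ring_def)

lemma cl_hom: "cl n : ring_hom QD (Qn n)"
 using ideal.rcos_ring_hom[OF qI_ideal[of n]] unfolding ring_hom_def Qn_simps qdp_class_def by simp

lemma cl_closed [simp]: "F : up A ==> cl n F : car (Qn n)"
 using ring_hom_closed[OF cl_hom, of F] by (simp add: QD_simps)

lemma cl_mult: "F : up A ==> G : up A ==> cl n F *[Qn n] cl n G = cl n (F *[DT] G)"
 using ring_hom_mult[OF cl_hom, of F G] by (simp add: QD_simps QD_mult)

lemma cl_add: "F : up A ==> G : up A ==> cl n F +[Qn n] cl n G = cl n (\<lambda>k. F k \<oplus> G k)"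
 using ring_hom_add[OF cl_hom, of F G] by (simp add: QD_simps zp.dp.T_simps)

lemma cl_one: "\<one>[Qn n] = cl n (basis 0)"
 using ring_hom_one[OF cl_hom] by (simp add: QD_simps zp.dp.T_simps zp.dp.basis_def)

lemma Qn_E:
 assumes "u : car (Qn n)"
 obtains F where "F : up A" "u = cl n F"
 using Quot_carrierE[of u QD "qI n"] assms unfolding Qn_simps qdp_class_def QD_simps(1) by blast

lemma cl_smult: "a : car A ==> F : up A ==> a \<odot>[Qn n] cl n F = cl n (\<lambda>k. a \<otimes> F k)"
proof -
 assume a: "a : car A" and F: "F : up A"
 have up: "(\<lambda>k. a \<otimes> G k) : up A" if "G : up A" for G
  using that a unfolding up_iff by (metis Ac.m_closed Ac.r_null)
 have "a \<odot>[Qn n] cl n F = (\<Union>G\<in>cl n F. cl n (\<lambda>k. a \<otimes> G k))"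
  by (simp add: qdp_trunc_def quot_algebra_def QD_simps qdp_class_def)
 also have "... = (\<Union>G\<in>cl n F. cl n (\<lambda>k. a \<otimes> F k))"
 proof (rule SUP_cong[OF refl])
  fix G assume "G : cl n F"
  then have "G : up A" "!!k. k <= n ==> G k = F k" unfolding in_cl_iff[OF F] by auto
  then show "cl n (\<lambda>k. a \<otimes> G k) = cl n (\<lambda>k. a \<otimes> F k)" using cl_eq_iff[OF up up[OF F]] by auto
 qed
 also have "... = cl n (\<lambda>k. a \<otimes> F k)" using in_cl_iff[OF F, of F n] F by auto
 finally show ?thesis .
qed

text \<open>Reads the coefficient from an arbitrary representative; this is meaningful for k \<le>
  n, where all representatives agree.\<close>

definition co :: "(nat => 'a) set => nat => 'a" where "co u k = (SOME F. F : u) k"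

lemma co_cl: "F : up A ==> k <= n ==> co (cl n F) k = F k"
proof -
 assume F: "F : up A" and k: "k <= n"
 have "F : cl n F" using in_cl_iff[OF F] F by blast
 then have "(SOME G. G : cl n F) : cl n F" by (rule someI[of "\<lambda>G. G : cl n F"])
 then show ?thesis using in_cl_iff[OF F] k unfolding co_def by blast
qed

lemma co_closed: "u : car (Qn n) ==> k <= n ==> co u k : car A"
 by (elim Qn_E) (simp add: co_cl)

lemma qdp_proj_cl: "m <= n ==> F : up A ==> qdp_proj R A x m (cl n F) = cl m F"
proof -
 assume m: "m <= n" and F: "F : up A"
 have "cl m G = cl m F" if "G : cl n F" for G
  using that m unfolding in_cl_iff[OF F] using cl_eq_iff[OF _ F] by auto
 moreover have "F : cl n F" using in_cl_iff[OF F] F by blast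
 ultimately have "cl m ` cl n F = {cl m F}" by blast
 then show ?thesis by (simp add: qdp_proj_def)
qed

lemma Qn_smult_closed: "a : car A ==> u : car (Qn n) ==> a \<odot>[Qn n] u : car (Qn n)"
proof -
 assume a: "a : car A" and u: "u : car (Qn n)"
 obtain F where F: "F : up A" "u = cl n F" using Qn_E[OF u] .
 have "(\<lambda>k. a \<otimes> F k) : up A" using F(1) a unfolding up_iff by (metis Ac.m_closed Ac.r_null)
 then show ?thesis unfolding F(2) cl_smult[OF a F(1)] by simp
qed

section \<open>The Taylor map\<close>

lemma poly_to_qdp_eq: "g : car UA ==> poly_to_qdp R A x g = zp.sc (Ps g)"
proof -
 assume g: "g : car UA"
 have 1: "(\<lambda>a. a \<odot>[QD] \<one>[QD]) : ring_hom A QD"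
  using cst_hom_QD smult_one_QD unfolding ring_hom_def by auto
 have 2: "xi_div A 1 : car QD" by (simp add: xi_div_eq QD_simps)
 note e = eval_UP_hom[OF A_cring QD_cring 1 2, folded poly_to_qdp_def]
 have h: "(\<lambda>F. F) : ring_hom QD DT"
  by (rule ring_hom_memI) (simp_all add: QD_simps(1,2,4) QD_mult up_DT)
 have h1: "poly_to_qdp R A x : ring_hom UA DT" using ring_hom_trans[OF e(1) h] by (simp add: comp_def)
 have h2: "zp.sc \<circ> Ps : ring_hom UA DT" by (rule ring_hom_trans[OF Ps_hom zp.sc_hom])
 have "poly_to_qdp R A x g = (zp.sc \<circ> Ps) g"
 proof (rule UP_hom_ext[OF A_cring zp.dp.T_cring h1 h2 _ _ g])
  show "poly_to_qdp R A x (monom UA a 0) = (zp.sc \<circ> Ps) (monom UA a 0)" if a: "a : car A" for a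
  proof -
   have "poly_to_qdp R A x (monom UA a 0) = cst a" using e(2)[OF a] smult_one_QD[OF a] by simp
   also have "... = zp.sc (zp.nw.cst a)" using a by (auto simp: zp.sc_def zp.nw.cst_def zp.dp.cst_def)
   finally show ?thesis unfolding comp_apply Ps_cst[OF a] .
  qed
  have q1: "q_fact 1 = 1" using q_fact_Suc[of 0] by simp
  have "poly_to_qdp R A x XA = basis 1" unfolding e(3) xi_div_eq ..
  also have "... = zp.sc (zp.nw.basis 1)" using q1 by (auto simp: zp.sc_def zp.nw.basis_def zp.dp.basis_def)
  finally show "poly_to_qdp R A x XA = (zp.sc \<circ> Ps) XA" unfolding comp_apply Ps_XA .
 qed
 then show ?thesis by simp
qed

text \<open>(m)_q is congruent to m modulo q - 1, so multiples of p give elements of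
  (p,q-1).\<close>

lemma q_int_cc: "hA (q_int (i * p)) : zp.\<cc>"
proof -
 have "\<exists>g. q_int m = of_nat m + (qv - 1) * g" for m
 proof (induction m)
  case 0
  show ?case by (rule exI[of _ 0]) simp
 next
  case (Suc m)
  then obtain g where g: "q_int m = of_nat m + (qv - 1) * g" by blast
  have "q_int (Suc m) = of_nat (Suc m) + (qv - 1) * (g + q_int m)"
   using q_int_Suc(2)[of m] q_int_mult[of m] g by (simp add: algebra_simps)
  then show ?case by blast
 qed
 then obtain g where g: "q_int (i * p) = of_nat (i * p) + (qv - 1) * g" by blast
 have "hA (of_nat p) : zp.\<cc>" unfolding zp.h_of_nat by (rule Ac.pq_ideal_p) simp
 then have 1: "hA (of_nat i) \<otimes> hA (of_nat p) : zp.\<cc>" by (intro ideal.I_l_closed[OF zp.cc_ideal]) auto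
 have "hA (qv - 1) : zp.\<cc>" unfolding zp.h_minus using Ac.pq_ideal_q[of "hA qv" p] by simp
 then have 2: "hA (qv - 1) \<otimes> hA g : zp.\<cc>" by (intro ideal.I_r_closed[OF zp.cc_ideal]) auto
 show ?thesis unfolding g zp.h_add of_nat_mult zp.h_mult by (rule Ac.ideal_add_closed[OF zp.cc_ideal 1 2])
qed

lemma q_fact_dvd: "m <= n ==> q_fact m dvd q_fact n"
 by (induction rule: dec_induct) (auto simp: q_fact_Suc)

text \<open>For each i from 1 to k the factorial contains the factor (ip)_q, which lies in (p,q-1).
  This is the quantitative form of (n)_q! -> 0.\<close>

lemma q_fact_cpw_p: "hA (q_fact (k * p)) : zp.cpw k"
proof (induction k)
 case 0
 show ?case by simp
next
 case (Suc k)
 have "0 < p" using prime by (rule prime_gt_0_nat)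
 then obtain m where m: "Suc k * p = Suc m" "k * p <= m" by (cases p) auto
 obtain g where g: "q_fact m = q_fact (k * p) * g" using q_fact_dvd[OF m(2)] by (elim dvdE)
 have "hA (q_fact (k * p)) \<otimes> hA (q_int (Suc k * p)) : zp.cpw (k + 1)"
  by (rule zp.cpw_mult[OF Suc]) (use q_int_cc[of "Suc k"] Ac.ideal_pow_1[OF zp.cc_ideal] in simp)
 then have "hA (q_fact (k * p)) \<otimes> hA (q_int (Suc k * p)) \<otimes> hA g : zp.cpw (k + 1)"
  by (rule zp.cpw_mult_r) simp
 moreover have "q_fact (Suc k * p) = q_fact (k * p) * q_int (Suc k * p) * g"
  unfolding m(1) q_fact_Suc g by (simp add: mult_ac)
 ultimately show ?case by (simp only: zp.h_mult Suc_eq_plus1)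
qed

lemma q_fact_cpw: "k * p <= n ==> a : car A ==> hA (q_fact n) \<otimes> a : zp.cpw k"
proof -
 assume n: "k * p <= n" and a: "a : car A"
 obtain g where g: "q_fact n = q_fact (k * p) * g" using q_fact_dvd[OF n] by (elim dvdE)
 have "hA (q_fact (k * p)) \<otimes> (hA g \<otimes> a) : zp.cpw k" by (rule zp.cpw_mult_r[OF q_fact_cpw_p]) (use a in simp)
 then show ?thesis unfolding g zp.h_mult using a by (simp add: Ac.m_assoc)
qed

section \<open>Adic filtrations of the divided polynomials and of their truncations\<close>

abbreviation qq where "qq \<equiv> qdp_adic p R A x"

lemma qq_eq: "qq = pq_ideal p QD (cst (hA qv))"
 by (simp add: qdp_adic_def q_in_A smult_one_QD)

lemma qq_ideal: "ideal qq QD"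
 unfolding qq_eq by (rule Qc.pq_ideal_ideal) (simp add: QD_simps)

definition LL where "LL k = {F : up A. \<forall>j. F j : zp.cpw k}"

lemma LL_ideal: "ideal (LL k) QD"
proof -
 have "LL k = {F : up A. F : zp.dp.coeff_ideal (\<lambda>_. zp.cpw k)}"
  using up_DT by (auto simp: LL_def zp.dp.coeff_ideal_def)
 then show ?thesis using inter_DT_ideal[OF zp.dp.coeff_ideal_ideal[of "\<lambda>_. zp.cpw k", OF zp.cpw_ideal]] by simp
qed

lemma LL_mult: "F : LL i ==> G : LL j ==> F *[DT] G : LL (i + j)"
proof -
 assume F: "F : LL i" and G: "G : LL j"
 have u: "F : up A" "G : up A" using F G by (auto simp: LL_def)
 have "(F *[DT] G) l : zp.cpw (i + j)" for l
  unfolding zp.dp.T_simps(5)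
  by (intro Ac.ideal_finsum_closed[OF zp.cpw_ideal] zp.cpw_mult_r zp.cpw_mult) (use F G in \<open>auto simp: LL_def\<close>)
 then show ?thesis using up_mult[OF u] by (simp add: LL_def)
qed

lemma cst_LL_1: "a : zp.\<cc> ==> cst a : LL 1"
 using ideal.Icarr[OF zp.cc_ideal] Ac.ideal_pow_1[OF zp.cc_ideal] Ac.ideal_zero_closed[OF zp.cpw_ideal, of 1]
 by (auto simp: LL_def zp.dp.cst_def[of a] intro: cst_up[unfolded zp.dp.cst_def])

lemma qq_gens:
 "add_pow QD p \<one>[QD] : LL 1" "cst (hA qv) -[QD] \<one>[QD] : LL 1"
proof -
 have "cst (add_pow A p \<one>) = add_pow QD p \<one>[QD]"
  using ring_hom_nat_mult[OF Ac.ring_axioms Qc.ring_axioms cst_hom_QD Ac.one_closed] ring_hom_one[OF cst_hom_QD] by simp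
 then show "add_pow QD p \<one>[QD] : LL 1" using cst_LL_1[OF Ac.pq_ideal_p[of "hA qv" p]] by simp
 have "cst (hA qv \<ominus> \<one>) = cst (hA qv) -[QD] \<one>[QD]"
  using ring_hom_minus[OF Ac.ring_axioms Qc.ring_axioms cst_hom_QD, of "hA qv" \<one>] ring_hom_one[OF cst_hom_QD] by simp
 then show "cst (hA qv) -[QD] \<one>[QD] : LL 1" using cst_LL_1[OF Ac.pq_ideal_q[of "hA qv" p]] by simp
qed

lemma qq_pow_LL: "ideal_power QD qq k <= LL k"
proof (rule Qc.ideal_pow_least[where K = LL])
 show "LL 0 = car QD" by (auto simp: LL_def QD_simps)
 have "qq <= LL 1" unfolding qq_eq by (rule Qc.pq_ideal_least[OF LL_ideal qq_gens])
 then show "F *[QD] G : LL (Suc k)" if "F : LL k" "G : qq" for k F G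
  using LL_mult[of F k G 1] that by (auto simp: QD_mult LL_def)
qed (rule LL_ideal)

lemma LL_qq_pow: "LL k <= ideal_power QD qq k"
proof
 fix F assume F: "F : LL k"
 show "F : ideal_power QD qq k"
 proof (rule coeff_induct[OF Qc.ideal_pow_ideal[OF qq_ideal]])
  show "F : up A" using F by (simp add: LL_def)
  fix j
  have 1: "cst ` zp.\<cc> <= qq"
   unfolding qq_eq by (rule ring_hom_pq_ideal[OF A_cring QD_cring cst_hom_QD]) auto
  have "cst ` zp.cpw k <= ideal_power QD qq k"
   by (rule ring_hom_ideal_pow[OF Ac.ring_axioms Qc.ring_axioms cst_hom_QD zp.cc_ideal qq_ideal 1])
  then have "cst (F j) : ideal_power QD qq k" using F by (auto simp: LL_def)
  then show "cst (F j) *[QD] basis j : ideal_power QD qq k"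
   by (rule ideal.I_r_closed[OF Qc.ideal_pow_ideal[OF qq_ideal]]) (simp add: QD_simps)
 qed
qed

lemma qq_pow_eq: "ideal_power QD qq k = LL k"
 using qq_pow_LL LL_qq_pow by blast

definition TT where "TT n f = (\<lambda>k. if k <= n then (\<delta> ^^ k) f else \<zero>)"

lemma TT_up: "f : car A ==> TT n f : up A"
 unfolding TT_def by (rule up_trunc) (simp add: \<delta>_pow_\<tau> zp.nw.T_closed[OF \<tau>_closed])

text \<open>Coefficients at j > kp are multiples of (j)_q! and vanish modulo (p,q-1)^k; up to kp
  they are \<delta>^j(f). So the class modulo the k-th power is that of the truncation at
  kp.\<close>

lemma LL_cong:
 assumes f: "f : car A" and F: "F : up A" and k: "k * p <= n"
  and le: "!!j. j <= n ==> F j = (\<delta> ^^ j) f" and gt: "!!j. n < j ==> \<exists>a\<in>car A. F j = hA (q_fact j) \<otimes> a"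
 shows "to_completion QD qq F k = ideal_power QD qq k +>[QD] TT (k * p) f"
proof -
 have "F -[QD] TT (k * p) f : LL k"
  unfolding LL_def
 proof (intro CollectI conjI allI)
  show "F -[QD] TT (k * p) f : up A" by (rule QD_minus_closed[OF F TT_up[OF f]])
  fix j
  have Fj: "F j : car A" using F by simp
  have "F j \<ominus> TT (k * p) f j : zp.cpw k"
  proof (cases "j <= k * p")
   case True
   then have "F j = TT (k * p) f j" using le[of j] k by (simp add: TT_def)
   then have "F j \<ominus> TT (k * p) f j = \<zero>" using Fj by (simp add: Ac.minus_eq Ac.r_neg)
   then show ?thesis using Ac.ideal_zero_closed[OF zp.cpw_ideal] by simp
  next
   case False
   have "\<exists>a\<in>car A. F j = hA (q_fact j) \<otimes> a"
   proof (cases "j <= n")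
    case True
    then show ?thesis using le[OF True] \<delta>_pow_\<tau>[OF f, of j] zp.nw.T_closed[OF \<tau>_closed[OF f], of j]
     by (intro bexI[of _ "\<tau> f j"]) auto
   qed (use gt in simp)
   then obtain a where a: "a : car A" "F j = hA (q_fact j) \<otimes> a" by blast
   have "F j : zp.cpw k" unfolding a(2) by (rule q_fact_cpw[OF _ a(1)]) (use False in simp)
   then show ?thesis using False Fj by (simp add: TT_def Ac.minus_eq)
  qed
  then show "(F -[QD] TT (k * p) f) j : zp.cpw k" unfolding QD_minus_at[OF F TT_up[OF f]] .
 qed
 then have "F -[QD] TT (k * p) f : ideal_power QD qq k" unfolding qq_pow_eq .
 then show ?thesis unfolding to_completion_def
  using Qc.rcos_eq_iff[OF Qc.ideal_pow_ideal[OF qq_ideal], of F "TT (k * p) f" k] F TT_up[OF f] by (simp add: QD_simps(1))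
qed

text \<open>The truncations have constant image modulo the k-th power from n = kp on, which provides
  the witness N.\<close>

lemma series_to_qdp_eq:
 assumes f: "f : car A"
 shows "series_to_qdp p R A x (taylor_series p R A x \<sigma> f) k = ideal_power QD qq k +>[QD] TT (k * p) f"
proof -
 let ?W = "ideal_power QD qq k +>[QD] TT (k * p) f"
 have ev: "to_completion QD qq (poly_to_qdp R A x g) k = ?W"
  if n: "k * p <= n" and g: "g : taylor_series p R A x \<sigma> f n" for n g
 proof -
  have gc: "g : car UA" "g -[UA] Phi n f : xI n"
   using g UAc.in_rcos_iff[OF xI_ideal Phi_closed[OF f]] unfolding taylor_series_eq[OF f] by auto
  have "Ps (g -[UA] Phi n f) : zp.nw.Tr (Suc n)"
   using xI_iff[OF UAc.minus_closed[OF gc(1) Phi_closed[OF f]]] gc(2) by blast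
  then have z: "Ps g j \<ominus> Ps (Phi n f) j = \<zero>" if "j <= n" for j
   unfolding ring_hom_minus[OF UAc.ring_axioms zp.nw.T.ring_axioms Ps_hom gc(1) Phi_closed[OF f]]
    zp.nw.T_minus[OF Ps_closed[OF gc(1)] Ps_closed[OF Phi_closed[OF f]]] zp.nw.Tr_iff
   using that by (simp add: less_Suc_eq_le)
  have c: "Ps g j : car A" "Ps (Phi n f) j : car A" for j
   using zp.nw.T_closed[OF Ps_closed[OF gc(1)]] zp.nw.T_closed[OF Ps_closed[OF Phi_closed[OF f]]] by auto
  have Pj: "Ps g j = \<tau> f j" if "j <= n" for j
   using z[OF that] Ac.r_right_minus_eq[OF c, of j j] Ps_Phi[OF f, of n] that by simp
  have up: "zp.sc (Ps g) : up A"
  proof -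
   obtain N F where F: "F : car NT" "!!k. k > N ==> F k = \<zero>" "g = newt N F" using newt_ex[OF gc(1)] by blast
   show ?thesis
    by (rule upI[of _ N]) (use c F(3) Ps_newt[OF F(1)] in \<open>auto simp: zp.sc_def\<close>)
  qed
  show ?thesis unfolding poly_to_qdp_eq[OF gc(1)]
  proof (rule LL_cong[OF f up n])
   show "zp.sc (Ps g) j = (\<delta> ^^ j) f" if "j <= n" for j
    using Pj[OF that] \<delta>_pow_\<tau>[OF f, of j] by (simp add: zp.sc_def)
   show "\<exists>a\<in>car A. zp.sc (Ps g) j = hA (q_fact j) \<otimes> a" for j using c by (auto simp: zp.sc_def)
  qed
 qed
 \<comment> \<open>Every coset in the series is inhabited, so the condition under \<open>THE\<close>
   cannot hold vacuously and its value is unique.\<close>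
 have ne: "Phi n f : taylor_series p R A x \<sigma> f n" for n
  unfolding taylor_series_eq[OF f] UAc.in_rcos_iff[OF xI_ideal Phi_closed[OF f]]
  using Phi_closed[OF f] UAc.ideal_zero_closed[OF xI_ideal] by (simp add: UAc.minus_eq UAc.r_neg)
 show ?thesis unfolding series_to_qdp_def
 proof (rule the_equality)
  show "\<exists>N. \<forall>n\<ge>N. \<forall>g\<in>taylor_series p R A x \<sigma> f n. to_completion QD qq (poly_to_qdp R A x g) k = ?W"
   using ev by blast
  fix W assume "\<exists>N. \<forall>n\<ge>N. \<forall>g\<in>taylor_series p R A x \<sigma> f n. to_completion QD qq (poly_to_qdp R A x g) k = W"
  then obtain N where "!!n g. n \<ge> N ==> g : taylor_series p R A x \<sigma> f n ==> to_completion QD qq (poly_to_qdp R A x g) k = W" by blast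
  from this[of "max N (k * p)", OF _ ne] ev[of "max N (k * p)", OF _ ne] show "W = ?W" by simp
 qed
qed

abbreviation qQ where "qQ n \<equiv> pq_ideal p (Qn n) (cl n (cst (hA qv)))"

lemma qQ_pow: "F : LL k ==> cl n F : ideal_power (Qn n) (qQ n) k"
proof -
 assume F: "F : LL k"
 interpret Q: cring "Qn n" by (rule Qn_cring)
 have 1: "cl n ` qq <= qQ n"
  unfolding qq_eq by (rule ring_hom_pq_ideal[OF QD_cring Qn_cring cl_hom]) (simp_all add: QD_simps)
 have "cl n ` ideal_power QD qq k <= ideal_power (Qn n) (qQ n) k"
  by (rule ring_hom_ideal_pow[OF Qc.ring_axioms Q.ring_axioms cl_hom qq_ideal Q.pq_ideal_ideal 1]) simp
 then show ?thesis using F unfolding qq_pow_eq by blast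
qed

text \<open>The truncation is free over A on the \<xi>^[j] with j \<le> n, so its adic powers are
  visible in the coefficients.\<close>

lemma qQ_pow_co:
 assumes "u : ideal_power (Qn n) (qQ n) k" "j <= n"
 shows "co u j : zp.cpw k"
proof -
 interpret Q: cring "Qn n" by (rule Qn_cring)
 interpret h: ring_hom_ring QD "Qn n" "cl n" by (rule ring_hom_ringI2[OF Qc.ring_axioms Q.ring_axioms cl_hom])
 have surj: "cl n ` car QD = car (Qn n)"
  using Qn_E[of _ n] by (auto simp: QD_simps)
 have id: "ideal (cl n ` LL k) (Qn n)" for k by (rule h.surj_image_ideal[OF LL_ideal surj])
 have "ideal_power (Qn n) (qQ n) k <= cl n ` LL k"
 proof (rule Q.ideal_pow_least[where K = "\<lambda>k. cl n ` LL k", OF id])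
  show "cl n ` LL 0 = car (Qn n)" unfolding surj[symmetric] by (rule arg_cong[of _ _ "image (cl n)"]) (auto simp: LL_def QD_simps)
  have "qQ n <= cl n ` LL 1"
  proof (rule Q.pq_ideal_least[OF id])
   have "cl n (add_pow QD p \<one>[QD]) = add_pow (Qn n) p \<one>[Qn n]"
    using ring_hom_nat_mult[OF Qc.ring_axioms Q.ring_axioms cl_hom Qc.one_closed] ring_hom_one[OF cl_hom] by simp
   then show "add_pow (Qn n) p \<one>[Qn n] : cl n ` LL 1" using qq_gens(1) by (metis imageI)
   have "cl n (cst (hA qv) -[QD] \<one>[QD]) = cl n (cst (hA qv)) -[Qn n] \<one>[Qn n]"
    using ring_hom_minus[OF Qc.ring_axioms Q.ring_axioms cl_hom _ Qc.one_closed, of "cst (hA qv)"] ring_hom_one[OF cl_hom]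
    by (simp add: QD_simps(1))
   then show "cl n (cst (hA qv)) -[Qn n] \<one>[Qn n] : cl n ` LL 1" using qq_gens(2) by (metis imageI)
  qed
  then show "u *[Qn n] v : cl n ` LL (Suc k)" if u: "u : cl n ` LL k" and v: "v : qQ n" for k u v
  proof -
   obtain F where F: "F : LL k" "u = cl n F" using u by blast
   obtain G where G: "G : LL 1" "v = cl n G" using v \<open>qQ n <= cl n ` LL 1\<close> by blast
   have "u *[Qn n] v = cl n (F *[DT] G)" unfolding F(2) G(2) by (rule cl_mult) (use F G in \<open>simp_all add: LL_def\<close>)
   then show ?thesis using LL_mult[OF F(1) G(1)] by simp
  qed
 qed
 then obtain F where F: "F : LL k" "u = cl n F" using assms(1) by blast
 then show ?thesis using co_cl[of F j n] assms(2) by (simp add: LL_def)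
qed

text \<open>Existence: up to index n the level-k approximation differs from \<open>TT n f\<close>
  only by coefficients in (p,q-1)^k. Uniqueness: two candidates have coefficients congruent modulo
  every power, and A is separated.\<close>

theorem taylor_map_eq:
 assumes f: "f : car A"
 shows "taylor_map p R A x \<sigma> n f = cl n (TT n f)"
proof -
 interpret Q: cring "Qn n" by (rule Qn_cring)
 let ?y = "series_to_qdp p R A x (taylor_series p R A x \<sigma> f)"
 let ?I = "\<lambda>k. ideal_power (Qn n) (qQ n) k"
 have Iid: "ideal (?I k) (Qn n)" for k by (rule Q.ideal_pow_ideal[OF Q.pq_ideal_ideal]) simp
 have qin: "q_in R A \<odot>[Qn n] \<one>[Qn n] = cl n (cst (hA qv))"
  unfolding cl_one q_in_A cl_smult[OF zp.h_closed basis_up]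
  by (rule arg_cong[of _ _ "cl n"]) (auto simp: zp.dp.basis_def zp.dp.cst_def)
 have in_y: "F : ?y k \<longleftrightarrow> F : up A \<and> F -[QD] TT (k * p) f : LL k" for F k
  unfolding series_to_qdp_eq[OF f]
  using Qc.in_rcos_iff[OF Qc.ideal_pow_ideal[OF qq_ideal], of "TT (k * p) f" F k] TT_up[OF f]
  unfolding qq_pow_eq QD_simps(1) by simp
 have good: "cl n (TT n f) -[Qn n] cl n F : ?I k" if F: "F : ?y k" for F k
 proof -
  have Fu: "F : up A" and FL: "F -[QD] TT (k * p) f : LL k" using F in_y by auto
  have Fj: "F j \<ominus> TT (k * p) f j : zp.cpw k" for j
   using FL unfolding LL_def QD_minus_at[OF Fu TT_up[OF f], symmetric] by blast
  let ?G = "\<lambda>j. if j <= n then TT n f j \<ominus> F j else \<zero>"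
  have c: "TT n f j : car A" "F j : car A" "TT (k * p) f j : car A" for j
   using up_at[OF TT_up[OF f]] up_at[OF Fu] by auto
  have Gu: "?G : up A" using c by (intro up_trunc) simp
  have "?G : LL k" unfolding LL_def
  proof (intro CollectI conjI Gu allI)
   fix j
   show "?G j : zp.cpw k"
   proof (cases "j <= n")
    case True
    have "TT n f j \<ominus> TT (k * p) f j : zp.cpw k"
    proof (cases "j <= k * p")
     case True
     then have "TT n f j \<ominus> TT (k * p) f j = \<zero>" using \<open>j <= n\<close> c(1)[of j] by (simp add: TT_def Ac.minus_eq Ac.r_neg)
     then show ?thesis using Ac.ideal_zero_closed[OF zp.cpw_ideal] by simp
    next
     case False
     have "hA (q_fact j) \<otimes> \<tau> f j : zp.cpw k"
      by (rule q_fact_cpw) (use False zp.nw.T_closed[OF \<tau>_closed[OF f]] in auto)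
     moreover from this have "hA (q_fact j) \<otimes> \<tau> f j : car A" by (rule zp.cpw_carr)
     ultimately show ?thesis using False \<open>j <= n\<close> by (simp add: TT_def \<delta>_pow_\<tau>[OF f] Ac.minus_eq)
    qed
    from Ac.ideal_minus_closed[OF zp.cpw_ideal this Fj[of j]]
    have "TT n f j \<ominus> F j : zp.cpw k" unfolding Ac.sub_sub_sub[OF c(1) c(3) c(2)] .
    then show ?thesis using True by simp
   qed (use Ac.ideal_zero_closed[OF zp.cpw_ideal] in simp)
  qed
  then have "cl n ?G : ?I k" by (rule qQ_pow)
  moreover have "cl n ?G = cl n (TT n f -[QD] F)"
   unfolding cl_eq_iff[OF Gu QD_minus_closed[OF TT_up[OF f] Fu]] QD_minus_at[OF TT_up[OF f] Fu] by simp
  moreover have "cl n (TT n f -[QD] F) = cl n (TT n f) -[Qn n] cl n F"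
   by (rule ring_hom_minus[OF Qc.ring_axioms Q.ring_axioms cl_hom]) (use TT_up[OF f] Fu in \<open>simp_all add: QD_simps\<close>)
  ultimately show ?thesis by simp
 qed
 have ne: "TT (k * p) f : ?y k" for k
  unfolding in_y using TT_up[OF f] Qc.ideal_zero_closed[OF LL_ideal, of k]
  by (simp add: Qc.minus_eq Qc.r_neg QD_simps(1))
 have cT: "cl n (TT n f) : car (Qn n)" by (rule cl_closed[OF TT_up[OF f]])
 show ?thesis unfolding taylor_map_def completed_qdp_proj_def Let_def qin
 proof (rule the_equality)
  show "cl n (TT n f) : car (Qn n) \<and> (\<forall>k. \<forall>F\<in>?y k. cl n (TT n f) -[Qn n] cl n F : ?I k)"
   using good cT by blast
  fix u assume u: "u : car (Qn n) \<and> (\<forall>k. \<forall>F\<in>?y k. u -[Qn n] cl n F : ?I k)"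
  then have uc: "u : car (Qn n)" by blast
  obtain U where U: "U : up A" "u = cl n U" using Qn_E[OF uc] .
  have d: "u -[Qn n] cl n (TT n f) = cl n (U -[QD] TT n f)"
   unfolding U(2) by (rule ring_hom_minus[OF Qc.ring_axioms Q.ring_axioms cl_hom, symmetric])
    (use TT_up[OF f] U in \<open>simp_all add: QD_simps\<close>)
  have dk: "u -[Qn n] cl n (TT n f) : ?I k" for k
  proof -
   have 1: "u -[Qn n] cl n (TT (k * p) f) : ?I k" using u ne by blast
   have 2: "cl n (TT n f) -[Qn n] cl n (TT (k * p) f) : ?I k" by (rule good[OF ne])
   show ?thesis using Q.ideal_minus_closed[OF Iid 1 2]
    unfolding Q.sub_sub_sub[OF uc cl_closed[OF TT_up[OF f]] cT] .
  qed
  have "U j = TT n f j" if j: "j <= n" for j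
  proof -
   have c: "U j : car A" "TT n f j : car A" using up_at[OF U(1)] up_at[OF TT_up[OF f]] by auto
   have "U j \<ominus> TT n f j = \<zero>"
   proof (rule ep.separated)
    show "U j \<ominus> TT n f j : zp.cpw k" for k
     using qQ_pow_co[OF dk[of k] j] unfolding d co_cl[OF QD_minus_closed[OF U(1) TT_up[OF f]] j]
      QD_minus_at[OF U(1) TT_up[OF f]] .
   qed (use c in simp)
   then show ?thesis using Ac.r_right_minus_eq[OF c] by simp
  qed
  then show "u = cl n (TT n f)" unfolding U(2) cl_eq_iff[OF U(1) TT_up[OF f]] by blast
 qed
qed

end

section \<open>Tensor products with a free module\<close>

text \<open>\<open>b\<close> stands for the \<xi>^[k] and \<open>c\<close> for the coefficient
  functions. The family \<open>b\<close> is indexed by all naturals; beyond n its coordinates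
  vanish, which suits the sums in \<Delta> whose indices exceed the truncation orders.\<close>

locale free_tensor = tensor_pair A M N + Mm: module A M
 for A :: "('a, 'c) ring_scheme" (structure) and M :: "('a, 'm, 'd) module_scheme"
  and N :: "('a, 'n, 'e) module_scheme" +
 fixes b :: "nat => 'n" and c :: "'n => nat => 'a" and n :: nat
 assumes b_closed [simp]: "b k : car N"
  and c_closed: "v : car N ==> k <= n ==> c v k : car A"
  and c_add: "v : car N ==> w : car N ==> k <= n ==> c (v +[N] w) k = c v k \<oplus> c w k"
  and c_smult: "a : car A ==> v : car N ==> k <= n ==> c (a \<odot>[N] v) k = a \<otimes> c v k"
  and c_b: "k <= n ==> c (b j) k = (if j = k then \<one> else \<zero>)"
  and expand: "v : car N ==> v = (\<Oplus>[N]k\<in>{..n}. c v k \<odot>[N] b k)"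
begin

definition crd :: "nat => ('m \<times> 'n \<Rightarrow>\<^sub>0 int) set => 'm" where
 "crd k = tensor_lift M (\<lambda>s v. c v k \<odot>[M] s)"

lemma crd_bal: "k <= n ==> balanced A M N M (\<lambda>s v. c v k \<odot>[M] s)"
 by (rule balancedI)
  (simp_all add: c_closed c_add c_smult Mm.smult_l_distr Mm.smult_r_distr Mm.smult_assoc1[symmetric] Mm.R.m_comm)

lemma crd_tens: "k <= n ==> s : car M ==> v : car N ==> crd k (tens A M N s v) = c v k \<odot>[M] s"
 unfolding crd_def by (rule tensor_lift_tens[OF M_grp crd_bal])

lemma crd_closed: "k <= n ==> Z : car MN ==> crd k Z : car M"
 unfolding crd_def by (rule tensor_lift_closed[OF M_grp crd_bal])

lemma crd_add: "k <= n ==> Y : car MN ==> Z : car MN ==> crd k (Y +[MN] Z) = crd k Y +[M] crd k Z"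
 unfolding crd_def by (rule tensor_lift_add[OF M_grp crd_bal])

lemma crd_b: "k <= n ==> s : car M ==> crd k (tens A M N s (b j)) = (if j = k then s else \<zero>[M])"
 by (simp add: crd_tens c_b Mm.smult_l_null)

lemma crd_finsum:
 assumes "k <= n" "!!i. i : I ==> f i : car MN"
 shows "crd k (\<Oplus>[MN]i\<in>I. f i) = (\<Oplus>[M]i\<in>I. crd k (f i))"
 by (rule additive_finsum[OF MN_abelian_group M_grp, where L = "crd k"]) (use assms crd_closed crd_add in auto)

definition vec :: "(nat => 'm) => ('m \<times> 'n \<Rightarrow>\<^sub>0 int) set" where
 "vec m = (\<Oplus>[MN]k\<in>{..n}. tens A M N (m k) (b k))"

lemma vec_closed: "(!!k. k <= n ==> m k : car M) ==> vec m : car MN"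
 unfolding vec_def by (rule MN.finsum_closed) (auto simp: tens_closed)

lemma crd_vec: "(!!k. k <= n ==> m k : car M) ==> k <= n ==> crd k (vec m) = m k"
proof -
 assume m: "!!k. k <= n ==> m k : car M" and k: "k <= n"
 have "crd k (vec m) = (\<Oplus>[M]j\<in>{..n}. crd k (tens A M N (m j) (b j)))"
  unfolding vec_def by (rule crd_finsum[OF k]) (use m in \<open>simp add: tens_closed\<close>)
 also have "... = (\<Oplus>[M]j\<in>{..n}. if j = k then m j else \<zero>[M])"
  by (rule M.finsum_cong2') (use m k in \<open>auto simp: crd_b\<close>)
 also have "... = (if k = k then m k else \<zero>[M])"
  by (rule M.finsum_single) (use m k in auto)
 finally show ?thesis by simp
qed

lemma vec_crd: "Z : car MN ==> vec (\<lambda>k. crd k Z) = Z"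
proof (induction Z rule: tensor_induct)
 case (tens s t)
 have "vec (\<lambda>k. crd k (tens A M N s t)) = (\<Oplus>[MN]k\<in>{..n}. tens A M N s (c t k \<odot>[N] b k))"
  unfolding vec_def using tens
  by (intro MN.finsum_cong2') (auto simp: crd_tens tens_smult c_closed tens_closed N_smult)
 also have "... = tens A M N s (\<Oplus>[N]k\<in>{..n}. c t k \<odot>[N] b k)"
  by (rule additive_finsum[OF N_grp MN_abelian_group, where L = "tens A M N s", symmetric])
   (use tens in \<open>auto simp: tens_closed tens_add_r c_closed N_smult\<close>)
 finally show ?case using expand[OF tens(2)] by simp
next
 case (add Y Z)
 have "vec (\<lambda>k. crd k (Y +[MN] Z)) = (\<Oplus>[MN]k\<in>{..n}. tens A M N (crd k Y) (b k) +[MN] tens A M N (crd k Z) (b k))"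
  unfolding vec_def
  by (intro MN.finsum_cong2') (use add(1,2) in \<open>auto simp: crd_add crd_closed tens_add_l tens_closed\<close>)
 also have "... = vec (\<lambda>k. crd k Y) +[MN] vec (\<lambda>k. crd k Z)"
  unfolding vec_def by (rule MN.finsum_addf) (use add(1,2) in \<open>auto simp: crd_closed tens_closed\<close>)
 finally show ?case using add(3,4) by simp
qed

lemma crd_eqI: "Y : car MN ==> Z : car MN ==> (!!k. k <= n ==> crd k Y = crd k Z) ==> Y = Z"
proof -
 assume Y: "Y : car MN" and Z: "Z : car MN" and eq: "!!k. k <= n ==> crd k Y = crd k Z"
 have "vec (\<lambda>k. crd k Y) = vec (\<lambda>k. crd k Z)"
  unfolding vec_def by (rule MN.finsum_cong2') (use eq Z in \<open>auto simp: crd_closed tens_closed\<close>)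
 then show ?thesis using vec_crd[OF Y] vec_crd[OF Z] by simp
qed

end

section \<open>Modules over the twisted divided polynomials\<close>

context q_setting
begin

abbreviation xi where "xi n k \<equiv> cl n (basis k)"

lemma co_add: "u : car (Qn n) ==> v : car (Qn n) ==> k <= n ==> co (u +[Qn n] v) k = co u k \<oplus> co v k"
proof -
 assume u: "u : car (Qn n)" and v: "v : car (Qn n)" and k: "k <= n"
 obtain F G where F: "F : up A" "u = cl n F" and G: "G : up A" "v = cl n G" using Qn_E[OF u] Qn_E[OF v] by metis
 have "(\<lambda>k. F k \<oplus> G k) : up A" using up_add[OF F(1) G(1)] by (simp add: zp.dp.T_simps)
 then show ?thesis unfolding F(2) G(2) cl_add[OF F(1) G(1)] using F(1) G(1) k by (simp add: co_cl)
qed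

lemma up_smult: "a : car A ==> F : up A ==> (\<lambda>k. a \<otimes> F k) : up A"
 unfolding up_iff by (metis Ac.m_closed Ac.r_null)

lemma co_smult: "a : car A ==> u : car (Qn n) ==> k <= n ==> co (a \<odot>[Qn n] u) k = a \<otimes> co u k"
proof -
 assume a: "a : car A" and u: "u : car (Qn n)" and k: "k <= n"
 obtain F where F: "F : up A" "u = cl n F" using Qn_E[OF u] .
 then show ?thesis unfolding F(2) cl_smult[OF a F(1)] using up_smult[OF a F(1)] k by (simp add: co_cl)
qed

lemma co_xi: "k <= n ==> co (xi n j) k = (if j = k then \<one> else \<zero>)"
proof -
 assume "k <= n"
 then have "co (xi n j) k = basis j k" by (rule co_cl[OF basis_up])
 also have "... = (if j = k then \<one> else \<zero>)" by (auto simp: zp.dp.basis_def)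
 finally show ?thesis .
qed

lemma co_eqI: "u : car (Qn n) ==> v : car (Qn n) ==> (!!k. k <= n ==> co u k = co v k) ==> u = v"
proof -
 assume u: "u : car (Qn n)" and v: "v : car (Qn n)" and eq: "!!k. k <= n ==> co u k = co v k"
 obtain F G where F: "F : up A" "u = cl n F" and G: "G : up A" "v = cl n G" using Qn_E[OF u] Qn_E[OF v] by metis
 have "F k = G k" if "k <= n" for k using eq[OF that] that F G by (simp add: co_cl)
 then show ?thesis unfolding F(2) G(2) cl_eq_iff[OF F(1) G(1)] by blast
qed

lemma xi_expand: "u : car (Qn n) ==> u = (\<Oplus>[Qn n]k\<in>{..n}. co u k \<odot>[Qn n] xi n k)"
proof (rule co_eqI)
 assume u: "u : car (Qn n)"
 interpret Q: cring "Qn n" by (rule Qn_cring)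
 have c: "co u k \<odot>[Qn n] xi n k : car (Qn n)" if "k <= n" for k
  using co_closed[OF u that] by (simp add: Qn_smult_closed)
 show "(\<Oplus>[Qn n]k\<in>{..n}. co u k \<odot>[Qn n] xi n k) : car (Qn n)"
  by (rule Q.finsum_closed) (use c in auto)
 fix j assume j: "j <= n"
 have "co (\<Oplus>[Qn n]k\<in>{..n}. co u k \<odot>[Qn n] xi n k) j = (\<Oplus>k\<in>{..n}. co (co u k \<odot>[Qn n] xi n k) j)"
  by (rule additive_finsum[OF Qn_grp Ac.abelian_group_axioms, where L = "\<lambda>u. co u j"])
   (use c j co_closed co_add in auto)
 also have "... = (\<Oplus>k\<in>{..n}. if k = j then co u k else \<zero>)"
  by (rule Ac.finsum_cong2') (use j co_closed[OF u] in \<open>auto simp: co_smult co_xi\<close>)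
 also have "... = (if j = j then co u j else \<zero>)"
  by (rule Ac.finsum_single) (use j co_closed[OF u] in auto)
 finally show "co u j = co (\<Oplus>[Qn n]k\<in>{..n}. co u k \<odot>[Qn n] xi n k) j" by simp
qed

lemma free_tensor_Qn:
 assumes "module A L"
 shows "free_tensor A L (Qn n) (xi n) co n"
proof -
 interpret L: module A L by fact
 show ?thesis
 proof (intro free_tensor.intro tensor_pair.intro free_tensor_axioms.intro assms)
  show "abelian_group L" by (rule L.abelian_group_axioms)
  show "abelian_group (Qn n)" by (rule Qn_grp)
  show "v = (\<Oplus>[Qn n]k\<in>{..n}. co v k \<odot>[Qn n] xi n k)" if "v : car (Qn n)" for v
   by (rule xi_expand[OF that])
 qed (simp_all add: Qn_smult_closed co_closed co_add co_smult co_xi)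
qed

text \<open>Truncation is harmless since product coefficients at k \<le> n involve only indices up
  to k. The homomorphism property is what makes scalar action through \<theta>_n a module
  structure.\<close>

lemma TT_hom: "(\<lambda>f. cl n (TT n f)) : ring_hom A (Qn n)"
proof -
 have tr: "cl n (\<lambda>k. if k <= n then F k else \<zero>) = cl n (\<lambda>k. if k <= n then G k else \<zero>)"
  if "!!k. k <= n ==> F k = G k" for F G
  using that by (intro arg_cong[of _ _ "cl n"]) auto
 have h: "f : car A ==> (\<lambda>k. (\<delta> ^^ k) f) : car DT" for f
  using ring_hom_closed[OF qd.taylor_hom] by blast
 show ?thesis
 proof (rule ring_hom_memI)
  fix f g assume f: "f : car A" and g: "g : car A"
  show "cl n (TT n f) : car (Qn n)" using TT_up[OF f] by simp
  note u = TT_up[OF f, of n] TT_up[OF g, of n]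
  have m: "(TT n f *[DT] TT n g) k = (\<delta> ^^ k) (f \<otimes> g)" if k: "k <= n" for k
  proof -
   have "(TT n f *[DT] TT n g) k = ((\<lambda>k. (\<delta> ^^ k) f) *[DT] (\<lambda>k. (\<delta> ^^ k) g)) k"
    unfolding zp.dp.T_simps(5)
    by (intro Ac.finsum_cong2' Ac.finsum_closed)
     (use k zp.dp.T_closed[OF h[OF f]] zp.dp.T_closed[OF h[OF g]] in \<open>auto simp: TT_def\<close>)
   also have "... = (\<delta> ^^ k) (f \<otimes> g)" using ring_hom_mult[OF qd.taylor_hom f g] by metis
   finally show ?thesis .
  qed
  show "cl n (TT n (f \<otimes> g)) = cl n (TT n f) *[Qn n] cl n (TT n g)"
   unfolding cl_mult[OF u] cl_eq_iff[OF TT_up[OF Ac.m_closed[OF f g]] up_mult[OF u]]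
   by (simp add: m) (simp add: TT_def)
  have a: "(\<delta> ^^ k) (f \<oplus> g) = (\<delta> ^^ k) f \<oplus> (\<delta> ^^ k) g" for k
   using ring_hom_add[OF qd.taylor_hom f g] unfolding zp.dp.T_simps(4) by metis
  have ua: "(\<lambda>k. TT n f k \<oplus> TT n g k) : up A" using up_add[OF u] by (simp add: zp.dp.T_simps)
  show "cl n (TT n (f \<oplus> g)) = cl n (TT n f) +[Qn n] cl n (TT n g)"
   unfolding cl_add[OF u] cl_eq_iff[OF TT_up[OF Ac.a_closed[OF f g]] ua] by (simp add: TT_def a)
 next
  have "(\<delta> ^^ k) \<one> = (if k = 0 then \<one> else \<zero>)" for k
   using ring_hom_one[OF qd.taylor_hom] unfolding zp.dp.T_simps(2) by metis
  then show "cl n (TT n \<one>) = \<one>[Qn n]"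
   unfolding cl_one cl_eq_iff[OF TT_up[OF Ac.one_closed] basis_up] by (auto simp: TT_def zp.dp.basis_def)
 qed
qed

end

locale q_module = q_setting p R A x \<sigma> \<delta> + Mo: module A M
 for p :: nat and R :: "(int poly fract, 'r) module" and A :: "('r, 'a) module" (structure)
  and x \<sigma> \<delta> and M :: "('a, 'm) module"
begin

abbreviation TQ where "TQ n \<equiv> ten_Q R A x M n"
abbreviation ts where "ts n \<equiv> tens A M (Qn n)"
abbreviation TQ' where "TQ' n \<equiv> ten_Q' p R A x \<sigma> M n"

lemma M_module: "module A M" by (rule Mo.module_axioms)
lemma M_grp: "abelian_group M" by (rule Mo.abelian_group_axioms)

lemma TQ_eq: "TQ n = tensor A M (Qn n)" by (rule ten_Q_def)

lemma fM: "free_tensor A M (Qn n) (xi n) co n"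
 by (rule free_tensor_Qn[OF M_module])

lemma tM: "tensor_pair A M (Qn n)"
 using fM by (simp add: free_tensor_def)

lemmas TQ_grp = tensor_pair.MN_abelian_group[OF tM, folded TQ_eq]
 and ts_closed = tensor_pair.tens_closed[OF tM, folded TQ_eq]
 and ts_add_l = tensor_pair.tens_add_l[OF tM, folded TQ_eq]
 and ts_add_r = tensor_pair.tens_add_r[OF tM, folded TQ_eq]
 and ts_smult = tensor_pair.tens_smult[OF tM]
 and TQ_induct = tensor_pair.tensor_induct[OF tM, folded TQ_eq, consumes 1, case_names tens add]

abbreviation cr where "cr \<equiv> free_tensor.crd M co"
abbreviation acQ where "acQ n \<equiv> ten_Q_act R A x M n"
abbreviation asl where "asl n m \<equiv> assoc_left p R A x \<sigma> M n m"
abbreviation IdD where "IdD n m \<equiv> Id_ten_Delta p R A x \<sigma> M n m"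
abbreviation thI where "thI n m \<equiv> theta_ten_Id p R A x \<sigma> M n m"
abbreviation Del where "Del n m \<equiv> Delta p R A x \<sigma> n m"
abbreviation qTS where "qTS \<equiv> q_taylor_structures p R A x \<sigma> M"
abbreviation DMS where "DMS \<equiv> D_module_structures A \<sigma> \<delta> M"
abbreviation vc where "vc n \<equiv> free_tensor.vec A M (Qn n) (xi n) n"

lemma smult_mult_Qn:
 assumes a: "a : car A" and u: "u : car (Qn n)" and v: "v : car (Qn n)"
 shows "u *[Qn n] (a \<odot>[Qn n] v) = a \<odot>[Qn n] (u *[Qn n] v)"
proof -
 interpret Q: cring "Qn n" by (rule Qn_cring)
 have e: "a \<odot>[Qn n] v = cl n (cst a) *[Qn n] v" if v: "v : car (Qn n)" for v
 proof -
  obtain F where F: "F : up A" "v = cl n F" using Qn_E[OF v] .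
  show ?thesis unfolding F(2) cl_smult[OF a F(1)] cl_mult[OF cst_up[OF a] F(1)]
   using zp.dp.cst_mult[OF a up_DT[OF F(1)]] by simp
 qed
 show ?thesis unfolding e[OF v] e[OF Q.m_closed[OF u v]] using u v a by (simp add: Q.m_lcomm)
qed

lemma act_bal: "u : car (Qn n) ==> balanced A M (Qn n) (TQ n) (\<lambda>s v. ts n s (u *[Qn n] v))"
proof -
 assume u: "u : car (Qn n)"
 interpret Q: cring "Qn n" by (rule Qn_cring)
 show ?thesis
  by (rule balancedI) (use u in \<open>simp_all add: ts_closed ts_add_l ts_add_r Q.r_distr ts_smult smult_mult_Qn\<close>)
qed

lemma act_ts: "u : car (Qn n) ==> s : car M ==> v : car (Qn n) ==>
  acQ n u (ts n s v) = ts n s (u *[Qn n] v)"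
 unfolding ten_Q_act_def by (rule tensor_pair.tensor_lift_tens[OF tM TQ_grp act_bal])

lemma act_closed: "u : car (Qn n) ==> Z : car (TQ n) ==> acQ n u Z : car (TQ n)"
 unfolding ten_Q_act_def by (rule tensor_pair.tensor_lift_closed[OF tM TQ_grp act_bal]) (simp_all add: TQ_eq)

lemma act_add: "u : car (Qn n) ==> Y : car (TQ n) ==> Z : car (TQ n) ==>
  acQ n u (Y +[TQ n] Z) = acQ n u Y +[TQ n] acQ n u Z"
 using tensor_pair.tensor_lift_add[OF tM TQ_grp act_bal] unfolding ten_Q_act_def TQ_eq by blast

lemma act_add_l:
 assumes u: "u : car (Qn n)" and v: "v : car (Qn n)" and Z: "Z : car (TQ n)"
 shows "acQ n (u +[Qn n] v) Z = acQ n u Z +[TQ n] acQ n v Z"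
proof -
 interpret Q: cring "Qn n" by (rule Qn_cring)
 interpret T: abelian_group "TQ n" by (rule TQ_grp)
 show ?thesis using Z
 proof (induction Z rule: TQ_induct)
  case (tens s t)
  then show ?case using u v by (simp add: act_ts Q.l_distr ts_add_r)
 next
  case (add Y Z)
  then show ?case using u v by (simp add: act_add act_closed T.a_ac)
 qed
qed

lemma act_mult:
 assumes u: "u : car (Qn n)" and v: "v : car (Qn n)" and Z: "Z : car (TQ n)"
 shows "acQ n (u *[Qn n] v) Z = acQ n u (acQ n v Z)"
proof -
 interpret Q: cring "Qn n" by (rule Qn_cring)
 show ?thesis using Z
 proof (induction Z rule: TQ_induct)
  case (tens s t)
  then show ?case using u v by (simp add: act_ts Q.m_assoc)
 next
  case (add Y Z)
  then show ?case using u v by (simp add: act_add act_closed)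
 qed
qed

lemma act_one: "Z : car (TQ n) ==> acQ n \<one>[Qn n] Z = Z"
proof -
 interpret Q: cring "Qn n" by (rule Qn_cring)
 assume "Z : car (TQ n)"
 then show ?thesis
 proof (induction Z rule: TQ_induct)
  case (tens s t)
  then show ?case by (simp add: act_ts)
 next
  case (add Y Z)
  then show ?case by (simp add: act_add)
 qed
qed

lemma TQ'_simps: "car (TQ' n) = car (TQ n)" "add (TQ' n) = add (TQ n)" "\<zero>[TQ' n] = \<zero>[TQ n]"
 by (simp_all add: ten_Q'_def)

lemma TQ'_smult: "f : car A ==> f \<odot>[TQ' n] Z = acQ n (cl n (TT n f)) Z"
 by (simp add: ten_Q'_def taylor_map_eq)

lemma TQ'_grp: "abelian_group (TQ' n)"
proof -
 interpret T: abelian_group "TQ n" by (rule TQ_grp)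
 show ?thesis
 proof (rule abelian_groupI)
  show "\<exists>Y\<in>car (TQ' n). Y +[TQ' n] Z = \<zero>[TQ' n]" if "Z : car (TQ' n)" for Z
   using that T.l_neg[of Z] T.a_inv_closed[of Z] unfolding TQ'_simps by blast
 qed (simp_all add: TQ'_simps T.a_ac)
qed

lemma TT_closed: "f : car A ==> cl n (TT n f) : car (Qn n)"
 by (rule cl_closed[OF TT_up])

text \<open>Lets the triple product be treated as a tensor product of this twisted module with a
  free module, with coordinates of its own.\<close>

lemma TQ'_module: "module A (TQ' n)"
proof (rule moduleI[OF A_cring TQ'_grp])
 note h = TT_hom[of n]
 show "a \<odot>[TQ' n] Z : car (TQ' n)" if "a : car A" "Z : car (TQ' n)" for a Z
  using that by (simp add: TQ'_simps TQ'_smult act_closed TT_closed)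
 show "(a \<oplus> b) \<odot>[TQ' n] Z = a \<odot>[TQ' n] Z +[TQ' n] b \<odot>[TQ' n] Z"
  if "a : car A" "b : car A" "Z : car (TQ' n)" for a b Z
  using that ring_hom_add[OF h that(1,2)] by (simp add: TQ'_simps TQ'_smult act_add_l TT_closed)
 show "a \<odot>[TQ' n] (Y +[TQ' n] Z) = a \<odot>[TQ' n] Y +[TQ' n] a \<odot>[TQ' n] Z"
  if "a : car A" "Y : car (TQ' n)" "Z : car (TQ' n)" for a Y Z
  using that by (simp add: TQ'_simps TQ'_smult act_add TT_closed)
 show "(a \<otimes> b) \<odot>[TQ' n] Z = a \<odot>[TQ' n] (b \<odot>[TQ' n] Z)"
  if "a : car A" "b : car A" "Z : car (TQ' n)" for a b Z
  using that ring_hom_mult[OF h that(1,2)] by (simp add: TQ'_simps TQ'_smult act_mult TT_closed)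
 show "\<one> \<odot>[TQ' n] Z = Z" if "Z : car (TQ' n)" for Z
  using that ring_hom_one[OF h] by (simp add: TQ'_simps TQ'_smult act_one)
qed

end

section \<open>Modules over the twisted differential operators\<close>

context q_module
begin

abbreviation DO where "DO \<equiv> diff_ops A \<sigma> \<delta>"
abbreviation sh where "sh \<equiv> diff_op_shift A \<sigma> \<delta>"
abbreviation q_der where "q_der d \<equiv> q_deriv_module A hA x \<sigma> \<delta> M d"

lemma \<delta>_closed: "a : car A ==> \<delta> a : car A"
 using deri by (auto simp: is_q_derivation_def)

lemma \<delta>_zero: "\<delta> \<zero> = \<zero>"
 using qd.\<delta>_h[of 0] by simp

lemma \<sigma>_zero: "\<sigma> \<zero> = \<zero>"
 using ring_hom_zero[OF qd.\<sigma>_hom Ac.ring_axioms Ac.ring_axioms] .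

lemma \<sigma>_one: "\<sigma> \<one> = \<one>"
 by (rule ring_hom_one[OF qd.\<sigma>_hom])

lemma gen_eq: "diff_op_gen A = basis 1" and const_eq: "diff_op_const A f = cst f"
 by (simp_all add: diff_op_gen_def zp.dp.basis_def diff_op_const_def zp.dp.cst_def)

lemma sh_at: "G : up A ==> sh G 0 = \<delta> (G 0)" "sh G (Suc k) = \<sigma> (G k) \<oplus> \<delta> (G (Suc k))"
 by (simp_all add: diff_op_shift_def \<delta>_closed)

lemma sh_up: "G : up A ==> sh G : up A"
proof -
 assume G: "G : up A"
 obtain N where N: "\<forall>k>N. G k = \<zero>" using G unfolding up_iff by blast
 show ?thesis
 proof (rule upI[of _ "Suc N"])
  show "sh G k : car A" for k using G by (cases k) (simp_all add: sh_at \<delta>_closed)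
  show "sh G k = \<zero>" if "k > Suc N" for k
   using that by (cases k) (simp_all add: sh_at N \<delta>_zero \<sigma>_zero)
 qed
qed

lemma sh_pow_up: "G : up A ==> (sh ^^ i) G : up A"
 by (induction i) (simp_all add: sh_up)

lemma DO_simps: "car DO = up A" "\<one>[DO] = basis 0" "F +[DO] G = (\<lambda>k. F k \<oplus> G k)"
 by (simp_all add: diff_ops_def zp.dp.basis_def)

lemma DO_mult_at:
 assumes F: "F : up A" and G: "G : up A" and N: "\<forall>k>N. F k = \<zero>"
 shows "(F *[DO] G) l = (\<Oplus>i\<in>{..N}. F i \<otimes> (sh ^^ i) G l)"
proof -
 have "(F *[DO] G) l = (\<Oplus>i\<in>{i. F i ~= \<zero>}. F i \<otimes> (sh ^^ i) G l)" by (simp add: diff_ops_def)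
 also have "... = (\<Oplus>i\<in>{..N}. F i \<otimes> (sh ^^ i) G l)"
 proof (rule Ac.finsum_neutral)
  show "{i. F i ~= \<zero>} <= {..N}" using N by (auto simp: not_less[symmetric])
 qed (use F sh_pow_up[OF G] in auto)
 finally show ?thesis .
qed

lemma DO_mult_up: "F : up A ==> G : up A ==> F *[DO] G : up A"
proof -
 assume F: "F : up A" and G: "G : up A"
 obtain N where N: "\<forall>k>N. F k = \<zero>" using F unfolding up_iff by blast
 have "\<exists>K. \<forall>i\<le>m. \<forall>l>K. (sh ^^ i) G l = \<zero>" for m
 proof (induction m)
  case 0
  then show ?case using G unfolding up_iff by simp
 next
  case (Suc m)
  then obtain K where K: "\<forall>i\<le>m. \<forall>l>K. (sh ^^ i) G l = \<zero>" by blast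
  obtain K' where K': "\<forall>l>K'. (sh ^^ Suc m) G l = \<zero>" using sh_pow_up[OF G, of "Suc m"] unfolding up_iff by blast
  have "\<forall>i\<le>Suc m. \<forall>l>max K K'. (sh ^^ i) G l = \<zero>"
   using K K' by (auto simp: le_Suc_eq simp del: funpow.simps)
  then show ?case by blast
 qed
 then obtain K where K: "!!i l. i <= N ==> l > K ==> (sh ^^ i) G l = \<zero>" by blast
 show ?thesis
 proof (rule upI[of _ K])
  show "(F *[DO] G) l : car A" for l
   unfolding DO_mult_at[OF F G N] by (rule Ac.finsum_closed) (use F sh_pow_up[OF G] in auto)
  show "(F *[DO] G) l = \<zero>" if "l > K" for l
   unfolding DO_mult_at[OF F G N] by (rule Ac.finsum_zero) (use F K that in auto)
 qed
qed

lemma cst_DO: "a : car A ==> G : up A ==> cst a *[DO] G = (\<lambda>l. a \<otimes> G l)"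
proof
 fix l assume a: "a : car A" and G: "G : up A"
 have "(cst a *[DO] G) l = (\<Oplus>i\<in>{..0}. cst a i \<otimes> (sh ^^ i) G l)"
  by (rule DO_mult_at[OF cst_up[OF a] G]) (simp add: zp.dp.cst_def)
 then show "(cst a *[DO] G) l = a \<otimes> G l" using a G by (simp add: zp.dp.cst_def)
qed

lemma gen_DO: "G : up A ==> basis 1 *[DO] G = sh G"
proof
 fix l assume G: "G : up A"
 have "(basis 1 *[DO] G) l = (\<Oplus>i\<in>{..1}. basis 1 i \<otimes> (sh ^^ i) G l)"
  by (rule DO_mult_at[OF basis_up G]) (simp add: zp.dp.basis_def)
 also have "... = basis 1 1 \<otimes> (sh ^^ 1) G l"
  by (rule Ac.finsum_single) (use up_at[OF sh_pow_up[OF G]] in \<open>auto simp: zp.dp.basis_def simp del: funpow.simps\<close>)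
 also have "... = sh G l" using sh_up[OF G] by (simp add: zp.dp.basis_def)
 finally show "(basis 1 *[DO] G) l = sh G l" .
qed

lemma sh_basis: "sh (basis k) = basis (Suc k)"
proof
 fix l
 have b: "basis k l = (if l = k then \<one> else \<zero>)" for k l by (simp add: zp.dp.basis_def)
 show "sh (basis k) l = basis (Suc k) l"
  by (cases l) (auto simp: sh_at(1)[OF basis_up] sh_at(2) b \<delta>_zero \<sigma>_zero \<delta>_one \<sigma>_one)
qed

lemma sh_cst: "f : car A ==> sh (cst f) = (cst (\<sigma> f) *[DO] basis 1) +[DO] cst (\<delta> f)"
proof
 fix l assume f: "f : car A"
 have c: "cst f l = (if l = 0 then f else \<zero>)" for f l by (simp add: zp.dp.cst_def)
 show "sh (cst f) l = ((cst (\<sigma> f) *[DO] basis 1) +[DO] cst (\<delta> f)) l"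
  unfolding DO_simps cst_DO[OF qd.\<sigma>_closed[OF f] basis_up]
  using f by (cases l) (auto simp: sh_at(1)[OF cst_up[OF f]] sh_at(2) c zp.dp.basis_def \<delta>_zero \<sigma>_zero \<delta>_closed)
qed

lemma left_actionD:
 assumes "act : DMS"
 shows "F : up A ==> s : car M ==> act F s : car M"
  and "F : up A ==> s : car M ==> t : car M ==> act F (s +[M] t) = act F s +[M] act F t"
  and "F : up A ==> G : up A ==> s : car M ==> act (F +[DO] G) s = act F s +[M] act G s"
  and "F : up A ==> G : up A ==> s : car M ==> act (F *[DO] G) s = act F (act G s)"
  and "s : car M ==> act (basis 0) s = s"
  and "f : car A ==> s : car M ==> act (cst f) s = f \<odot>[M] s"
  and "act : up A \<rightarrow>\<^sub>E (car M \<rightarrow>\<^sub>E car M)"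
proof -
 note * = assms[unfolded D_module_structures_def is_left_action_def const_eq DO_simps(1,2) mem_Collect_eq]
 show 1: "act : up A \<rightarrow>\<^sub>E (car M \<rightarrow>\<^sub>E car M)" using * by blast
 show "F : up A ==> s : car M ==> act F s : car M"
  using PiE_mem[OF PiE_mem[OF 1]] by blast
qed (use assms[unfolded D_module_structures_def is_left_action_def const_eq DO_simps(1,2) mem_Collect_eq] in blast)+

lemma act_q_der:
 assumes act: "act : DMS"
 shows "q_der (act (basis 1))"
proof (intro q_deriv_module.intro qd.q_deriv_axioms M_module q_deriv_module_axioms.intro)
 note a = left_actionD[OF act]
 show "act (basis 1) v : car M" if "v : car M" for v using that by (simp add: a(1))
 show "act (basis 1) (v +[M] w) = act (basis 1) v +[M] act (basis 1) w" if "v : car M" "w : car M" for v w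
  using that by (rule a(2)[OF basis_up])
 show "act (basis 1) (f \<odot>[M] v) = \<delta> f \<odot>[M] v +[M] \<sigma> f \<odot>[M] act (basis 1) v"
  if f: "f : car A" and v: "v : car M" for f v
 proof -
  have dv: "act (basis 1) v : car M" using v by (simp add: a(1))
  have "act (basis 1) (f \<odot>[M] v) = act (basis 1 *[DO] cst f) v"
   using f v by (simp add: a(4,6))
  also have "basis 1 *[DO] cst f = (cst (\<sigma> f) *[DO] basis 1) +[DO] cst (\<delta> f)"
   using f by (simp only: gen_DO[OF cst_up[OF f]] sh_cst)
  also have "act ... v = act (cst (\<sigma> f) *[DO] basis 1) v +[M] act (cst (\<delta> f)) v"
   by (rule a(3)[OF DO_mult_up cst_up v]) (use f in \<open>simp_all add: \<delta>_closed\<close>)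
  also have "... = \<sigma> f \<odot>[M] act (basis 1) v +[M] \<delta> f \<odot>[M] v"
   using f v dv by (simp add: a(4,6) \<delta>_closed)
  finally show ?thesis using f v dv by (simp add: Mo.M.a_comm \<delta>_closed)
 qed
qed

text \<open>Operators are finite sums of f \<partial>^k, and \<open>basis (Suc k)\<close> is the
  generator times \<open>basis k\<close>, so the generator determines the action; extensionality
  upgrades this to equality of functions.\<close>

lemma act_eqI:
 assumes act: "act : DMS" and act': "act' : DMS"
  and eq: "!!s. s : car M ==> act (basis 1) s = act' (basis 1) s"
 shows "act = act'"
proof -
 note a = left_actionD[OF act] and b = left_actionD[OF act']
 have basis: "act (basis k) s = act' (basis k) s" if "s : car M" for k s
 proof (induction k)
  case 0
  show ?case using that by (simp add: a(5) b(5))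
 next
  case (Suc k)
  have e: "basis (Suc k) = basis 1 *[DO] basis k" unfolding gen_DO[OF basis_up] sh_basis ..
  have "act (basis (Suc k)) s = act (basis 1) (act' (basis k) s)"
   unfolding e a(4)[OF basis_up basis_up that] Suc ..
  also have "... = act' (basis (Suc k)) s"
   unfolding e b(4)[OF basis_up basis_up that] by (rule eq) (simp add: b(1) that)
  finally show ?case .
 qed
 have "act F s = act' F s" if F: "F : up A" and s: "s : car M" for F s
 proof -
  obtain N where N: "\<forall>k>N. F k = \<zero>" using F unfolding up_iff by blast
  let ?F = "\<lambda>m k. if k < m then F k else \<zero>"
  have Fu: "?F m : up A" for m by (rule upI[of _ m]) (use F in auto)
  have "act (?F m) s = act' (?F m) s" for m
  proof (induction m)
   case 0
   have "?F 0 = cst \<zero>" by (simp add: zp.dp.cst_def)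
   then show ?case using s by (simp only: a(6) b(6) Ac.zero_closed)
  next
   case (Suc m)
   have eq: "?F (Suc m) = ?F m +[DO] (cst (F m) *[DO] basis m)"
    unfolding cst_DO[OF up_at[OF F] basis_up] DO_simps
    using F by (auto simp: fun_eq_iff less_Suc_eq zp.dp.basis_def)
   have bc: "act' (basis m) s : car M" using s by (simp add: b(1))
   have up: "cst (F m) *[DO] basis m : up A" using F by (simp add: DO_mult_up)
   show ?case unfolding eq a(3)[OF Fu up s] b(3)[OF Fu up s] Suc
    using F s bc by (simp add: a(4,6) b(4,6) basis)
  qed
  moreover have "?F (Suc N) = F" using N by (auto simp: fun_eq_iff)
  ultimately show ?thesis by metis
 qed
 then show ?thesis
  by (intro PiE_ext[OF a(7) b(7)] PiE_ext[OF PiE_mem[OF a(7)] PiE_mem[OF b(7)]])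
qed

definition dact :: "('m => 'm) => (nat => 'a) => 'm => 'm" where
 "dact d = (\<lambda>F\<in>up A. \<lambda>s\<in>car M. \<Oplus>[M]k\<in>{k. F k ~= \<zero>}. F k \<odot>[M] (d ^^ k) s)"

text \<open>The core is \<open>shF\<close>: left multiplication by the generator acts as d, which is
  the twisted Leibniz rule applied termwise. Multiplicativity follows because F G is a combination
  of iterated shifts of G.\<close>

lemma dact_structure:
 assumes d: "q_der d"
 shows "dact d : DMS" "s : car M ==> dact d (basis 1) s = d s"
proof -
 interpret d: q_deriv_module A hA x p \<sigma> \<delta> M d by (rule d)
 have bound: "dact d F s = (\<Oplus>[M]k\<in>{..N}. F k \<odot>[M] (d ^^ k) s)"
  if F: "F : up A" and s: "s : car M" and N: "\<forall>k>N. F k = \<zero>" for F s N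
 proof -
  have "dact d F s = (\<Oplus>[M]k\<in>{k. F k ~= \<zero>}. F k \<odot>[M] (d ^^ k) s)" using F s by (simp add: dact_def)
  also have "... = (\<Oplus>[M]k\<in>{..N}. F k \<odot>[M] (d ^^ k) s)"
  proof (rule Mo.M.finsum_neutral)
   show "{k. F k ~= \<zero>} <= {..N}" using N by (auto simp: not_less[symmetric])
  qed (use F s in \<open>auto simp: Mo.smult_l_null\<close>)
  finally show ?thesis .
 qed
 have ex: "\<exists>N. \<forall>k>N. F k = \<zero>" if "F : up A" for F using that unfolding up_iff by blast
 have cl: "dact d F s : car M" if F: "F : up A" and s: "s : car M" for F s
 proof -
  obtain N where N: "\<forall>k>N. F k = \<zero>" using ex[OF F] by blast
  show ?thesis unfolding bound[OF F s N] by (rule Mo.M.finsum_closed) (use F s in auto)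
 qed
 have add: "dact d F (s +[M] t) = dact d F s +[M] dact d F t"
  if F: "F : up A" and s: "s : car M" and t: "t : car M" for F s t
 proof -
  obtain N where N: "\<forall>k>N. F k = \<zero>" using ex[OF F] by blast
  have "dact d F (s +[M] t) = (\<Oplus>[M]k\<in>{..N}. F k \<odot>[M] (d ^^ k) s +[M] F k \<odot>[M] (d ^^ k) t)"
   unfolding bound[OF F Mo.M.a_closed[OF s t] N]
   by (rule Mo.M.finsum_cong2') (use F s t in \<open>auto simp: d.d_pow_add Mo.smult_r_distr\<close>)
  also have "... = dact d F s +[M] dact d F t"
   unfolding bound[OF F s N] bound[OF F t N] by (rule Mo.M.finsum_addf) (use F s t in auto)
  finally show ?thesis .
 qed
 have upadd: "(\<lambda>k. F k \<oplus> G k) : up A" if "F : up A" "G : up A" for F G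
  using up_add[OF that] by (simp add: zp.dp.T_simps)
 have addF: "dact d (\<lambda>k. F k \<oplus> G k) s = dact d F s +[M] dact d G s"
  if F: "F : up A" and G: "G : up A" and s: "s : car M" for F G s
 proof -
  obtain N N' where N: "\<forall>k>N. F k = \<zero>" and N': "\<forall>k>N'. G k = \<zero>" using ex[OF F] ex[OF G] by blast
  have F0: "\<forall>k>max N N'. F k = \<zero>" and G0: "\<forall>k>max N N'. G k = \<zero>" using N N' by auto
  have "dact d (\<lambda>k. F k \<oplus> G k) s = (\<Oplus>[M]k\<in>{..max N N'}. F k \<odot>[M] (d ^^ k) s +[M] G k \<odot>[M] (d ^^ k) s)"
   by (subst bound[OF upadd[OF F G] s, of "max N N'"])
    (use F0 G0 F G s in \<open>auto simp: Mo.smult_l_distr intro!: Mo.M.finsum_cong2'\<close>)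
  also have "... = dact d F s +[M] dact d G s"
   unfolding bound[OF F s F0] bound[OF G s G0] by (rule Mo.M.finsum_addf) (use F G s in auto)
  finally show ?thesis .
 qed
 have smF: "dact d (\<lambda>k. a \<otimes> F k) s = a \<odot>[M] dact d F s"
  if a: "a : car A" and F: "F : up A" and s: "s : car M" for a F s
 proof -
  obtain N where N: "\<forall>k>N. F k = \<zero>" using ex[OF F] by blast
  have "dact d (\<lambda>k. a \<otimes> F k) s = (\<Oplus>[M]k\<in>{..N}. a \<odot>[M] (F k \<odot>[M] (d ^^ k) s))"
   by (subst bound[OF up_smult[OF a F] s, of N])
    (use N a F s in \<open>auto simp: Mo.smult_assoc1 intro!: Mo.M.finsum_cong2'\<close>)
  also have "... = a \<odot>[M] dact d F s" unfolding bound[OF F s N]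
   by (rule additive_finsum[OF M_grp M_grp, where L = "\<lambda>v. a \<odot>[M] v", symmetric])
    (use a F s in \<open>auto simp: Mo.smult_r_distr\<close>)
  finally show ?thesis .
 qed
 have shF: "dact d (sh G) s = d (dact d G s)" if G: "G : up A" and s: "s : car M" for G s
 proof -
  obtain N where N: "\<forall>k>N. G k = \<zero>" using ex[OF G] by blast
  let ?t = "\<lambda>k. \<delta> (G k) \<odot>[M] (d ^^ k) s" and ?u = "\<lambda>k. \<sigma> (G k) \<odot>[M] (d ^^ Suc k) s"
  have tc: "?t k : car M" and uc: "?u k : car M" for k
   using G s d.d_pow_closed[OF s, of "Suc k"] by (auto simp: \<delta>_closed simp del: funpow.simps)
  have N1: "\<forall>k>Suc N. sh G k = \<zero>"
  proof (intro allI impI)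
   fix k assume "k > Suc N"
   then show "sh G k = \<zero>" by (cases k) (simp_all add: sh_at N \<delta>_zero \<sigma>_zero)
  qed
  have "dact d (sh G) s = (\<Oplus>[M]k\<in>{..Suc N}. (case k of 0 => \<zero>[M] | Suc j => ?u j) +[M] ?t k)"
   unfolding bound[OF sh_up[OF G] s N1]
  proof (rule Mo.M.finsum_cong2')
   fix k
   show "sh G k \<odot>[M] (d ^^ k) s = (case k of 0 => \<zero>[M] | Suc j => ?u j) +[M] ?t k"
    using G s tc d.d_pow_closed[OF s, of k]
    by (cases k) (simp_all add: sh_at Mo.smult_l_distr \<delta>_closed)
   show "(case k of 0 => \<zero>[M] | Suc j => ?u j) +[M] ?t k : car M"
    using tc[of k] uc by (cases k) (simp_all del: funpow.simps(2))
  qed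
  also have "... = (\<Oplus>[M]k\<in>{..Suc N}. case k of 0 => \<zero>[M] | Suc j => ?u j) +[M] (\<Oplus>[M]k\<in>{..Suc N}. ?t k)"
   by (rule Mo.M.finsum_addf) (use tc uc in \<open>auto split: nat.split simp del: funpow.simps\<close>)
  also have "(\<Oplus>[M]k\<in>{..Suc N}. case k of 0 => \<zero>[M] | Suc j => ?u j) = (\<Oplus>[M]k\<in>{..Suc N}. ?u k)"
  proof (rule Mo.M.finsum_shift[symmetric, of ?u "Suc N"])
   show "?u (Suc N) = \<zero>[M]" using N d.d_pow_closed[OF s, of "Suc (Suc N)"]
    by (simp add: \<sigma>_zero Mo.smult_l_null del: funpow.simps)
  qed (rule uc)
  also have "(\<Oplus>[M]k\<in>{..Suc N}. ?u k) +[M] (\<Oplus>[M]k\<in>{..Suc N}. ?t k) = (\<Oplus>[M]k\<in>{..Suc N}. ?u k +[M] ?t k)"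
   by (rule Mo.M.finsum_addf[symmetric]) (use tc uc in auto)
  also have "... = (\<Oplus>[M]k\<in>{..Suc N}. d (G k \<odot>[M] (d ^^ k) s))"
   by (rule Mo.M.finsum_cong2') (use G s tc uc in \<open>auto simp: d.d_smult Mo.M.a_comm \<delta>_closed\<close>)
  also have "... = d (\<Oplus>[M]k\<in>{..Suc N}. G k \<odot>[M] (d ^^ k) s)"
   by (rule d.d_finsum[symmetric]) (use G s in auto)
  also have "... = d (dact d G s)" by (subst bound[OF G s, of "Suc N"]) (use N in auto)
  finally show ?thesis .
 qed
 have shpF: "dact d ((sh ^^ i) G) s = (d ^^ i) (dact d G s)" if G: "G : up A" and s: "s : car M" for i G s
  by (induction i) (use shF[OF sh_pow_up[OF G] s] in simp_all)
 have sumF: "(\<lambda>l. \<Oplus>i\<in>{..N}. g i l) : up A \<and>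
   dact d (\<lambda>l. \<Oplus>i\<in>{..N}. g i l) s = (\<Oplus>[M]i\<in>{..N}. dact d (g i) s)"
  if g: "!!i. g i : up A" and s: "s : car M" for g s and N :: nat
 proof (induction N)
  case 0
  then show ?case using g cl[OF g s] by simp
 next
  case (Suc N)
  have e: "(\<lambda>l. \<Oplus>i\<in>{..Suc N}. g i l) = (\<lambda>l. g (Suc N) l \<oplus> (\<Oplus>i\<in>{..N}. g i l))"
   using g by (simp add: Ac.finsum_Suc)
  show ?case unfolding e using Suc upadd[OF g] addF[OF g _ s] cl[OF g s] by (simp add: Mo.M.finsum_Suc)
 qed
 have mult: "dact d (F *[DO] G) s = dact d F (dact d G s)"
  if F: "F : up A" and G: "G : up A" and s: "s : car M" for F G s
 proof -
  obtain N where N: "\<forall>k>N. F k = \<zero>" using ex[OF F] by blast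
  have e: "F *[DO] G = (\<lambda>l. \<Oplus>i\<in>{..N}. F i \<otimes> (sh ^^ i) G l)" using DO_mult_at[OF F G N] by (intro ext)
  have gu: "(\<lambda>l. F i \<otimes> (sh ^^ i) G l) : up A" for i by (rule up_smult[OF up_at[OF F] sh_pow_up[OF G]])
  have "dact d (F *[DO] G) s = (\<Oplus>[M]i\<in>{..N}. dact d (\<lambda>l. F i \<otimes> (sh ^^ i) G l) s)"
   unfolding e using sumF[of "\<lambda>i l. F i \<otimes> (sh ^^ i) G l", OF gu s] by blast
  also have "... = (\<Oplus>[M]i\<in>{..N}. F i \<odot>[M] (d ^^ i) (dact d G s))"
   by (rule Mo.M.finsum_cong2')
    (use F cl[OF G s] in \<open>auto simp: smF[OF up_at[OF F] sh_pow_up[OF G] s] shpF[OF G s]\<close>)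
  also have "... = dact d F (dact d G s)" by (rule bound[OF F cl[OF G s] N, symmetric])
  finally show ?thesis .
 qed
 have cst: "dact d (cst f) s = f \<odot>[M] s" if f: "f : car A" and s: "s : car M" for f s
 proof -
  have "dact d (cst f) s = (\<Oplus>[M]k\<in>{..0}. cst f k \<odot>[M] (d ^^ k) s)"
   by (rule bound[OF cst_up[OF f] s]) (simp add: zp.dp.cst_def)
  then show ?thesis using f s by (simp add: zp.dp.cst_def)
 qed
 have one: "dact d (basis 0) s = s" if s: "s : car M" for s
 proof -
  have "basis 0 = cst \<one>" by (simp add: zp.dp.basis_def zp.dp.cst_def)
  then show ?thesis using cst[OF Ac.one_closed s] s by simp
 qed
 show "dact d (basis 1) s = d s" if s: "s : car M" for s
 proof -
  have "basis 1 = sh (basis 0)" using sh_basis[of 0] by simp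
  then show ?thesis using shF[OF basis_up s, of 0] one[OF s] by simp
 qed
 show "dact d : DMS"
  unfolding D_module_structures_def is_left_action_def const_eq DO_simps(1,2) mem_Collect_eq
 proof (intro conjI ballI M_grp)
  show "dact d : up A \<rightarrow>\<^sub>E car M \<rightarrow>\<^sub>E car M"
  proof (rule PiE_I)
   fix F assume F: "F : up A"
   show "dact d F : car M \<rightarrow>\<^sub>E car M"
    by (rule PiE_I) (use cl[OF F] F in \<open>auto simp: dact_def\<close>)
  qed (simp add: dact_def)
  show "dact d (F +[DO] G) s = dact d F s +[M] dact d G s" if "F : up A" "G : up A" "s : car M" for F G s
   unfolding DO_simps by (rule addF[OF that])
 qed (simp_all add: add mult one cst)
qed

end

section \<open>The cocycle condition in coordinates\<close>

context q_module
begin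

abbreviation Q' where "Q' n \<equiv> qdp_trunc' p R A x \<sigma> n"
abbreviation T0 where "T0 n m \<equiv> tensor A (Q' n) (Qn m)"
abbreviation t0 where "t0 n m \<equiv> tens A (Q' n) (Qn m)"
abbreviation T2 where "T2 n m \<equiv> Q_ten'_Q p R A x \<sigma> n m"
abbreviation TTQ where "TTQ n m \<equiv> ten_Q_ten'_Q p R A x \<sigma> M n m"
abbreviation tt2 where "tt2 n m \<equiv> tens A (TQ' n) (Qn m)"

lemma Q'_simps: "car (Q' n) = car (Qn n)" "add (Q' n) = add (Qn n)" "\<zero>[Q' n] = \<zero>[Qn n]"
 by (simp_all add: qdp_trunc'_def)

lemma Q'_smult: "f : car A ==> f \<odot>[Q' n] u = cl n (TT n f) *[Qn n] u"
 by (simp add: qdp_trunc'_def taylor_map_eq)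

lemma Q'_pair: "tensor_pair A (Q' n) (Qn m)"
proof (rule tensor_pair.intro)
 interpret Q: cring "Qn n" by (rule Qn_cring)
 show "abelian_group (Q' n)"
 proof (rule abelian_groupI)
  show "\<exists>v\<in>car (Q' n). v +[Q' n] u = \<zero>[Q' n]" if "u : car (Q' n)" for u
   using that Q.l_neg[of u] Q.a_inv_closed[of u] unfolding Q'_simps by blast
 qed (simp_all add: Q'_simps Q.a_ac)
 show "a \<odot>[Q' n] s : car (Q' n)" if "a : car A" "s : car (Q' n)" for a s
  using that by (simp add: Q'_simps Q'_smult TT_closed)
qed (auto simp: Qn_grp Qn_smult_closed)

lemma T0_grp: "abelian_group (T0 n m)"
 by (rule tensor_pair.MN_abelian_group[OF Q'_pair])

lemmas t0_closed = tensor_pair.tens_closed[OF Q'_pair, unfolded Q'_simps]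
 and t0_add_l = tensor_pair.tens_add_l[OF Q'_pair, unfolded Q'_simps]
 and t0_add_r = tensor_pair.tens_add_r[OF Q'_pair]
 and t0_smult = tensor_pair.tens_smult[OF Q'_pair]
 and T0_induct = tensor_pair.tensor_induct[OF Q'_pair, unfolded Q'_simps, consumes 1, case_names tens add]

lemma T2_simps: "car (T2 n m) = car (T0 n m)" "add (T2 n m) = add (T0 n m)" "\<zero>[T2 n m] = \<zero>[T0 n m]"
 by (simp_all add: Q_ten'_Q_def Let_def)

lemma Qn_module: "module A (Qn n)"
proof (rule moduleI[OF A_cring Qn_grp])
 fix a b u assume a: "a : car A" and b: "b : car A" and u: "u : car (Qn n)"
 obtain F where F: "F : up A" "u = cl n F" using Qn_E[OF u] .
 show "(a \<oplus> b) \<odot>[Qn n] u = a \<odot>[Qn n] u +[Qn n] b \<odot>[Qn n] u"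
  unfolding F(2) using a b F(1) by (simp add: cl_smult cl_add up_smult Ac.l_distr)
 show "(a \<otimes> b) \<odot>[Qn n] u = a \<odot>[Qn n] (b \<odot>[Qn n] u)"
  unfolding F(2) using a b F(1) by (simp add: cl_smult up_smult Ac.m_assoc)
next
 fix a u v assume a: "a : car A" and u: "u : car (Qn n)" and v: "v : car (Qn n)"
 obtain F G where F: "F : up A" "u = cl n F" and G: "G : up A" "v = cl n G" using Qn_E[OF u] Qn_E[OF v] by metis
 have s: "(\<lambda>k. F k \<oplus> G k) : up A" using up_add[OF F(1) G(1)] by (simp add: zp.dp.T_simps)
 show "a \<odot>[Qn n] (u +[Qn n] v) = a \<odot>[Qn n] u +[Qn n] a \<odot>[Qn n] v"
  unfolding F(2) G(2) using a F(1) G(1) s by (simp add: cl_smult cl_add up_smult Ac.r_distr)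
next
 fix u assume u: "u : car (Qn n)"
 obtain F where F: "F : up A" "u = cl n F" using Qn_E[OF u] .
 show "\<one> \<odot>[Qn n] u = u" unfolding F(2) using F(1) by (simp add: cl_smult)
qed (rule Qn_smult_closed)

text \<open>The original scalars commute with those through \<theta>_n, as both act compatibly with
  multiplication in the commutative algebra of truncated polynomials.\<close>

lemma T2_bal: "a : car A ==> balanced A (Q' n) (Qn m) (T0 n m) (\<lambda>u v. t0 n m (a \<odot>[Qn n] u) v)"
proof -
 assume a: "a : car A"
 interpret Qm: module A "Qn n" by (rule Qn_module)
 show ?thesis
 proof (rule balancedI)
  fix f u v assume f: "f : car A" and u: "u : car (Q' n)" and v: "v : car (Qn m)"
  have "t0 n m (a \<odot>[Qn n] (f \<odot>[Q' n] u)) v = t0 n m (f \<odot>[Q' n] (a \<odot>[Qn n] u)) v"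
   using a f u by (simp add: Q'_smult Q'_simps smult_mult_Qn TT_closed)
  also have "... = t0 n m (a \<odot>[Qn n] u) (f \<odot>[Qn m] v)"
   by (rule t0_smult) (use a f u v in \<open>simp_all add: Q'_simps Qn_smult_closed\<close>)
  finally show "t0 n m (a \<odot>[Qn n] (f \<odot>[Q' n] u)) v = t0 n m (a \<odot>[Qn n] u) (f \<odot>[Qn m] v)" .
 qed (use a in \<open>simp_all add: Q'_simps t0_closed t0_add_l t0_add_r Qn_smult_closed Qm.smult_r_distr\<close>)
qed

lemma T2_smult: "a \<odot>[T2 n m] Z = tensor_lift (T0 n m) (\<lambda>u v. t0 n m (a \<odot>[Qn n] u) v) Z"
 by (simp add: Q_ten'_Q_def Let_def)

lemma T2_smult_t0: "a : car A ==> u : car (Qn n) ==> v : car (Qn m) ==>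
  a \<odot>[T2 n m] t0 n m u v = t0 n m (a \<odot>[Qn n] u) v"
 unfolding T2_smult by (rule tensor_pair.tensor_lift_tens[OF Q'_pair T0_grp T2_bal]) (simp_all add: Q'_simps)

lemma T2_smult_closed: "a : car A ==> Z : car (T0 n m) ==> a \<odot>[T2 n m] Z : car (T0 n m)"
 unfolding T2_smult by (rule tensor_pair.tensor_lift_closed[OF Q'_pair T0_grp T2_bal])

lemma T2_smult_add: "a : car A ==> Y : car (T0 n m) ==> Z : car (T0 n m) ==>
  a \<odot>[T2 n m] (Y +[T0 n m] Z) = a \<odot>[T2 n m] Y +[T0 n m] a \<odot>[T2 n m] Z"
 unfolding T2_smult by (rule tensor_pair.tensor_lift_add[OF Q'_pair T0_grp T2_bal])

lemma T2_module: "module A (T2 n m)"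
proof -
 interpret T0: abelian_group "T0 n m" by (rule T0_grp)
 interpret Qm: module A "Qn n" by (rule Qn_module)
 have grp: "abelian_group (T2 n m)"
 proof (rule abelian_groupI)
  show "\<exists>v\<in>car (T2 n m). v +[T2 n m] u = \<zero>[T2 n m]" if "u : car (T2 n m)" for u
   using that T0.l_neg[of u] T0.a_inv_closed[of u] unfolding T2_simps by blast
 qed (simp_all add: T2_simps T0.a_ac)
 show ?thesis
 proof (rule moduleI[OF A_cring grp])
  fix a b Z assume a: "a : car A" and b: "b : car A" and "Z : car (T2 n m)"
  then have Z: "Z : car (T0 n m)" by (simp add: T2_simps)
  show "(a \<oplus> b) \<odot>[T2 n m] Z = a \<odot>[T2 n m] Z +[T2 n m] b \<odot>[T2 n m] Z" unfolding T2_simps using Z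
  proof (induction Z rule: T0_induct)
   case (tens s t)
   then show ?case using a b by (simp add: T2_smult_t0 Qm.smult_l_distr t0_add_l)
  next
   case (add Y Z)
   then show ?case using a b by (simp add: T2_smult_add T2_smult_closed T0.a_ac)
  qed
  show "(a \<otimes> b) \<odot>[T2 n m] Z = a \<odot>[T2 n m] (b \<odot>[T2 n m] Z)" using Z
  proof (induction Z rule: T0_induct)
   case (tens s t)
   then show ?case using a b by (simp add: T2_smult_t0 Qm.smult_assoc1)
  next
   case (add Y Z)
   then show ?case using a b by (simp add: T2_smult_add T2_smult_closed)
  qed
 next
  fix Z assume "Z : car (T2 n m)"
  then have Z: "Z : car (T0 n m)" by (simp add: T2_simps)
  show "\<one> \<odot>[T2 n m] Z = Z" using Z
  proof (induction Z rule: T0_induct)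
   case (tens s t)
   then show ?case by (simp add: T2_smult_t0)
  next
   case (add Y Z)
   then show ?case by (simp add: T2_smult_add)
  qed
 qed (simp_all add: T2_simps T2_smult_closed T2_smult_add)
qed

definition dk where "dk n m k = (\<Oplus>[T2 n m]i\<in>{..k}. t0 n m (xi n i) (xi m (k - i)))"

lemma dk_closed: "dk n m k : car (T2 n m)"
proof -
 interpret T2: module A "T2 n m" by (rule T2_module)
 show ?thesis unfolding dk_def by (rule T2.finsum_closed) (auto simp: T2_simps t0_closed)
qed

lemma xi_zero: "n < k ==> xi n k = \<zero>[Qn n]"
proof (rule co_eqI)
 interpret Q: cring "Qn n" by (rule Qn_cring)
 show "\<zero>[Qn n] : car (Qn n)" by simp
 fix j assume k: "n < k" and j: "j <= n"
 have "co (\<zero>[Qn n] +[Qn n] \<zero>[Qn n]) j = co \<zero>[Qn n] j \<oplus> co \<zero>[Qn n] j"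
  by (rule co_add[of _ n]) (simp_all add: j)
 moreover have "co \<zero>[Qn n] j : car A" by (rule co_closed[of _ n]) (simp_all add: j)
 ultimately have "co \<zero>[Qn n] j = \<zero>" using Ac.add.r_cancel_one' by fastforce
 then show "co (xi n k) j = co \<zero>[Qn n] j" using k j co_xi[OF j, of k] by simp
qed simp

text \<open>In each summand i > n or k - i > m. Hence \<Delta> does not depend on the representative
  of a class of order n + m.\<close>

lemma dk_zero: "n + m < k ==> dk n m k = \<zero>[T2 n m]"
proof -
 assume k: "n + m < k"
 interpret T2: module A "T2 n m" by (rule T2_module)
 interpret Qa: cring "Qn n" by (rule Qn_cring)
 interpret Qb: cring "Qn m" by (rule Qn_cring)
 have "t0 n m (xi n i) (xi m (k - i)) = \<zero>[T2 n m]" for i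
 proof (cases "n < i")
  case True
  then show ?thesis using tensor_pair.tens_zero_l[OF Q'_pair, of "xi m (k - i)" m n]
   by (simp add: xi_zero T2_simps Q'_simps)
 next
  case False
  then have "m < k - i" using k by simp
  then show ?thesis using tensor_pair.tens_zero_r[OF Q'_pair, of "xi n i" n m]
   by (simp add: xi_zero T2_simps Q'_simps)
 qed
 then show ?thesis unfolding dk_def by (intro T2.finsum_zero) auto
qed

lemma Delta_cl:
 assumes F: "F : up A"
 shows "Del n m (cl (n + m) F) = (\<Oplus>[T2 n m]k\<in>{..n + m}. F k \<odot>[T2 n m] dk n m k)"
proof -
 interpret T2: module A "T2 n m" by (rule T2_module)
 let ?f = "\<lambda>G. \<Oplus>[T2 n m]k\<in>{k. G k ~= \<zero>}. G k \<odot>[T2 n m] dk n m k"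
 have "?f G = (\<Oplus>[T2 n m]k\<in>{..n + m}. F k \<odot>[T2 n m] dk n m k)" if G: "G : cl (n + m) F" for G
 proof -
  have Gu: "G : up A" and GF: "!!k. k <= n + m ==> G k = F k" using G in_cl_iff[OF F] by auto
  obtain N where N: "\<forall>k>N. G k = \<zero>" using Gu unfolding up_iff by blast
  have c: "G k \<odot>[T2 n m] dk n m k : car (T2 n m)" for k using Gu dk_closed by simp
  have "?f G = (\<Oplus>[T2 n m]k\<in>{..N + (n + m)}. G k \<odot>[T2 n m] dk n m k)"
  proof (rule T2.M.finsum_neutral)
   show "{k. G k ~= \<zero>} <= {..N + (n + m)}"
   proof
    fix k assume "k : {k. G k ~= \<zero>}"
    then have "\<not> N < k" using N by blast
    then show "k : {..N + (n + m)}" by simp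
   qed
  qed (use c dk_closed in \<open>auto simp: T2.smult_l_null\<close>)
  also have "... = (\<Oplus>[T2 n m]k\<in>{..n + m}. G k \<odot>[T2 n m] dk n m k)"
   by (rule T2.M.finsum_neutral[symmetric]) (use c Gu in \<open>auto simp: dk_zero T2.smult_r_null\<close>)
  also have "... = (\<Oplus>[T2 n m]k\<in>{..n + m}. F k \<odot>[T2 n m] dk n m k)"
   by (rule T2.M.finsum_cong2') (use GF F dk_closed in auto)
  finally show ?thesis .
 qed
 moreover have "F : cl (n + m) F" using in_cl_iff[OF F] F by blast
 ultimately have "?f ` cl (n + m) F = {\<Oplus>[T2 n m]k\<in>{..n + m}. F k \<odot>[T2 n m] dk n m k}" by blast
 then show ?thesis unfolding Delta_def Let_def xi_div_eq dk_def[symmetric] by simp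
qed

lemma Delta_closed: "u : car (Qn (n + m)) ==> Del n m u : car (T2 n m)"
proof -
 assume u: "u : car (Qn (n + m))"
 interpret T2: module A "T2 n m" by (rule T2_module)
 obtain F where F: "F : up A" "u = cl (n + m) F" using Qn_E[OF u] .
 show ?thesis unfolding F(2) Delta_cl[OF F(1)] by (rule T2.finsum_closed) (use F(1) dk_closed in auto)
qed

lemma Delta_add:
 assumes u: "u : car (Qn (n + m))" and v: "v : car (Qn (n + m))"
 shows "Del n m (u +[Qn (n + m)] v) = Del n m u +[T2 n m] Del n m v"
proof -
 interpret T2: module A "T2 n m" by (rule T2_module)
 obtain F where F: "F : up A" "u = cl (n + m) F" using Qn_E[OF u] .
 obtain G where G: "G : up A" "v = cl (n + m) G" using Qn_E[OF v] .
 have s: "(\<lambda>k. F k \<oplus> G k) : up A" using up_add[OF F(1) G(1)] by (simp add: zp.dp.T_simps)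
 have "Del n m (u +[Qn (n + m)] v)
  = (\<Oplus>[T2 n m]k\<in>{..n + m}. F k \<odot>[T2 n m] dk n m k +[T2 n m] G k \<odot>[T2 n m] dk n m k)"
  unfolding F(2) G(2) cl_add[OF F(1) G(1)] Delta_cl[OF s]
  by (rule T2.M.finsum_cong2') (use F(1) G(1) dk_closed in \<open>auto simp: T2.smult_l_distr\<close>)
 also have "... = Del n m u +[T2 n m] Del n m v"
  unfolding F(2) G(2) Delta_cl[OF F(1)] Delta_cl[OF G(1)]
  by (rule T2.finsum_addf) (use F(1) G(1) dk_closed in auto)
 finally show ?thesis .
qed

lemma Delta_smult:
 assumes a: "a : car A" and u: "u : car (Qn (n + m))"
 shows "Del n m (a \<odot>[Qn (n + m)] u) = a \<odot>[T2 n m] Del n m u"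
proof -
 interpret T2: module A "T2 n m" by (rule T2_module)
 obtain F where F: "F : up A" "u = cl (n + m) F" using Qn_E[OF u] .
 have "Del n m (a \<odot>[Qn (n + m)] u) = (\<Oplus>[T2 n m]k\<in>{..n + m}. a \<odot>[T2 n m] (F k \<odot>[T2 n m] dk n m k))"
  unfolding F(2) cl_smult[OF a F(1)] Delta_cl[OF up_smult[OF a F(1)]]
  by (rule T2.M.finsum_cong2') (use F(1) a dk_closed in \<open>auto simp: T2.smult_assoc1\<close>)
 also have "... = a \<odot>[T2 n m] Del n m u"
  unfolding F(2) Delta_cl[OF F(1)]
  by (rule additive_finsum[OF T2.abelian_group_axioms T2.abelian_group_axioms, where L = "\<lambda>v. a \<odot>[T2 n m] v", symmetric])
   (use a F(1) dk_closed in \<open>auto simp: T2.smult_r_distr\<close>)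
 finally show ?thesis .
qed

lemma Delta_xi: "k <= n + m ==> Del n m (xi (n + m) k) = dk n m k"
proof -
 assume k: "k <= n + m"
 interpret T2: module A "T2 n m" by (rule T2_module)
 have "Del n m (xi (n + m) k) = basis k k \<odot>[T2 n m] dk n m k"
  unfolding Delta_cl[OF basis_up]
  by (rule T2.M.finsum_single) (use k dk_closed in \<open>auto simp: zp.dp.basis_def T2.smult_l_null\<close>)
 then show ?thesis using dk_closed by (simp add: zp.dp.basis_def)
qed

lemma TTQ_eq: "TTQ n m = tensor A (TQ' n) (Qn m)" by (rule ten_Q_ten'_Q_def)

lemma fT: "free_tensor A (TQ' n) (Qn m) (xi m) co m"
 by (rule free_tensor_Qn[OF TQ'_module])

lemma tT: "tensor_pair A (TQ' n) (Qn m)"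
 using fT by (simp add: free_tensor_def)

lemmas TTQ_grp = tensor_pair.MN_abelian_group[OF tT, folded TTQ_eq]
 and tt2_closed = tensor_pair.tens_closed[OF tT, folded TTQ_eq, unfolded TQ'_simps]
 and tt2_add_l = tensor_pair.tens_add_l[OF tT, folded TTQ_eq, unfolded TQ'_simps]
 and tt2_add_r = tensor_pair.tens_add_r[OF tT, folded TTQ_eq, unfolded TQ'_simps]
 and tt2_smult = tensor_pair.tens_smult[OF tT, unfolded TQ'_simps]

lemma TM2: "tensor_pair A M (T2 n m)"
proof (rule tensor_pair.intro)
 show "abelian_group (T2 n m)" using T2_module by (simp add: module_def)
qed (auto simp: M_grp T2_simps T2_smult_closed)

text \<open>The associativity map with the element s of M held fixed. It is balanced because s
  \<otimes> \<theta>_n(f)u is f times s \<otimes> u for the structure through \<theta>_n.\<close>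

definition inner where
 "inner n m s = tensor_lift (TTQ n m) (\<lambda>u v. tt2 n m (ts n s u) v)"

lemma inner_bal: "s : car M ==> balanced A (Q' n) (Qn m) (TTQ n m) (\<lambda>u v. tt2 n m (ts n s u) v)"
proof (rule balancedI)
 fix f u v assume s: "s : car M" and f: "f : car A" and u: "u : car (Q' n)" and v: "v : car (Qn m)"
 have u': "u : car (Qn n)" using u by (simp add: Q'_simps)
 have "ts n s (f \<odot>[Q' n] u) = f \<odot>[TQ' n] ts n s u"
  using s f u' by (simp add: Q'_smult TQ'_smult act_ts TT_closed)
 then show "tt2 n m (ts n s (f \<odot>[Q' n] u)) v = tt2 n m (ts n s u) (f \<odot>[Qn m] v)"
  using tt2_smult[OF f ts_closed[OF s u'] v] by simp
qed (simp_all add: Q'_simps ts_closed ts_add_r tt2_closed tt2_add_l tt2_add_r)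

lemma inner_t0: "s : car M ==> u : car (Qn n) ==> v : car (Qn m) ==>
  inner n m s (t0 n m u v) = tt2 n m (ts n s u) v"
 unfolding inner_def by (rule tensor_pair.tensor_lift_tens[OF Q'_pair TTQ_grp inner_bal]) (simp_all add: Q'_simps)

lemma inner_closed: "s : car M ==> Z : car (T0 n m) ==> inner n m s Z : car (TTQ n m)"
 unfolding inner_def by (rule tensor_pair.tensor_lift_closed[OF Q'_pair TTQ_grp inner_bal])

lemma inner_add: "s : car M ==> Y : car (T0 n m) ==> Z : car (T0 n m) ==>
  inner n m s (Y +[T0 n m] Z) = inner n m s Y +[TTQ n m] inner n m s Z"
 unfolding inner_def by (rule tensor_pair.tensor_lift_add[OF Q'_pair TTQ_grp inner_bal])

lemma assoc_bal: "balanced A M (T2 n m) (TTQ n m) (inner n m)"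
proof -
 interpret TTQ: abelian_group "TTQ n m" by (rule TTQ_grp)
 interpret T0: abelian_group "T0 n m" by (rule T0_grp)
 show ?thesis
 proof (rule balancedI)
  fix s s' Z assume s: "s : car M" "s' : car M" and "Z : car (T2 n m)"
  then have "Z : car (T0 n m)" by (simp add: T2_simps)
  then show "inner n m (s +[M] s') Z = inner n m s Z +[TTQ n m] inner n m s' Z"
  proof (induction Z rule: T0_induct)
   case (tens u v)
   then show ?case using s by (simp add: inner_t0 ts_add_l ts_closed tt2_add_l)
  next
   case (add Y Z)
   then show ?case using s by (simp add: inner_add inner_closed TTQ.a_ac)
  qed
 next
  fix a s Z assume a: "a : car A" and s: "s : car M" and "Z : car (T2 n m)"
  then have "Z : car (T0 n m)" by (simp add: T2_simps)
  then show "inner n m (a \<odot>[M] s) Z = inner n m s (a \<odot>[T2 n m] Z)"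
  proof (induction Z rule: T0_induct)
   case (tens u v)
   then show ?case using a s by (simp add: inner_t0 T2_smult_t0 Qn_smult_closed ts_smult)
  next
   case (add Y Z)
   then show ?case using a s by (simp add: inner_add T2_smult_add T2_smult_closed)
  qed
 qed (simp_all add: T2_simps inner_closed inner_add)
qed

lemma assoc_left_eq: "asl n m = tensor_lift (TTQ n m) (inner n m)"
 unfolding assoc_left_def Let_def inner_def[abs_def] ..

lemma IdDelta_bal: "balanced A M (Qn (n + m)) (tensor A M (T2 n m)) (\<lambda>s u. tens A M (T2 n m) s (Del n m u))"
 by (rule balancedI)
  (simp_all add: Delta_closed Delta_add Delta_smult tensor_pair.tens_closed[OF TM2] tensor_pair.tens_add_l[OF TM2]
   tensor_pair.tens_add_r[OF TM2] tensor_pair.tens_smult[OF TM2])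

lemma rhs_eq:
 assumes D: "!!k. k <= n + m ==> D k : car M"
 shows "asl n m (IdD n m (vc (n + m) D))
  = (\<Oplus>[TTQ n m]k\<in>{..n + m}. \<Oplus>[TTQ n m]i\<in>{..k}. tt2 n m (ts n (D k) (xi n i)) (xi m (k - i)))"
proof -
 interpret F: free_tensor A M "Qn (n + m)" "xi (n + m)" co "n + m" by (rule fM)
 note grp2 = tensor_pair.MN_abelian_group[OF TM2, of n m]
 interpret TTQ: abelian_group "TTQ n m" by (rule TTQ_grp)
 have "IdD n m (vc (n + m) D)
   = (\<Oplus>[tensor A M (T2 n m)]k\<in>{..n + m}. IdD n m (ts (n + m) (D k) (xi (n + m) k)))"
  unfolding F.vec_def Id_ten_Delta_def Let_def
  by (rule additive_finsum[OF F.MN_abelian_group grp2])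
   (use D F.tensor_lift_closed[OF grp2 IdDelta_bal] F.tensor_lift_add[OF grp2 IdDelta_bal] in \<open>auto simp: F.tens_closed\<close>)
 also have "... = (\<Oplus>[tensor A M (T2 n m)]k\<in>{..n + m}. tens A M (T2 n m) (D k) (dk n m k))"
 proof (rule abelian_monoid.finsum_cong2'[OF abelian_group.axioms(1)[OF grp2]])
  fix k assume k: "k : {..n + m}"
  then show "IdD n m (ts (n + m) (D k) (xi (n + m) k)) = tens A M (T2 n m) (D k) (dk n m k)"
   unfolding Id_ten_Delta_def Let_def
   using F.tensor_lift_tens[OF grp2 IdDelta_bal, of "D k" "xi (n + m) k"] D by (simp add: Delta_xi)
  show "tens A M (T2 n m) (D k) (dk n m k) : car (tensor A M (T2 n m))"
   by (rule tensor_pair.tens_closed[OF TM2]) (use k D dk_closed in auto)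
 qed
 finally have 1: "IdD n m (vc (n + m) D)
  = (\<Oplus>[tensor A M (T2 n m)]k\<in>{..n + m}. tens A M (T2 n m) (D k) (dk n m k))" .
 have "asl n m (IdD n m (vc (n + m) D))
  = (\<Oplus>[TTQ n m]k\<in>{..n + m}. tensor_lift (TTQ n m) (inner n m) (tens A M (T2 n m) (D k) (dk n m k)))"
  unfolding 1 assoc_left_eq
  by (rule additive_finsum[OF grp2 TTQ_grp])
   (use D dk_closed tensor_pair.tensor_lift_closed[OF TM2 TTQ_grp assoc_bal]
    tensor_pair.tensor_lift_add[OF TM2 TTQ_grp assoc_bal] in \<open>auto simp: tensor_pair.tens_closed[OF TM2]\<close>)
 also have "... = (\<Oplus>[TTQ n m]k\<in>{..n + m}. \<Oplus>[TTQ n m]i\<in>{..k}. tt2 n m (ts n (D k) (xi n i)) (xi m (k - i)))"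
 proof (rule TTQ.finsum_cong2')
  fix k assume k: "k : {..n + m}"
  then have Dk: "D k : car M" using D by simp
  have "tensor_lift (TTQ n m) (inner n m) (tens A M (T2 n m) (D k) (dk n m k)) = inner n m (D k) (dk n m k)"
   by (rule tensor_pair.tensor_lift_tens[OF TM2 TTQ_grp assoc_bal Dk dk_closed])
  also have "... = (\<Oplus>[TTQ n m]i\<in>{..k}. inner n m (D k) (t0 n m (xi n i) (xi m (k - i))))"
   unfolding dk_def
   by (rule additive_finsum[OF _ TTQ_grp])
    (use Dk T2_module in \<open>auto simp: T2_simps t0_closed inner_closed inner_add module_def\<close>)
  also have "... = (\<Oplus>[TTQ n m]i\<in>{..k}. tt2 n m (ts n (D k) (xi n i)) (xi m (k - i)))"
   by (rule TTQ.finsum_cong2') (use Dk in \<open>auto simp: inner_t0 tt2_closed ts_closed\<close>)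
  finally show "tensor_lift (TTQ n m) (inner n m) (tens A M (T2 n m) (D k) (dk n m k))
   = (\<Oplus>[TTQ n m]i\<in>{..k}. tt2 n m (ts n (D k) (xi n i)) (xi m (k - i)))" .
  show "(\<Oplus>[TTQ n m]i\<in>{..k}. tt2 n m (ts n (D k) (xi n i)) (xi m (k - i))) : car (TTQ n m)"
   by (rule TTQ.finsum_closed) (use Dk in \<open>auto simp: tt2_closed ts_closed\<close>)
 qed
 finally show ?thesis .
qed

text \<open>Additivity and semilinearity of \<theta> are exactly what makes \<theta> \<otimes> Id
  balanced, with scalars acting on the target through \<theta>_n.\<close>

lemma lhs_eq:
 assumes \<theta>: "!!s. s : car M ==> \<theta> s : car (TQ n)"
  and add: "!!s t. s : car M ==> t : car M ==> \<theta> (s +[M] t) = \<theta> s +[TQ n] \<theta> t"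
  and semi: "!!f s. f : car A ==> s : car M ==> \<theta> (f \<odot>[M] s) = f \<odot>[TQ' n] \<theta> s"
  and D: "!!k. k <= m ==> D k : car M"
 shows "thI n m \<theta> (vc m D) = (\<Oplus>[TTQ n m]j\<in>{..m}. tt2 n m (\<theta> (D j)) (xi m j))"
proof -
 interpret F: free_tensor A M "Qn m" "xi m" co m by (rule fM)
 interpret TTQ: abelian_group "TTQ n m" by (rule TTQ_grp)
 have bal: "balanced A M (Qn m) (TTQ n m) (\<lambda>s v. tt2 n m (\<theta> s) v)"
  by (rule balancedI) (simp_all add: \<theta> add semi tt2_closed tt2_add_l tt2_add_r tt2_smult)
 have "thI n m \<theta> (vc m D)
  = (\<Oplus>[TTQ n m]j\<in>{..m}. thI n m \<theta> (ts m (D j) (xi m j)))"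
  unfolding F.vec_def theta_ten_Id_def
  by (rule additive_finsum[OF F.MN_abelian_group TTQ_grp])
   (use D F.tensor_lift_closed[OF TTQ_grp bal] F.tensor_lift_add[OF TTQ_grp bal] in \<open>auto simp: F.tens_closed\<close>)
 also have "... = (\<Oplus>[TTQ n m]j\<in>{..m}. tt2 n m (\<theta> (D j)) (xi m j))"
  unfolding theta_ten_Id_def
  by (rule TTQ.finsum_cong2') (use D \<theta> in \<open>auto simp: F.tensor_lift_tens[OF TTQ_grp bal] tt2_closed\<close>)
 finally show ?thesis .
qed

text \<open>In coordinates, the cocycle condition says $D_i D_j = D_{i+j}$.\<close>

lemma cocycle_iff:
 assumes \<theta>: "!!s. s : car M ==> \<theta> s = vc n (\<lambda>k. D k s)"
  and D: "!!k s. s : car M ==> D k s : car M"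
  and add: "!!s t. s : car M ==> t : car M ==> \<theta> (s +[M] t) = \<theta> s +[TQ n] \<theta> t"
  and semi: "!!f s. f : car A ==> s : car M ==> \<theta> (f \<odot>[M] s) = f \<odot>[TQ' n] \<theta> s"
  and s: "s : car M"
 shows "thI n m \<theta> (vc m (\<lambda>k. D k s)) =
   asl n m (IdD n m (vc (n + m) (\<lambda>k. D k s))) \<longleftrightarrow>
  (\<forall>i\<le>n. \<forall>j\<le>m. D i (D j s) = D (i + j) s)" (is "?L = ?Rh \<longleftrightarrow> _")
proof -
 interpret F: free_tensor A M "Qn n" "xi n" co n by (rule fM)
 interpret G: free_tensor A "TQ' n" "Qn m" "xi m" co m by (rule fT)
 interpret TTQ: abelian_group "TTQ n m" by (rule TTQ_grp)
 interpret TQ: abelian_group "TQ n" by (rule TQ_grp)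
 have \<theta>c: "\<theta> s : car (TQ n)" if "s : car M" for s
  unfolding \<theta>[OF that] TQ_eq by (rule F.vec_closed) (simp add: D that)
 have L: "?L = G.vec (\<lambda>j. \<theta> (D j s))"
  unfolding G.vec_def TTQ_eq[symmetric] by (rule lhs_eq) (use \<theta>c add semi D s in auto)
 have Lc: "?L : car (TTQ n m)"
  unfolding L TTQ_eq by (rule G.vec_closed) (simp add: TQ'_simps \<theta>c D s)
 have tmc: "tt2 n m (ts n (D k s) (xi n i)) (xi m j) : car (TTQ n m)" for k i j
  using D s by (simp add: tt2_closed ts_closed)
 have Rc: "?Rh : car (TTQ n m)"
  by (subst rhs_eq) (use D s tmc in \<open>auto intro!: TTQ.finsum_closed\<close>)
 \<comment> \<open>Double coordinates, first along \<xi>^[j] in the right factor and then along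
   \<xi>^[i] in the middle one. Together they determine an element, since both factors are
   free.\<close>
 let ?c = "\<lambda>i j Z. F.crd i (G.crd j Z)"
 have cc: "G.crd j Z : car (TQ n)" if "j <= m" "Z : car (TTQ n m)" for j Z
  using G.crd_closed[OF that(1)] that(2) by (simp add: TTQ_eq TQ'_simps)
 have ca: "?c i j (Y +[TTQ n m] Z) = ?c i j Y +[M] ?c i j Z"
  if "i <= n" "j <= m" "Y : car (TTQ n m)" "Z : car (TTQ n m)" for i j Y Z
  using that cc G.crd_add[of j Y Z] F.crd_add[of i "G.crd j Y" "G.crd j Z"] by (simp add: TTQ_eq TQ_eq TQ'_simps)
 have cM: "?c i j Z : car M" if "i <= n" "j <= m" "Z : car (TTQ n m)" for i j Z
  using F.crd_closed[OF that(1)] cc[OF that(2,3)] by (simp add: TQ_eq)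
 have csum: "?c i j (\<Oplus>[TTQ n m]k\<in>I. f k) = (\<Oplus>[M]k\<in>I. ?c i j (f k))"
  if "i <= n" "j <= m" "!!k. k : I ==> f k : car (TTQ n m)" for i j f and I :: "nat set"
  by (rule additive_finsum[OF TTQ_grp M_grp, where L = "?c i j"]) (use that ca cM in auto)
 have cL: "?c i j ?L = D i (D j s)" if i: "i <= n" and j: "j <= m" for i j
 proof -
  have "G.crd j ?L = \<theta> (D j s)" unfolding L by (rule G.crd_vec[OF _ j]) (simp add: TQ'_simps \<theta>c D s)
  then show ?thesis using F.crd_vec[of "\<lambda>k. D k (D j s)" i] i D s by (simp add: \<theta>)
 qed
 have cterm: "?c i j (tt2 n m (ts n (D k s) (xi n i')) (xi m j')) = (if i' = i \<and> j' = j then D k s else \<zero>[M])"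
  if i: "i <= n" and j: "j <= m" for i j k i' j'
 proof -
  have ds: "D k s : car M" using D s by simp
  have z: "F.crd i \<zero>[TQ n] = \<zero>[M]"
   using F.crd_finsum[OF i, of "{}" "\<lambda>_. undefined"] by (simp add: TQ_eq)
  have "G.crd j (tt2 n m (ts n (D k s) (xi n i')) (xi m j')) = (if j' = j then ts n (D k s) (xi n i') else \<zero>[TQ' n])"
   by (rule G.crd_b[OF j]) (simp add: TQ'_simps ts_closed ds)
  then show ?thesis using F.crd_b[OF i ds, of i'] by (auto simp: z TQ'_simps)
 qed
 have cR: "?c i j ?Rh = D (i + j) s" if i: "i <= n" and j: "j <= m" for i j
 proof -
  have "?c i j ?Rh = (\<Oplus>[M]k\<in>{..n + m}. ?c i j (\<Oplus>[TTQ n m]i'\<in>{..k}. tt2 n m (ts n (D k s) (xi n i')) (xi m (k - i'))))"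
   by (subst rhs_eq, simp add: D s, rule csum[OF i j]) (use tmc in \<open>auto intro!: TTQ.finsum_closed\<close>)
  also have "... = (\<Oplus>[M]k\<in>{..n + m}. if k = i + j then D k s else \<zero>[M])"
  proof (rule Mo.M.finsum_cong2')
   fix k
   have "?c i j (\<Oplus>[TTQ n m]i'\<in>{..k}. tt2 n m (ts n (D k s) (xi n i')) (xi m (k - i')))
    = (\<Oplus>[M]i'\<in>{..k}. if i' = i \<and> k - i' = j then D k s else \<zero>[M])"
    by (subst csum[OF i j]) (use tmc cterm[OF i j] D s in \<open>auto intro!: Mo.M.finsum_cong2'\<close>)
   also have "... = (if k = i + j then D k s else \<zero>[M])"
   proof (cases "k = i + j")
    case True
    have "(\<Oplus>[M]i'\<in>{..k}. if i' = i \<and> k - i' = j then D k s else \<zero>[M]) = (if i = i \<and> k - i = j then D k s else \<zero>[M])"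
     by (rule Mo.M.finsum_single) (use True D s in auto)
    then show ?thesis using True by simp
   next
    case False
    then show ?thesis by (auto intro!: Mo.M.finsum_zero)
   qed
   finally show "?c i j (\<Oplus>[TTQ n m]i'\<in>{..k}. tt2 n m (ts n (D k s) (xi n i')) (xi m (k - i')))
    = (if k = i + j then D k s else \<zero>[M])" .
  qed (use D s in simp)
  also have "... = (if i + j = i + j then D (i + j) s else \<zero>[M])"
   by (rule Mo.M.finsum_single) (use i j D s in auto)
  finally show ?thesis by simp
 qed
 show ?thesis
 proof
  assume "?L = ?Rh"
  then show "\<forall>i\<le>n. \<forall>j\<le>m. D i (D j s) = D (i + j) s" using cL cR by metis
 next
  assume eq: "\<forall>i\<le>n. \<forall>j\<le>m. D i (D j s) = D (i + j) s"
  show "?L = ?Rh"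
  proof (rule G.crd_eqI)
   fix j assume j: "j <= m"
   show "G.crd j ?L = G.crd j ?Rh"
   proof (rule F.crd_eqI)
    fix i assume i: "i <= n"
    show "?c i j ?L = ?c i j ?Rh" using cL[OF i j] cR[OF i j] eq i j by simp
   qed (use cc[OF j Lc] cc[OF j Rc] in \<open>simp_all add: TQ_eq\<close>)
  qed (use Lc Rc in \<open>simp_all add: TTQ_eq\<close>)
 qed
qed

end

section \<open>Taylor structures and twisted derivations\<close>

context q_module
begin

text \<open>Writes multiplication by \<theta>_n(f) with the coefficients of the iterated Leibniz
  rule, so that semilinearity and that rule become the same formula.\<close>

lemma act_coord:
 assumes f: "f : car A" and D: "!!k. k <= n ==> D k : car M" and k: "k <= n"
 shows "cr k (f \<odot>[TQ' n] vc n D)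
  = (\<Oplus>[M]m\<in>{..n}. (\<Oplus>i\<in>{..k}. zp.dp.s i m k \<otimes> (\<delta> ^^ i) f) \<odot>[M] D m)"
proof -
 interpret F: free_tensor A M "Qn n" "xi n" co n by (rule fM)
 let ?u = "cl n (TT n f)"
 note u = TT_closed[OF f, of n]
 have dc: "(\<delta> ^^ i) f : car A" for i using \<delta>_pow_\<tau>[OF f, of i] zp.nw.T_closed[OF \<tau>_closed[OF f]] by simp
 have xc: "?u *[Qn n] xi n m : car (Qn n)" for m
  using cring.cring_simprules(5)[OF Qn_cring u] by simp
 have co: "co (?u *[Qn n] xi n m) k = (\<Oplus>i\<in>{..k}. zp.dp.s i m k \<otimes> (\<delta> ^^ i) f)" for m
 proof -
  have "co (?u *[Qn n] xi n m) k = (TT n f *[DT] basis m) k"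
   unfolding cl_mult[OF TT_up[OF f] basis_up] by (rule co_cl[OF up_mult[OF TT_up[OF f] basis_up] k])
  also have "... = (\<Oplus>i\<in>{..k}. zp.dp.s i m k \<otimes> (\<delta> ^^ i) f)"
   unfolding zp.dp.T_simps(5)
  proof (rule Ac.finsum_cong2')
   fix i assume i: "i : {..k}"
   then have T: "TT n f i = (\<delta> ^^ i) f" using k by (simp add: TT_def)
   show "(\<Oplus>j\<in>{..k}. TT n f i \<otimes> basis m j \<otimes> zp.dp.s i j k) = zp.dp.s i m k \<otimes> (\<delta> ^^ i) f"
   proof (cases "m <= k")
    case True
    have "(\<Oplus>j\<in>{..k}. TT n f i \<otimes> basis m j \<otimes> zp.dp.s i j k) = TT n f i \<otimes> basis m m \<otimes> zp.dp.s i m k"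
     by (rule Ac.finsum_single) (use True dc in \<open>auto simp: T zp.dp.basis_def\<close>)
    then show ?thesis using dc by (simp add: T zp.dp.basis_def Ac.m_comm)
   next
    case False
    then have "(\<Oplus>j\<in>{..k}. TT n f i \<otimes> basis m j \<otimes> zp.dp.s i j k) = \<zero>"
     using dc by (intro Ac.finsum_zero) (auto simp: T zp.dp.basis_def)
    then show ?thesis using False dc by (simp add: zp.dp.s_eq_0)
   qed
  qed (use dc in simp)
  finally show ?thesis .
 qed
 have tc: "ts n (D m) (xi n m) : car (TQ n)" if "m <= n" for m using D[OF that] by (simp add: ts_closed)
 have "f \<odot>[TQ' n] vc n D = (\<Oplus>[TQ n]m\<in>{..n}. acQ n ?u (ts n (D m) (xi n m)))"
  unfolding TQ'_smult[OF f] F.vec_def TQ_eq[symmetric]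
  by (rule additive_finsum[OF TQ_grp TQ_grp]) (use tc u act_closed act_add in auto)
 also have "... = (\<Oplus>[TQ n]m\<in>{..n}. ts n (D m) (?u *[Qn n] xi n m))"
  by (rule abelian_monoid.finsum_cong2'[OF abelian_group.axioms(1)[OF TQ_grp]])
   (use D u xc in \<open>auto simp: act_ts ts_closed\<close>)
 finally have "F.crd k (f \<odot>[TQ' n] vc n D) = (\<Oplus>[M]m\<in>{..n}. F.crd k (ts n (D m) (?u *[Qn n] xi n m)))"
  using F.crd_finsum[OF k, of "{..n}" "\<lambda>m. ts n (D m) (?u *[Qn n] xi n m)"] D xc by (simp add: TQ_eq F.tens_closed)
 also have "... = (\<Oplus>[M]m\<in>{..n}. (\<Oplus>i\<in>{..k}. zp.dp.s i m k \<otimes> (\<delta> ^^ i) f) \<odot>[M] D m)"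
  by (rule Mo.M.finsum_cong2') (use D xc k dc in \<open>auto simp: F.crd_tens co intro!: Mo.smult_closed Ac.finsum_closed\<close>)
 finally show ?thesis .
qed

lemma proj_vc:
 assumes m: "m <= n" and D: "!!k. k <= n ==> D k : car M"
 shows "tensor_lift (TQ m) (\<lambda>t u. ts m t (qdp_proj R A x m u)) (vc n D) = vc m D"
proof -
 interpret F: free_tensor A M "Qn n" "xi n" co n by (rule fM)
 interpret G: free_tensor A M "Qn m" "xi m" co m by (rule fM)
 interpret TQ: abelian_group "TQ m" by (rule TQ_grp)
 let ?p = "qdp_proj R A x m"
 have pc: "?p u : car (Qn m)" if u: "u : car (Qn n)" for u
  using Qn_E[OF u] qdp_proj_cl[OF m] by (metis cl_closed)
 have pa: "?p (u +[Qn n] v) = ?p u +[Qn m] ?p v" if u: "u : car (Qn n)" and v: "v : car (Qn n)" for u v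
 proof -
  obtain U V where U: "U : up A" "u = cl n U" and V: "V : up A" "v = cl n V" using Qn_E[OF u] Qn_E[OF v] by metis
  have s: "(\<lambda>k. U k \<oplus> V k) : up A" using up_add[OF U(1) V(1)] by (simp add: zp.dp.T_simps)
  show ?thesis unfolding U(2) V(2) cl_add[OF U(1) V(1)] qdp_proj_cl[OF m U(1)] qdp_proj_cl[OF m V(1)] qdp_proj_cl[OF m s] ..
 qed
 have ps: "?p (a \<odot>[Qn n] u) = a \<odot>[Qn m] ?p u" if a: "a : car A" and u: "u : car (Qn n)" for a u
 proof -
  obtain U where U: "U : up A" "u = cl n U" using Qn_E[OF u] .
  show ?thesis unfolding U(2) cl_smult[OF a U(1)] qdp_proj_cl[OF m U(1)] qdp_proj_cl[OF m up_smult[OF a U(1)]] ..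
 qed
 have bal: "balanced A M (Qn n) (TQ m) (\<lambda>t u. ts m t (?p u))"
  by (rule balancedI) (simp_all add: pc pa ps ts_closed ts_add_l ts_add_r ts_smult)
 have "tensor_lift (TQ m) (\<lambda>t u. ts m t (?p u)) (vc n D)
  = (\<Oplus>[TQ m]k\<in>{..n}. tensor_lift (TQ m) (\<lambda>t u. ts m t (?p u)) (ts n (D k) (xi n k)))"
  unfolding F.vec_def
  by (rule additive_finsum[OF F.MN_abelian_group TQ_grp])
   (use D F.tensor_lift_closed[OF TQ_grp bal] F.tensor_lift_add[OF TQ_grp bal] in \<open>auto simp: F.tens_closed\<close>)
 also have "... = (\<Oplus>[TQ m]k\<in>{..n}. ts m (D k) (xi m k))"
  by (rule TQ.finsum_cong2')
   (use D in \<open>auto simp: F.tensor_lift_tens[OF TQ_grp bal] qdp_proj_cl[OF m basis_up] ts_closed\<close>)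
 also have "... = (\<Oplus>[TQ m]k\<in>{..m}. ts m (D k) (xi m k))"
 proof (rule TQ.finsum_neutral[symmetric])
  show "ts m (D k) (xi m k) = \<zero>[TQ m]" if "k : {..n} - {..m}" for k
   using that D G.tens_zero_r[of "D k"] by (simp add: xi_zero TQ_eq)
 qed (use m D in \<open>auto simp: ts_closed\<close>)
 finally show ?thesis unfolding G.vec_def TQ_eq .
qed

definition ThD :: "('m => 'm) => nat => 'm => ('a, 'm) taylor_target" where
 "ThD d n = (\<lambda>s\<in>car M. vc n (\<lambda>k. (d ^^ k) s))"

lemma ThD_taylor:
 assumes d: "q_der d"
 shows "ThD d : qTS"
proof -
 interpret d: q_deriv_module A hA x p \<sigma> \<delta> M d by (rule d)
 have eq: "ThD d n s = vc n (\<lambda>k. (d ^^ k) s)" if "s : car M" for n s using that by (simp add: ThD_def)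
 have cl: "ThD d n s : car (TQ n)" if s: "s : car M" for n s
  unfolding eq[OF s] TQ_eq by (rule free_tensor.vec_closed[OF fM]) (simp add: s)
 have crd: "cr k (ThD d n s) = (d ^^ k) s" if s: "s : car M" and k: "k <= n" for n s k
  unfolding eq[OF s] by (rule free_tensor.crd_vec[OF fM _ k]) (simp add: s)
 have add: "ThD d n (s +[M] t) = ThD d n s +[TQ n] ThD d n t" if s: "s : car M" and t: "t : car M" for n s t
 proof -
  interpret TQ: abelian_group "TQ n" by (rule TQ_grp)
  show ?thesis
  proof (rule free_tensor.crd_eqI[OF fM, folded TQ_eq])
   show "ThD d n (s +[M] t) : car (TQ n)" by (rule cl) (simp add: s t)
   show "ThD d n s +[TQ n] ThD d n t : car (TQ n)" by (simp add: cl s t)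
   show "cr k (ThD d n (s +[M] t)) = cr k (ThD d n s +[TQ n] ThD d n t)"
    if k: "k <= n" for k
    using free_tensor.crd_add[OF fM k, folded TQ_eq, OF cl[OF s] cl[OF t]] crd[OF _ k] s t by (simp add: d.d_pow_add)
  qed
 qed
 have semi: "ThD d n (f \<odot>[M] s) = f \<odot>[TQ' n] ThD d n s" if f: "f : car A" and s: "s : car M" for n f s
 proof (rule free_tensor.crd_eqI[OF fM, folded TQ_eq])
  show "ThD d n (f \<odot>[M] s) : car (TQ n)" by (rule cl) (simp add: f s)
  show "f \<odot>[TQ' n] ThD d n s : car (TQ n)" unfolding TQ'_smult[OF f] by (rule act_closed[OF TT_closed[OF f] cl[OF s]])
  fix k assume k: "k <= n"
  let ?t = "\<lambda>i m. (zp.dp.s i m k \<otimes> (\<delta> ^^ i) f) \<odot>[M] (d ^^ m) s"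
  have c: "zp.dp.s i m k \<otimes> (\<delta> ^^ i) f : car A" for i m using f by simp
  have tc: "?t i m : car M" for i m using c s by simp
  have "cr k (ThD d n (f \<odot>[M] s)) = (d ^^ k) (f \<odot>[M] s)"
   by (rule crd[OF _ k]) (simp add: f s)
  also have "... = (\<Oplus>[M]i\<in>{..k}. \<Oplus>[M]m\<in>{..k}. ?t i m)" by (rule d.leibniz_aux[OF f s order_refl])
  also have "... = (\<Oplus>[M]m\<in>{..k}. \<Oplus>[M]i\<in>{..k}. ?t i m)" by (rule Mo.M.finsum_swap) (use tc in auto)
  \<comment> \<open>The Leibniz sum stops at m = k; it extends to n because the structure constants
    vanish for m > k.\<close>
  also have "... = (\<Oplus>[M]m\<in>{..n}. \<Oplus>[M]i\<in>{..k}. ?t i m)"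
  proof (rule Mo.M.finsum_neutral)
   show "(\<Oplus>[M]i\<in>{..k}. ?t i m) = \<zero>[M]" if "m : {..n} - {..k}" for m
    by (rule Mo.M.finsum_zero) (use that f s in \<open>auto simp: zp.dp.s_eq_0 Mo.smult_l_null\<close>)
  qed (use k tc in \<open>auto intro!: Mo.M.finsum_closed\<close>)
  also have "... = (\<Oplus>[M]m\<in>{..n}. (\<Oplus>i\<in>{..k}. zp.dp.s i m k \<otimes> (\<delta> ^^ i) f) \<odot>[M] (d ^^ m) s)"
  proof (rule Mo.M.finsum_cong2')
   fix m
   show "(\<Oplus>[M]i\<in>{..k}. ?t i m) = (\<Oplus>i\<in>{..k}. zp.dp.s i m k \<otimes> (\<delta> ^^ i) f) \<odot>[M] (d ^^ m) s"
    by (rule additive_finsum[OF Ac.abelian_group_axioms M_grp, where L = "\<lambda>a. a \<odot>[M] (d ^^ m) s", symmetric])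
     (use c s in \<open>auto simp: Mo.smult_l_distr\<close>)
  qed (use c s in \<open>auto intro!: Mo.smult_closed Ac.finsum_closed\<close>)
  also have "... = cr k (f \<odot>[TQ' n] ThD d n s)"
   unfolding eq[OF s] by (rule act_coord[OF f _ k, symmetric]) (simp add: s)
  finally show "cr k (ThD d n (f \<odot>[M] s)) = cr k (f \<odot>[TQ' n] ThD d n s)" .
 qed
 show ?thesis unfolding q_taylor_structures_def mem_Collect_eq
 proof (intro conjI allI ballI impI)
  show "ThD d n : car M \<rightarrow>\<^sub>E car (TQ n)" for n
   by (rule PiE_I) (use cl in \<open>auto simp: ThD_def\<close>)
  show "tensor_lift (TQ m) (\<lambda>t u. ts m t (qdp_proj R A x m u)) (ThD d n s) = ThD d m s"
   if "m <= n" "s : car M" for m n s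
   unfolding eq[OF that(2)] by (rule proj_vc[OF that(1)]) (simp add: that)
  show "ThD d n (f \<odot>[M] s) = acQ n (taylor_map p R A x \<sigma> n f) (ThD d n s)"
   if "f : car A" "s : car M" for n f s
   using semi[OF that] TQ'_smult[OF that(1)] taylor_map_eq[OF that(1)] by simp
  show "ThD d 0 s = ts 0 s \<one>[Qn 0]" if s: "s : car M" for s
  proof -
   interpret F: free_tensor A M "Qn 0" "xi 0" co 0 by (rule fM)
   show ?thesis unfolding eq[OF s] F.vec_def cl_one using F.tens_closed[OF s F.b_closed[of 0]] by simp
  qed
  show "thI n m (ThD d n) (ThD d m s) =
    asl n m (IdD n m (ThD d (m + n) s))"
   if s: "s : car M" for m n s
  proof -
   have "\<forall>i\<le>n. \<forall>j\<le>m. (d ^^ i) ((d ^^ j) s) = (d ^^ (i + j)) s" by (simp add: funpow_add)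
   then show ?thesis unfolding eq[OF s] add.commute[of m n]
    using cocycle_iff[of "ThD d n" n "\<lambda>k. d ^^ k", OF eq _ add semi s] by simp
  qed
 qed (rule add)
qed

lemma taylor_ThD:
 assumes \<Theta>: "\<Theta> : qTS"
 shows "\<exists>d. q_der d \<and> \<Theta> = ThD d"
proof -
 note T = \<Theta>[unfolded q_taylor_structures_def mem_Collect_eq]
 note T1 = conjunct2[OF T] note T2 = conjunct2[OF T1] note T3 = conjunct2[OF T2] note T4 = conjunct2[OF T3]
 have ext: "\<Theta> n : car M \<rightarrow>\<^sub>E car (TQ n)" for n by (rule conjunct1[OF T, rule_format])
 have cl: "\<Theta> n s : car (TQ n)" if "s : car M" for n s using PiE_mem[OF ext that] .
 have add: "\<Theta> n (s +[M] t) = \<Theta> n s +[TQ n] \<Theta> n t" if "s : car M" "t : car M" for n s t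
  by (rule conjunct1[OF T1, rule_format, OF that])
 have compat: "tensor_lift (TQ m) (\<lambda>t u. ts m t (qdp_proj R A x m u)) (\<Theta> n s) = \<Theta> m s"
  if "m <= n" "s : car M" for m n s by (rule conjunct1[OF T2, rule_format, OF that])
 have semi: "\<Theta> n (f \<odot>[M] s) = f \<odot>[TQ' n] \<Theta> n s" if f: "f : car A" and s: "s : car M" for n f s
 proof -
  have "\<Theta> n (f \<odot>[M] s) = acQ n (taylor_map p R A x \<sigma> n f) (\<Theta> n s)"
   by (rule conjunct1[OF T3, rule_format, OF f s])
  then show ?thesis unfolding TQ'_smult[OF f] taylor_map_eq[OF f] .
 qed
 have zero: "\<Theta> 0 s = ts 0 s \<one>[Qn 0]" if "s : car M" for s
  by (rule conjunct1[OF T4, rule_format, OF that])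
 have coc: "thI n m (\<Theta> n) (\<Theta> m s) =
   asl n m (IdD n m (\<Theta> (n + m) s))" if "s : car M" for m n s
  unfolding add.commute[of n m] by (rule conjunct2[OF T4, rule_format, OF that])
 let ?c = "cr"
 \<comment> \<open>The diagonal choice n = k; \<open>Dn\<close> uses compatibility with the
   projections to show that the k-th coordinate of \<theta>_n(s) is the same for all n \<ge>
   k.\<close>
 define D where "D k s = ?c k (\<Theta> k s)" for k s
 have cc: "?c k (\<Theta> n s) : car M" if "s : car M" "k <= n" for n k s
  using free_tensor.crd_closed[OF fM that(2), folded TQ_eq] cl[OF that(1)] by blast
 have vcc: "\<Theta> n s = vc n (\<lambda>k. ?c k (\<Theta> n s))" if s: "s : car M" for n s
  by (rule free_tensor.vec_crd[OF fM, symmetric]) (use cl[OF s] in \<open>simp add: TQ_eq\<close>)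
 have Dn: "?c k (\<Theta> n s) = D k s" if s: "s : car M" and k: "k <= n" for n k s
 proof -
  have "\<Theta> k s = vc k (\<lambda>k. ?c k (\<Theta> n s))"
   using compat[OF k s] proj_vc[OF k, of "\<lambda>k. ?c k (\<Theta> n s)"] cc[OF s] vcc[OF s, of n] by simp
  then have "D k s = ?c k (vc k (\<lambda>k. ?c k (\<Theta> n s)))" by (simp add: D_def)
  also have "... = ?c k (\<Theta> n s)"
   by (rule free_tensor.crd_vec[OF fM]) (use cc[OF s] k in auto)
  finally show ?thesis by simp
 qed
 have Dc: "D k s : car M" if "s : car M" for k s unfolding D_def by (rule cc[OF that order_refl])
 have eq: "\<Theta> n s = vc n (\<lambda>k. D k s)" if s: "s : car M" for n s
 proof (rule free_tensor.crd_eqI[OF fM])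
  show "\<Theta> n s : car (tensor A M (Qn n))" using cl[OF s] by (simp add: TQ_eq)
  show "vc n (\<lambda>k. D k s) : car (tensor A M (Qn n))" by (rule free_tensor.vec_closed[OF fM Dc[OF s]])
  show "?c k (\<Theta> n s) = ?c k (vc n (\<lambda>k. D k s))" if "k <= n" for k
   using Dn[OF s that] free_tensor.crd_vec[OF fM, of n "\<lambda>k. D k s" k] Dc[OF s] that by simp
 qed
 have D0: "D 0 s = s" if s: "s : car M" for s
  unfolding D_def zero[OF s] cl_one using free_tensor.crd_b[OF fM, of 0 0 s 0] s by simp
 have DD: "D i (D j s) = D (i + j) s" if s: "s : car M" for i j s
  using cocycle_iff[of "\<Theta> i" i D, OF eq Dc add semi s, of j] coc[OF s, of i j] unfolding eq[OF s] by simp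
 let ?d = "D 1"
 have pow: "(?d ^^ k) s = D k s" if s: "s : car M" for k s
  by (induction k) (use D0[OF s] DD[OF s, of 1] in simp_all)
 have der: "q_der ?d"
 proof (intro q_deriv_module.intro qd.q_deriv_axioms M_module q_deriv_module_axioms.intro)
  show "?d v : car M" if "v : car M" for v by (rule Dc[OF that])
  show "?d (v +[M] w) = ?d v +[M] ?d w" if v: "v : car M" and w: "w : car M" for v w
   unfolding D_def add[OF v w]
   by (rule free_tensor.crd_add[OF fM, folded TQ_eq, OF order_refl cl[OF v] cl[OF w]])
  show "?d (f \<odot>[M] v) = \<delta> f \<odot>[M] v +[M] \<sigma> f \<odot>[M] ?d v" if f: "f : car A" and v: "v : car M" for f v
  proof -
   have fc: "\<delta> f : car A" "x : car A" "?d v : car M" using f v \<delta>_closed x_closed Dc by auto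
   \<comment> \<open>In order 1 this is the one structure constant different from 0 and 1. The first
     coordinate of \<theta>_1(f) \<theta>_1(v) is then \<delta>(f) v plus f + (q-1)x \<delta>(f)
     times the derivative of v, and \<open>\<sigma>_eq\<close> recognises that factor as
     \<sigma>(f).\<close>
   have s111: "zp.dp.s 1 1 1 = hA (qv - 1) \<otimes> x"
    using x_closed q_fact_nonzero[of 1] by (simp add: tw_el_def str_at_def qdp_str_def q_binom_def)
   have s101: "zp.dp.s 1 0 1 = \<one>" using zp.dp.s_comm[of 1 0 1] by (simp add: zp.dp.s_0)
   have "?d (f \<odot>[M] v) = ?c 1 (f \<odot>[TQ' 1] vc 1 (\<lambda>k. D k v))"
    unfolding D_def[of 1] semi[OF f v] eq[OF v] ..
   also have "... = (\<Oplus>[M]m\<in>{..Suc 0}. (\<Oplus>i\<in>{..Suc 0}. zp.dp.s i m 1 \<otimes> (\<delta> ^^ i) f) \<odot>[M] D m v)"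
    using act_coord[OF f, of 1 "\<lambda>k. D k v" 1] Dc[OF v] by simp
   also have "... = (\<delta> f) \<odot>[M] v +[M] (f \<oplus> hA (qv - 1) \<otimes> x \<otimes> \<delta> f) \<odot>[M] ?d v"
   proof -
    have e: "(\<Oplus>i\<in>{..Suc 0}. zp.dp.s i m 1 \<otimes> (\<delta> ^^ i) f) = zp.dp.s 1 m 1 \<otimes> \<delta> f \<oplus> zp.dp.s 0 m 1 \<otimes> f" for m
    proof -
     have dc: "(\<delta> ^^ i) f : car A" for i
      using \<delta>_pow_\<tau>[OF f, of i] zp.nw.T_closed[OF \<tau>_closed[OF f]] by simp
     show ?thesis using Ac.finsum_Suc[of "\<lambda>i. zp.dp.s i m 1 \<otimes> (\<delta> ^^ i) f" 0] dc f by simp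
    qed
    have "(\<Oplus>[M]m\<in>{..Suc 0}. (\<Oplus>i\<in>{..Suc 0}. zp.dp.s i m 1 \<otimes> (\<delta> ^^ i) f) \<odot>[M] D m v)
     = (zp.dp.s 1 1 1 \<otimes> \<delta> f \<oplus> zp.dp.s 0 1 1 \<otimes> f) \<odot>[M] D 1 v +[M] (zp.dp.s 1 0 1 \<otimes> \<delta> f \<oplus> zp.dp.s 0 0 1 \<otimes> f) \<odot>[M] D 0 v"
     unfolding e
     using Mo.M.finsum_Suc[of "\<lambda>m. (zp.dp.s 1 m 1 \<otimes> \<delta> f \<oplus> zp.dp.s 0 m 1 \<otimes> f) \<odot>[M] D m v" 0] f fc Dc[OF v]
     by simp
    then show ?thesis
     using f v fc by (simp only: s111 s101 zp.dp.s_0 D0[OF v]) (simp add: Ac.a_comm Mo.M.a_comm)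
   qed
   also have "... = \<delta> f \<odot>[M] v +[M] \<sigma> f \<odot>[M] ?d v" unfolding qd.\<sigma>_eq[OF f] ..
   finally show ?thesis .
  qed
 qed
 have "\<Theta> n = ThD ?d n" for n
 proof (rule PiE_ext[OF ext])
  show "ThD ?d n : car M \<rightarrow>\<^sub>E car (TQ n)"
   by (rule PiE_I) (use eq cl pow in \<open>auto simp: ThD_def\<close>)
  show "\<Theta> n s = ThD ?d n s" if "s : car M" for s using that eq pow by (simp add: ThD_def)
 qed
 then show ?thesis using der by blast
qed

lemma ThD_cong: "q_der d ==> (!!s. s : car M ==> d' s = d s) ==> ThD d' = ThD d"
proof -
 assume d: "q_der d" and eq: "!!s. s : car M ==> d' s = d s"
 interpret d: q_deriv_module A hA x p \<sigma> \<delta> M d by (rule d)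
 have "(d' ^^ k) s = (d ^^ k) s" if "s : car M" for k s
  by (induction k) (use that eq d.d_pow_closed[OF that] in simp_all)
 then show ?thesis by (simp add: ThD_def fun_eq_iff restrict_def)
qed

text \<open>Recovers the derivation from the Taylor structure; with \<open>act_eqI\<close> this
  gives injectivity of the correspondence.\<close>

lemma ThD_1:
 assumes d: "q_der d" and s: "s : car M"
 shows "cr 1 (ThD d 1 s) = d s"
proof -
 interpret d: q_deriv_module A hA x p \<sigma> \<delta> M d by (rule d)
 have "cr 1 (vc 1 (\<lambda>k. (d ^^ k) s)) = (d ^^ 1) s"
  by (rule free_tensor.crd_vec[OF fM]) (use s in auto)
 then show ?thesis using s by (simp add: ThD_def)
qed

theorem taylor_bij:
 "bij_betw (\<lambda>act. ThD (act (basis 1))) (DMS) (qTS)"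
proof (rule bij_betw_imageI)
 show "inj_on (\<lambda>act. ThD (act (basis 1))) (DMS)"
 proof (rule inj_onI)
  fix act act'
  assume a: "act : DMS" and b: "act' : DMS"
   and eq: "ThD (act (basis 1)) = ThD (act' (basis 1))"
  show "act = act'"
   by (rule act_eqI[OF a b]) (use ThD_1[OF act_q_der[OF a]] ThD_1[OF act_q_der[OF b]] eq in metis)
 qed
 show "(\<lambda>act. ThD (act (basis 1))) ` DMS = qTS"
 proof (intro equalityI subsetI)
  fix \<Theta> assume "\<Theta> : (\<lambda>act. ThD (act (basis 1))) ` DMS"
  then show "\<Theta> : qTS" using ThD_taylor[OF act_q_der] by blast
 next
  fix \<Theta> assume "\<Theta> : qTS"
  then obtain d where d: "q_der d" "\<Theta> = ThD d" using taylor_ThD by blast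
  have "\<Theta> = ThD (dact d (basis 1))"
   unfolding d(2) by (rule ThD_cong[OF d(1), symmetric]) (rule dact_structure(2)[OF d(1)])
  then show "\<Theta> : (\<lambda>act. ThD (act (basis 1))) ` DMS"
   using dact_structure(1)[OF d(1)] by blast
 qed
qed

end

theorem proposition6p16:
  fixes p :: nat
    and R :: "(int poly fract, 'r) module"
    and A :: "('r, 'a) module"
    and x :: 'a
    and \<sigma> \<delta> :: "'a \<Rightarrow> 'a"
    and M :: "('a, 'm) module"
  assumes "prime p"
    and "algebra (loc_Zq p) R"
    and "algebra R A"
    and "adically_complete A (pq_ideal p A (q_in R A))"
    and "top_etale_coordinate p R A x"
    and "is_q_endomorphism R A x \<sigma>"
    and "is_q_derivation R A x \<sigma> \<delta>"
    and "module A M"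
  shows "bij_betw
     (\<lambda>act n. \<lambda>s\<in>carrier M. \<Oplus>\<^bsub>ten_Q R A x M n\<^esub>k\<in>{..n}.
        tens A M (qdp_trunc R A x n) ((act (diff_op_gen A) ^^ k) s) (xi_bar R A x n k))
     (D_module_structures A \<sigma> \<delta> M)
     (q_taylor_structures p R A x \<sigma> M)"
proof -
  interpret q_module p R A x \<sigma> \<delta> M
    by (intro q_module.intro q_setting.intro zq_base.intro q_setting_axioms.intro assms)
  have "(\<lambda>act n. \<lambda>s\<in>carrier M. \<Oplus>\<^bsub>ten_Q R A x M n\<^esub>k\<in>{..n}.
        tens A M (qdp_trunc R A x n) ((act (diff_op_gen A) ^^ k) s) (xi_bar R A x n k))
    = (\<lambda>act. ThD (act (basis 1)))"
    unfolding ThD_def[abs_def] free_tensor.vec_def[OF fM] TQ_eq gen_eq xi_div_eq ..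
  then show ?thesis using taylor_bij by simp
qed

end
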